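(* Suppose that $f,g$ have the power-law asymptotic expansions described in the context and that $-1\le\sigma<\frac bq$, where $\sigma=\frac bq\big(l-1+\frac{p-1}{h-1}\big)-\frac aq$. Let $n\ge 0$ be an integer. Then there exists $t_0>0$ such that for all $(x,y)\in\mathcal D(E_1)$ and $t>t_0$ the perturbed system $$\frac{dx}{dt}=\partial_yH(x,y)+t^{-\frac aq}f(x,y,S(t),t),\qquad \frac{dy}{dt}=-\partial_xH(x,y)+t^{-\frac aq}g(x,y,S(t),t)$$ can be transformed into the averaged system $$\frac{dR}{d\tau}=\sum_{K=0}^n\tau^{-\frac{M+K}{N}}\Lambda_K(R,\Psi)+\widetilde\Lambda_n(R,\Psi,\tau),\qquad \frac{d\Psi}{d\tau}=\sum_{K=0}^n\tau^{-\frac{M+K}{N}}\Omega_K(R,\Psi)+\widetilde\Omega_n(R,\Psi,\tau),$$ with $\widetilde\Lambda_n,\widetilde\Omega_n=\mathcal O\big(\tau^{-\frac{M+n+1}{N}}\big)$ as $\tau\to\infty$ uniformly for $|R|\le d_0$, $\Psi\in\mathbb R$ (with some constant $d_0>0$), by the successive transformations $$x=X(\phi,I),\quad y=Y(\phi,I);\qquad I=I_\ast(t)\big(1+t^{-\mu}r\big)^{2h},\quad \phi=\theta+\varkappa^{-1}S(t),\quad \tau=\frac{t^\nu}{\nu};$$ $$R=r+\sum_{K=0}^n\tau^{-\frac{M+K}{N}}\rho_K(r,\theta,\zeta(\tau)),\qquad \Psi=\theta+\sum_{K=0}^n\tau^{-\frac{M+K}{N}}\psi_K(r,\theta,\ze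ta(\tau)).$$
   Context: Setting. $h\ge2$ is an integer; $a,b,q$ are integers with $1\le a,b\le q$; $l,p$ are integers with $0\le l\le p\le 2h-1$; $s>0$; $S(t)=st^{1+b/q}$; $H(x,y)=\frac{y^2}{2}+U(x)$, $U(x)=\frac{x^{2h}}{2h}+\sum_{i=1}^{2h-1}u_ix^i$ with real constants $u_i$. The functions $f(x,y,S,t)$, $g(x,y,S,t)$ are infinitely differentiable for $(x,y,S)\in\mathbb R^3$, $t>0$, $2\pi$-periodic in $S$, and have power-law asymptotics as $t\to\infty$: $f=\sum_{k\ge0}t^{-k/q}f_k(x,y,S)$, $g=\sum_{k\ge0}t^{-k/q}g_k(x,y,S)$ with $f_k=\sum_{i=0}^p\sum_{j=0}^{l-1}A_{k,i,j}(S)x^iy^j$, $g_k=\sum_{i=0}^p\sum_{j=0}^{l}B_{k,i,j}(S)x^iy^j$ (so $f_k\equiv0$ if $l=0$), where $A_{k,i,j},B_{k,i,j}$ are $2\pi$-periodic and vanish identically if $i+j>p$. Energy-angle variables. $E_0>0$ is such that for all $E>E_0$ the level lines $\{H=E\}$ are closed curves containing no fixed points of $\dot x=\partial_yH$, $\dot y=-\partial_xH$. For $E>E_0$ let $x_0(t,E),y_0(t,E)$ be the corresponding periodic solution (depending smoothly on $E$), $T(E)$ its period, $\omega(E)=2\pi/T(E)$, $X(\phi,E)=x_0(\phi/\omega(E),E)$, $Y(\phi,E)=y_0(\phi/\omega(E),E)$. The initial phase of the family is chosen so that, as $E\to\infty$, $X=E^{\frac1{2h}}\sum_{j\ge0}E^{-\frac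 j{2h}}X_j(\phi)$, $Y=E^{\frac12}\sum_{j\ge0}E^{-\frac j{2h}}Y_j(\phi)$, $\omega=E^{\frac{h-1}{2h}}\sum_{j\ge0}E^{-\frac j{2h}}\omega_j$ with $2\pi$-periodic $X_j,Y_j$ and constants $\omega_j$, $\omega_0=2\pi/\kappa$, $\kappa=\sqrt2(2h)^{\frac1{2h}}\int_{-1}^1\frac{d\varsigma}{\sqrt{1-\varsigma^{2h}}}$. Put $\mathcal D(E)=\{(x,y)\in\mathbb R^2:H(x,y)>E\}$ and, with $X=X(\phi,I)$, $Y=Y(\phi,I)$, $F(I,\phi,S,t)=f(X,Y,S,t)U'(X)+g(X,Y,S,t)Y$, $G(I,\phi,S,t)=\omega(I)\big(f(X,Y,S,t)\partial_EY-g(X,Y,S,t)\partial_EX\big)$. Rescaled variables. $\varkappa$ is a fixed positive integer. $E_1\ge E_0$ is such that $\omega'(E)>0$ for all $E\ge E_1$, and $I_\ast(t)\ge E_1$ is the smooth solution, defined for $t\ge t_1$ with some $t_1>0$, of $\omega(I_\ast(t))=\varkappa^{-1}S'(t)$. Constants: $\vartheta=s(1+\frac bq)$, $\mu=\frac12(\frac bq-\sigma)>0$, $\nu=1+2\mu+\sigma=1+\frac bq$, $M=2\mu q(h-1)$, $N=2\nu q(h-1)$ (integers). The variables $r,\theta,\tau$ are defined by $I=I_\ast(t)(1+t^{-\mu}r)^{2h}$, $\phi=\theta+\varkappa^{-1}S(t)$, $\tau=t^\nu/\nu$, and $\zeta(\tau)=S(t)=\vartheta\tau$. They satisfy $\frac{dr}{d\tau}=\tau^{-\frac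 MN}\mathcal A(r,\theta,\zeta(\tau),\tau)$, $\frac{d\theta}{d\tau}=\tau^{-\frac MN}\mathcal B(r,\theta,\zeta(\tau),\tau)$, where, with $t=(\nu\tau)^{1/\nu}$, $I=I_\ast(t)(1+t^{-\mu}r)^{2h}$, $\phi=\theta+\varkappa^{-1}\zeta$, $$\tau^{-\frac MN}\mathcal A=t^{1-\nu+\mu}\Big[\frac{t^{-a/q}F(I,\phi,\zeta,t)}{2hI_\ast(t)(1+t^{-\mu}r)^{2h-1}}-\frac{I_\ast'(t)}{2hI_\ast(t)}(1+t^{-\mu}r)+\mu t^{-\mu-1}r\Big],$$ $$\tau^{-\frac MN}\mathcal B=t^{1-\nu}\big[\omega(I)-\omega(I_\ast(t))+t^{-a/q}G(I,\phi,\zeta,t)\big].$$ Inserting the asymptotic series of $f,g,X,Y,\omega,I_\ast$ gives, as $\tau\to\infty$ (uniformly for $r$ in bounded sets and $\theta\in\mathbb R$), $\mathcal A=\sum_{K\ge0}\tau^{-\frac KN}\mathcal A_K(r,\theta,\zeta)$, $\mathcal B=\sum_{K\ge0}\tau^{-\frac KN}\mathcal B_K(r,\theta,\zeta)$, with $\mathcal A_K,\mathcal B_K$ polynomial in $r$, $2\pi$-periodic in $\theta$, $2\pi\varkappa$-periodic in $\zeta$. Averaging. The functions $\Lambda_K(r,\theta),\Omega_K(r,\theta),\rho_K(r,\theta,\zeta),\psi_K(r,\theta,\zeta)$, $K\ge0$ (smooth, $2\pi$-periodic in $\theta$; $\rho_K,\psi_K$ being $2\pi\varkappa$-periodic in $\zeta$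 with zero mean over $\zeta$) are the uniquely determined ones such that, with $R_\infty=r+\sum_{K\ge0}\tau^{-\frac{M+K}N}\rho_K$, $\Psi_\infty=\theta+\sum_{K\ge0}\tau^{-\frac{M+K}N}\psi_K$, one has, as formal series in powers of $\tau^{-1/N}$ (right-hand sides Taylor-expanded about $(r,\theta)$), $$\Big(\tau^{-\frac MN}(\mathcal A\partial_r+\mathcal B\partial_\theta)+\partial_\tau+\vartheta\partial_\zeta\Big)\begin{pmatrix}R_\infty\\ \Psi_\infty\end{pmatrix}=\sum_{K\ge0}\tau^{-\frac{M+K}N}\begin{pmatrix}\Lambda_K(R_\infty,\Psi_\infty)\\ \Omega_K(R_\infty,\Psi_\infty)\end{pmatrix}.$$ *)

theory Defs
  imports "HOL-Analysis.Analysis" "HOL-Computational_Algebra.Formal_Power_Series"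
begin

(* Meant for open sets S: all derivatives are the two-sided ones. *)
primrec cont_diff_on :: "nat \<Rightarrow> ('a::euclidean_space \<Rightarrow> real) \<Rightarrow> 'a set \<Rightarrow> bool" where
  "cont_diff_on 0 f S \<longleftrightarrow> continuous_on S f"
| "cont_diff_on (Suc k) f S \<longleftrightarrow>
     (\<forall>z\<in>S. f differentiable (at z)) \<and>
     (\<forall>v. cont_diff_on k (\<lambda>z. frechet_derivative f (at z) v) S)"

definition smooth_on :: "('a::euclidean_space \<Rightarrow> real) \<Rightarrow> 'a set \<Rightarrow> bool" where
  "smooth_on f S \<longleftrightarrow> (\<forall>k. cont_diff_on k f S)"

definition periodic :: "real \<Rightarrow> (real \<Rightarrow> real) \<Rightarrow> bool" where
  "periodic P c \<longleftrightarrow> (\<forall>z. c (z + P) = c z)"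

definition closed_curve :: "(real \<times> real) set \<Rightarrow> bool" where
  "closed_curve C \<longleftrightarrow>
     (\<exists>\<gamma>. simple_path \<gamma> \<and> pathfinish \<gamma> = pathstart \<gamma> \<and> path_image \<gamma> = C)"

definition solves_on ::
    "real set \<Rightarrow> (real \<Rightarrow> real \<Rightarrow> real \<Rightarrow> real) \<Rightarrow> (real \<Rightarrow> real \<Rightarrow> real \<Rightarrow> real)
       \<Rightarrow> (real \<Rightarrow> real) \<Rightarrow> (real \<Rightarrow> real) \<Rightarrow> bool" where
  "solves_on J P Q x y \<longleftrightarrow>
     (\<forall>t\<in>J. (x has_real_derivative P (x t) (y t) t) (at t) \<and>
            (y has_real_derivative Q (x t) (y t) t) (at t))"

(* F x y S t has the asymptotic series sum_k t^(-k/q) Fc k x y S as t tends to infinity.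
   The bound is uniform in S and holds for all x, y, up to a polynomial weight whose degree d
   is the same for all orders n: the series is going to be evaluated at points (x, y) that
   tend to infinity with t. *)
definition power_law_asymptotics ::
    "nat \<Rightarrow> (real \<Rightarrow> real \<Rightarrow> real \<Rightarrow> real \<Rightarrow> real) \<Rightarrow> (nat \<Rightarrow> real \<Rightarrow> real \<Rightarrow> real \<Rightarrow> real) \<Rightarrow> bool" where
  "power_law_asymptotics q F Fc \<longleftrightarrow>
     (\<exists>d::nat. \<forall>n. \<exists>C t'. 0 < t' \<and> (\<forall>t\<ge>t'. \<forall>x y S.
        \<bar>F x y S t - (\<Sum>k\<le>n. t powr (- (real k / real q)) * Fc k x y S)\<bar>
          \<le> C * t powr (- (real (Suc n) / real q)) * (1 + \<bar>x\<bar> + \<bar>y\<bar>) ^ d))"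

(* W \<phi> E = E^\<alpha> sum_j E^(-j/(2h)) c j \<phi> as E tends to infinity, uniformly in \<phi>. *)
definition energy_asymptotics ::
    "nat \<Rightarrow> real \<Rightarrow> (real \<Rightarrow> real \<Rightarrow> real) \<Rightarrow> (nat \<Rightarrow> real \<Rightarrow> real) \<Rightarrow> bool" where
  "energy_asymptotics h \<alpha> W c \<longleftrightarrow>
     (\<forall>m. \<exists>C E'. 0 < E' \<and> (\<forall>E\<ge>E'. \<forall>\<phi>.
        \<bar>W \<phi> E - (\<Sum>j\<le>m. E powr (\<alpha> - real j / (2 * real h)) * c j \<phi>)\<bar>
          \<le> C * E powr (\<alpha> - real (Suc m) / (2 * real h))))"

(* The series may in addition be differentiated once, term by term, with respect to E. *)
definition energy_asymptotics_C1 ::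
    "nat \<Rightarrow> real \<Rightarrow> (real \<Rightarrow> real \<Rightarrow> real) \<Rightarrow> (nat \<Rightarrow> real \<Rightarrow> real) \<Rightarrow> bool" where
  "energy_asymptotics_C1 h \<alpha> W c \<longleftrightarrow>
     energy_asymptotics h \<alpha> W c \<and>
     energy_asymptotics h (\<alpha> - 1) (\<lambda>\<phi> E. deriv (W \<phi>) E)
       (\<lambda>j \<phi>. (\<alpha> - real j / (2 * real h)) * c j \<phi>)"

(* The coefficient of \<tau>^(-K/N) in the asymptotic expansion of w in powers of \<tau>^(-1/N). *)
fun expansion_coeff :: "nat \<Rightarrow> (real \<Rightarrow> real) \<Rightarrow> nat \<Rightarrow> real" where
  "expansion_coeff N w K =
     Lim at_top (\<lambda>\<tau>. \<tau> powr (real K / real N) *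
       (w \<tau> - (\<Sum>j<K. \<tau> powr (- (real j / real N)) * expansion_coeff N w j)))"

(* Formal series in powers of \<tau>^(-1/N) are written as formal power series, fps_X standing for
   \<tau>^(-1/N), with (r, \<theta>, \<zeta>) kept fixed. *)

(* sum_K \<tau>^(-(M+K)/N) c_K *)
definition shifted_series :: "nat \<Rightarrow> (nat \<Rightarrow> real) \<Rightarrow> real fps" where
  "shifted_series M c = fps_X ^ M * Abs_fps c"

(* The operator \<tau>^(-M/N) (A d_r + B d_\<theta>) + d_\<tau> + vartheta d_\<zeta> applied to
   w_0 + sum_K \<tau>^(-(M+K)/N) w_K, where w_0 is r or \<theta> and (cr, c\<theta>) is its gradient.
   On formal series d_\<tau> is - (1/N) z^(N+1) d/dz with z = \<tau>^(-1/N). *)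
definition formal_derivative ::
    "nat \<Rightarrow> nat \<Rightarrow> real \<Rightarrow> (nat \<Rightarrow> real \<Rightarrow> real \<Rightarrow> real \<Rightarrow> real) \<Rightarrow> (nat \<Rightarrow> real \<Rightarrow> real \<Rightarrow> real \<Rightarrow> real)
       \<Rightarrow> real \<Rightarrow> real \<Rightarrow> (nat \<Rightarrow> real \<Rightarrow> real \<Rightarrow> real \<Rightarrow> real) \<Rightarrow> real \<Rightarrow> real \<Rightarrow> real \<Rightarrow> real fps" where
  "formal_derivative M N vartheta A B cr c\<theta> w r \<theta> \<zeta> =
     shifted_series M (\<lambda>K. A K r \<theta> \<zeta>) *
       (fps_const cr + shifted_series M (\<lambda>K. deriv (\<lambda>r'. w K r' \<theta> \<zeta>) r)) +
     shifted_series M (\<lambda>K. B K r \<theta> \<zeta>) *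
       (fps_const c\<theta> + shifted_series M (\<lambda>K. deriv (\<lambda>\<theta>'. w K r \<theta>' \<zeta>) \<theta>)) -
     fps_const (1 / real N) * fps_X ^ (N + 1) * fps_deriv (shifted_series M (\<lambda>K. w K r \<theta> \<zeta>)) +
     fps_const vartheta * shifted_series M (\<lambda>K. deriv (\<lambda>\<zeta>'. w K r \<theta> \<zeta>') \<zeta>)"

definition mixed_deriv :: "nat \<Rightarrow> nat \<Rightarrow> (real \<Rightarrow> real \<Rightarrow> real) \<Rightarrow> real \<Rightarrow> real \<Rightarrow> real" where
  "mixed_deriv i j L r \<theta> = (deriv ^^ i) (\<lambda>r'. (deriv ^^ j) (\<lambda>\<theta>'. L r' \<theta>') \<theta>) r"

(* sum_K \<tau>^(-(M+K)/N) L_K (r + P, \<theta> + Q), Taylor-expanded about (r, \<theta>). The truncation of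
   the sums is harmless when P and Q have no constant term: only i + j \<le> m and K \<le> m
   contribute to the coefficient of order m. *)
definition formal_composition ::
    "nat \<Rightarrow> (nat \<Rightarrow> real \<Rightarrow> real \<Rightarrow> real) \<Rightarrow> real fps \<Rightarrow> real fps \<Rightarrow> real \<Rightarrow> real \<Rightarrow> real fps" where
  "formal_composition M L P Q r \<theta> =
     Abs_fps (\<lambda>m. \<Sum>K\<le>m. \<Sum>i\<le>m. \<Sum>j\<le>m.
       fps_nth (fps_X ^ (M + K) * fps_const (mixed_deriv i j (L K) r \<theta> / (fact i * fact j))
                  * P ^ i * Q ^ j) m)"

definition averaging_functions ::
    "nat \<Rightarrow> nat \<Rightarrow> real \<Rightarrow> nat
       \<Rightarrow> (nat \<Rightarrow> real \<Rightarrow> real \<Rightarrow> real \<Rightarrow> real) \<Rightarrow> (nat \<Rightarrow> real \<Rightarrow> real \<Rightarrow> real \<Rightarrow> real)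
       \<Rightarrow> (nat \<Rightarrow> real \<Rightarrow> real \<Rightarrow> real) \<Rightarrow> (nat \<Rightarrow> real \<Rightarrow> real \<Rightarrow> real)
       \<Rightarrow> (nat \<Rightarrow> real \<Rightarrow> real \<Rightarrow> real \<Rightarrow> real) \<Rightarrow> (nat \<Rightarrow> real \<Rightarrow> real \<Rightarrow> real \<Rightarrow> real) \<Rightarrow> bool" where
  "averaging_functions M N vartheta varkappa A B \<Lambda> \<Omega> \<rho> \<psi> \<longleftrightarrow>
     (\<forall>K. smooth_on (\<lambda>(r, \<theta>). \<Lambda> K r \<theta>) UNIV \<and>
          smooth_on (\<lambda>(r, \<theta>). \<Omega> K r \<theta>) UNIV \<and>
          smooth_on (\<lambda>(r, \<theta>, \<zeta>). \<rho> K r \<theta> \<zeta>) UNIV \<and>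
          smooth_on (\<lambda>(r, \<theta>, \<zeta>). \<psi> K r \<theta> \<zeta>) UNIV) \<and>
     (\<forall>K r. periodic (2 * pi) (\<Lambda> K r) \<and> periodic (2 * pi) (\<Omega> K r)) \<and>
     (\<forall>K r \<zeta>. periodic (2 * pi) (\<lambda>\<theta>. \<rho> K r \<theta> \<zeta>) \<and> periodic (2 * pi) (\<lambda>\<theta>. \<psi> K r \<theta> \<zeta>)) \<and>
     (\<forall>K r \<theta>. periodic (2 * pi * real varkappa) (\<rho> K r \<theta>) \<and>
             periodic (2 * pi * real varkappa) (\<psi> K r \<theta>) \<and>
             integral {0..2 * pi * real varkappa} (\<rho> K r \<theta>) = 0 \<and>
             integral {0..2 * pi * real varkappa} (\<psi> K r \<theta>) = 0) \<and>
     (\<forall>r \<theta> \<zeta>.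
        let P = shifted_series M (\<lambda>K. \<rho> K r \<theta> \<zeta>);
            Q = shifted_series M (\<lambda>K. \<psi> K r \<theta> \<zeta>)
        in formal_derivative M N vartheta A B 1 0 \<rho> r \<theta> \<zeta> = formal_composition M \<Lambda> P Q r \<theta> \<and>
           formal_derivative M N vartheta A B 0 1 \<psi> r \<theta> \<zeta> = formal_composition M \<Omega> P Q r \<theta>)"

end

(* Let z = tau^(-1/N). An expansion up to O(z^m), uniform in parameters, is stable under sums,
   products, reciprocals and roots. Solving the resonance condition for I_* by bootstrapping, every
   ingredient of the rescaled right-hand sides has such an expansion; the hypothesis sigma >= -1 and
   the degree bound i + j <= p ensure that only nonnegative powers of z occur. Hence the coefficients of A and B
   are the formal ones, and truncating the formal averaging identity at order n leaves a remainder
   O(z^(M+n+1)).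

   The bounds on coefficients that the hypotheses leave implicit come from periodicity and from
   polynomial growth of the remainders in x and y. For large tau the averaging map differs from the
   identity by a contraction, so Banach's fixed point theorem makes it invertible on |r| <= 2 with
   range containing |R| <= 1.

   On H > E_0 the map (phi, E) -> (X, Y) is onto and injective up to phi + 2 pi Z by uniqueness of
   orbits, and a local diffeomorphism: its Jacobian determinant is 1 / omega. A curve in
   the plane therefore lifts to a differentiable energy; its exp(i phi) is continuous, and a continuous
   logarithm of it on the interval of definition yields a differentiable angle. *)
theory Submission imports Defs begin

section \<open>Derivatives of smooth and periodic functions\<close>

text \<open>Estimates are uniform over a parameter set \<open>P\<close> of triples (r, \<theta>,
  \<zeta>) with r bounded and both angles unbounded. Functions of the energy do not expand in z
  directly but in \<open>I powr (- 1 / (2 h))\<close>, which is comparable with the power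
  \<open>2 b\<close> of z. In this quantity X, Y, \<omega> and their derivatives have fixed weights,
  and \<sigma> is made so that the total weight of the perturbation cancels against the powers of t
  in front of it. Mostly only the existence of expansions is tracked: the coefficients in the
  averaging identities are defined by limits, and a limit recovers them from any expansion. The
  obstacle at the end is that the averaging map is inverted on a strip only, while the perturbed
  system is transformed on all of \<open>D E1\<close>, where r is unbounded. Hence the remainder has
  two forms, one in (r, \<theta>) and one in (R, \<Psi>), and solutions are carried over in each
  direction separately. On the way back, r and \<theta> are first known as values of an inverse map;
  that they are differentiable in \<tau> comes from the inverse function theorem with \<tau> as a
  third coordinate, and only then can their equations be derived.\<close>

lemma smooth_on_imp_differentiable:
  assumes "smooth_on f S" "z \<in> S"
  shows "f differentiable (at z)"
proof -
  have "cont_diff_on (Suc 0) f S" using assms(1) unfolding smooth_on_def by blast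
  then show ?thesis using assms(2) by simp
qed

lemma smooth_on_imp_continuous_on:
  assumes "smooth_on f S" shows "continuous_on S f"
proof -
  have "cont_diff_on 0 f S" using assms(1) unfolding smooth_on_def by blast
  then show ?thesis by simp
qed

lemma smooth_on_frechet_derivative:
  assumes "smooth_on f S" shows "smooth_on (\<lambda>z. frechet_derivative f (at z) v) S"
  unfolding smooth_on_def
proof
  fix k
  have "cont_diff_on (Suc k) f S" using assms(1) unfolding smooth_on_def by blast
  then show "cont_diff_on k (\<lambda>z. frechet_derivative f (at z) v) S" by simp
qed

text \<open>\<open>smooth_on\<close> speaks of Frechet derivatives, whereas the averaging identities
  are written with the one-variable \<open>deriv\<close>. Restricting the total derivative to the
  coordinate axes translates between the two, and linearity reassembles it.\<close>

lemma has_derivative_partials2: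
  fixes f :: "real \<Rightarrow> real \<Rightarrow> real"
  assumes "(\<lambda>(x, y). f x y) differentiable (at (x, y))"
  shows "((\<lambda>(x, y). f x y) has_derivative
      (\<lambda>(dx, dy). deriv (\<lambda>x'. f x' y) x * dx + deriv (f x) y * dy)) (at (x, y))"
    and "deriv (\<lambda>x'. f x' y) x = frechet_derivative (\<lambda>(x, y). f x y) (at (x, y)) (1, 0)"
    and "deriv (f x) y = frechet_derivative (\<lambda>(x, y). f x y) (at (x, y)) (0, 1)"
    and "((\<lambda>x'. f x' y) has_real_derivative deriv (\<lambda>x'. f x' y) x) (at x)"
    and "(f x has_real_derivative deriv (f x) y) (at y)"
proof -
  define D where "D = frechet_derivative (\<lambda>(x, y). f x y) (at (x, y))"
  have D: "((\<lambda>(x, y). f x y) has_derivative D) (at (x, y))"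
    unfolding D_def using assms frechet_derivative_works by blast
  then interpret D: bounded_linear D by (rule has_derivative_bounded_linear)
  have "(\<lambda>d. D (d, 0)) = (\<lambda>d. d * D (1, 0))"
  proof
    fix d show "D (d, 0) = d * D (1, 0)" using D.scaleR[of d "(1, 0)"] by simp
  qed
  moreover have "((\<lambda>x'. (x', y)) has_derivative (\<lambda>d. (d, 0))) (at x)"
    by (auto intro!: has_derivative_eq_rhs[OF has_derivative_Pair] derivative_intros simp: zero_prod_def)
  from has_derivative_compose[OF this, of "\<lambda>(x, y). f x y" D] D have "((\<lambda>x'. f x' y) has_derivative (\<lambda>d. D (d, 0))) (at x)" by simp
  ultimately have 1: "((\<lambda>x'. f x' y) has_real_derivative D (1, 0)) (at x)"
    by (simp add: has_field_derivative_def mult_commute_abs)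
  have "(\<lambda>d. D (0, d)) = (\<lambda>d. d * D (0, 1))"
  proof
    fix d show "D (0, d) = d * D (0, 1)" using D.scaleR[of d "(0, 1)"] by simp
  qed
  moreover have "((\<lambda>y'. (x, y')) has_derivative (\<lambda>d. (0, d))) (at y)"
    by (auto intro!: has_derivative_eq_rhs[OF has_derivative_Pair] derivative_intros simp: zero_prod_def)
  from has_derivative_compose[OF this, of "\<lambda>(x, y). f x y" D] D have "(f x has_derivative (\<lambda>d. D (0, d))) (at y)" by simp
  ultimately have 2: "(f x has_real_derivative D (0, 1)) (at y)"
    by (simp add: has_field_derivative_def mult_commute_abs)
  from 1 2 show a: "deriv (\<lambda>x'. f x' y) x = frechet_derivative (\<lambda>(x, y). f x y) (at (x, y)) (1, 0)"
    and b: "deriv (f x) y = frechet_derivative (\<lambda>(x, y). f x y) (at (x, y)) (0, 1)"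
    using DERIV_imp_deriv D_def by auto
  show "((\<lambda>x'. f x' y) has_real_derivative deriv (\<lambda>x'. f x' y) x) (at x)"
    and "(f x has_real_derivative deriv (f x) y) (at y)"
    using 1 2 a b D_def by auto
  have "D = (\<lambda>(dx, dy). D (1, 0) * dx + D (0, 1) * dy)"
  proof
    fix v show "D v = (\<lambda>(dx, dy). D (1, 0) * dx + D (0, 1) * dy) v"
      using D.scaleR[of "fst v" "(1, 0)"] D.scaleR[of "snd v" "(0, 1)"]
        D.add[of "(fst v, 0)" "(0, snd v)"] by (simp add: case_prod_unfold mult.commute)
  qed
  then show "((\<lambda>(x, y). f x y) has_derivative
      (\<lambda>(dx, dy). deriv (\<lambda>x'. f x' y) x * dx + deriv (f x) y * dy)) (at (x, y))"
    using D a b D_def by simp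
qed

lemma has_derivative_partials3:
  fixes f :: "real \<Rightarrow> real \<Rightarrow> real \<Rightarrow> real"
  assumes "(\<lambda>(x, y, z). f x y z) differentiable (at (x, y, z))"
  shows "((\<lambda>(x, y, z). f x y z) has_derivative
      (\<lambda>(dx, dy, dz). deriv (\<lambda>x'. f x' y z) x * dx + deriv (\<lambda>y'. f x y' z) y * dy
         + deriv (f x y) z * dz)) (at (x, y, z))"
    and "deriv (\<lambda>x'. f x' y z) x = frechet_derivative (\<lambda>(x, y, z). f x y z) (at (x, y, z)) (1, 0, 0)"
    and "deriv (\<lambda>y'. f x y' z) y = frechet_derivative (\<lambda>(x, y, z). f x y z) (at (x, y, z)) (0, 1, 0)"
    and "deriv (f x y) z = frechet_derivative (\<lambda>(x, y, z). f x y z) (at (x, y, z)) (0, 0, 1)"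
proof -
  define D where "D = frechet_derivative (\<lambda>(x, y, z). f x y z) (at (x, y, z))"
  have D: "((\<lambda>(x, y, z). f x y z) has_derivative D) (at (x, y, z))"
    unfolding D_def using assms frechet_derivative_works by blast
  then interpret D: bounded_linear D by (rule has_derivative_bounded_linear)
  have "(\<lambda>d. D (d, 0, 0)) = (\<lambda>d. d * D (1, 0, 0))"
  proof
    fix d show "D (d, 0, 0) = d * D (1, 0, 0)" using D.scaleR[of d "(1, 0, 0)"] by simp
  qed
  moreover have "((\<lambda>x'. (x', y, z)) has_derivative (\<lambda>d. (d, 0, 0))) (at x)"
    by (auto intro!: has_derivative_eq_rhs[OF has_derivative_Pair] derivative_intros simp: zero_prod_def)
  from has_derivative_compose[OF this, of "\<lambda>(x, y, z). f x y z" D] D have "((\<lambda>x'. f x' y z) has_derivative (\<lambda>d. D (d, 0, 0))) (at x)" by simp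
  ultimately have 1: "((\<lambda>x'. f x' y z) has_real_derivative D (1, 0, 0)) (at x)"
    by (simp add: has_field_derivative_def mult_commute_abs)
  have "(\<lambda>d. D (0, d, 0)) = (\<lambda>d. d * D (0, 1, 0))"
  proof
    fix d show "D (0, d, 0) = d * D (0, 1, 0)" using D.scaleR[of d "(0, 1, 0)"] by simp
  qed
  moreover have "((\<lambda>y'. (x, y', z)) has_derivative (\<lambda>d. (0, d, 0))) (at y)"
    by (auto intro!: has_derivative_eq_rhs[OF has_derivative_Pair] derivative_intros simp: zero_prod_def)
  from has_derivative_compose[OF this, of "\<lambda>(x, y, z). f x y z" D] D have "((\<lambda>y'. f x y' z) has_derivative (\<lambda>d. D (0, d, 0))) (at y)" by simp
  ultimately have 2: "((\<lambda>y'. f x y' z) has_real_derivative D (0, 1, 0)) (at y)"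
    by (simp add: has_field_derivative_def mult_commute_abs)
  have "(\<lambda>d. D (0, 0, d)) = (\<lambda>d. d * D (0, 0, 1))"
  proof
    fix d show "D (0, 0, d) = d * D (0, 0, 1)" using D.scaleR[of d "(0, 0, 1)"] by simp
  qed
  moreover have "((\<lambda>z'. (x, y, z')) has_derivative (\<lambda>d. (0, 0, d))) (at z)"
    by (auto intro!: has_derivative_eq_rhs[OF has_derivative_Pair] derivative_intros simp: zero_prod_def)
  from has_derivative_compose[OF this, of "\<lambda>(x, y, z). f x y z" D] D have "(f x y has_derivative (\<lambda>d. D (0, 0, d))) (at z)" by simp
  ultimately have 3: "(f x y has_real_derivative D (0, 0, 1)) (at z)"
    by (simp add: has_field_derivative_def mult_commute_abs)
  from 1 2 3 show a: "deriv (\<lambda>x'. f x' y z) x = frechet_derivative (\<lambda>(x, y, z). f x y z) (at (x, y, z)) (1, 0, 0)"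
    and b: "deriv (\<lambda>y'. f x y' z) y = frechet_derivative (\<lambda>(x, y, z). f x y z) (at (x, y, z)) (0, 1, 0)"
    and c: "deriv (f x y) z = frechet_derivative (\<lambda>(x, y, z). f x y z) (at (x, y, z)) (0, 0, 1)"
    using DERIV_imp_deriv D_def by auto
  have "D = (\<lambda>(dx, dy, dz). D (1, 0, 0) * dx + D (0, 1, 0) * dy + D (0, 0, 1) * dz)"
  proof
    fix v show "D v = (\<lambda>(dx, dy, dz). D (1, 0, 0) * dx + D (0, 1, 0) * dy + D (0, 0, 1) * dz) v"
    proof (cases v)
      case (fields dx dy dz)
      show ?thesis
        using D.scaleR[of dx "(1, 0, 0)"] D.scaleR[of dy "(0, 1, 0)"] D.scaleR[of dz "(0, 0, 1)"]
          D.add[of "(dx, 0, 0)" "(0, dy, dz)"] D.add[of "(0, dy, 0)" "(0, 0, dz)"] fields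
        by (simp add: mult.commute)
    qed
  qed
  then show "((\<lambda>(x, y, z). f x y z) has_derivative
      (\<lambda>(dx, dy, dz). deriv (\<lambda>x'. f x' y z) x * dx + deriv (\<lambda>y'. f x y' z) y * dy
         + deriv (f x y) z * dz)) (at (x, y, z))"
    using D a b c D_def by simp
qed

lemma smooth_on_partials2:
  fixes f :: "real \<Rightarrow> real \<Rightarrow> real"
  assumes "smooth_on (\<lambda>(x, y). f x y) UNIV"
  shows "smooth_on (\<lambda>(x, y). deriv (\<lambda>x'. f x' y) x) UNIV"
    and "smooth_on (\<lambda>(x, y). deriv (f x) y) UNIV"
proof -
  have "(\<lambda>(x, y). f x y) differentiable (at (x, y))" for x y
    using smooth_on_imp_differentiable[OF assms] by blast
  note * = has_derivative_partials2[OF this]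
  show "smooth_on (\<lambda>(x, y). deriv (\<lambda>x'. f x' y) x) UNIV"
    using smooth_on_frechet_derivative[OF assms, of "(1, 0)"]
    by (simp add: *(2) case_prod_unfold)
  show "smooth_on (\<lambda>(x, y). deriv (f x) y) UNIV"
    using smooth_on_frechet_derivative[OF assms, of "(0, 1)"]
    by (simp add: *(3) case_prod_unfold)
qed

lemma smooth_on_partials3:
  fixes f :: "real \<Rightarrow> real \<Rightarrow> real \<Rightarrow> real"
  assumes "smooth_on (\<lambda>(x, y, z). f x y z) UNIV"
  shows "smooth_on (\<lambda>(x, y, z). deriv (\<lambda>x'. f x' y z) x) UNIV"
    and "smooth_on (\<lambda>(x, y, z). deriv (\<lambda>y'. f x y' z) y) UNIV"
    and "smooth_on (\<lambda>(x, y, z). deriv (f x y) z) UNIV"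
proof -
  have "(\<lambda>(x, y, z). f x y z) differentiable (at (x, y, z))" for x y z
    using smooth_on_imp_differentiable[OF assms] by blast
  note * = has_derivative_partials3[OF this]
  show "smooth_on (\<lambda>(x, y, z). deriv (\<lambda>x'. f x' y z) x) UNIV"
    using smooth_on_frechet_derivative[OF assms, of "(1, 0, 0)"]
    by (simp add: *(2) case_prod_unfold)
  show "smooth_on (\<lambda>(x, y, z). deriv (\<lambda>y'. f x y' z) y) UNIV"
    using smooth_on_frechet_derivative[OF assms, of "(0, 1, 0)"]
    by (simp add: *(3) case_prod_unfold)
  show "smooth_on (\<lambda>(x, y, z). deriv (f x y) z) UNIV"
    using smooth_on_frechet_derivative[OF assms, of "(0, 0, 1)"]
    by (simp add: *(4) case_prod_unfold)
qed

section \<open>Periodic functions and bounds by compactness\<close>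

lemma periodic_deriv:
  assumes "periodic P c" shows "periodic P (deriv c)"
  unfolding periodic_def
proof
  fix z
  \<comment> \<open>The numbers that are derivatives of \<open>c\<close> at \<open>z + P\<close> are
    those of the shifted function at \<open>z\<close>, so \<open>deriv\<close> makes the same choice
    even where there is no derivative.\<close>
  have "deriv c (z + P) = deriv (\<lambda>w. c (w + P)) z"
    unfolding deriv_def using DERIV_shift[of c _ z P] by (auto simp: add.commute)
  then show "deriv c (z + P) = deriv c z"
    using assms by (simp add: periodic_def)
qed

lemma periodic_int:
  assumes "periodic P c" shows "c (z + of_int k * P) = c z"
proof -
  have nat: "c (z + of_nat k * P) = c z" for z k
  proof (induction k)
    case (Suc k)
    have "c (z + of_nat (Suc k) * P) = c ((z + of_nat k * P) + P)" by (simp add: algebra_simps)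
    then show ?case using Suc assms by (simp add: periodic_def)
  qed simp
  show ?thesis
  proof (cases "k \<ge> 0")
    case True
    then show ?thesis using nat[of z "nat k"] by simp
  next
    case False
    then show ?thesis using nat[of "z + of_int k * P" "nat (- k)"] by (simp add: algebra_simps)
  qed
qed

lemma periodic_representative:
  assumes "0 < (P::real)"
  obtains w k where "0 \<le> w" "w \<le> P" "z = w + of_int k * P"
proof
  show "0 \<le> z - of_int \<lfloor>z / P\<rfloor> * P" "z - of_int \<lfloor>z / P\<rfloor> * P \<le> P"
    using floor_divide_lower[OF assms, of z] floor_divide_upper[OF assms, of z]
    by (auto simp: algebra_simps)
  show "z = (z - of_int \<lfloor>z / P\<rfloor> * P) + of_int \<lfloor>z / P\<rfloor> * P" by simp
qed

text \<open>Periodicity moves the unbounded variable into one period, and a continuous function is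
  bounded on the remaining rectangle.\<close>

lemma bounded_periodic2:
  fixes f :: "real \<Rightarrow> real \<Rightarrow> real"
  assumes "continuous_on UNIV (\<lambda>(x, y). f x y)" "\<And>x. periodic P (f x)" "0 < P"
  shows "\<exists>B. \<forall>x y. \<bar>x\<bar> \<le> d \<longrightarrow> \<bar>f x y\<bar> \<le> B"
proof -
  have "compact ((\<lambda>(x, y). f x y) ` ({- d..d} \<times> {0..P}))"
    by (intro compact_continuous_image continuous_on_subset[OF assms(1)] compact_Times) auto
  then obtain B where B: "\<And>v. v \<in> (\<lambda>(x, y). f x y) ` ({- d..d} \<times> {0..P}) \<Longrightarrow> norm v \<le> B"
    using compact_imp_bounded bounded_iff by metis
  have "\<bar>f x y\<bar> \<le> B" if "\<bar>x\<bar> \<le> d" for x y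
  proof -
    obtain w k where "0 \<le> w" "w \<le> P" "y = w + of_int k * P"
      using periodic_representative[OF assms(3)] .
    then have "f x y = f x w" using periodic_int[OF assms(2)] by simp
    also have "\<bar>f x w\<bar> \<le> B" using B[of "f x w"] \<open>0 \<le> w\<close> \<open>w \<le> P\<close> that by force
    finally show ?thesis .
  qed
  then show ?thesis by blast
qed

lemma bounded_periodic3:
  fixes f :: "real \<Rightarrow> real \<Rightarrow> real \<Rightarrow> real"
  assumes "continuous_on UNIV (\<lambda>(x, y, z). f x y z)"
    "\<And>x z. periodic P (\<lambda>y. f x y z)" "0 < P" "\<And>x y. periodic Q (f x y)" "0 < Q"
  shows "\<exists>B. \<forall>x y z. \<bar>x\<bar> \<le> d \<longrightarrow> \<bar>f x y z\<bar> \<le> B"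
proof -
  have "compact ((\<lambda>(x, y, z). f x y z) ` ({- d..d} \<times> {0..P} \<times> {0..Q}))"
    by (intro compact_continuous_image continuous_on_subset[OF assms(1)] compact_Times) auto
  then obtain B where B: "\<And>v. v \<in> (\<lambda>(x, y, z). f x y z) ` ({- d..d} \<times> {0..P} \<times> {0..Q}) \<Longrightarrow> norm v \<le> B"
    using compact_imp_bounded bounded_iff by metis
  have "\<bar>f x y z\<bar> \<le> B" if "\<bar>x\<bar> \<le> d" for x y z
  proof -
    obtain w k where w: "0 \<le> w" "w \<le> P" "y = w + of_int k * P"
      using periodic_representative[OF assms(3)] .
    obtain w' k' where w': "0 \<le> w'" "w' \<le> Q" "z = w' + of_int k' * Q"
      using periodic_representative[OF assms(5)] .
    have "f x y z = f x w z" using periodic_int[OF assms(2)] w by simp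
    also have "\<dots> = f x w w'" using periodic_int[OF assms(4)] w' by simp
    also have "f x w w' \<in> (\<lambda>(x, y, z). f x y z) ` ({- d..d} \<times> {0..P} \<times> {0..Q})"
      by (rule image_eqI[of _ _ "(x, w, w')"]) (use w w' that in auto)
    then have "\<bar>f x w w'\<bar> \<le> B" using B by force
    finally show ?thesis .
  qed
  then show ?thesis by blast
qed

text \<open>As an iteration of operators on functions of two variables, the mixed derivative can be
  treated by induction: each operator preserves joint smoothness and periodicity, whereas the
  definition freezes one variable at a time.\<close>

lemma mixed_deriv_eq:
  "mixed_deriv i j L = ((\<lambda>f x y. deriv (\<lambda>x'. f x' y) x) ^^ i) (((\<lambda>f x. deriv (f x)) ^^ j) L)"
proof -
  have 1: "((\<lambda>f x. deriv (f x)) ^^ j) L r = (deriv ^^ j) (L r)" for L :: "real \<Rightarrow> real \<Rightarrow> real" and r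
    by (induction j) auto
  have 2: "((\<lambda>f x y. deriv (\<lambda>x'. f x' y) x) ^^ i) g r \<theta> = (deriv ^^ i) (\<lambda>r'. g r' \<theta>) r"
    for g :: "real \<Rightarrow> real \<Rightarrow> real" and r \<theta>
    by (induction i arbitrary: r) auto
  show ?thesis
    by (rule ext)+ (simp add: 1 2 mixed_deriv_def)
qed

lemma smooth_mixed_deriv:
  assumes "smooth_on (\<lambda>(x, y). L x y) UNIV" "\<And>x. periodic P (L x)"
  shows "smooth_on (\<lambda>(x, y). mixed_deriv i j L x y) UNIV" "periodic P (mixed_deriv i j L x)"
proof -
  have 1: "smooth_on (\<lambda>(x, y). ((\<lambda>f x. deriv (f x)) ^^ j) L x y) UNIV
      \<and> (\<forall>x. periodic P (((\<lambda>f x. deriv (f x)) ^^ j) L x))" (is "smooth_on (\<lambda>(x, y). ?L x y) UNIV \<and> _")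
    using assms by (induction j) (auto intro: smooth_on_partials2 periodic_deriv)
  have "smooth_on (\<lambda>(x, y). ((\<lambda>f x y. deriv (\<lambda>x'. f x' y) x) ^^ i) ?L x y) UNIV
      \<and> (\<forall>x. periodic P (((\<lambda>f x y. deriv (\<lambda>x'. f x' y) x) ^^ i) ?L x))"
  proof (induction i)
    case (Suc i)
    then show ?case by (auto intro: smooth_on_partials2 simp: periodic_def)
  qed (use 1 in simp)
  then show "smooth_on (\<lambda>(x, y). mixed_deriv i j L x y) UNIV" "periodic P (mixed_deriv i j L x)"
    unfolding mixed_deriv_eq by blast+
qed

lemma mixed_deriv_DERIV:
  fixes L :: "real \<Rightarrow> real \<Rightarrow> real"
  assumes "smooth_on (\<lambda>(x, y). L x y) UNIV" "\<And>x. periodic P (L x)"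
  shows "((\<lambda>x. mixed_deriv i j L x y) has_real_derivative mixed_deriv (Suc i) j L x y) (at x)"
    and "(mixed_deriv 0 j L x has_real_derivative mixed_deriv 0 (Suc j) L x y) (at y)"
proof -
  have "(\<lambda>(x, y). mixed_deriv i j L x y) differentiable (at (x, y))" for i x y
    using smooth_on_imp_differentiable[OF smooth_mixed_deriv(1)[OF assms]] by blast
  note * = has_derivative_partials2[OF this]
  show "((\<lambda>x. mixed_deriv i j L x y) has_real_derivative mixed_deriv (Suc i) j L x y) (at x)"
    using *(4)[of i y x] by (simp add: mixed_deriv_eq)
  show "(mixed_deriv 0 j L x has_real_derivative mixed_deriv 0 (Suc j) L x y) (at y)"
    using *(5)[of 0 x y] by (simp add: mixed_deriv_eq)
qed

text \<open>Lagrange form of the remainder, with the factor \<open>1 / fact m\<close> estimated by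
  1.\<close>

lemma Taylor_bound:
  fixes D :: "nat \<Rightarrow> real \<Rightarrow> real"
  assumes "0 < m" "\<And>i x. (D i has_real_derivative D (Suc i) x) (at x)"
    and "\<And>x. \<bar>x - c\<bar> \<le> \<bar>a\<bar> \<Longrightarrow> \<bar>D m x\<bar> \<le> B"
  shows "\<bar>D 0 (c + a) - (\<Sum>i<m. D i c / fact i * a ^ i)\<bar> \<le> B * \<bar>a\<bar> ^ m"
\<comment> \<open>\<open>Taylor\<close> asks for an evaluation point different from the centre. For
  \<open>a = 0\<close> the sum reduces to its term of index 0, which exists because
  \<open>0 < m\<close>.\<close>
proof (cases "a = 0")
  case True
  obtain k where "m = Suc k" using assms(1) gr0_conv_Suc by blast
  then show ?thesis using True by (simp add: sum.lessThan_Suc_shift)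
next
  case False
  have "\<exists>t. (if c + a < c then c + a < t \<and> t < c else c < t \<and> t < c + a) \<and>
      D 0 (c + a) = (\<Sum>i<m. D i c / fact i * (c + a - c) ^ i) + D m t / fact m * (c + a - c) ^ m"
    by (rule Taylor[of m D "D 0" "c - \<bar>a\<bar>" "c + \<bar>a\<bar>"]) (use assms False in auto)
  then obtain t where t0: "if c + a < c then c + a < t \<and> t < c else c < t \<and> t < c + a"
    and eq0: "D 0 (c + a) = (\<Sum>i<m. D i c / fact i * (c + a - c) ^ i) + D m t / fact m * (c + a - c) ^ m"
    by blast
  have t: "\<bar>t - c\<bar> \<le> \<bar>a\<bar>" using t0 by (auto split: if_splits)
  have eq: "D 0 (c + a) - (\<Sum>i<m. D i c / fact i * a ^ i) = D m t / fact m * a ^ m"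
    using eq0 by simp
  have "\<bar>D m t / fact m * a ^ m\<bar> = \<bar>D m t\<bar> / fact m * \<bar>a\<bar> ^ m"
    by (simp add: abs_mult power_abs)
  also have "\<dots> \<le> \<bar>D m t\<bar> * \<bar>a\<bar> ^ m"
  proof (rule mult_right_mono)
    show "\<bar>D m t\<bar> / fact m \<le> \<bar>D m t\<bar>"
      using mult_left_mono[of 1 "fact m" "\<bar>D m t\<bar>"] by (simp add: divide_le_eq)
  qed simp
  also have "\<dots> \<le> B * \<bar>a\<bar> ^ m" by (rule mult_right_mono) (use assms(3) t in auto)
  finally show ?thesis using eq by simp
qed

text \<open>Two one-variable expansions: first in the second variable at \<open>x + a\<close>, then
  of each coefficient in the first variable at \<open>x\<close>. The sum runs over a square of
  indices, as in \<open>formal_composition\<close>, and the error contains no mixed powers.\<close>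

lemma Taylor2_bound:
  assumes "smooth_on (\<lambda>(x, y). L x y) UNIV" "\<And>x. periodic P (L x)" "0 < P" "0 < m"
  shows "\<exists>C. \<forall>x y a b :: real. \<bar>x\<bar> \<le> d \<longrightarrow> \<bar>a\<bar> \<le> 1 \<longrightarrow> \<bar>b\<bar> \<le> 1 \<longrightarrow>
    \<bar>L (x + a) (y + b) - (\<Sum>i<m. \<Sum>j<m. mixed_deriv i j L x y / (fact i * fact j) * a ^ i * b ^ j)\<bar>
      \<le> C * (\<bar>a\<bar> ^ m + \<bar>b\<bar> ^ m)"
proof -
  have "\<exists>B. \<forall>x y :: real. \<bar>x\<bar> \<le> d + 1 \<longrightarrow> \<bar>mixed_deriv i j L x y\<bar> \<le> B" for i j
    using bounded_periodic2[OF smooth_on_imp_continuous_on[OF smooth_mixed_deriv(1)[OF assms(1,2)]]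
        smooth_mixed_deriv(2)[OF assms(1,2)] assms(3), where d = "d + 1"] by simp
  \<comment> \<open>The margin 1 in \<open>d + 1\<close> is for the shift of the first variable by
    \<open>a\<close>.\<close>
  then obtain B where B: "\<And>i j x y. \<bar>x\<bar> \<le> d + 1 \<Longrightarrow> \<bar>mixed_deriv i j L x y\<bar> \<le> B i j" by metis
  define C where "C = \<bar>B 0 m\<bar> + (\<Sum>j<m. \<bar>B m j\<bar>)"
  have "\<bar>L (x + a) (y + b) - (\<Sum>i<m. \<Sum>j<m. mixed_deriv i j L x y / (fact i * fact j) * a ^ i * b ^ j)\<bar>
      \<le> C * (\<bar>a\<bar> ^ m + \<bar>b\<bar> ^ m)" if x: "\<bar>x\<bar> \<le> d" and a: "\<bar>a\<bar> \<le> 1" and b: "\<bar>b\<bar> \<le> 1" for x y a b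
  proof -
    let ?S = "\<Sum>i<m. \<Sum>j<m. mixed_deriv i j L x y / (fact i * fact j) * a ^ i * b ^ j"
    \<comment> \<open>The intermediate sum, expanded in the second variable only.\<close>
    let ?T = "\<Sum>j<m. mixed_deriv 0 j L (x + a) y / fact j * b ^ j"
    have "\<bar>mixed_deriv 0 0 L (x + a) (y + b) - ?T\<bar> \<le> \<bar>B 0 m\<bar> * \<bar>b\<bar> ^ m"
    proof (rule Taylor_bound[OF assms(4), of "\<lambda>j. mixed_deriv 0 j L (x + a)"])
      fix w assume "\<bar>w - y\<bar> \<le> \<bar>b\<bar>"
      have "\<bar>x + a\<bar> \<le> d + 1" using x a by linarith
      then show "\<bar>mixed_deriv 0 m L (x + a) w\<bar> \<le> \<bar>B 0 m\<bar>" using B[of "x + a" 0 m w] by linarith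
    qed (rule mixed_deriv_DERIV[OF assms(1,2)])
    moreover have "mixed_deriv 0 0 L (x + a) (y + b) = L (x + a) (y + b)" by (simp add: mixed_deriv_def)
    ultimately have 1: "\<bar>L (x + a) (y + b) - ?T\<bar> \<le> \<bar>B 0 m\<bar> * \<bar>b\<bar> ^ m" by simp
    have 2: "\<bar>mixed_deriv 0 j L (x + a) y - (\<Sum>i<m. mixed_deriv i j L x y / fact i * a ^ i)\<bar> \<le> \<bar>B m j\<bar> * \<bar>a\<bar> ^ m" for j
    proof (rule Taylor_bound[OF assms(4), of "\<lambda>i x. mixed_deriv i j L x y"])
      fix w assume "\<bar>w - x\<bar> \<le> \<bar>a\<bar>"
      then have "\<bar>w\<bar> \<le> d + 1" using x a by linarith
      then show "\<bar>mixed_deriv m j L w y\<bar> \<le> \<bar>B m j\<bar>" using B[of w m j y] by linarith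
    qed (rule mixed_deriv_DERIV[OF assms(1,2)])
    have "?S = (\<Sum>j<m. (\<Sum>i<m. mixed_deriv i j L x y / fact i * a ^ i) / fact j * b ^ j)"
      by (subst sum.swap) (simp add: sum_distrib_left sum_distrib_right sum_divide_distrib field_simps)
    then have "?T - ?S = (\<Sum>j<m. (mixed_deriv 0 j L (x + a) y - (\<Sum>i<m. mixed_deriv i j L x y / fact i * a ^ i)) / fact j * b ^ j)"
      by (simp add: sum_subtractf[symmetric] diff_divide_distrib left_diff_distrib)
    also have "\<bar>\<dots>\<bar> \<le> (\<Sum>j<m. \<bar>B m j\<bar> * \<bar>a\<bar> ^ m)"
    proof (rule order.trans[OF sum_abs sum_mono])
      fix j
      let ?D = "mixed_deriv 0 j L (x + a) y - (\<Sum>i<m. mixed_deriv i j L x y / fact i * a ^ i)"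
      have "\<bar>?D / fact j * b ^ j\<bar> = \<bar>?D\<bar> / fact j * \<bar>b\<bar> ^ j" by (simp add: abs_mult power_abs)
      also have "\<dots> \<le> \<bar>?D\<bar> * 1"
      proof (rule mult_mono)
        show "\<bar>?D\<bar> / fact j \<le> \<bar>?D\<bar>"
          using mult_left_mono[of 1 "fact j" "\<bar>?D\<bar>"] by (simp add: divide_le_eq)
        show "\<bar>b\<bar> ^ j \<le> 1" using b by (simp add: power_le_one)
      qed auto
      finally show "\<bar>?D / fact j * b ^ j\<bar> \<le> \<bar>B m j\<bar> * \<bar>a\<bar> ^ m" using 2[of j] by simp
    qed
    finally have "\<bar>?T - ?S\<bar> \<le> (\<Sum>j<m. \<bar>B m j\<bar>) * \<bar>a\<bar> ^ m" by (simp add: sum_distrib_right)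
    then have "\<bar>L (x + a) (y + b) - ?S\<bar> \<le> \<bar>B 0 m\<bar> * \<bar>b\<bar> ^ m + (\<Sum>j<m. \<bar>B m j\<bar>) * \<bar>a\<bar> ^ m"
      using 1 by linarith
    also have "\<dots> \<le> C * \<bar>b\<bar> ^ m + C * \<bar>a\<bar> ^ m"
      unfolding C_def by (intro add_mono mult_right_mono) (auto simp: sum_nonneg)
    finally show ?thesis by (simp add: algebra_simps)
  qed
  then show ?thesis by blast
qed

section \<open>Uniform expansions in powers of a small parameter\<close>

unbundle no vec_syntax
unbundle fps_syntax

declare expansion_coeff.simps [simp del]

text \<open>Uniform asymptotic expansions in powers of \<open>z\<close>, up to and including an error of order \<open>m\<close>.
  The recursion over \<open>m\<close> peels off the leading coefficient, which turns the rules for products,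
  reciprocals and roots into short inductions.\<close>

locale small_parameter =
  fixes z :: "real \<Rightarrow> real" and P :: "'p set"
  assumes z_pos: "\<forall>\<^sub>F \<tau> in at_top. 0 < z \<tau>" and z_lim: "(z \<longlongrightarrow> 0) at_top"
begin

lemma z_le: "\<forall>\<^sub>F \<tau> in at_top. 0 < z \<tau> \<and> z \<tau> \<le> 1"
  using order_tendstoD(2)[OF z_lim, of 1] z_pos by (auto elim: eventually_elim2)

definition bigO :: "nat \<Rightarrow> (real \<Rightarrow> 'p \<Rightarrow> real) \<Rightarrow> bool" where
  "bigO m u \<longleftrightarrow> (\<exists>C. \<forall>\<^sub>F \<tau> in at_top. \<forall>p\<in>P. \<bar>u \<tau> p\<bar> \<le> C * z \<tau> ^ m)"

definition bdd_on :: "('p \<Rightarrow> real) \<Rightarrow> bool" where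
  "bdd_on c \<longleftrightarrow> (\<exists>C. \<forall>p\<in>P. \<bar>c p\<bar> \<le> C)"

lemma bdd_onI: "(\<And>p. p \<in> P \<Longrightarrow> \<bar>c p\<bar> \<le> C) \<Longrightarrow> bdd_on c"
  unfolding bdd_on_def by blast

lemma bdd_on_const [simp]: "bdd_on (\<lambda>p. c)"
  by (rule bdd_onI[of _ "\<bar>c\<bar>"]) simp

lemma bigO_nonneg:
  assumes "bigO m u"
  obtains C where "0 \<le> C" "\<forall>\<^sub>F \<tau> in at_top. \<forall>p\<in>P. \<bar>u \<tau> p\<bar> \<le> C * z \<tau> ^ m"
proof -
  obtain C where C: "\<forall>\<^sub>F \<tau> in at_top. \<forall>p\<in>P. \<bar>u \<tau> p\<bar> \<le> C * z \<tau> ^ m"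
    using assms unfolding bigO_def by blast
  have "\<forall>\<^sub>F \<tau> in at_top. \<forall>p\<in>P. \<bar>u \<tau> p\<bar> \<le> \<bar>C\<bar> * z \<tau> ^ m"
    using C z_pos
  proof eventually_elim
    case (elim \<tau>)
    have "C * z \<tau> ^ m \<le> \<bar>C\<bar> * z \<tau> ^ m" using elim by (intro mult_right_mono) auto
    then show ?case using elim(1) by (meson order_trans)
  qed
  then show ?thesis using that[of "\<bar>C\<bar>"] by simp
qed

lemma bigO_cong:
  assumes "\<forall>\<^sub>F \<tau> in at_top. \<forall>p\<in>P. u \<tau> p = v \<tau> p" "bigO m u"
  shows "bigO m v"
proof -
  obtain C where "\<forall>\<^sub>F \<tau> in at_top. \<forall>p\<in>P. \<bar>u \<tau> p\<bar> \<le> C * z \<tau> ^ m"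
    using assms(2) unfolding bigO_def by blast
  with assms(1) have "\<forall>\<^sub>F \<tau> in at_top. \<forall>p\<in>P. \<bar>v \<tau> p\<bar> \<le> C * z \<tau> ^ m"
    by eventually_elim simp
  then show ?thesis unfolding bigO_def by blast
qed

lemma bigO_cong_iff:
  assumes "\<forall>\<^sub>F \<tau> in at_top. \<forall>p\<in>P. u \<tau> p = v \<tau> p"
  shows "bigO m u \<longleftrightarrow> bigO m v"
  using bigO_cong[OF assms] bigO_cong[of v u m] assms by (auto simp: eq_commute)

lemma bigO_bound:
  assumes "\<forall>\<^sub>F \<tau> in at_top. \<forall>p\<in>P. \<bar>v \<tau> p\<bar> \<le> \<bar>u \<tau> p\<bar>" "bigO m u"
  shows "bigO m v"
proof -
  obtain C where "\<forall>\<^sub>F \<tau> in at_top. \<forall>p\<in>P. \<bar>u \<tau> p\<bar> \<le> C * z \<tau> ^ m"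
    using assms(2) unfolding bigO_def by blast
  with assms(1) have "\<forall>\<^sub>F \<tau> in at_top. \<forall>p\<in>P. \<bar>v \<tau> p\<bar> \<le> C * z \<tau> ^ m"
    by eventually_elim (meson order_trans)
  then show ?thesis unfolding bigO_def by blast
qed

lemma bigO_add:
  assumes "bigO m u" "bigO m v" shows "bigO m (\<lambda>\<tau> p. u \<tau> p + v \<tau> p)"
proof -
  obtain C D where "\<forall>\<^sub>F \<tau> in at_top. \<forall>p\<in>P. \<bar>u \<tau> p\<bar> \<le> C * z \<tau> ^ m"
      "\<forall>\<^sub>F \<tau> in at_top. \<forall>p\<in>P. \<bar>v \<tau> p\<bar> \<le> D * z \<tau> ^ m"
    using assms unfolding bigO_def by blast
  then have "\<forall>\<^sub>F \<tau> in at_top. \<forall>p\<in>P. \<bar>u \<tau> p + v \<tau> p\<bar> \<le> (C + D) * z \<tau> ^ m"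
    by eventually_elim
      (auto simp: distrib_right intro!: order_trans[OF abs_triangle_ineq] add_mono)
  then show ?thesis unfolding bigO_def by blast
qed

lemma bigO_mult:
  assumes "bigO m u" "bigO k v" shows "bigO (m + k) (\<lambda>\<tau> p. u \<tau> p * v \<tau> p)"
proof -
  obtain C where C: "0 \<le> C" "\<forall>\<^sub>F \<tau> in at_top. \<forall>p\<in>P. \<bar>u \<tau> p\<bar> \<le> C * z \<tau> ^ m"
    using bigO_nonneg[OF assms(1)] .
  obtain D where D: "0 \<le> D" "\<forall>\<^sub>F \<tau> in at_top. \<forall>p\<in>P. \<bar>v \<tau> p\<bar> \<le> D * z \<tau> ^ k"
    using bigO_nonneg[OF assms(2)] .
  have "\<forall>\<^sub>F \<tau> in at_top. \<forall>p\<in>P. \<bar>u \<tau> p * v \<tau> p\<bar> \<le> (C * D) * z \<tau> ^ (m + k)"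
    using C(2) D(2) z_pos
  proof eventually_elim
    case (elim \<tau>)
    show ?case
    proof
      fix p assume "p \<in> P"
      then have "\<bar>u \<tau> p\<bar> * \<bar>v \<tau> p\<bar> \<le> (C * z \<tau> ^ m) * (D * z \<tau> ^ k)"
        using elim C(1) by (intro mult_mono) auto
      then show "\<bar>u \<tau> p * v \<tau> p\<bar> \<le> (C * D) * z \<tau> ^ (m + k)"
        by (simp add: abs_mult power_add algebra_simps)
    qed
  qed
  then show ?thesis unfolding bigO_def by blast
qed

lemma bigO_mono:
  assumes "bigO m u" "k \<le> m" shows "bigO k u"
proof -
  obtain C where C: "0 \<le> C" "\<forall>\<^sub>F \<tau> in at_top. \<forall>p\<in>P. \<bar>u \<tau> p\<bar> \<le> C * z \<tau> ^ m"
    using bigO_nonneg[OF assms(1)] .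
  have "\<forall>\<^sub>F \<tau> in at_top. \<forall>p\<in>P. \<bar>u \<tau> p\<bar> \<le> C * z \<tau> ^ k"
    using C(2) z_le
  proof eventually_elim
    case (elim \<tau>)
    have "C * z \<tau> ^ m \<le> C * z \<tau> ^ k"
      using elim C(1) assms(2) by (intro mult_left_mono power_decreasing) auto
    then show ?case using elim(1) by (meson order_trans)
  qed
  then show ?thesis unfolding bigO_def by blast
qed

lemma bigO_z: "bigO 1 (\<lambda>\<tau> p. z \<tau>)"
proof -
  have "\<forall>\<^sub>F \<tau> in at_top. \<forall>p\<in>P. \<bar>z \<tau>\<bar> \<le> 1 * z \<tau> ^ 1"
    using z_pos by eventually_elim simp
  then show ?thesis unfolding bigO_def by blast
qed

lemma bigO_bdd_iff: "bigO 0 (\<lambda>\<tau> p. c p) \<longleftrightarrow> bdd_on c"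
  unfolding bdd_on_def bigO_def by simp

lemma bigO_bdd: "bdd_on c \<Longrightarrow> bigO 0 (\<lambda>\<tau> p. c p)"
  by (simp add: bigO_bdd_iff)

lemma bigO_power: "bigO m u \<Longrightarrow> bigO (k * m) (\<lambda>\<tau> p. u \<tau> p ^ k)"
proof (induction k)
  case 0
  show ?case using bigO_bdd[of "\<lambda>p. 1"] by simp
next
  case (Suc k)
  then show ?case using bigO_mult[of m u "k * m"] by simp
qed

lemma bigO_zpow: "bigO k (\<lambda>\<tau> p. z \<tau> ^ k)"
  using bigO_power[OF bigO_z, of k] by simp

lemma bigO_zero [simp]: "bigO m (\<lambda>\<tau> p. 0)"
  unfolding bigO_def by (rule exI[of _ 0]) simp

lemma bigO_cmult: "bigO m u \<Longrightarrow> bigO m (\<lambda>\<tau> p. c * u \<tau> p)"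
  using bigO_mult[OF bigO_bdd[of "\<lambda>p. c"], of m u] by simp

text \<open>Lets the order of an error be counted by repeated division by z, which is how the
  recursion of \<open>expands\<close> proceeds.\<close>

lemma bigO_divide_z: "bigO (Suc m) u \<longleftrightarrow> bigO m (\<lambda>\<tau> p. u \<tau> p / z \<tau>)"
proof
  assume "bigO m (\<lambda>\<tau> p. u \<tau> p / z \<tau>)"
  then have "bigO (1 + m) (\<lambda>\<tau> p. z \<tau> * (u \<tau> p / z \<tau>))" by (intro bigO_mult bigO_z)
  then have *: "bigO (Suc m) (\<lambda>\<tau> p. z \<tau> * (u \<tau> p / z \<tau>))" by simp
  have "\<forall>\<^sub>F \<tau> in at_top. \<forall>p\<in>P. z \<tau> * (u \<tau> p / z \<tau>) = u \<tau> p"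
    using z_pos by eventually_elim simp
  from bigO_cong[OF this *] show "bigO (Suc m) u" .
next
  assume "bigO (Suc m) u"
  then obtain C where "\<forall>\<^sub>F \<tau> in at_top. \<forall>p\<in>P. \<bar>u \<tau> p\<bar> \<le> C * z \<tau> ^ Suc m"
    unfolding bigO_def by blast
  then have "\<forall>\<^sub>F \<tau> in at_top. \<forall>p\<in>P. \<bar>u \<tau> p / z \<tau>\<bar> \<le> C * z \<tau> ^ m"
    using z_pos by eventually_elim (auto simp: divide_le_eq abs_divide algebra_simps)
  then show "bigO m (\<lambda>\<tau> p. u \<tau> p / z \<tau>)" unfolding bigO_def by blast
qed

lemma bigO_divide_zpow: "bigO (m + k) u \<Longrightarrow> bigO m (\<lambda>\<tau> p. u \<tau> p / z \<tau> ^ k)"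
proof (induction k arbitrary: u)
  case (Suc k)
  then have "bigO (m + k) (\<lambda>\<tau> p. u \<tau> p / z \<tau>)" using bigO_divide_z by simp
  from Suc.IH[OF this] show ?case by (simp add: mult.commute)
qed simp

section \<open>Expansions with explicit coefficients\<close>

primrec expands :: "nat \<Rightarrow> (real \<Rightarrow> 'p \<Rightarrow> real) \<Rightarrow> ('p \<Rightarrow> real fps) \<Rightarrow> bool" where
  "expands 0 u F \<longleftrightarrow> bigO 0 u"
| "expands (Suc m) u F \<longleftrightarrow> bdd_on (\<lambda>p. F p $ 0) \<and>
     expands m (\<lambda>\<tau> p. (u \<tau> p - F p $ 0) / z \<tau>) (\<lambda>p. fps_shift 1 (F p))"

lemma expands_cong:
  assumes "\<forall>\<^sub>F \<tau> in at_top. \<forall>p\<in>P. u \<tau> p = v \<tau> p" "\<And>k p. k < m \<Longrightarrow> p \<in> P \<Longrightarrow> F p $ k = G p $ k"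
    "expands m u F"
  shows "expands m v G"
  using assms
proof (induction m arbitrary: u v F G)
  case 0
  then show ?case using bigO_cong by auto
next
  case (Suc m)
  have FG: "F p $ 0 = G p $ 0" if "p \<in> P" for p using Suc.prems(2)[of 0 p] that by simp
  have "expands m (\<lambda>\<tau> p. (v \<tau> p - G p $ 0) / z \<tau>) (\<lambda>p. fps_shift 1 (G p))"
  proof (rule Suc.IH)
    show "\<forall>\<^sub>F \<tau> in at_top. \<forall>p\<in>P. (u \<tau> p - F p $ 0) / z \<tau> = (v \<tau> p - G p $ 0) / z \<tau>"
      using Suc.prems(1) by eventually_elim (simp add: FG)
    show "expands m (\<lambda>\<tau> p. (u \<tau> p - F p $ 0) / z \<tau>) (\<lambda>p. fps_shift 1 (F p))"
      using Suc.prems(3) by simp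
    show "fps_shift 1 (F p) $ k = fps_shift 1 (G p) $ k" if "k < m" "p \<in> P" for k p
      using Suc.prems(2)[of "Suc k" p] that by simp
  qed
  then show ?case using Suc.prems(3) FG by (simp add: bdd_on_def)
qed

text \<open>The recursion unfolded into the familiar form: bounded coefficients and a partial sum
  with an error of order m. It is the passage between expansions and estimates.\<close>

lemma expands_iff:
  "expands m u F \<longleftrightarrow> (\<forall>k<m. bdd_on (\<lambda>p. F p $ k)) \<and> bigO m (\<lambda>\<tau> p. u \<tau> p - (\<Sum>k<m. F p $ k * z \<tau> ^ k))"
proof (induction m arbitrary: u F)
  case (Suc m)
  have "bigO m (\<lambda>\<tau> p. (u \<tau> p - F p $ 0) / z \<tau> - (\<Sum>k<m. fps_shift 1 (F p) $ k * z \<tau> ^ k)) \<longleftrightarrow>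
      bigO m (\<lambda>\<tau> p. (u \<tau> p - (\<Sum>k<Suc m. F p $ k * z \<tau> ^ k)) / z \<tau>)"
  proof -
    have "\<forall>\<^sub>F \<tau> in at_top. \<forall>p\<in>P. (u \<tau> p - F p $ 0) / z \<tau> - (\<Sum>k<m. fps_shift 1 (F p) $ k * z \<tau> ^ k)
        = (u \<tau> p - (\<Sum>k<Suc m. F p $ k * z \<tau> ^ k)) / z \<tau>"
      using z_pos
    proof eventually_elim
      case (elim \<tau>)
      then show ?case
        by (simp add: sum.lessThan_Suc_shift sum_distrib_left field_simps del: sum.lessThan_Suc)
    qed
    then show ?thesis by (rule bigO_cong_iff)
  qed
  then show ?case
    by (simp only: expands.simps Suc.IH bigO_divide_z) (auto simp: All_less_Suc2)
qed simp

text \<open>The last term is absorbed into the error, which is possible because its coefficient is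
  bounded on \<open>P\<close>.\<close>

lemma expands_mono:
  assumes "expands m u F" "k \<le> m" shows "expands k u F"
proof -
  have "expands k u F" if "expands (Suc k) u F" for k
  proof -
    have "bdd_on (\<lambda>p. F p $ k)" using that expands_iff by blast
    then have 1: "bigO k (\<lambda>\<tau> p. F p $ k * z \<tau> ^ k)"
      using bigO_mult[OF bigO_bdd bigO_zpow, of "\<lambda>p. F p $ k" k] by simp
    have "bigO (Suc k) (\<lambda>\<tau> p. u \<tau> p - (\<Sum>j<Suc k. F p $ j * z \<tau> ^ j))" using that expands_iff by blast
    then have "bigO k (\<lambda>\<tau> p. u \<tau> p - (\<Sum>j<Suc k. F p $ j * z \<tau> ^ j))" by (rule bigO_mono) simp
    from bigO_add[OF this 1] have "bigO k (\<lambda>\<tau> p. u \<tau> p - (\<Sum>j<k. F p $ j * z \<tau> ^ j))" by simp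
    then show ?thesis using that by (simp add: expands_iff)
  qed
  with assms show ?thesis by (induction m) (auto simp: le_Suc_eq)
qed

lemma expands_zero: "bigO m u \<Longrightarrow> expands m u (\<lambda>p. 0)"
  by (simp add: expands_iff)

lemma expands_zeroD: "expands m u (\<lambda>p. 0) \<Longrightarrow> bigO m u"
  by (simp add: expands_iff)

lemma expands_const: assumes "bdd_on c" shows "expands m (\<lambda>\<tau> p. c p) (\<lambda>p. fps_const (c p))"
proof (cases m)
  case (Suc k)
  then show ?thesis using assms by (auto simp: expands_zero fps_shift_fps_const intro!: expands_zero)
qed (simp add: bigO_bdd assms)

lemma expands_z: "expands m (\<lambda>\<tau> p. z \<tau>) (\<lambda>p. fps_X)"
proof (cases m)
  case (Suc k)
  have "expands k (\<lambda>\<tau> p. z \<tau> / z \<tau>) (\<lambda>p. fps_shift 1 fps_X)"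
  proof (rule expands_cong[OF _ _ expands_const[of "\<lambda>p. 1"]])
    show "\<forall>\<^sub>F \<tau> in at_top. \<forall>p\<in>P. 1 = z \<tau> / z \<tau>" using z_pos by eventually_elim simp
  qed auto
  then show ?thesis using Suc by simp
qed (simp add: bigO_mono[OF bigO_z])

lemma expands_add:
  assumes "expands m u F" "expands m v G"
  shows "expands m (\<lambda>\<tau> p. u \<tau> p + v \<tau> p) (\<lambda>p. F p + G p)"
  using assms
proof (induction m arbitrary: u v F G)
  case 0
  then show ?case by (simp add: bigO_add)
next
  case (Suc m)
  have "bdd_on (\<lambda>p. F p $ 0 + G p $ 0)"
    using bigO_add[of 0 "\<lambda>\<tau> p. F p $ 0" "\<lambda>\<tau> p. G p $ 0"] Suc.prems
    by (simp add: bigO_bdd_iff)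
  moreover have "expands m (\<lambda>\<tau> p. (u \<tau> p + v \<tau> p - (F p $ 0 + G p $ 0)) / z \<tau>) (\<lambda>p. fps_shift 1 (F p) + fps_shift 1 (G p))"
    using Suc.IH[of "\<lambda>\<tau> p. (u \<tau> p - F p $ 0) / z \<tau>" _ "\<lambda>\<tau> p. (v \<tau> p - G p $ 0) / z \<tau>"] Suc.prems
    by (simp add: add_divide_distrib[symmetric] algebra_simps)
  ultimately show ?case by (simp add: fps_shift_add)
qed

text \<open>Induction on \<open>u v - u0 v0 = (u - u0) v + u0 (v - v0)\<close>, where u0, v0 are the
  leading coefficients. Dividing by z lowers the order in one factor of each summand, and shifting a
  Cauchy product obeys the same identity.\<close>

lemma expands_mult:
  assumes "expands m u F" "expands m v G"
  shows "expands m (\<lambda>\<tau> p. u \<tau> p * v \<tau> p) (\<lambda>p. F p * G p)"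
  using assms
proof (induction m arbitrary: u v F G)
  case 0
  then show ?case using bigO_mult[of 0 u 0 v] by simp
next
  case (Suc m)
  let ?u = "\<lambda>\<tau> p. (u \<tau> p - F p $ 0) / z \<tau>" and ?v = "\<lambda>\<tau> p. (v \<tau> p - G p $ 0) / z \<tau>"
  have bdd: "bdd_on (\<lambda>p. F p $ 0 * G p $ 0)"
    using bigO_mult[of 0 "\<lambda>\<tau> p. F p $ 0" 0 "\<lambda>\<tau> p. G p $ 0"] Suc.prems
    by (simp add: bigO_bdd_iff)
  have "expands m (\<lambda>\<tau> p. ?u \<tau> p * v \<tau> p) (\<lambda>p. fps_shift 1 (F p) * G p)"
    using Suc.IH[of ?u _ v G] Suc.prems expands_mono[OF Suc.prems(2)] by simp
  moreover have "expands m (\<lambda>\<tau> p. F p $ 0 * ?v \<tau> p) (\<lambda>p. fps_const (F p $ 0) * fps_shift 1 (G p))"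
    using Suc.IH[OF expands_const, of "\<lambda>p. F p $ 0" ?v] Suc.prems by simp
  ultimately have E: "expands m (\<lambda>\<tau> p. ?u \<tau> p * v \<tau> p + F p $ 0 * ?v \<tau> p)
      (\<lambda>p. fps_shift 1 (F p) * G p + fps_const (F p $ 0) * fps_shift 1 (G p))"
    by (intro expands_add)
  have shift: "fps_shift 1 (f * g) = fps_shift 1 f * g + fps_const (f $ 0) * fps_shift 1 g"
    for f g :: "real fps"
    by (rule fps_ext) (simp add: fps_mult_nth sum.atLeast0_atMost_Suc_shift if_distrib[where f = "\<lambda>x. x * y" for y]
      cong: if_cong del: sum.atLeast0_atMost_Suc sum.cl_ivl_Suc)
  have "expands m (\<lambda>\<tau> p. (u \<tau> p * v \<tau> p - F p $ 0 * G p $ 0) / z \<tau>) (\<lambda>p. fps_shift 1 (F p * G p))"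
  proof (rule expands_cong[OF _ _ E])
    show "\<forall>\<^sub>F \<tau> in at_top. \<forall>p\<in>P. ?u \<tau> p * v \<tau> p + F p $ 0 * ?v \<tau> p
        = (u \<tau> p * v \<tau> p - F p $ 0 * G p $ 0) / z \<tau>"
      using z_pos by eventually_elim (simp add: field_simps)
  qed (simp only: shift)
  with bdd show ?case by simp
qed

lemma expands_diff:
  assumes "expands m u F" "expands m v G"
  shows "expands m (\<lambda>\<tau> p. u \<tau> p - v \<tau> p) (\<lambda>p. F p - G p)"
  using expands_add[OF assms(1) expands_mult[OF expands_const[of "\<lambda>p. - 1"] assms(2)]]
  by (simp add: fps_const_neg[symmetric] del: fps_const_neg)

lemma expands_power: "expands m u F \<Longrightarrow> expands m (\<lambda>\<tau> p. u \<tau> p ^ k) (\<lambda>p. F p ^ k)"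
  using expands_const[of "\<lambda>p. 1"] by (induction k) (auto intro: expands_mult)

lemma expands_sum:
  "(\<And>i. i \<in> I \<Longrightarrow> expands m (u i) (F i)) \<Longrightarrow> expands m (\<lambda>\<tau> p. \<Sum>i\<in>I. u i \<tau> p) (\<lambda>p. \<Sum>i\<in>I. F i p)"
  by (induction I rule: infinite_finite_induct) (auto intro: expands_add simp: expands_zero)

text \<open>Existence of an expansion is enough for the ingredients of the rescaled system: the
  coefficients of the end result are recovered as limits by
  \<open>expands_expansion_coeff\<close>.\<close>

definition expandable :: "nat \<Rightarrow> (real \<Rightarrow> 'p \<Rightarrow> real) \<Rightarrow> bool" where
  "expandable m u \<longleftrightarrow> (\<exists>F. expands m u F)"

lemma expandable_const: "bdd_on c \<Longrightarrow> expandable m (\<lambda>\<tau> p. c p)"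
  unfolding expandable_def using expands_const by blast

lemma expandable_const' [simp]: "expandable m (\<lambda>\<tau> p. c)"
  by (rule expandable_const) simp

lemma expandable_z: "expandable m (\<lambda>\<tau> p. z \<tau>)"
  unfolding expandable_def using expands_z by blast

lemma expandable_add: "expandable m u \<Longrightarrow> expandable m v \<Longrightarrow> expandable m (\<lambda>\<tau> p. u \<tau> p + v \<tau> p)"
  unfolding expandable_def using expands_add by blast

lemma expandable_diff: "expandable m u \<Longrightarrow> expandable m v \<Longrightarrow> expandable m (\<lambda>\<tau> p. u \<tau> p - v \<tau> p)"
  unfolding expandable_def using expands_diff by blast

lemma expandable_mult: "expandable m u \<Longrightarrow> expandable m v \<Longrightarrow> expandable m (\<lambda>\<tau> p. u \<tau> p * v \<tau> p)"
  unfolding expandable_def using expands_mult by blast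

lemma expandable_power: "expandable m u \<Longrightarrow> expandable m (\<lambda>\<tau> p. u \<tau> p ^ k)"
  unfolding expandable_def using expands_power by blast

lemma expandable_sum:
  "(\<And>i. i \<in> I \<Longrightarrow> expandable m (u i)) \<Longrightarrow> expandable m (\<lambda>\<tau> p. \<Sum>i\<in>I. u i \<tau> p)"
  by (induction I rule: infinite_finite_induct) (auto intro: expandable_add)

lemma expandable_bigO: "bigO m u \<Longrightarrow> expandable m u"
  unfolding expandable_def using expands_zero by blast

lemma expandable_imp_bigO: "expandable m u \<Longrightarrow> bigO 0 u"
  unfolding expandable_def using expands_mono[of m u _ 0] by auto

lemma expandable_mono: "expandable m u \<Longrightarrow> k \<le> m \<Longrightarrow> expandable k u"
  unfolding expandable_def using expands_mono by blast

lemma expandable_cong: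
  "\<forall>\<^sub>F \<tau> in at_top. \<forall>p\<in>P. u \<tau> p = v \<tau> p \<Longrightarrow> expandable m u \<Longrightarrow> expandable m v"
  unfolding expandable_def using expands_cong[of u v m] by blast

lemma expandable_SucI:
  assumes "bdd_on c" "expandable m (\<lambda>\<tau> p. (u \<tau> p - c p) / z \<tau>)"
  shows "expandable (Suc m) u"
proof -
  obtain K where K: "expands m (\<lambda>\<tau> p. (u \<tau> p - c p) / z \<tau>) K"
    using assms(2) unfolding expandable_def by blast
  have "fps_shift 1 (fps_const (c p) + fps_X * K p) = K p" for p
    by (rule fps_ext) simp
  then have "expands (Suc m) u (\<lambda>p. fps_const (c p) + fps_X * K p)"
    using assms(1) K by simp
  then show ?thesis unfolding expandable_def by blast
qed

text \<open>The leading coefficient comes with its description as a limit, so that lower bounds on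
  \<open>u\<close> pass on to it. Reciprocals and roots depend on this.\<close>

lemma expandable_SucE:
  assumes "expandable (Suc m) u"
  obtains c where "bdd_on c" "expandable m (\<lambda>\<tau> p. (u \<tau> p - c p) / z \<tau>)"
    "\<forall>p\<in>P. ((\<lambda>\<tau>. u \<tau> p) \<longlongrightarrow> c p) at_top"
proof -
  obtain F where F: "expands (Suc m) u F" using assms unfolding expandable_def by blast
  have "((\<lambda>\<tau>. u \<tau> p) \<longlongrightarrow> F p $ 0) at_top" if "p \<in> P" for p
  proof -
    have "expands 1 u F" by (rule expands_mono[OF F]) simp
    then obtain C where "\<forall>\<^sub>F \<tau> in at_top. \<forall>p\<in>P. \<bar>u \<tau> p - F p $ 0\<bar> \<le> C * z \<tau> ^ 1"
      by (auto simp: expands_iff bigO_def)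
    then have "\<forall>\<^sub>F \<tau> in at_top. norm (u \<tau> p - F p $ 0) \<le> C * z \<tau>"
      by eventually_elim (use that in simp)
    moreover have "((\<lambda>\<tau>. C * z \<tau>) \<longlongrightarrow> 0) at_top" using tendsto_mult_right_zero[OF z_lim] by simp
    ultimately have "((\<lambda>\<tau>. u \<tau> p - F p $ 0) \<longlongrightarrow> 0) at_top" by (rule Lim_null_comparison)
    then show ?thesis using LIM_zero_iff by blast
  qed
  then show ?thesis using that[of "\<lambda>p. F p $ 0"] F unfolding expandable_def by auto
qed

text \<open>With leading coefficient c, the quotient \<open>(1 / u - 1 / c) / z\<close> equals minus
  \<open>(u - c) / z\<close> times \<open>1 / u\<close> times \<open>1 / c\<close>. Here
  \<open>1 / u\<close> enters to the lower order only, so the induction closes.\<close>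

lemma expandable_inverse:
  assumes "expandable m u" "0 < \<delta>" "\<forall>\<^sub>F \<tau> in at_top. \<forall>p\<in>P. \<delta> \<le> u \<tau> p"
  shows "expandable m (\<lambda>\<tau> p. 1 / u \<tau> p)"
  using assms(1)
proof (induction m)
  case 0
  have "\<forall>\<^sub>F \<tau> in at_top. \<forall>p\<in>P. \<bar>1 / u \<tau> p\<bar> \<le> (1 / \<delta>) * z \<tau> ^ 0"
    using assms(3)
  proof eventually_elim
    case (elim \<tau>)
    show ?case
    proof
      fix p assume "p \<in> P"
      then have "\<delta> \<le> u \<tau> p" using elim by blast
      then show "\<bar>1 / u \<tau> p\<bar> \<le> (1 / \<delta>) * z \<tau> ^ 0" using assms(2) by (simp add: frac_le)
    qed
  qed
  then have "bigO 0 (\<lambda>\<tau> p. 1 / u \<tau> p)" unfolding bigO_def by blast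
  then show ?case by (rule expandable_bigO)
next
  case (Suc m)
  obtain c where c: "bdd_on c" "expandable m (\<lambda>\<tau> p. (u \<tau> p - c p) / z \<tau>)"
    "\<forall>p\<in>P. ((\<lambda>\<tau>. u \<tau> p) \<longlongrightarrow> c p) at_top"
    using expandable_SucE[OF Suc.prems] .
  have cd: "\<delta> \<le> c p" if "p \<in> P" for p
  proof (rule tendsto_lowerbound[OF bspec[OF c(3) that]])
    show "\<forall>\<^sub>F \<tau> in at_top. \<delta> \<le> u \<tau> p"
      using assms(3) by eventually_elim (use that in blast)
  qed simp
  have b: "bdd_on (\<lambda>p. 1 / c p)"
  proof (rule bdd_onI)
    fix p assume "p \<in> P"
    with cd assms(2) have "0 < \<delta>" "\<delta> \<le> c p" by auto
    then show "\<bar>1 / c p\<bar> \<le> 1 / \<delta>" by (simp add: frac_le)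
  qed
  have "expandable m (\<lambda>\<tau> p. ((u \<tau> p - c p) / z \<tau>) * (1 / u \<tau> p) * (- 1) * (1 / c p))"
    using c(2) Suc expandable_mono[OF Suc.prems] b
    by (intro expandable_mult expandable_const) auto
  then have "expandable m (\<lambda>\<tau> p. (1 / u \<tau> p - 1 / c p) / z \<tau>)"
  proof (rule expandable_cong[rotated])
    show "\<forall>\<^sub>F \<tau> in at_top. \<forall>p\<in>P. ((u \<tau> p - c p) / z \<tau>) * (1 / u \<tau> p) * (- 1) * (1 / c p)
        = (1 / u \<tau> p - 1 / c p) / z \<tau>"
      using z_pos assms(3)
    proof eventually_elim
      case (elim \<tau>)
      show ?case
      proof
        fix p assume "p \<in> P"
        then have "u \<tau> p \<noteq> 0" "c p \<noteq> 0" using elim cd assms(2) by fastforce+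
        then show "((u \<tau> p - c p) / z \<tau>) * (1 / u \<tau> p) * (- 1) * (1 / c p) = (1 / u \<tau> p - 1 / c p) / z \<tau>"
          using elim by (simp add: field_simps)
      qed
    qed
  qed
  from expandable_SucI[OF b this] show ?case .
qed

text \<open>With e the root of the leading coefficient of \<open>R ^ k\<close>, the difference
  \<open>R - e\<close> is \<open>R ^ k - e ^ k\<close> divided by a sum of products of powers of R
  and e. That divisor is needed to the lower order only; the mere boundedness of R starts the
  induction.\<close>

lemma expandable_root:
  assumes "expandable m (\<lambda>\<tau> p. R \<tau> p ^ k)" "0 < k" "0 < \<delta>" "\<forall>\<^sub>F \<tau> in at_top. \<forall>p\<in>P. \<delta> \<le> R \<tau> p"
    and "bigO 0 R"
  shows "expandable m R"
  using assms(1)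
proof (induction m)
  case 0
  then show ?case using assms(5) by (simp add: expandable_bigO)
next
  case (Suc m)
  obtain c where c: "bdd_on c" "expandable m (\<lambda>\<tau> p. (R \<tau> p ^ k - c p) / z \<tau>)"
    "\<forall>p\<in>P. ((\<lambda>\<tau>. R \<tau> p ^ k) \<longlongrightarrow> c p) at_top"
    using expandable_SucE[OF Suc.prems] .
  have "\<delta> ^ k \<le> c p" if "p \<in> P" for p
  proof (rule tendsto_lowerbound[OF bspec[OF c(3) that]])
    show "\<forall>\<^sub>F \<tau> in at_top. \<delta> ^ k \<le> R \<tau> p ^ k"
      using assms(4) by eventually_elim (use that assms(3) in \<open>auto intro!: power_mono\<close>)
  qed simp
  note c_low = this
  define e where "e p = root k (c p)" for p
  have e: "\<delta> \<le> e p" "e p ^ k = c p" if "p \<in> P" for p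
  proof -
    have "root k (\<delta> ^ k) \<le> root k (c p)" using c_low[OF that] assms(2) by simp
    then show "\<delta> \<le> e p" using assms(2,3) by (simp add: e_def real_root_power_cancel)
    have "0 \<le> c p" using c_low[OF that] assms(3) by (meson less_imp_le order_trans zero_le_power)
    then show "e p ^ k = c p" using assms(2) by (simp add: e_def)
  qed
  obtain C where C: "\<And>p. p \<in> P \<Longrightarrow> \<bar>c p\<bar> \<le> C" using c(1) unfolding bdd_on_def by blast
  have be: "bdd_on e"
  proof (rule bdd_onI)
    fix p assume p: "p \<in> P"
    have "root k (c p) \<le> root k C" using C[OF p] assms(2) by simp
    then show "\<bar>e p\<bar> \<le> root k C" using e(1)[OF p] assms(3) by (simp add: e_def)
  qed
  \<comment> \<open>The cofactor in \<open>R ^ k - e ^ k = (R - e) * Sm\<close>. All of its terms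
    are nonnegative, so the term of index 0 bounds it away from zero.\<close>
  define Sm where "Sm \<tau> p = (\<Sum>i<k. e p ^ (k - Suc i) * R \<tau> p ^ i)" for \<tau> p
  have R: "expandable m R" using Suc.IH expandable_mono[OF Suc.prems] by simp
  have "expandable m Sm" unfolding Sm_def
    using R expandable_const[OF be] by (intro expandable_sum expandable_mult expandable_power)
  moreover have Sm_low: "\<forall>\<^sub>F \<tau> in at_top. \<forall>p\<in>P. \<delta> ^ (k - 1) \<le> Sm \<tau> p"
    using assms(4)
  proof eventually_elim
    case (elim \<tau>)
    show ?case
    proof
      fix p assume p: "p \<in> P"
      have "\<delta> ^ (k - 1) \<le> e p ^ (k - Suc 0) * R \<tau> p ^ 0"
        using e(1)[OF p] assms(3) by (simp add: power_mono)
      also have "\<dots> \<le> Sm \<tau> p" unfolding Sm_def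
      proof (rule member_le_sum[of "0::nat" "{..<k}" "\<lambda>i. e p ^ (k - Suc i) * R \<tau> p ^ i"])
        have "0 \<le> e p" "0 \<le> R \<tau> p" using e(1)[OF p] assms(3) elim p by fastforce+
        then show "0 \<le> e p ^ (k - Suc i) * R \<tau> p ^ i" for i by simp
      qed (use assms(2) in auto)
      finally show "\<delta> ^ (k - 1) \<le> Sm \<tau> p" .
    qed
  qed
  ultimately have "expandable m (\<lambda>\<tau> p. 1 / Sm \<tau> p)"
    using expandable_inverse[of m Sm "\<delta> ^ (k - 1)"] assms(3) by simp
  with c(2) have "expandable m (\<lambda>\<tau> p. (R \<tau> p ^ k - c p) / z \<tau> * (1 / Sm \<tau> p))"
    by (rule expandable_mult)
  then have "expandable m (\<lambda>\<tau> p. (R \<tau> p - e p) / z \<tau>)"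
  proof (rule expandable_cong[rotated])
    show "\<forall>\<^sub>F \<tau> in at_top. \<forall>p\<in>P. (R \<tau> p ^ k - c p) / z \<tau> * (1 / Sm \<tau> p) = (R \<tau> p - e p) / z \<tau>"
      using Sm_low
    proof eventually_elim
      case (elim \<tau>)
      show ?case
      proof
        fix p assume p: "p \<in> P"
        have "Sm \<tau> p > 0" using elim p zero_less_power[OF assms(3), of "k - 1"] by fastforce
        moreover have "R \<tau> p ^ k - c p = (R \<tau> p - e p) * Sm \<tau> p"
          unfolding Sm_def e(2)[OF p, symmetric] by (rule power_diff_sumr2)
        ultimately show "(R \<tau> p ^ k - c p) / z \<tau> * (1 / Sm \<tau> p) = (R \<tau> p - e p) / z \<tau>" by simp
      qed
    qed
  qed
  from expandable_SucI[OF be this] show ?case .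
qed

text \<open>The coefficients of an asymptotic expansion are forced. By strong induction each limit
  in \<open>expansion_coeff\<close> exists and equals the corresponding coefficient of any
  expansion, so the limits may be used as the coefficients.\<close>

lemma expands_expansion_coeff:
  assumes "\<And>m. expandable m u" "\<forall>\<^sub>F \<tau> in at_top. z \<tau> = \<tau> powr (- (1 / real N))"
  shows "expands m u (\<lambda>p. Abs_fps (expansion_coeff N (\<lambda>\<tau>. u \<tau> p)))"
proof -
  have zk: "\<forall>\<^sub>F \<tau> in at_top. \<forall>k. \<tau> powr (- (real k / real N)) = z \<tau> ^ k \<and> \<tau> powr (real k / real N) = 1 / z \<tau> ^ k"
    using assms(2) eventually_gt_at_top[of 0]
  proof eventually_elim
    case (elim \<tau>)
    show ?case
    proof
      fix k
      have "z \<tau> ^ k = (\<tau> powr (- (1 / real N))) powr real k"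
        unfolding elim(1) by (rule powr_realpow[symmetric]) (use elim(2) in simp)
      also have "\<dots> = \<tau> powr (- (real k / real N))" by (simp add: powr_powr)
      finally have 1: "\<tau> powr (- (real k / real N)) = z \<tau> ^ k" by simp
      have "\<tau> powr (real k / real N) * \<tau> powr (- (real k / real N)) = 1"
        using elim(2) by (simp flip: powr_add)
      then show "\<tau> powr (- (real k / real N)) = z \<tau> ^ k \<and> \<tau> powr (real k / real N) = 1 / z \<tau> ^ k"
        unfolding 1 using elim(1,2) by (simp add: eq_divide_eq)
    qed
  qed
  have "expansion_coeff N (\<lambda>\<tau>. u \<tau> p) k = F p $ k" if F: "expands m u F" and "p \<in> P" "k < m" for F p k m
    using \<open>k < m\<close>
  proof (induction k rule: less_induct)
    case (less k)
    let ?w = "\<lambda>\<tau>. \<tau> powr (real k / real N) *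
       (u \<tau> p - (\<Sum>j<k. \<tau> powr (- (real j / real N)) * expansion_coeff N (\<lambda>\<tau>. u \<tau> p) j))"
    have IH: "(\<Sum>j<k. a j * expansion_coeff N (\<lambda>\<tau>. u \<tau> p) j) = (\<Sum>j<k. a j * F p $ j)" for a :: "nat \<Rightarrow> real"
      by (rule sum.cong) (use less in auto)
    have "expands (Suc k) u F" by (rule expands_mono[OF F]) (use less.prems in simp)
    then have "bigO (1 + k) (\<lambda>\<tau> p. u \<tau> p - (\<Sum>j<Suc k. F p $ j * z \<tau> ^ j))" by (simp add: expands_iff)
    then have "bigO 1 (\<lambda>\<tau> p. (u \<tau> p - (\<Sum>j<Suc k. F p $ j * z \<tau> ^ j)) / z \<tau> ^ k)" by (rule bigO_divide_zpow)
    then obtain C where "\<forall>\<^sub>F \<tau> in at_top. \<forall>p\<in>P. \<bar>(u \<tau> p - (\<Sum>j<Suc k. F p $ j * z \<tau> ^ j)) / z \<tau> ^ k\<bar> \<le> C * z \<tau> ^ 1"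
      unfolding bigO_def by blast
    then have "\<forall>\<^sub>F \<tau> in at_top. norm (?w \<tau> - F p $ k) \<le> C * z \<tau>"
      using zk z_pos
    proof eventually_elim
      case (elim \<tau>)
      have "?w \<tau> - F p $ k = (u \<tau> p - (\<Sum>j<Suc k. F p $ j * z \<tau> ^ j)) / z \<tau> ^ k"
        unfolding IH using elim(2,3) by (simp add: field_simps mult.commute)
      then show ?case using elim(1) that(2) by simp
    qed
    moreover have "((\<lambda>\<tau>. C * z \<tau>) \<longlongrightarrow> 0) at_top" using tendsto_mult_right_zero[OF z_lim] by simp
    ultimately have "((\<lambda>\<tau>. ?w \<tau> - F p $ k) \<longlongrightarrow> 0) at_top" by (rule Lim_null_comparison)
    then have "(?w \<longlongrightarrow> F p $ k) at_top" using LIM_zero_iff by blast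
    then have "Lim at_top ?w = F p $ k" by (intro tendsto_Lim) simp_all
    then show ?case by (subst expansion_coeff.simps)
  qed
  note coeff = this
  obtain F where F: "expands m u F" using assms(1) unfolding expandable_def by blast
  show ?thesis
    by (rule expands_cong[OF _ _ F]) (simp_all add: coeff[OF F])
qed

end

section \<open>Energy-angle coordinates\<close>

text \<open>Gronwall's argument in both directions of time: with the weight
  \<open>exp (- L * t)\<close> the function does not increase, with \<open>exp (L * t)\<close> it
  does not decrease.\<close>

lemma vanishing_of_linear_growth:
  fixes D :: "real \<Rightarrow> real"
  assumes D: "\<And>t. (D has_real_derivative D' t) (at t)" "\<And>t. \<bar>D' t\<bar> \<le> L * D t" "\<And>t. 0 \<le> D t"
    and "D t0 = 0"
  shows "D t = 0"
proof -
  have "D t * exp (- L * t) \<le> 0" if "t0 \<le> t"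
  proof -
    have "D t * exp (- L * t) \<le> D t0 * exp (- L * t0)"
    proof (rule DERIV_nonpos_imp_nonincreasing[OF that])
      fix s
      have "((\<lambda>t. D t * exp (- L * t)) has_real_derivative (D' s - L * D s) * exp (- L * s)) (at s)"
        by (auto intro!: derivative_eq_intros D(1) simp: algebra_simps)
      moreover have "(D' s - L * D s) * exp (- L * s) \<le> 0"
        using D(2)[of s] by (intro mult_nonpos_nonneg) auto
      ultimately show "\<exists>y. ((\<lambda>t. D t * exp (- L * t)) has_real_derivative y) (at s) \<and> y \<le> 0" by blast
    qed
    then show ?thesis using assms(4) by simp
  qed
  moreover have "D t * exp (L * t) \<le> 0" if "t \<le> t0"
  proof -
    have "D t * exp (L * t) \<le> D t0 * exp (L * t0)"
    proof (rule DERIV_nonneg_imp_nondecreasing[OF that])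
      fix s
      have "((\<lambda>t. D t * exp (L * t)) has_real_derivative (D' s + L * D s) * exp (L * s)) (at s)"
        by (auto intro!: derivative_eq_intros D(1) simp: algebra_simps)
      moreover have "(D' s + L * D s) * exp (L * s) \<ge> 0"
        using D(2)[of s] by (intro mult_nonneg_nonneg) auto
      ultimately show "\<exists>y. ((\<lambda>t. D t * exp (L * t)) has_real_derivative y) (at s) \<and> 0 \<le> y" by blast
    qed
    then show ?thesis using assms(4) by simp
  qed
  ultimately have "D t \<le> 0"
    by (cases "t0 \<le> t") (auto simp: mult_le_0_iff not_le[symmetric])
  then show ?thesis using D(3)[of t] by simp
qed

text \<open>A discrete nontrivial subgroup of the reals is cyclic. The generator is the infimum of
  the positive elements, which is the form in which the period is given.\<close>

lemma real_subgroup_generator: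
  fixes G :: "real set"
  assumes diff: "\<And>P Q. P \<in> G \<Longrightarrow> Q \<in> G \<Longrightarrow> P - Q \<in> G"
    and gap: "0 < \<delta>" "\<And>P. P \<in> G \<Longrightarrow> 0 < P \<Longrightarrow> \<delta> \<le> P"
    and ex: "P0 \<in> G" "0 < P0"
    and T: "T = Inf {P. 0 < P \<and> P \<in> G}"
  shows "0 < T" "P \<in> G \<longleftrightarrow> (\<exists>k::int. P = of_int k * T)"
proof -
  let ?S = "{P. 0 < P \<and> P \<in> G}"
  have ne: "?S \<noteq> {}" and bdd: "bdd_below ?S" using ex by (auto intro: bdd_belowI[of _ 0])
  have "\<delta> \<le> T" unfolding T by (rule cInf_greatest[OF ne]) (use gap in auto)
  then show T0: "0 < T" using gap(1) by simp
  have low: "T \<le> P" if "P \<in> G" "0 < P" for P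
    unfolding T by (rule cInf_lower[OF _ bdd]) (use that in simp)
  \<comment> \<open>The infimum is attained: otherwise two different elements would lie between
    \<open>T\<close> and \<open>T + \<delta>\<close>, and their difference would be positive and
    smaller than \<delta>.\<close>
  have TG: "T \<in> G"
  proof (rule ccontr)
    assume "T \<notin> G"
    obtain P1 where P1: "P1 \<in> G" "0 < P1" "P1 < T + \<delta>"
      using cInf_lessD[OF ne, of "T + \<delta>"] gap(1) T by auto
    then have "T < P1" using low[of P1] \<open>T \<notin> G\<close> by (cases "T = P1") auto
    then obtain P2 where P2: "P2 \<in> G" "0 < P2" "P2 < P1"
      using cInf_lessD[OF ne, of P1] T by auto
    then have "\<delta> \<le> P1 - P2" using gap(2)[of "P1 - P2"] diff P1(1) by simp
    then show False using low[of P2] P1 P2 by linarith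
  qed
  have 0: "0 \<in> G" using diff[OF TG TG] by simp
  have neg: "- P \<in> G" if "P \<in> G" for P using diff[OF 0 that] by simp
  have nat: "of_nat n * T \<in> G" for n
  proof (induction n)
    case (Suc n)
    then show ?case using diff[OF Suc neg[OF TG]] by (simp add: algebra_simps)
  qed (simp add: 0)
  have int: "of_int k * T \<in> G" for k
  proof (cases "k \<ge> 0")
    case True
    then show ?thesis using nat[of "nat k"] by simp
  next
    case False
    then show ?thesis using neg[OF nat[of "nat (- k)"]] by simp
  qed
  show "P \<in> G \<longleftrightarrow> (\<exists>k::int. P = of_int k * T)"
  proof
    assume "P \<in> G"
    \<comment> \<open>The remainder of P modulo T belongs to the group and is smaller than its least
      positive element.\<close>
    define d where "d = P - of_int \<lfloor>P / T\<rfloor> * T"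
    have "d \<in> G" unfolding d_def by (rule diff[OF \<open>P \<in> G\<close> int])
    moreover have "0 \<le> d" "d < T"
      using floor_divide_lower[OF T0, of P] floor_divide_upper[OF T0, of P]
      by (auto simp: d_def algebra_simps)
    ultimately have "d = 0" using low[of d] by fastforce
    then show "\<exists>k::int. P = of_int k * T" unfolding d_def by (intro exI[of _ "\<lfloor>P / T\<rfloor>"]) simp
  qed (use int in auto)
qed

text \<open>The level lines enter through their compactness, which bounds the orbits; the absence of
  fixed points excludes arbitrarily small periods.\<close>

locale hamiltonian_orbits =
  fixes U dU d2U :: "real \<Rightarrow> real" and H x0 y0 X Y :: "real \<Rightarrow> real \<Rightarrow> real"
    and T \<omega> :: "real \<Rightarrow> real" and E0 :: real
  assumes U: "\<And>x. (U has_real_derivative dU x) (at x)"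
    and dU: "\<And>x. (dU has_real_derivative d2U x) (at x)" and d2U: "continuous_on UNIV d2U"
    and H: "H = (\<lambda>x y. y\<^sup>2 / 2 + U x)"
    and level: "\<And>E. E0 < E \<Longrightarrow> compact {(x, y). H x y = E}"
    and no_fixed: "\<And>x y. E0 < H x y \<Longrightarrow> y \<noteq> 0 \<or> dU x \<noteq> 0"
    and x0: "\<And>E t. E0 < E \<Longrightarrow> ((\<lambda>t. x0 t E) has_real_derivative y0 t E) (at t)"
    and y0: "\<And>E t. E0 < E \<Longrightarrow> ((\<lambda>t. y0 t E) has_real_derivative - dU (x0 t E)) (at t)"
    and orbit_range: "\<And>E. E0 < E \<Longrightarrow> range (\<lambda>t. (x0 t E, y0 t E)) = {(x, y). H x y = E}"
    and orbit_periodic: "\<And>E. E0 < E \<Longrightarrow> \<exists>P>0. periodic P (\<lambda>t. x0 t E) \<and> periodic P (\<lambda>t. y0 t E)"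
    and T: "T = (\<lambda>E. Inf {P. 0 < P \<and> periodic P (\<lambda>t. x0 t E) \<and> periodic P (\<lambda>t. y0 t E)})"
    and \<omega>: "\<omega> = (\<lambda>E. 2 * pi / T E)"
    and x0_diff: "\<And>t E. E0 < E \<Longrightarrow> (\<lambda>(t, E). x0 t E) differentiable (at (t, E))"
    and y0_diff: "\<And>t E. E0 < E \<Longrightarrow> (\<lambda>(t, E). y0 t E) differentiable (at (t, E))"
    and \<omega>_diff: "\<And>E. E0 < E \<Longrightarrow> \<omega> differentiable (at E)"
    and X: "X = (\<lambda>\<phi> E. x0 (\<phi> / \<omega> E) E)" and Y: "Y = (\<lambda>\<phi> E. y0 (\<phi> / \<omega> E) E)"
begin

lemma orbit_energy: "E0 < E \<Longrightarrow> H (x0 t E) (y0 t E) = E"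
  using orbit_range[of E] by (auto simp: set_eq_iff)

lemma orbit_bounded:
  assumes "E0 < E"
  obtains B where "\<And>t. \<bar>x0 t E\<bar> \<le> B" "\<And>t. \<bar>y0 t E\<bar> \<le> B"
proof -
  obtain B where B: "\<And>v. v \<in> {(x, y). H x y = E} \<Longrightarrow> norm v \<le> B"
    using compact_imp_bounded[OF level[OF assms]] by (auto simp: bounded_iff)
  have "norm (x0 t E, y0 t E) \<le> B" for t using B orbit_energy[OF assms] by simp
  then have "\<bar>x0 t E\<bar> \<le> B" "\<bar>y0 t E\<bar> \<le> B" for t
    using norm_fst_le[of "x0 t E" "y0 t E"] norm_snd_le[of "y0 t E" "x0 t E"]
    by (auto intro: order_trans simp: real_norm_def[symmetric] simp del: real_norm_def)
  then show ?thesis using that by blast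
qed

text \<open>The squared distance of two time shifts of the orbit grows at most linearly in itself,
  the constant being controlled by a Lipschitz constant of \<open>dU\<close> on the bounded range of
  the orbit. It vanishes at one time, hence always.\<close>

lemma orbit_unique:
  assumes E: "E0 < E" and eq: "x0 a E = x0 b E" "y0 a E = y0 b E"
  shows "x0 (t + a) E = x0 (t + b) E \<and> y0 (t + a) E = y0 (t + b) E"
proof -
  obtain B where B: "\<And>t. \<bar>x0 t E\<bar> \<le> B" using orbit_bounded[OF E] by metis
  have "compact (d2U ` {- B..B})"
    by (intro compact_continuous_image continuous_on_subset[OF d2U]) auto
  then obtain L where L: "\<And>x. x \<in> {- B..B} \<Longrightarrow> \<bar>d2U x\<bar> \<le> L"
    using compact_imp_bounded by (force simp: bounded_iff)
  have lip: "\<bar>dU x - dU x'\<bar> \<le> L * \<bar>x - x'\<bar>" if "x \<in> {- B..B}" "x' \<in> {- B..B}" for x x'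
    using field_differentiable_bound[of "{- B..B}" dU d2U L x x'] dU L that
    by (auto intro: has_field_derivative_at_within)
  define p where "p t = x0 (t + a) E - x0 (t + b) E" for t
  define q where "q t = y0 (t + a) E - y0 (t + b) E" for t
  define r where "r t = dU (x0 (t + a) E) - dU (x0 (t + b) E)" for t
  have p: "(p has_real_derivative q t) (at t)" for t
    unfolding p_def q_def
    by (rule DERIV_diff[OF iffD1[OF DERIV_shift x0[OF E]] iffD1[OF DERIV_shift x0[OF E]]])
  have q: "(q has_real_derivative - r t) (at t)" for t
    unfolding q_def r_def
    by (rule DERIV_cong[OF DERIV_diff[OF iffD1[OF DERIV_shift y0[OF E]] iffD1[OF DERIV_shift y0[OF E]]]]) simp
  have r: "\<bar>r t\<bar> \<le> L * \<bar>p t\<bar>" for t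
    unfolding p_def r_def by (rule lip) (use B[of "t + a"] B[of "t + b"] in \<open>auto simp: abs_le_iff\<close>)
  have "0 \<le> L" using L[of 0] B[of 0] by fastforce
  define D where "D t = p t ^ 2 + q t ^ 2" for t
  have "D t = 0" for t
  proof (rule vanishing_of_linear_growth[of D "\<lambda>s. 2 * (p s * q s) - 2 * (q s * r s)" "1 + L" 0])
    show "(D has_real_derivative 2 * (p s * q s) - 2 * (q s * r s)) (at s)" for s
      unfolding D_def by (auto intro!: derivative_eq_intros p q)
    show "\<bar>2 * (p s * q s) - 2 * (q s * r s)\<bar> \<le> (1 + L) * D s" for s
    proof -
      have "\<bar>2 * (p s * q s) - 2 * (q s * r s)\<bar> \<le> 2 * (\<bar>p s\<bar> * \<bar>q s\<bar>) + 2 * (\<bar>q s\<bar> * \<bar>r s\<bar>)"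
        by (rule order_trans[OF abs_triangle_ineq4]) (simp add: abs_mult)
      also have "\<dots> \<le> 2 * (\<bar>p s\<bar> * \<bar>q s\<bar>) + 2 * (\<bar>q s\<bar> * (L * \<bar>p s\<bar>))"
        using r[of s] by (intro add_mono mult_left_mono) auto
      also have "\<dots> = (1 + L) * (2 * \<bar>p s\<bar> * \<bar>q s\<bar>)" by (simp add: algebra_simps)
      also have "\<dots> \<le> (1 + L) * (p s ^ 2 + q s ^ 2)"
        using sum_squares_bound[of "\<bar>p s\<bar>" "\<bar>q s\<bar>"] \<open>0 \<le> L\<close> by (intro mult_left_mono) auto
      finally show ?thesis by (simp add: D_def)
    qed
    show "D 0 = 0" using eq by (simp add: p_def q_def D_def)
  qed (simp add: D_def)
  then have "p t = 0" "q t = 0" unfolding D_def using sum_power2_eq_zero_iff by blast+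
  then show ?thesis by (simp add: p_def q_def)
qed

text \<open>At time 0 one of the two velocities is nonzero, so that coordinate does not return to
  its initial value after a short positive time.\<close>

lemma period_gap:
  assumes E: "E0 < E"
  shows "\<exists>\<delta>>0. \<forall>P. periodic P (\<lambda>t. x0 t E) \<and> periodic P (\<lambda>t. y0 t E) \<and> 0 < P \<longrightarrow> \<delta> \<le> P"
proof -
  have *: "\<exists>\<delta>>0. \<forall>P. periodic P w \<and> 0 < P \<longrightarrow> \<delta> \<le> P"
    if w: "(w has_real_derivative d) (at 0)" "d \<noteq> 0" for w :: "real \<Rightarrow> real" and d
  proof -
    have "((\<lambda>h. (w (0 + h) - w 0) / h) \<longlongrightarrow> d) (at 0)" using w(1) by (simp add: DERIV_def)
    then have "\<forall>\<^sub>F h in at 0. (w (0 + h) - w 0) / h \<noteq> 0" using w(2) tendsto_imp_eventually_ne by blast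
    then obtain \<delta> where "\<delta> > 0" and ne: "\<And>h. h \<noteq> 0 \<Longrightarrow> dist h 0 < \<delta> \<Longrightarrow> (w (0 + h) - w 0) / h \<noteq> 0"
      unfolding eventually_at by auto
    have "\<delta> \<le> P" if "periodic P w" "0 < P" for P
    proof (rule ccontr)
      assume "\<not> \<delta> \<le> P"
      with that(2) have "(w (0 + P) - w 0) / P \<noteq> 0"
        using ne[of P] by simp
      moreover have "w (0 + P) = w 0" using that(1) unfolding periodic_def by blast
      ultimately show False by simp
    qed
    then show ?thesis using \<open>\<delta> > 0\<close> by blast
  qed
  have "E0 < H (x0 0 E) (y0 0 E)" using orbit_energy[OF E] E by simp
  then consider "y0 0 E \<noteq> 0" | "- dU (x0 0 E) \<noteq> 0" using no_fixed by force
  then show ?thesis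
  proof cases
    case 1
    then show ?thesis using *[OF x0[OF E, of 0]] by blast
  next
    case 2
    then show ?thesis using *[OF y0[OF E, of 0]] by blast
  qed
qed

lemma period:
  assumes E: "E0 < E"
  shows "0 < T E" "x0 t E = x0 t' E \<and> y0 t E = y0 t' E \<longleftrightarrow> (\<exists>k::int. t' = t + of_int k * T E)"
proof -
  define G where "G = {P. periodic P (\<lambda>t. x0 t E) \<and> periodic P (\<lambda>t. y0 t E)}"
  have diff: "P - Q \<in> G" if "P \<in> G" "Q \<in> G" for P Q
  proof -
    have "x0 (z + (P - Q)) E = x0 z E" "y0 (z + (P - Q)) E = y0 z E" for z
      using that unfolding G_def periodic_def mem_Collect_eq
      by (metis add.assoc diff_add_cancel add.commute)+
    then show ?thesis by (simp add: G_def periodic_def)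
  qed
  obtain \<delta> where \<delta>: "0 < \<delta>" "\<And>P. P \<in> G \<Longrightarrow> 0 < P \<Longrightarrow> \<delta> \<le> P"
    using period_gap[OF E] unfolding G_def by auto
  obtain P0 where P0: "P0 \<in> G" "0 < P0" using orbit_periodic[OF E] unfolding G_def by auto
  have TG: "T E = Inf {P. 0 < P \<and> P \<in> G}" unfolding T G_def by simp
  note gen = real_subgroup_generator[OF diff \<delta> P0 TG]
  show "0 < T E" by (rule gen(1))
  have "x0 t E = x0 t' E \<and> y0 t E = y0 t' E \<longleftrightarrow> t' - t \<in> G"
  proof
    assume eq: "x0 t E = x0 t' E \<and> y0 t E = y0 t' E"
    have "x0 (z + (t' - t)) E = x0 z E \<and> y0 (z + (t' - t)) E = y0 z E" for z
      using orbit_unique[OF E, of t' t "z - t"] eq by (simp add: algebra_simps)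
    then show "t' - t \<in> G" by (simp add: G_def periodic_def)
  next
    assume "t' - t \<in> G"
    then have "x0 (t + (t' - t)) E = x0 t E" "y0 (t + (t' - t)) E = y0 t E"
      unfolding G_def periodic_def by blast+
    then show "x0 t E = x0 t' E \<and> y0 t E = y0 t' E" by simp
  qed
  also have "\<dots> \<longleftrightarrow> (\<exists>k::int. t' - t = of_int k * T E)" by (rule gen(2))
  also have "\<dots> \<longleftrightarrow> (\<exists>k::int. t' = t + of_int k * T E)" by (simp add: diff_eq_eq add.commute)
  finally show "x0 t E = x0 t' E \<and> y0 t E = y0 t' E \<longleftrightarrow> (\<exists>k::int. t' = t + of_int k * T E)" .
qed

section \<open>The map from angle and energy to the plane\<close>

lemma \<omega>_pos: "E0 < E \<Longrightarrow> 0 < \<omega> E"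
  using period(1) by (simp add: \<omega>)

lemma XY_energy: "E0 < E \<Longrightarrow> H (X \<phi> E) (Y \<phi> E) = E"
  by (simp add: X Y orbit_energy)

lemma XY_surj:
  assumes "E0 < H x y"
  obtains \<phi> where "X \<phi> (H x y) = x" "Y \<phi> (H x y) = y"
proof -
  define e where "e = H x y"
  have e: "E0 < e" using assms by (simp add: e_def)
  have "(x, y) \<in> range (\<lambda>t. (x0 t e, y0 t e))" using orbit_range[OF e] by (simp add: e_def)
  then obtain t where "x = x0 t e" "y = y0 t e" by blast
  then have "X (t * \<omega> e) e = x" "Y (t * \<omega> e) e = y" using \<omega>_pos[OF e] by (simp_all add: X Y)
  then show ?thesis using that unfolding e_def by blast
qed

lemma XY_angle:
  assumes E: "E0 < E"
  shows "X \<phi> E = X \<phi>' E \<and> Y \<phi> E = Y \<phi>' E \<longleftrightarrow> (\<exists>k::int. \<phi>' = \<phi> + 2 * pi * of_int k)"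
proof -
  have "\<phi>' / \<omega> E = \<phi> / \<omega> E + of_int k * T E \<longleftrightarrow> \<phi>' = \<phi> + 2 * pi * of_int k" for k
  proof -
    have "\<phi> / \<omega> E + of_int k * T E = (\<phi> + 2 * pi * of_int k) / \<omega> E"
      using period(1)[OF E] by (simp add: \<omega> field_simps)
    then show ?thesis using \<omega>_pos[OF E] by simp
  qed
  then show ?thesis using period(2)[OF E] by (simp add: X Y)
qed

lemma XY_inj:
  assumes "E0 < E" "E0 < E'"
  shows "X \<phi> E = X \<phi>' E' \<and> Y \<phi> E = Y \<phi>' E' \<longleftrightarrow> E = E' \<and> (\<exists>k::int. \<phi>' = \<phi> + 2 * pi * of_int k)"
  using XY_energy[OF assms(1), of \<phi>] XY_energy[OF assms(2), of \<phi>'] XY_angle[OF assms(1)] by metis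

lemma XY_bounded:
  assumes "E0 < E"
  shows "\<exists>B. \<forall>\<phi>. \<bar>X \<phi> E\<bar> \<le> B" "\<exists>B. \<forall>\<phi>. \<bar>Y \<phi> E\<bar> \<le> B"
  using orbit_bounded[OF assms] unfolding X Y by metis+

text \<open>The angular derivatives are the equations of motion divided by \<omega>. The third
  identity arises by differentiating \<open>H (X \<phi> E) (Y \<phi> E) = E\<close> in E.\<close>

lemma XY_differentiable:
  assumes E: "E0 < E"
  shows "((\<lambda>(\<phi>, E). X \<phi> E) has_derivative
           (\<lambda>(d\<phi>, dE). Y \<phi> E / \<omega> E * d\<phi> + deriv (X \<phi>) E * dE)) (at (\<phi>, E))"
    and "((\<lambda>(\<phi>, E). Y \<phi> E) has_derivative
           (\<lambda>(d\<phi>, dE). - dU (X \<phi> E) / \<omega> E * d\<phi> + deriv (Y \<phi>) E * dE)) (at (\<phi>, E))"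
    and "dU (X \<phi> E) * deriv (X \<phi>) E + Y \<phi> E * deriv (Y \<phi>) E = 1"
proof -
  have snd: "snd differentiable (at (\<phi>, E))" and fst: "fst differentiable (at (\<phi>, E))"
    by (rule bounded_linear_imp_differentiable, rule bounded_linear_snd bounded_linear_fst)+
  have "(\<lambda>(\<phi>, E). \<omega> E) differentiable (at (\<phi>, E))"
    using differentiable_chain_at[OF snd, of \<omega>] \<omega>_diff[OF E] by (simp add: o_def case_prod_unfold)
  moreover have "(\<lambda>(\<phi>, E). \<phi>) differentiable (at (\<phi>, E))"
    using fst by (simp add: case_prod_unfold)
  ultimately have "(\<lambda>(\<phi>, E). \<phi> / \<omega> E) differentiable (at (\<phi>, E))"
    using \<omega>_pos[OF E] by (simp add: case_prod_unfold differentiable_divide)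
  moreover have "(\<lambda>(\<phi>, E). E) differentiable (at (\<phi>, E))"
    using snd by (simp add: case_prod_unfold)
  ultimately have inner: "(\<lambda>(\<phi>, E). (\<phi> / \<omega> E, E)) differentiable (at (\<phi>, E))"
    by (auto simp: case_prod_unfold differentiable_def intro: has_derivative_Pair)
  have dX: "(\<lambda>(\<phi>, E). X \<phi> E) differentiable (at (\<phi>, E))"
    using differentiable_chain_at[OF inner, of "\<lambda>(t, E). x0 t E"] x0_diff[OF E]
    by (simp add: o_def case_prod_unfold X)
  have dY: "(\<lambda>(\<phi>, E). Y \<phi> E) differentiable (at (\<phi>, E))"
    using differentiable_chain_at[OF inner, of "\<lambda>(t, E). y0 t E"] y0_diff[OF E]
    by (simp add: o_def case_prod_unfold Y)
  have lin: "((\<lambda>\<phi>'. \<phi>' / \<omega> E) has_real_derivative 1 / \<omega> E) (at \<phi>)"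
    using \<omega>_pos[OF E] by (auto intro!: derivative_eq_intros)
  have "deriv (\<lambda>\<phi>'. X \<phi>' E) \<phi> = Y \<phi> E / \<omega> E"
    using DERIV_chain2[OF x0[OF E] lin] by (intro DERIV_imp_deriv) (simp add: X Y)
  then show 1: "((\<lambda>(\<phi>, E). X \<phi> E) has_derivative
           (\<lambda>(d\<phi>, dE). Y \<phi> E / \<omega> E * d\<phi> + deriv (X \<phi>) E * dE)) (at (\<phi>, E))"
    using has_derivative_partials2(1)[OF dX] by simp
  have "deriv (\<lambda>\<phi>'. Y \<phi>' E) \<phi> = - dU (X \<phi> E) / \<omega> E"
    using DERIV_chain2[OF y0[OF E] lin] by (intro DERIV_imp_deriv) (simp add: X Y)
  then show "((\<lambda>(\<phi>, E). Y \<phi> E) has_derivative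
           (\<lambda>(d\<phi>, dE). - dU (X \<phi> E) / \<omega> E * d\<phi> + deriv (Y \<phi>) E * dE)) (at (\<phi>, E))"
    using has_derivative_partials2(1)[OF dY] by simp
  have XE: "(X \<phi> has_real_derivative deriv (X \<phi>) E) (at E)" by (rule has_derivative_partials2(5)[OF dX])
  have YE: "(Y \<phi> has_real_derivative deriv (Y \<phi>) E) (at E)" by (rule has_derivative_partials2(5)[OF dY])
  have "((\<lambda>E. H (X \<phi> E) (Y \<phi> E)) has_real_derivative
      dU (X \<phi> E) * deriv (X \<phi>) E + Y \<phi> E * deriv (Y \<phi>) E) (at E)"
    unfolding H by (auto intro!: derivative_eq_intros XE YE DERIV_chain2[OF U])
  moreover have "((\<lambda>E. H (X \<phi> E) (Y \<phi> E)) has_real_derivative 1) (at E)"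
    by (rule has_field_derivative_transform_within_open[of "\<lambda>E. E" _ _ "{E0<..}"])
      (auto simp: XY_energy E)
  ultimately show "dU (X \<phi> E) * deriv (X \<phi>) E + Y \<phi> E * deriv (Y \<phi>) E = 1" by (rule DERIV_unique)
qed

lemma XY_map_derivative:
  assumes E: "E0 < E"
  shows "((\<lambda>(\<phi>, E). (X \<phi> E, Y \<phi> E)) has_derivative
     (\<lambda>(d\<phi>, dE). (Y \<phi> E / \<omega> E * d\<phi> + deriv (X \<phi>) E * dE,
        - dU (X \<phi> E) / \<omega> E * d\<phi> + deriv (Y \<phi>) E * dE))) (at (\<phi>, E))"
  using has_derivative_Pair[OF XY_differentiable(1,2)[OF E, of \<phi>]] by (simp add: case_prod_unfold)

text \<open>On a strip of angular width \<open>2 * pi\<close> the map is injective, so one inverse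
  serves the whole strip rather than a small neighbourhood. Its derivative is the inverse matrix,
  computed with the identity between the E-derivatives.\<close>

lemma local_inverse:
  assumes E: "E0 < E"
  obtains g W where "open W" "(X \<phi> E, Y \<phi> E) \<in> W"
    "\<forall>w\<in>W. \<exists>\<phi>' E'. \<bar>\<phi>' - \<phi>\<bar> < pi \<and> E0 < E' \<and> w = (X \<phi>' E', Y \<phi>' E')"
    "\<forall>\<phi>' E'. \<bar>\<phi>' - \<phi>\<bar> < pi \<longrightarrow> E0 < E' \<longrightarrow> g (X \<phi>' E', Y \<phi>' E') = (\<phi>', E')"
    "(g has_derivative (\<lambda>(dx, dy). (\<omega> E * (deriv (Y \<phi>) E * dx - deriv (X \<phi>) E * dy),
        dU (X \<phi> E) * dx + Y \<phi> E * dy))) (at (X \<phi> E, Y \<phi> E))"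
proof -
  let ?F = "\<lambda>(\<phi>, E). (X \<phi> E, Y \<phi> E)" and ?S = "{\<phi> - pi<..<\<phi> + pi} \<times> {E0<..}"
  have op: "open ?S" by (intro open_Times) auto
  have inj: "inj_on ?F ?S"
  proof (rule inj_onI)
    fix v w assume vw: "v \<in> ?S" "w \<in> ?S" "?F v = ?F w"
    obtain a Ea b Eb where v: "v = (a, Ea)" "w = (b, Eb)" by (metis surj_pair)
    then have *: "a \<in> {\<phi> - pi<..<\<phi> + pi}" "b \<in> {\<phi> - pi<..<\<phi> + pi}" "Ea \<in> {E0<..}" "Eb \<in> {E0<..}"
      "X a Ea = X b Eb" "Y a Ea = Y b Eb" using vw by auto
    then obtain k :: int where k: "Ea = Eb" "b = a + 2 * pi * of_int k" using XY_inj[of Ea Eb a b] by auto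
    \<comment> \<open>The strip is open and has width \<open>2 * pi\<close>, so two of its angles
      differ by strictly less than one turn and k must be 0.\<close>
    have "\<bar>2 * pi * of_int k\<bar> < 2 * pi" using k *(1,2) by auto
    then have "\<bar>real_of_int k\<bar> < 1" by (simp add: abs_mult)
    then show "v = w" using k v by (cases "k = 0") auto
  qed
  have cont: "continuous_on ?S ?F"
    using XY_map_derivative by (intro has_derivative_continuous_on[of _ _ "\<lambda>(\<phi>, E) (d\<phi>, dE).
       (Y \<phi> E / \<omega> E * d\<phi> + deriv (X \<phi>) E * dE, - dU (X \<phi> E) / \<omega> E * d\<phi> + deriv (Y \<phi>) E * dE)"])
      (auto intro: has_derivative_at_withinI)
  \<comment> \<open>Invariance of domain makes the image of the entire strip open, not only the
    image of a neighbourhood of the chosen point.\<close>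
  have W: "open (?F ` ?S)" by (rule invariance_of_domain[OF cont op inj])
  have gF: "inv_into ?S ?F (?F v) = v" if "v \<in> ?S" for v using inj that by simp
  show ?thesis
  proof
    show "open (?F ` ?S)" by fact
    show "(X \<phi> E, Y \<phi> E) \<in> ?F ` ?S"
      by (rule image_eqI[of _ _ "(\<phi>, E)"]) (use E in auto)
    show "\<forall>w\<in>?F ` ?S. \<exists>\<phi>' E'. \<bar>\<phi>' - \<phi>\<bar> < pi \<and> E0 < E' \<and> w = (X \<phi>' E', Y \<phi>' E')"
    proof
      fix w assume "w \<in> ?F ` ?S"
      then obtain \<phi>' E' where "(\<phi>', E') \<in> ?S" "w = (X \<phi>' E', Y \<phi>' E')" by auto
      then show "\<exists>\<phi>' E'. \<bar>\<phi>' - \<phi>\<bar> < pi \<and> E0 < E' \<and> w = (X \<phi>' E', Y \<phi>' E')"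
        by (intro exI[of _ \<phi>'] exI[of _ E']) auto
    qed
    show "\<forall>\<phi>' E'. \<bar>\<phi>' - \<phi>\<bar> < pi \<longrightarrow> E0 < E' \<longrightarrow> inv_into ?S ?F (X \<phi>' E', Y \<phi>' E') = (\<phi>', E')"
    proof (intro allI impI)
      fix \<phi>' E' assume "\<bar>\<phi>' - \<phi>\<bar> < pi" "E0 < E'"
      then show "inv_into ?S ?F (X \<phi>' E', Y \<phi>' E') = (\<phi>', E')"
        using gF[of "(\<phi>', E')"] by (auto simp: abs_less_iff)
    qed
    have "(inv_into ?S ?F has_derivative (\<lambda>(dx, dy). (\<omega> E * (deriv (Y \<phi>) E * dx - deriv (X \<phi>) E * dy),
        dU (X \<phi> E) * dx + Y \<phi> E * dy))) (at (?F (\<phi>, E)))"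
    proof (rule has_derivative_inverse_strong[OF op _ cont gF XY_map_derivative[OF E]])
      show "(\<phi>, E) \<in> ?S" using E by simp
      let ?a = "dU (X \<phi> E)" and ?b = "deriv (X \<phi>) E" and ?c = "Y \<phi> E" and ?d = "deriv (Y \<phi>) E"
      have J: "?a * ?b + ?c * ?d = 1" by (rule XY_differentiable(3)[OF E])
      have "?c / \<omega> E * (\<omega> E * (?d * dx - ?b * dy)) + ?b * (?a * dx + ?c * dy) = (?a * ?b + ?c * ?d) * dx"
        "- ?a / \<omega> E * (\<omega> E * (?d * dx - ?b * dy)) + ?d * (?a * dx + ?c * dy) = (?a * ?b + ?c * ?d) * dy" for dx dy
        using \<omega>_pos[OF E] by (auto simp: field_simps)
      then show "(\<lambda>(d\<phi>, dE). (?c / \<omega> E * d\<phi> + ?b * dE, - ?a / \<omega> E * d\<phi> + ?d * dE)) \<circ>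
         (\<lambda>(dx, dy). (\<omega> E * (?d * dx - ?b * dy), ?a * dx + ?c * dy)) = id"
        unfolding J by (auto simp: fun_eq_iff)
    qed
    then show "(inv_into ?S ?F has_derivative (\<lambda>(dx, dy). (\<omega> E * (deriv (Y \<phi>) E * dx - deriv (X \<phi>) E * dy),
        dU (X \<phi> E) * dx + Y \<phi> E * dy))) (at (X \<phi> E, Y \<phi> E))" by simp
  qed
qed

lemma lift_angle:
  assumes J: "open J" "is_interval J"
    and x: "\<And>t. t \<in> J \<Longrightarrow> (x has_real_derivative x' t) (at t)"
    and y: "\<And>t. t \<in> J \<Longrightarrow> (y has_real_derivative y' t) (at t)"
    and E: "\<And>t. t \<in> J \<Longrightarrow> E0 < H (x t) (y t)"
  obtains \<phi> where "\<And>t. t \<in> J \<Longrightarrow> X (\<phi> t) (H (x t) (y t)) = x t \<and> Y (\<phi> t) (H (x t) (y t)) = y t"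
    "\<And>t. t \<in> J \<Longrightarrow> (\<phi> has_real_derivative \<omega> (H (x t) (y t)) *
       (deriv (Y (\<phi> t)) (H (x t) (y t)) * x' t - deriv (X (\<phi> t)) (H (x t) (y t)) * y' t)) (at t)"
proof -
  define e where "e t = H (x t) (y t)" for t
  have Ee: "E0 < e t" if "t \<in> J" for t using E[OF that] by (simp add: e_def)
  have "\<exists>a. X a (e t) = x t \<and> Y a (e t) = y t" if "t \<in> J" for t
    using XY_surj[OF E[OF that]] unfolding e_def by metis
  \<comment> \<open>These angles are chosen separately for each time, with no continuity; only
    \<open>cis\<close> of them will turn out to be continuous.\<close>
  then obtain a where a: "X (a t) (e t) = x t" "Y (a t) (e t) = y t" if "t \<in> J" for t by metis
  have xy: "((\<lambda>t. (x t, y t)) has_derivative (\<lambda>d. (x' t * d, y' t * d))) (at t)" if "t \<in> J" for t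
    using x[OF that] y[OF that] by (intro has_derivative_Pair) (auto simp: has_field_derivative_def)
  have near: "\<forall>\<^sub>F s in at t. s \<in> J \<and> (x s, y s) \<in> W" if "t \<in> J" "open W" "(x t, y t) \<in> W" for t W
  proof -
    have "continuous (at t) (\<lambda>t. (x t, y t))" using xy[OF \<open>t \<in> J\<close>] by (rule has_derivative_continuous)
    then have "((\<lambda>t. (x t, y t)) \<longlongrightarrow> (x t, y t)) (at t)" by (simp add: continuous_at)
    from topological_tendstoD[OF this that(2,3)] show ?thesis
      using eventually_at_in_open'[OF J(1) that(1)] by eventually_elim simp
  qed
  have "isCont (\<lambda>t. cis (a t)) t" if t: "t \<in> J" for t
  proof -
    obtain g W where g: "open W" "(X (a t) (e t), Y (a t) (e t)) \<in> W"
      "\<forall>w\<in>W. \<exists>\<phi>' E'. \<bar>\<phi>' - a t\<bar> < pi \<and> E0 < E' \<and> w = (X \<phi>' E', Y \<phi>' E')"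
      "\<forall>\<phi>' E'. \<bar>\<phi>' - a t\<bar> < pi \<longrightarrow> E0 < E' \<longrightarrow> g (X \<phi>' E', Y \<phi>' E') = (\<phi>', E')"
      "(g has_derivative (\<lambda>(dx, dy). (\<omega> (e t) * (deriv (Y (a t)) (e t) * dx - deriv (X (a t)) (e t) * dy),
        dU (X (a t) (e t)) * dx + Y (a t) (e t) * dy))) (at (X (a t) (e t), Y (a t) (e t)))"
      using local_inverse[OF Ee[OF t], of "a t"] .
    \<comment> \<open>The chosen angle and the angle given by the local inverse describe the same
      point, so they differ by whole turns, which \<open>cis\<close> does not see.\<close>
    have eq: "cis (a s) = cis (fst (g (x s, y s)))" if s: "s \<in> J" "(x s, y s) \<in> W" for s
    proof -
      obtain \<phi>' E' where w: "\<bar>\<phi>' - a t\<bar> < pi" "E0 < E'" "(x s, y s) = (X \<phi>' E', Y \<phi>' E')"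
        using bspec[OF g(3) s(2)] by blast
      then have "X (a s) (e s) = X \<phi>' E' \<and> Y (a s) (e s) = Y \<phi>' E'" using a[OF s(1)] by simp
      then obtain k :: int where "\<phi>' = a s + 2 * pi * of_int k" using XY_inj[OF Ee[OF s(1)] w(2)] by blast
      then have "cis \<phi>' = cis (a s)" by (metis cis_mult cis_multiple_2pi Ints_of_int mult.right_neutral)
      moreover have "fst (g (x s, y s)) = \<phi>'" using g(4) w by simp
      ultimately show ?thesis by simp
    qed
    have "continuous (at (x t, y t)) g" using has_derivative_continuous[OF g(5)] a[OF t] by simp
    from isCont_o2[OF has_derivative_continuous[OF xy[OF t]] this]
    have "isCont (\<lambda>s. g (x s, y s)) t" .
    then have "isCont (\<lambda>s. cis (fst (g (x s, y s)))) t"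
      unfolding cis_conv_exp by (intro continuous_intros)
    moreover have "\<forall>\<^sub>F s in nhds t. cis (fst (g (x s, y s))) = cis (a s)"
      using near[OF t g(1)] g(2) a[OF t] eq t by (auto simp: eventually_nhds_conv_at elim: eventually_mono)
    ultimately show ?thesis by (simp add: isCont_cong)
  qed
  then have "continuous_on J (\<lambda>t. cis (a t))" by (simp add: continuous_at_imp_continuous_on)
  \<comment> \<open>Intervals are convex; contractibility is what gives a continuous logarithm of a
    function without zeros.\<close>
  moreover have "contractible J" using J(2) by (simp add: is_interval_convex convex_imp_contractible)
  ultimately obtain \<Theta> where \<Theta>: "continuous_on J \<Theta>" "\<And>t. t \<in> J \<Longrightarrow> cis (a t) = exp (\<Theta> t)"
    by (rule continuous_logarithm_on_contractible) (auto simp: cis_neq_zero)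
  \<comment> \<open>The logarithm is purely imaginary because \<open>cis\<close> has norm 1; its
    imaginary part is a continuous choice of the angle.\<close>
  define \<phi> where "\<phi> t = Im (\<Theta> t)" for t
  have cont: "isCont \<phi> t" if "t \<in> J" for t
  proof -
    have "isCont \<Theta> t" using \<Theta>(1) J(1) that by (simp add: continuous_on_eq_continuous_at)
    then show ?thesis unfolding \<phi>_def isCont_def by (rule tendsto_Im)
  qed
  have \<phi>: "X (\<phi> t) (e t) = x t \<and> Y (\<phi> t) (e t) = y t" if t: "t \<in> J" for t
  proof -
    have "norm (exp (\<Theta> t)) = 1" using \<Theta>(2)[OF t] norm_cis[of "a t"] by simp
    then have "Re (\<Theta> t) = 0" by simp
    then have "cis (a t) = cis (\<phi> t)" using \<Theta>(2)[OF t] by (simp add: exp_eq_polar \<phi>_def)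
    then have "sin (a t) = sin (\<phi> t) \<and> cos (a t) = cos (\<phi> t)" by (simp add: complex_eq_iff)
    then obtain k :: int where "a t = \<phi> t + 2 * pi * of_int k" by (auto simp: sin_cos_eq_iff)
    then show ?thesis using XY_angle[OF Ee[OF t], of "\<phi> t" "a t"] a[OF t] by metis
  qed
  moreover have "(\<phi> has_real_derivative \<omega> (e t) * (deriv (Y (\<phi> t)) (e t) * x' t - deriv (X (\<phi> t)) (e t) * y' t)) (at t)"
    if t: "t \<in> J" for t
  proof -
    obtain g W where g: "open W" "(X (\<phi> t) (e t), Y (\<phi> t) (e t)) \<in> W"
      "\<forall>w\<in>W. \<exists>\<phi>' E'. \<bar>\<phi>' - \<phi> t\<bar> < pi \<and> E0 < E' \<and> w = (X \<phi>' E', Y \<phi>' E')"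
      "\<forall>\<phi>' E'. \<bar>\<phi>' - \<phi> t\<bar> < pi \<longrightarrow> E0 < E' \<longrightarrow> g (X \<phi>' E', Y \<phi>' E') = (\<phi>', E')"
      "(g has_derivative (\<lambda>(dx, dy). (\<omega> (e t) * (deriv (Y (\<phi> t)) (e t) * dx - deriv (X (\<phi> t)) (e t) * dy),
        dU (X (\<phi> t) (e t)) * dx + Y (\<phi> t) (e t) * dy))) (at (X (\<phi> t) (e t), Y (\<phi> t) (e t)))"
      using local_inverse[OF Ee[OF t], of "\<phi> t"] .
    have "((\<lambda>s. g (x s, y s)) has_derivative (\<lambda>d. (\<omega> (e t) * (deriv (Y (\<phi> t)) (e t) * (x' t * d) - deriv (X (\<phi> t)) (e t) * (y' t * d)),
        dU (X (\<phi> t) (e t)) * (x' t * d) + Y (\<phi> t) (e t) * (y' t * d)))) (at t)"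
      using has_derivative_compose[OF xy[OF t] g(5)[unfolded conjunct1[OF \<phi>[OF t]] conjunct2[OF \<phi>[OF t]]]]
      by (simp add: conjunct1[OF \<phi>[OF t]] conjunct2[OF \<phi>[OF t]])
    from has_derivative_fst[OF this]
    have d: "((\<lambda>s. fst (g (x s, y s))) has_real_derivative
        \<omega> (e t) * (deriv (Y (\<phi> t)) (e t) * x' t - deriv (X (\<phi> t)) (e t) * y' t)) (at t)"
      unfolding has_field_derivative_def by (rule has_derivative_eq_rhs) (auto simp: algebra_simps)
    \<comment> \<open>By continuity \<phi> stays within pi of its value at t, so it coincides nearby
      with the angle of the local inverse, whose derivative is known.\<close>
    have ev: "\<forall>\<^sub>F s in nhds t. fst (g (x s, y s)) = \<phi> s"
    proof -
      have "\<forall>\<^sub>F s in nhds t. dist (\<phi> s) (\<phi> t) < pi"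
        using cont[OF t] pi_gt_zero by (simp add: isCont_def tendsto_iff eventually_nhds_conv_at)
      moreover have "\<forall>\<^sub>F s in nhds t. s \<in> J" using J(1) t by (rule eventually_nhds_in_open)
      ultimately show ?thesis
      proof eventually_elim
        case (elim s)
        then show ?case using g(4)[rule_format, of "\<phi> s" "e s"] \<phi>[OF elim(2)] Ee[OF elim(2)] by (simp add: dist_real_def)
      qed
    qed
    show ?thesis by (rule iffD1[OF DERIV_cong_ev[OF refl ev refl] d])
  qed
  ultimately show ?thesis using that[of \<phi>] unfolding e_def by blast
qed

end

section \<open>Bounds on the coefficients that the asymptotic hypotheses contain implicitly\<close>

lemma polynomial_coeffs_bounded:
  fixes c :: "nat \<Rightarrow> 'a \<Rightarrow> real"
  assumes "\<And>x. \<exists>B. \<forall>s\<in>A. \<bar>\<Sum>i\<le>n. c i s * x ^ i\<bar> \<le> B" "i \<le> n"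
  shows "\<exists>B. \<forall>s\<in>A. \<bar>c i s\<bar> \<le> B"
  using assms
proof (induction n arbitrary: c i)
  case 0
  then show ?case using "0.prems"(1)[of 0] by simp
next
  case (Suc n)
  have low: "\<exists>B. \<forall>s\<in>A. \<bar>c i s\<bar> \<le> B" if "i \<le> n" for i
  proof -
    \<comment> \<open>passing from \<open>p x\<close> to \<open>p (2 x) - 2 ^ Suc n * p x\<close> removes the leading term\<close>
    have "\<exists>B. \<forall>s\<in>A. \<bar>\<Sum>i\<le>n. (c i s * (2 ^ i - 2 ^ Suc n)) * x ^ i\<bar> \<le> B" for x
    proof -
      obtain B1 B2 where B1: "\<forall>s\<in>A. \<bar>\<Sum>i\<le>Suc n. c i s * (2 * x) ^ i\<bar> \<le> B1"
        and B2: "\<forall>s\<in>A. \<bar>\<Sum>i\<le>Suc n. c i s * x ^ i\<bar> \<le> B2"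
        using Suc.prems(1) by metis
      have "\<bar>\<Sum>i\<le>n. (c i s * (2 ^ i - 2 ^ Suc n)) * x ^ i\<bar> \<le> B1 + 2 ^ Suc n * B2" if "s \<in> A" for s
      proof -
        have "(\<Sum>i\<le>n. (c i s * (2 ^ i - 2 ^ Suc n)) * x ^ i)
            = (\<Sum>i\<le>Suc n. (c i s * (2 ^ i - 2 ^ Suc n)) * x ^ i)" by simp
        also have "\<dots> = (\<Sum>i\<le>Suc n. c i s * (2 * x) ^ i) - 2 ^ Suc n * (\<Sum>i\<le>Suc n. c i s * x ^ i)"
          unfolding sum_distrib_left sum_subtractf[symmetric]
          by (rule sum.cong[OF refl]) (simp add: power_mult_distrib algebra_simps)
        finally have eq: "(\<Sum>i\<le>n. (c i s * (2 ^ i - 2 ^ Suc n)) * x ^ i)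
            = (\<Sum>i\<le>Suc n. c i s * (2 * x) ^ i) - 2 ^ Suc n * (\<Sum>i\<le>Suc n. c i s * x ^ i)" .
        have "\<bar>2 ^ Suc n * (\<Sum>i\<le>Suc n. c i s * x ^ i)\<bar> \<le> 2 ^ Suc n * B2"
          unfolding abs_mult using B2 that by (intro mult_mono) auto
        then show ?thesis unfolding eq using bspec[OF B1 that] by linarith
      qed
      then show ?thesis by blast
    qed
    from Suc.IH[of "\<lambda>i s. c i s * (2 ^ i - 2 ^ Suc n)", OF this that]
    obtain B where B: "\<forall>s\<in>A. \<bar>c i s * (2 ^ i - 2 ^ Suc n)\<bar> \<le> B" by blast
    have "\<bar>c i s\<bar> \<le> B" if "s \<in> A" for s
    proof -
      \<comment> \<open>The factor produced by eliminating the leading term has absolute value at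
        least 1, so a bound for the product is a bound for the coefficient.\<close>
      have "(2::real) ^ i \<le> 2 ^ n" using \<open>i \<le> n\<close> by (intro power_increasing) auto
      then have "1 \<le> \<bar>(2::real) ^ i - 2 ^ Suc n\<bar>" using one_le_power[of "2::real" n] unfolding power_Suc by linarith
      then have "\<bar>c i s\<bar> * 1 \<le> \<bar>c i s\<bar> * \<bar>2 ^ i - 2 ^ Suc n\<bar>" by (intro mult_left_mono) auto
      then show ?thesis using B that unfolding abs_mult[symmetric] by fastforce
    qed
    then show ?thesis by blast
  qed
  show ?case
  proof (cases "i = Suc n")
    case True
    obtain B where B: "\<And>i s. i \<le> n \<Longrightarrow> s \<in> A \<Longrightarrow> \<bar>c i s\<bar> \<le> B i" using low by metis
    obtain B1 where B1: "\<forall>s\<in>A. \<bar>\<Sum>i\<le>Suc n. c i s * 1 ^ i\<bar> \<le> B1" using Suc.prems(1) by metis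
    have "\<bar>c (Suc n) s\<bar> \<le> B1 + (\<Sum>i\<le>n. B i)" if "s \<in> A" for s
    proof -
      have "\<bar>\<Sum>i\<le>n. c i s\<bar> \<le> (\<Sum>i\<le>n. B i)"
        by (rule order_trans[OF sum_abs sum_mono]) (use B that in auto)
      moreover have "\<bar>(\<Sum>i\<le>n. c i s) + c (Suc n) s\<bar> \<le> B1" using B1 that by simp
      ultimately show ?thesis by linarith
    qed
    then show ?thesis using True by blast
  qed (use Suc.prems(2) low in auto)
qed

lemma polynomial_coeffs_bounded2:
  fixes c :: "nat \<Rightarrow> nat \<Rightarrow> real \<Rightarrow> real"
  assumes "\<And>x y. \<exists>B. \<forall>s. \<bar>\<Sum>i\<le>p. \<Sum>j<l. c i j s * x ^ i * y ^ j\<bar> \<le> B" "i \<le> p" "j < l"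
  shows "\<exists>B. \<forall>s. \<bar>c i j s\<bar> \<le> B"
proof -
  have "\<exists>B. \<forall>s\<in>UNIV. \<bar>\<Sum>j\<le>l - 1. c i j s * y ^ j\<bar> \<le> B" for y
  proof (rule polynomial_coeffs_bounded[OF _ assms(2)])
    fix x
    have "(\<Sum>i\<le>p. (\<Sum>j\<le>l - 1. c i j s * y ^ j) * x ^ i) = (\<Sum>i\<le>p. \<Sum>j<l. c i j s * x ^ i * y ^ j)" for s
    proof (rule sum.cong[OF refl])
      have "{..l - 1} = {..<l}" using assms(3) by auto
      then show "(\<Sum>j\<le>l - 1. c i j s * y ^ j) * x ^ i = (\<Sum>j<l. c i j s * x ^ i * y ^ j)" for i
        by (simp add: sum_distrib_left sum_distrib_right algebra_simps)
    qed
    then show "\<exists>B. \<forall>s\<in>UNIV. \<bar>\<Sum>i\<le>p. (\<Sum>j\<le>l - 1. c i j s * y ^ j) * x ^ i\<bar> \<le> B" using assms(1) by simp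
  qed
  from polynomial_coeffs_bounded[OF this, of j] assms(3) show ?thesis by auto
qed

text \<open>No continuity of the coefficients is available, so compactness does not bound them.
  Instead the estimate of order k is read at one fixed time, where F is bounded in S: lower orders
  are bounded by induction, so the polynomial of order k is bounded at every point, and hence so are
  its coefficients.\<close>

lemma power_law_coeffs_bounded:
  assumes asymp: "power_law_asymptotics q F (\<lambda>k x y S. \<Sum>i\<le>p. \<Sum>j<l. A k i j S * x ^ i * y ^ j)"
    and bdd: "\<And>x y t. 0 < t \<Longrightarrow> \<exists>B. \<forall>S. \<bar>F x y S t\<bar> \<le> B"
    and "i \<le> p" "j < l"
  shows "\<exists>B. \<forall>S. \<bar>A k i j S\<bar> \<le> B"
  using \<open>i \<le> p\<close> \<open>j < l\<close>
proof (induction k arbitrary: i j rule: less_induct)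
  case (less k)
  obtain d :: nat where "\<forall>n. \<exists>C t'. 0 < t' \<and> (\<forall>t\<ge>t'. \<forall>x y S.
        \<bar>F x y S t - (\<Sum>k\<le>n. t powr (- (real k / real q)) * (\<Sum>i\<le>p. \<Sum>j<l. A k i j S * x ^ i * y ^ j))\<bar>
          \<le> C * t powr (- (real (Suc n) / real q)) * (1 + \<bar>x\<bar> + \<bar>y\<bar>) ^ d)"
    using asymp unfolding power_law_asymptotics_def by blast
  from spec[OF this, of k] obtain C t where t: "0 < t" and C: "\<And>x y S.
        \<bar>F x y S t - (\<Sum>k\<le>k. t powr (- (real k / real q)) * (\<Sum>i\<le>p. \<Sum>j<l. A k i j S * x ^ i * y ^ j))\<bar>
          \<le> C * t powr (- (real (Suc k) / real q)) * (1 + \<bar>x\<bar> + \<bar>y\<bar>) ^ d"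
    by blast
  obtain B where B: "\<And>k' i j S. k' < k \<Longrightarrow> i \<le> p \<Longrightarrow> j < l \<Longrightarrow> \<bar>A k' i j S\<bar> \<le> B k' i j"
    using less.IH by metis
  show ?case
  proof (rule polynomial_coeffs_bounded2[OF _ less.prems])
    fix x y
    obtain B0 where B0: "\<And>S. \<bar>F x y S t\<bar> \<le> B0" using bdd[OF t] by blast
    let ?P = "\<lambda>k S. \<Sum>i\<le>p. \<Sum>j<l. A k i j S * x ^ i * y ^ j"
    let ?a = "\<lambda>k. t powr (- (real k / real q))"
    \<comment> \<open>\<open>D\<close> bounds the terms of order below k, and \<open>R\<close> is
      the error of the estimate at the fixed time and point.\<close>
    define D where "D = (\<Sum>k'<k. ?a k' * (\<Sum>i\<le>p. \<Sum>j<l. B k' i j * \<bar>x\<bar> ^ i * \<bar>y\<bar> ^ j))"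
    define R where "R = C * t powr (- (real (Suc k) / real q)) * (1 + \<bar>x\<bar> + \<bar>y\<bar>) ^ d"
    have "\<bar>?P k S\<bar> \<le> (B0 + D + R) / ?a k" for S
    proof -
      have "\<bar>\<Sum>k'<k. ?a k' * ?P k' S\<bar> \<le> D"
        unfolding D_def
      proof (rule order_trans[OF sum_abs sum_mono])
        fix k' assume "k' \<in> {..<k}"
        then have "\<bar>?P k' S\<bar> \<le> (\<Sum>i\<le>p. \<Sum>j<l. B k' i j * \<bar>x\<bar> ^ i * \<bar>y\<bar> ^ j)"
          by (intro order_trans[OF sum_abs sum_mono])
            (auto simp: abs_mult power_abs intro!: mult_right_mono B)
        then show "\<bar>?a k' * ?P k' S\<bar> \<le> ?a k' * (\<Sum>i\<le>p. \<Sum>j<l. B k' i j * \<bar>x\<bar> ^ i * \<bar>y\<bar> ^ j)"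
          unfolding abs_mult by (intro mult_mono) auto
      qed
      moreover have "(\<Sum>k'\<le>k. ?a k' * ?P k' S) = (\<Sum>k'<k. ?a k' * ?P k' S) + ?a k * ?P k S"
        by (simp add: lessThan_Suc_atMost[symmetric])
      ultimately have "\<bar>?a k * ?P k S\<bar> \<le> B0 + D + R"
        using B0[of S] C[of x y S] unfolding R_def by linarith
      then show ?thesis using t by (simp add: abs_mult le_divide_eq mult.commute)
    qed
    then show "\<exists>B. \<forall>S. \<bar>?P k S\<bar> \<le> B" by blast
  qed
qed

text \<open>Multiplied by \<open>E powr (- \<alpha>)\<close>, the asymptotics become an ordinary
  expansion in nonnegative powers of \<open>E powr (- (1 / (2 * real h)))\<close>.\<close>

lemma energy_asymptotics_scaled:
  assumes "energy_asymptotics h \<alpha> W c" "0 < h"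
  shows "\<exists>C E'. 0 < E' \<and> (\<forall>E\<ge>E'. \<forall>\<phi>.
    \<bar>W \<phi> E * E powr (- \<alpha>) - (\<Sum>j\<le>m. c j \<phi> * (E powr (- (1 / (2 * real h)))) ^ j)\<bar>
      \<le> C * (E powr (- (1 / (2 * real h)))) ^ Suc m)"
proof -
  obtain C E' where E': "0 < E'" and C: "\<And>E \<phi>. E' \<le> E \<Longrightarrow>
      \<bar>W \<phi> E - (\<Sum>j\<le>m. E powr (\<alpha> - real j / (2 * real h)) * c j \<phi>)\<bar>
          \<le> C * E powr (\<alpha> - real (Suc m) / (2 * real h))"
    using assms(1) unfolding energy_asymptotics_def by blast
  have "\<bar>W \<phi> E * E powr (- \<alpha>) - (\<Sum>j\<le>m. c j \<phi> * (E powr (- (1 / (2 * real h)))) ^ j)\<bar>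
      \<le> C * (E powr (- (1 / (2 * real h)))) ^ Suc m" if E: "E' \<le> E" for E \<phi>
  proof -
    have pw: "E powr (\<alpha> - real j / (2 * real h)) * E powr (- \<alpha>) = (E powr (- (1 / (2 * real h)))) ^ j" for j
    proof -
      have "(E powr (- (1 / (2 * real h)))) ^ j = E powr (- (1 / (2 * real h)) * real j)"
        using E E' by (simp add: powr_powr flip: powr_realpow)
      then show ?thesis by (simp flip: powr_add)
    qed
    have "\<bar>W \<phi> E - (\<Sum>j\<le>m. E powr (\<alpha> - real j / (2 * real h)) * c j \<phi>)\<bar> * E powr (- \<alpha>)
        \<le> C * E powr (\<alpha> - real (Suc m) / (2 * real h)) * E powr (- \<alpha>)"
      using C[OF E] by (intro mult_right_mono) auto
    also have "\<bar>W \<phi> E - (\<Sum>j\<le>m. E powr (\<alpha> - real j / (2 * real h)) * c j \<phi>)\<bar> * E powr (- \<alpha>)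
        = \<bar>(W \<phi> E - (\<Sum>j\<le>m. E powr (\<alpha> - real j / (2 * real h)) * c j \<phi>)) * E powr (- \<alpha>)\<bar>"
      by (simp add: abs_mult)
    also have "(W \<phi> E - (\<Sum>j\<le>m. E powr (\<alpha> - real j / (2 * real h)) * c j \<phi>)) * E powr (- \<alpha>)
        = W \<phi> E * E powr (- \<alpha>) - (\<Sum>j\<le>m. c j \<phi> * (E powr (\<alpha> - real j / (2 * real h)) * E powr (- \<alpha>)))"
      by (simp add: left_diff_distrib sum_distrib_left sum_distrib_right algebra_simps)
    finally show ?thesis unfolding pw by (simp only: mult.assoc pw)
  qed
  then show ?thesis using E' by blast
qed

text \<open>The same device as for the power laws: a single energy, large enough for the estimate
  and above E0, bounds the coefficients one after the other.\<close>

lemma energy_coeffs_bounded: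
  assumes "energy_asymptotics h \<alpha> W c" "0 < h" and bdd: "\<And>E. E0 < E \<Longrightarrow> \<exists>B. \<forall>\<phi>. \<bar>W \<phi> E\<bar> \<le> B"
  shows "\<exists>B. \<forall>\<phi>. \<bar>c j \<phi>\<bar> \<le> B"
proof (induction j rule: less_induct)
  case (less j)
  obtain C E' where E': "0 < E'" and C: "\<And>E \<phi>. E' \<le> E \<Longrightarrow>
    \<bar>W \<phi> E * E powr (- \<alpha>) - (\<Sum>j\<le>j. c j \<phi> * (E powr (- (1 / (2 * real h)))) ^ j)\<bar>
      \<le> C * (E powr (- (1 / (2 * real h)))) ^ Suc j"
    using energy_asymptotics_scaled[OF assms(1,2)] by blast
  define E where "E = max E' (E0 + 1)"
  have E: "E' \<le> E" "E0 < E" "0 < E" using E' unfolding E_def by auto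
  obtain B where B: "\<And>\<phi>. \<bar>W \<phi> E\<bar> \<le> B" using bdd[OF E(2)] by blast
  obtain D where D: "\<And>i \<phi>. i < j \<Longrightarrow> \<bar>c i \<phi>\<bar> \<le> D i" using less.IH by metis
  define v where "v = E powr (- (1 / (2 * real h)))"
  have v: "0 < v" using E(3) by (simp add: v_def)
  have "\<bar>c j \<phi>\<bar> \<le> (B * E powr (- \<alpha>) + (\<Sum>i<j. D i * v ^ i) + C * v ^ Suc j) / v ^ j" for \<phi>
  proof -
    have 1: "\<bar>\<Sum>i<j. c i \<phi> * v ^ i\<bar> \<le> (\<Sum>i<j. D i * v ^ i)"
      by (rule order_trans[OF sum_abs sum_mono]) (use D v in \<open>auto simp: abs_mult intro!: mult_right_mono\<close>)
    have 2: "\<bar>W \<phi> E * E powr (- \<alpha>)\<bar> \<le> B * E powr (- \<alpha>)"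
      unfolding abs_mult using B[of \<phi>] by (intro mult_mono) auto
    have "(\<Sum>j\<le>j. c j \<phi> * v ^ j) = (\<Sum>i<j. c i \<phi> * v ^ i) + c j \<phi> * v ^ j"
      by (simp add: lessThan_Suc_atMost[symmetric])
    then have "\<bar>c j \<phi> * v ^ j\<bar> \<le> B * E powr (- \<alpha>) + (\<Sum>i<j. D i * v ^ i) + C * v ^ Suc j"
      using C[OF E(1), of \<phi>] 1 2 unfolding v_def[symmetric] by linarith
    then show ?thesis using v by (simp add: abs_mult le_divide_eq)
  qed
  then show ?case by blast
qed

context small_parameter
begin

lemma expandable_mult_z:
  assumes "expandable m u" shows "expandable (Suc m) (\<lambda>\<tau> p. z \<tau> * u \<tau> p)"
proof (rule expandable_SucI[of "\<lambda>p. 0"])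
  show "expandable m (\<lambda>\<tau> p. (z \<tau> * u \<tau> p - 0) / z \<tau>)"
  proof (rule expandable_cong[OF _ assms])
    show "\<forall>\<^sub>F \<tau> in at_top. \<forall>p\<in>P. u \<tau> p = (z \<tau> * u \<tau> p - 0) / z \<tau>"
      using z_pos by eventually_elim simp
  qed
qed simp

text \<open>Substitution of a small quantity \<open>v\<close> for the root of the inverse energy.
  Since \<open>v\<close> is of order z, cutting the series at index m leaves an error of order
  \<open>m + 1\<close>, and the partial sum is a polynomial in \<open>v\<close> with bounded
  coefficients.\<close>

lemma expandable_energy:
  assumes EA: "energy_asymptotics h \<alpha> W c" "0 < h" and c: "\<And>j. bdd_on (\<lambda>p. c j (\<phi> p))"
    and large: "\<And>K. \<forall>\<^sub>F \<tau> in at_top. \<forall>p\<in>P. K \<le> I \<tau> p"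
    and v: "expandable m v" "bigO 1 v"
    and v_eq: "\<forall>\<^sub>F \<tau> in at_top. \<forall>p\<in>P. I \<tau> p powr (- (1 / (2 * real h))) = v \<tau> p"
  shows "expandable m (\<lambda>\<tau> p. W (\<phi> p) (I \<tau> p) * I \<tau> p powr (- \<alpha>))"
    and "bigO m (\<lambda>\<tau> p. W (\<phi> p) (I \<tau> p) * I \<tau> p powr (- \<alpha>) - (\<Sum>j\<le>m. c j (\<phi> p) * v \<tau> p ^ j))"
    and "bigO 1 (\<lambda>\<tau> p. W (\<phi> p) (I \<tau> p) * I \<tau> p powr (- \<alpha>) - c 0 (\<phi> p))"
proof -
  have R: "bigO (Suc m) (\<lambda>\<tau> p. W (\<phi> p) (I \<tau> p) * I \<tau> p powr (- \<alpha>) - (\<Sum>j\<le>m. c j (\<phi> p) * v \<tau> p ^ j))" for m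
  proof -
    obtain C E' where E': "0 < E'" and C: "\<And>E \<phi>. E' \<le> E \<Longrightarrow>
      \<bar>W \<phi> E * E powr (- \<alpha>) - (\<Sum>j\<le>m. c j \<phi> * (E powr (- (1 / (2 * real h)))) ^ j)\<bar>
        \<le> C * (E powr (- (1 / (2 * real h)))) ^ Suc m"
      using energy_asymptotics_scaled[OF EA] by blast
    have "bigO (Suc m * 1) (\<lambda>\<tau> p. v \<tau> p ^ Suc m)" by (rule bigO_power[OF v(2)])
    then have "bigO (Suc m) (\<lambda>\<tau> p. C * v \<tau> p ^ Suc m)" using bigO_cmult by simp
    moreover have "\<forall>\<^sub>F \<tau> in at_top. \<forall>p\<in>P.
        \<bar>W (\<phi> p) (I \<tau> p) * I \<tau> p powr (- \<alpha>) - (\<Sum>j\<le>m. c j (\<phi> p) * v \<tau> p ^ j)\<bar> \<le> \<bar>C * v \<tau> p ^ Suc m\<bar>"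
      using large[of E'] v_eq
    proof eventually_elim
      case (elim \<tau>)
      show ?case
      proof
        fix p assume p: "p \<in> P"
        show "\<bar>W (\<phi> p) (I \<tau> p) * I \<tau> p powr (- \<alpha>) - (\<Sum>j\<le>m. c j (\<phi> p) * v \<tau> p ^ j)\<bar> \<le> \<bar>C * v \<tau> p ^ Suc m\<bar>"
          using C[OF bspec[OF elim(1) p], of "\<phi> p"] unfolding bspec[OF elim(2) p] by linarith
      qed
    qed
    ultimately show ?thesis by (rule bigO_bound[rotated])
  qed
  show "bigO m (\<lambda>\<tau> p. W (\<phi> p) (I \<tau> p) * I \<tau> p powr (- \<alpha>) - (\<Sum>j\<le>m. c j (\<phi> p) * v \<tau> p ^ j))"
    by (rule bigO_mono[OF R]) simp
  then have "expandable m (\<lambda>\<tau> p. W (\<phi> p) (I \<tau> p) * I \<tau> p powr (- \<alpha>) - (\<Sum>j\<le>m. c j (\<phi> p) * v \<tau> p ^ j))"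
    by (rule expandable_bigO)
  moreover have "expandable m (\<lambda>\<tau> p. \<Sum>j\<le>m. c j (\<phi> p) * v \<tau> p ^ j)"
    by (intro expandable_sum expandable_mult expandable_power v(1) expandable_const c)
  ultimately have "expandable m (\<lambda>\<tau> p. (W (\<phi> p) (I \<tau> p) * I \<tau> p powr (- \<alpha>) - (\<Sum>j\<le>m. c j (\<phi> p) * v \<tau> p ^ j))
      + (\<Sum>j\<le>m. c j (\<phi> p) * v \<tau> p ^ j))" by (rule expandable_add)
  then show "expandable m (\<lambda>\<tau> p. W (\<phi> p) (I \<tau> p) * I \<tau> p powr (- \<alpha>))" by simp
  show "bigO 1 (\<lambda>\<tau> p. W (\<phi> p) (I \<tau> p) * I \<tau> p powr (- \<alpha>) - c 0 (\<phi> p))" using R[of 0] by simp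
qed

lemma bigO_1_eventually_less:
  assumes "bigO 1 (\<lambda>\<tau> p. u \<tau> p)" "0 < \<epsilon>"
  shows "\<forall>\<^sub>F \<tau> in at_top. \<forall>p\<in>P. \<bar>u \<tau> p\<bar> < \<epsilon>"
proof -
  obtain C where C: "\<forall>\<^sub>F \<tau> in at_top. \<forall>p\<in>P. \<bar>u \<tau> p\<bar> \<le> C * z \<tau> ^ 1"
    using assms(1) unfolding bigO_def by blast
  have "((\<lambda>\<tau>. C * z \<tau>) \<longlongrightarrow> 0) at_top" using tendsto_mult_right_zero[OF z_lim] by simp
  from order_tendstoD(2)[OF this assms(2)] C show ?thesis
    by eventually_elim (auto intro: le_less_trans)
qed

end

section \<open>Expansion of the rescaled system\<close>

lemma filterlim_powr_at_top:
  assumes "0 < p" shows "filterlim (\<lambda>x::real. x powr p) at_top at_top"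
proof -
  have "filterlim (\<lambda>x. exp (p * ln x)) at_top at_top"
    by (intro filterlim_compose[OF exp_at_top] filterlim_tendsto_pos_mult_at_top[OF tendsto_const assms] ln_at_top)
  moreover have "\<forall>\<^sub>F x in at_top. exp (p * ln x) = x powr p"
    using eventually_gt_at_top[of 0] by eventually_elim (simp add: powr_def)
  ultimately show ?thesis by (rule filterlim_cong[OF refl refl, THEN iffD1, rotated])
qed

locale rescaled_system = small_parameter z P
  for z :: "real \<Rightarrow> real" and P :: "(real \<times> real \<times> real) set" +
  fixes h a b q l p varkappa M N :: nat
    and \<sigma> \<mu> \<nu> vartheta d E0 :: real
    and u :: "nat \<Rightarrow> real"
    and dU \<omega> Istar time :: "real \<Rightarrow> real"
    and X Y Ires :: "real \<Rightarrow> real \<Rightarrow> real"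
    and f g F G calA calB :: "real \<Rightarrow> real \<Rightarrow> real \<Rightarrow> real \<Rightarrow> real"
    and Acoef Bcoef :: "nat \<Rightarrow> nat \<Rightarrow> nat \<Rightarrow> real \<Rightarrow> real"
    and Xcoef Ycoef :: "nat \<Rightarrow> real \<Rightarrow> real"
    and \<omega>coef :: "nat \<Rightarrow> real"
  assumes z: "z = (\<lambda>\<tau>. \<tau> powr (- (1 / real N)))" and P: "P = {- d..d} \<times> UNIV \<times> UNIV" and d: "0 < d"
    and h: "2 \<le> h" and b: "1 \<le> b" and q: "1 \<le> q" and varkappa: "1 \<le> varkappa"
    and vartheta: "0 < vartheta"
    and dU: "\<And>x. dU x = x ^ (2 * h - 1) + (\<Sum>i = 1..2 * h - 1. u i * (real i * x ^ (i - 1)))"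
    and f_asymp: "power_law_asymptotics q f
                    (\<lambda>k x y S. \<Sum>i\<le>p. \<Sum>j<l. Acoef k i j S * x ^ i * y ^ j)"
    and g_asymp: "power_law_asymptotics q g
                    (\<lambda>k x y S. \<Sum>i\<le>p. \<Sum>j\<le>l. Bcoef k i j S * x ^ i * y ^ j)"
    and coef_zero: "\<And>k i j S. p < i + j \<Longrightarrow> Acoef k i j S = 0"
                   "\<And>k i j S. p < i + j \<Longrightarrow> Bcoef k i j S = 0"
    and f_bdd: "\<And>x y t. 0 < t \<Longrightarrow> \<exists>B. \<forall>S. \<bar>f x y S t\<bar> \<le> B"
    and g_bdd: "\<And>x y t. 0 < t \<Longrightarrow> \<exists>B. \<forall>S. \<bar>g x y S t\<bar> \<le> B"
    and XY_bdd: "\<And>E. E0 < E \<Longrightarrow> \<exists>B. \<forall>\<phi>. \<bar>X \<phi> E\<bar> \<le> B" "\<And>E. E0 < E \<Longrightarrow> \<exists>B. \<forall>\<phi>. \<bar>Y \<phi> E\<bar> \<le> B"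
    and X_asymp: "energy_asymptotics_C1 h (1 / (2 * real h)) X Xcoef"
    and Y_asymp: "energy_asymptotics_C1 h (1 / 2) Y Ycoef"
    and \<omega>_asymp: "energy_asymptotics_C1 h ((real h - 1) / (2 * real h)) (\<lambda>\<phi>. \<omega>) (\<lambda>j \<phi>. \<omega>coef j)"
    and \<omega>coef0: "0 < \<omega>coef 0"
    and F: "F = (\<lambda>I \<phi> S t. f (X \<phi> I) (Y \<phi> I) S t * dU (X \<phi> I) + g (X \<phi> I) (Y \<phi> I) S t * Y \<phi> I)"
    and G: "G = (\<lambda>I \<phi> S t. \<omega> I * (f (X \<phi> I) (Y \<phi> I) S t * deriv (\<lambda>E. Y \<phi> E) I
                                  - g (X \<phi> I) (Y \<phi> I) S t * deriv (\<lambda>E. X \<phi> E) I))"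
    and Istar_lim: "filterlim Istar at_top at_top"
    and Istar: "\<forall>\<^sub>F t in at_top. \<omega> (Istar t) = vartheta * t powr (real b / real q) / real varkappa"
    and Istar': "\<forall>\<^sub>F t in at_top. deriv \<omega> (Istar t) * deriv Istar t
        = vartheta * (real b / real q) * t powr (real b / real q - 1) / real varkappa"
    and \<sigma>: "\<sigma> = real b / real q * (real l - 1 + (real p - 1) / (real h - 1)) - real a / real q"
    and \<mu>: "\<mu> = (real b / real q - \<sigma>) / 2"
    and \<nu>: "\<nu> = 1 + 2 * \<mu> + \<sigma>"
    and M: "real M = 2 * \<mu> * real q * (real h - 1)"
    and N: "real N = 2 * \<nu> * real q * (real h - 1)"
    and \<sigma>_range: "- 1 \<le> \<sigma>" "\<sigma> < real b / real q"
    and time: "time = (\<lambda>\<tau>. (\<nu> * \<tau>) powr (1 / \<nu>))"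
    and Ires: "Ires = (\<lambda>t r. Istar t * (1 + t powr (- \<mu>) * r) ^ (2 * h))"
    and calA: "calA = (\<lambda>r \<theta> \<zeta> \<tau>. \<tau> powr (real M / real N) *
                 (let t = time \<tau>; I = Ires t r; \<phi> = \<theta> + \<zeta> / real varkappa in
                  t powr (1 - \<nu> + \<mu>) *
                   (t powr (- (real a / real q)) * F I \<phi> \<zeta> t
                       / (2 * real h * Istar t * (1 + t powr (- \<mu>) * r) ^ (2 * h - 1))
                    - deriv Istar t / (2 * real h * Istar t) * (1 + t powr (- \<mu>) * r)
                    + \<mu> * t powr (- \<mu> - 1) * r)))"
    and calB: "calB = (\<lambda>r \<theta> \<zeta> \<tau>. \<tau> powr (real M / real N) *
                 (let t = time \<tau>; I = Ires t r; \<phi> = \<theta> + \<zeta> / real varkappa in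
                  t powr (1 - \<nu>) *
                   (\<omega> I - \<omega> (Istar t) + t powr (- (real a / real q)) * G I \<phi> \<zeta> t)))"
begin

section \<open>Exponents, and powers of the time variable\<close>

lemma \<mu>_pos: "0 < \<mu>" using \<sigma>_range by (simp add: \<mu>)

lemma \<nu>_eq: "\<nu> = 1 + real b / real q" by (simp add: \<nu> \<mu> field_simps)

lemma \<nu>_pos: "0 < \<nu>" unfolding \<nu>_eq by (simp add: add_pos_nonneg)

text \<open>The common denominator of the powers of t: \<open>t powr e\<close> is a constant times
  \<open>z ^ k\<close> when \<open>e * D = - k\<close>. In these units N corresponds to \<nu> and M
  to \<mu>.\<close>

definition D :: real where "D = 2 * real q * (real h - 1)"

lemma D_pos: "0 < D" using h q by (simp add: D_def)

lemma N_eq: "real N = \<nu> * D" by (simp add: N D_def)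

lemma M_eq: "real M = \<mu> * D" by (simp add: M D_def)

lemma time_powr:
  assumes "0 < \<tau>" "e * D = - real k"
  shows "time \<tau> powr e = \<nu> powr (- (real k / real N)) * z \<tau> ^ k"
proof -
  have e: "e = - (real k / D)" using assms(2) D_pos by (simp add: field_simps)
  have "time \<tau> powr e = (\<nu> * \<tau>) powr (- (real k / real N))"
    unfolding time powr_powr using D_pos \<nu>_pos by (simp add: e N_eq field_simps)
  also have "\<dots> = \<nu> powr (- (real k / real N)) * \<tau> powr (- (real k / real N))"
    using \<nu>_pos assms(1) by (simp add: powr_mult)
  also have "\<tau> powr (- (real k / real N)) = z \<tau> ^ k"
    unfolding z using assms(1) by (simp add: powr_powr flip: powr_realpow)
  finally show ?thesis .
qed

lemma time_pos: "0 < \<tau> \<Longrightarrow> 0 < time \<tau>"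
  using \<nu>_pos by (simp add: time)

lemma \<tau>_powr: "0 < \<tau> \<Longrightarrow> \<tau> powr (real M / real N) = \<nu> powr (- (real M / real N)) * time \<tau> powr \<mu>"
proof -
  assume \<tau>: "0 < \<tau>"
  have "real M / real N = \<mu> / \<nu>" using D_pos by (simp add: M_eq N_eq)
  then show ?thesis
    using \<nu>_pos \<tau> by (simp add: time powr_powr powr_mult powr_minus)
qed

lemma time_lim: "filterlim time at_top at_top"
proof -
  have "filterlim (\<lambda>\<tau>. \<nu> * \<tau>) at_top at_top"
    using \<nu>_pos by (intro filterlim_tendsto_pos_mult_at_top[OF tendsto_const]) (auto simp: filterlim_ident)
  then show ?thesis unfolding time
    by (rule filterlim_compose[OF filterlim_powr_at_top, rotated]) (use \<nu>_pos in simp)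
qed

lemma eventually_time: "eventually Q at_top \<Longrightarrow> \<forall>\<^sub>F \<tau> in at_top. Q (time \<tau>)"
  using time_lim by (simp add: filterlim_iff)

lemma bigO_time:
  assumes "e * D = - real k" shows "bigO k (\<lambda>\<tau> p. time \<tau> powr e)"
proof (rule bigO_cong)
  show "bigO k (\<lambda>\<tau> p. \<nu> powr (- (real k / real N)) * z \<tau> ^ k)"
    by (intro bigO_cmult bigO_zpow)
  show "\<forall>\<^sub>F \<tau> in at_top. \<forall>p\<in>P. \<nu> powr (- (real k / real N)) * z \<tau> ^ k = time \<tau> powr e"
    using eventually_gt_at_top[of 0] by eventually_elim (simp add: time_powr[OF _ assms])
qed

lemma expandable_time:
  assumes "e * D = - real k" shows "expandable m (\<lambda>\<tau> p. time \<tau> powr e)"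
proof (rule expandable_cong)
  show "expandable m (\<lambda>\<tau> p. \<nu> powr (- (real k / real N)) * z \<tau> ^ k)"
    by (intro expandable_mult expandable_const' expandable_power expandable_z)
  show "\<forall>\<^sub>F \<tau> in at_top. \<forall>p\<in>P. \<nu> powr (- (real k / real N)) * z \<tau> ^ k = time \<tau> powr e"
    using eventually_gt_at_top[of 0] by eventually_elim (simp add: time_powr[OF _ assms])
qed

text \<open>The small quantity in which functions of the resonant energy \<open>Istar\<close>
  expand.\<close>

definition V :: "real \<Rightarrow> real" where "V \<tau> = Istar (time \<tau>) powr (- (1 / (2 * real h)))"

text \<open>The power of t with the same rate of decay as \<open>V\<close>: the resonance condition
  gives \<open>\<omega> (Istar t)\<close> the order of \<open>t powr (b / q)\<close>, while \<omega>
  grows like the power \<open>h - 1\<close> of \<open>1 / V\<close>. It is an exact multiple of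
  \<open>z ^ (2 * b)\<close>.\<close>

definition Z :: "real \<Rightarrow> real" where "Z \<tau> = time \<tau> powr (- (real b / (real q * (real h - 1))))"

text \<open>The relative displacement of the amplitude: \<open>1 + y\<close> is the root of order
  \<open>2 * h\<close> of the quotient of the energy by the resonant energy, once
  \<open>1 + y\<close> is positive.\<close>

definition y :: "real \<Rightarrow> real \<times> real \<times> real \<Rightarrow> real" where "y \<tau> w = time \<tau> powr (- \<mu>) * fst w"

section \<open>The resonant energy\<close>

lemma Z_exponent: "- (real b / (real q * (real h - 1))) * D = - real (2 * b)"
proof -
  define c where "c = real q * (real h - 1)"
  have "c \<noteq> 0" using h q by (simp add: c_def)
  moreover have "D = 2 * c" by (simp add: D_def c_def)
  ultimately show ?thesis unfolding c_def[symmetric] by simp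
qed

lemma Z_pos: "0 < \<tau> \<Longrightarrow> 0 < Z \<tau>" using time_pos[of \<tau>] by (simp add: Z_def)

lemma Z_power: "0 < \<tau> \<Longrightarrow> Z \<tau> ^ k = time \<tau> powr (- (real b / (real q * (real h - 1))) * real k)"
  using time_pos[of \<tau>] by (simp add: Z_def powr_powr flip: powr_realpow)

lemma Z_power_h: "0 < \<tau> \<Longrightarrow> Z \<tau> ^ (h - 1) = time \<tau> powr (- (real b / real q))"
  using h by (simp add: Z_power of_nat_diff)

lemma Z_eq: "0 < \<tau> \<Longrightarrow> Z \<tau> = \<nu> powr (- (real (2 * b) / real N)) * z \<tau> ^ (2 * b)"
  unfolding Z_def by (rule time_powr[OF _ Z_exponent])

lemma Istar_time_large: "\<forall>\<^sub>F \<tau> in at_top. K \<le> Istar (time \<tau>)"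
  using eventually_time[OF filterlim_at_top[THEN iffD1, OF Istar_lim, rule_format]] by simp

lemma V_lim: "(V \<longlongrightarrow> 0) at_top"
  unfolding V_def using h
  by (intro tendsto_neg_powr filterlim_compose[OF Istar_lim time_lim]) simp

lemma V_pos: "\<forall>\<^sub>F \<tau> in at_top. 0 < V \<tau>"
  using Istar_time_large[of 1] by eventually_elim (simp add: V_def)

lemma \<omega>_scaled: "((\<lambda>\<tau>. \<omega> (Istar (time \<tau>)) * V \<tau> ^ (h - 1)) \<longlongrightarrow> \<omega>coef 0) at_top"
proof -
  have EA: "energy_asymptotics h ((real h - 1) / (2 * real h)) (\<lambda>\<phi>. \<omega>) (\<lambda>j \<phi>. \<omega>coef j)"
    using \<omega>_asymp unfolding energy_asymptotics_C1_def by blast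
  obtain C E' where E': "0 < E'" and C: "\<And>E. E' \<le> E \<Longrightarrow>
    \<bar>\<omega> E * E powr (- ((real h - 1) / (2 * real h))) - (\<Sum>j\<le>0. \<omega>coef j * (E powr (- (1 / (2 * real h)))) ^ j)\<bar>
      \<le> C * (E powr (- (1 / (2 * real h)))) ^ Suc 0"
    using energy_asymptotics_scaled[OF EA, of 0] h by auto
  have "\<forall>\<^sub>F \<tau> in at_top. norm (\<omega> (Istar (time \<tau>)) * V \<tau> ^ (h - 1) - \<omega>coef 0) \<le> C * V \<tau>"
    using Istar_time_large[of E']
  proof eventually_elim
    case (elim \<tau>)
    have "V \<tau> ^ (h - 1) = Istar (time \<tau>) powr (- ((real h - 1) / (2 * real h)))"
      unfolding V_def using elim E' h by (simp add: powr_powr of_nat_diff flip: powr_realpow)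
    then show ?case using C[OF elim] by (simp add: V_def)
  qed
  moreover have "((\<lambda>\<tau>. C * V \<tau>) \<longlongrightarrow> 0) at_top" using tendsto_mult_right_zero[OF V_lim] by simp
  ultimately have "((\<lambda>\<tau>. \<omega> (Istar (time \<tau>)) * V \<tau> ^ (h - 1) - \<omega>coef 0) \<longlongrightarrow> 0) at_top"
    by (rule Lim_null_comparison)
  then show ?thesis using LIM_zero_iff by blast
qed

text \<open>\<open>V\<close> with its leading power removed. Unlike \<open>V\<close> it stays away
  from zero, so the rules for roots and reciprocals apply to it.\<close>

definition Q :: "real \<Rightarrow> real" where "Q \<tau> = V \<tau> / Z \<tau>"

definition Q0 :: real where "Q0 = root (h - 1) (real varkappa / vartheta * \<omega>coef 0)"

lemma Q0_pos: "0 < Q0" using h varkappa vartheta \<omega>coef0 by (simp add: Q0_def)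

lemma Q_power: "\<forall>\<^sub>F \<tau> in at_top. Q \<tau> ^ (h - 1) = real varkappa / vartheta * (\<omega> (Istar (time \<tau>)) * V \<tau> ^ (h - 1))"
  using eventually_time[OF Istar] eventually_gt_at_top[of 0]
proof eventually_elim
  case (elim \<tau>)
  have t: "0 < time \<tau>" using time_pos elim by simp
  have "real varkappa / vartheta * \<omega> (Istar (time \<tau>)) = time \<tau> powr (real b / real q)"
    using elim(1) vartheta varkappa by simp
  also have "\<dots> = 1 / Z \<tau> ^ (h - 1)" unfolding Z_power_h[OF elim(2)] using t by (simp add: powr_minus_divide)
  finally have e: "real varkappa / vartheta * \<omega> (Istar (time \<tau>)) = 1 / Z \<tau> ^ (h - 1)" .
  have "Q \<tau> ^ (h - 1) = 1 / Z \<tau> ^ (h - 1) * V \<tau> ^ (h - 1)" by (simp add: Q_def power_divide)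
  then show ?case unfolding e[symmetric] by (simp only: mult.assoc)
qed

lemma Q_lim: "(Q \<longlongrightarrow> Q0) at_top"
proof -
  have "((\<lambda>\<tau>. root (h - 1) (real varkappa / vartheta * (\<omega> (Istar (time \<tau>)) * V \<tau> ^ (h - 1)))) \<longlongrightarrow> Q0) at_top"
    unfolding Q0_def by (intro tendsto_intros \<omega>_scaled)
  moreover have "\<forall>\<^sub>F \<tau> in at_top. root (h - 1) (real varkappa / vartheta * (\<omega> (Istar (time \<tau>)) * V \<tau> ^ (h - 1))) = Q \<tau>"
    using Q_power V_pos eventually_gt_at_top[of 0]
  proof eventually_elim
    case (elim \<tau>)
    then have "0 \<le> Q \<tau>" using Z_pos by (simp add: Q_def less_imp_le)
    then show ?case unfolding elim(1)[symmetric] using h by (simp add: real_root_power_cancel)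
  qed
  ultimately show ?thesis by (rule tendsto_cong[THEN iffD1, rotated])
qed

lemma Q_bounds: "\<forall>\<^sub>F \<tau> in at_top. Q0 / 2 \<le> Q \<tau> \<and> Q \<tau> \<le> 2 * Q0"
  using order_tendstoD(1)[OF Q_lim, of "Q0 / 2"] order_tendstoD(2)[OF Q_lim, of "2 * Q0"] Q0_pos
  by (auto elim: eventually_elim2)

lemma V_eq: "\<forall>\<^sub>F \<tau> in at_top. V \<tau> = Z \<tau> * Q \<tau>"
  using eventually_gt_at_top[of 0] by eventually_elim (use Z_pos in \<open>fastforce simp: Q_def\<close>)

lemma bigO_Q: "bigO 0 (\<lambda>\<tau> p. Q \<tau>)"
proof -
  have "\<forall>\<^sub>F \<tau> in at_top. \<forall>p\<in>P. \<bar>Q \<tau>\<bar> \<le> (2 * Q0) * z \<tau> ^ 0"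
    using Q_bounds by eventually_elim (use Q0_pos in auto)
  then show ?thesis unfolding bigO_def by blast
qed

lemma bigO_Z: "bigO (2 * b) (\<lambda>\<tau> p. Z \<tau>)"
  unfolding Z_def by (rule bigO_time[OF Z_exponent])

lemma bigO_V: "bigO 1 (\<lambda>\<tau> p. V \<tau>)"
proof (rule bigO_cong)
  show "bigO 1 (\<lambda>\<tau> p. Z \<tau> * Q \<tau>)"
    using bigO_mono[OF bigO_mult[OF bigO_Z bigO_Q]] b by simp
  show "\<forall>\<^sub>F \<tau> in at_top. \<forall>p\<in>P. Z \<tau> * Q \<tau> = V \<tau>" using V_eq by eventually_elim simp
qed

text \<open>\<open>Z\<close> contains the factor \<open>z ^ (2 * b)\<close> with
  \<open>b \<ge> 1\<close>, so at least one order is gained in passing from \<open>Q\<close> to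
  \<open>V\<close>.\<close>

lemma expandable_V_Suc:
  assumes "expandable m (\<lambda>\<tau> p. Q \<tau>)" shows "expandable (Suc m) (\<lambda>\<tau> p. V \<tau>)"
proof (rule expandable_cong)
  have "expandable m (\<lambda>\<tau> p. \<nu> powr (- (real (2 * b) / real N)) * (z \<tau> ^ (2 * b - 1) * Q \<tau>))"
    by (intro expandable_mult expandable_const' expandable_power expandable_z assms)
  then show "expandable (Suc m) (\<lambda>\<tau> p. z \<tau> * (\<nu> powr (- (real (2 * b) / real N)) * (z \<tau> ^ (2 * b - 1) * Q \<tau>)))"
    by (rule expandable_mult_z)
  show "\<forall>\<^sub>F \<tau> in at_top. \<forall>p\<in>P. z \<tau> * (\<nu> powr (- (real (2 * b) / real N)) * (z \<tau> ^ (2 * b - 1) * Q \<tau>)) = V \<tau>"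
    using V_eq eventually_gt_at_top[of 0]
  proof eventually_elim
    case (elim \<tau>)
    have "z \<tau> ^ (2 * b) = z \<tau> * z \<tau> ^ (2 * b - 1)" using b by (cases "2 * b") auto
    then show ?case unfolding elim(1) Z_eq[OF elim(2)] by simp
  qed
qed

text \<open>The equation for \<open>Istar\<close> expresses \<open>Q ^ (h - 1)\<close> through \<open>V = Z * Q\<close>, which is of one order
  smaller, so that the expansion of \<open>Q\<close> can be bootstrapped.\<close>

lemma expandable_Q: "expandable m (\<lambda>\<tau> p. Q \<tau>)"
proof (induction m)
  case 0
  show ?case using bigO_Q by (rule expandable_bigO)
next
  case (Suc m)
  have EA: "energy_asymptotics h ((real h - 1) / (2 * real h)) (\<lambda>\<phi>. \<omega>) (\<lambda>j \<phi>. \<omega>coef j)"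
    using \<omega>_asymp unfolding energy_asymptotics_C1_def by blast
  have "expandable (Suc m) (\<lambda>\<tau> p. \<omega> (Istar (time \<tau>)) * Istar (time \<tau>) powr (- ((real h - 1) / (2 * real h))))"
    by (rule expandable_energy(1)[OF EA, where I = "\<lambda>\<tau> p. Istar (time \<tau>)" and v = "\<lambda>\<tau> p. V \<tau>"])
      (use h Istar_time_large expandable_V_Suc[OF Suc] bigO_V in \<open>auto simp: V_def intro: eventually_mono\<close>)
  then have "expandable (Suc m) (\<lambda>\<tau> p. real varkappa / vartheta *
      (\<omega> (Istar (time \<tau>)) * Istar (time \<tau>) powr (- ((real h - 1) / (2 * real h)))))"
    by (intro expandable_mult[OF expandable_const'])
  then have "expandable (Suc m) (\<lambda>\<tau> p. Q \<tau> ^ (h - 1))"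
  proof (rule expandable_cong[rotated])
    show "\<forall>\<^sub>F \<tau> in at_top. \<forall>p\<in>P. real varkappa / vartheta *
      (\<omega> (Istar (time \<tau>)) * Istar (time \<tau>) powr (- ((real h - 1) / (2 * real h)))) = Q \<tau> ^ (h - 1)"
      using Q_power Istar_time_large[of 1]
    proof eventually_elim
      case (elim \<tau>)
      have "V \<tau> ^ (h - 1) = Istar (time \<tau>) powr (- ((real h - 1) / (2 * real h)))"
        unfolding V_def using elim h by (simp add: powr_powr of_nat_diff flip: powr_realpow)
      then show ?case unfolding elim(1) by simp
    qed
  qed
  then show ?case
  proof (rule expandable_root)
    show "\<forall>\<^sub>F \<tau> in at_top. \<forall>p\<in>P. Q0 / 2 \<le> Q \<tau>" using Q_bounds by eventually_elim simp
  qed (use h Q0_pos bigO_Q in auto)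
qed

lemma expandable_V: "expandable m (\<lambda>\<tau> p. V \<tau>)"
  by (rule expandable_mono[OF expandable_V_Suc[OF expandable_Q, of m]]) simp

lemma expandable_y: "expandable m y"
proof -
  have "bdd_on fst" by (rule bdd_onI[of _ d]) (auto simp: P)
  moreover have "expandable m (\<lambda>\<tau> p. time \<tau> powr (- \<mu>))"
    by (rule expandable_time[of _ M]) (simp add: M_eq)
  ultimately show ?thesis unfolding y_def[abs_def]
    by (intro expandable_mult expandable_const)
qed

lemma bigO_y: "bigO 1 y"
proof -
  have "0 < M" using M_eq \<mu>_pos D_pos by (metis of_nat_0_less_iff mult_pos_pos)
  moreover have "bdd_on fst" by (rule bdd_onI[of _ d]) (auto simp: P)
  moreover have "bigO M (\<lambda>\<tau> p. time \<tau> powr (- \<mu>))"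
    by (rule bigO_time) (simp add: M_eq)
  ultimately have "bigO (M + 0) y" unfolding y_def[abs_def]
    by (intro bigO_mult bigO_bdd)
  then show ?thesis using \<open>0 < M\<close> by (auto intro: bigO_mono)
qed

lemma y_small: "\<forall>\<^sub>F \<tau> in at_top. \<forall>p\<in>P. 1 / 2 \<le> 1 + y \<tau> p \<and> 1 + y \<tau> p \<le> 2"
  using bigO_1_eventually_less[OF bigO_y, of "1 / 2"]
  by (auto elim!: eventually_mono simp: abs_less_iff)

lemma expandable_inverse_y: "expandable m (\<lambda>\<tau> p. 1 / (1 + y \<tau> p))"
  by (rule expandable_inverse[where \<delta> = "1 / 2"])
    (use y_small in \<open>auto intro: expandable_add expandable_y elim!: eventually_mono\<close>)

text \<open>Factored form of \<open>energy \<tau> w powr (- (1 / (2 * real h)))\<close>, which shows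
  at once that it expands; the two agree for large \<tau> by \<open>regular\<close>.\<close>

definition vI :: "real \<Rightarrow> real \<times> real \<times> real \<Rightarrow> real" where "vI \<tau> w = V \<tau> * (1 / (1 + y \<tau> w))"

definition energy :: "real \<Rightarrow> real \<times> real \<times> real \<Rightarrow> real" where "energy \<tau> w = Ires (time \<tau>) (fst w)"

definition angle :: "real \<times> real \<times> real \<Rightarrow> real" where
  "angle w = fst (snd w) + snd (snd w) / real varkappa"

definition phase :: "real \<times> real \<times> real \<Rightarrow> real" where "phase w = snd (snd w)"

lemma energy_eq: "energy \<tau> w = Istar (time \<tau>) * (1 + y \<tau> w) ^ (2 * h)"
  unfolding energy_def y_def by (simp add: Ires)

lemma expandable_vI: "expandable m vI"
  unfolding vI_def[abs_def] by (intro expandable_mult expandable_V expandable_inverse_y)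

lemma bigO_vI: "bigO 1 vI"
  unfolding vI_def[abs_def]
  using bigO_mult[OF bigO_V expandable_imp_bigO[OF expandable_inverse_y]] by simp

text \<open>Collects the positivity facts and power laws valid for all large \<tau>, so that later
  identities between expansions can be checked pointwise by algebra.\<close>

lemma regular: "\<forall>\<^sub>F \<tau> in at_top. 0 < \<tau> \<and> 0 < time \<tau> \<and> 0 < Z \<tau> \<and> 0 < V \<tau> \<and> 0 < Istar (time \<tau>) \<and> V \<tau> = Z \<tau> * Q \<tau> \<and>
    Istar (time \<tau>) = 1 / V \<tau> ^ (2 * h) \<and>
    (\<forall>p\<in>P. 0 < 1 + y \<tau> p \<and> 0 < vI \<tau> p \<and> 0 < energy \<tau> p \<and> vI \<tau> p * (1 + y \<tau> p) = V \<tau> \<and>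
      (\<forall>k. energy \<tau> p powr (- (real k / (2 * real h))) = vI \<tau> p ^ k \<and>
           energy \<tau> p powr (real k / (2 * real h)) = 1 / vI \<tau> p ^ k))"
  using eventually_gt_at_top[of 0] V_pos V_eq y_small Istar_time_large[of 1]
proof eventually_elim
  case (elim \<tau>)
  have V: "V \<tau> ^ k = Istar (time \<tau>) powr (- (real k / (2 * real h)))" for k
    unfolding V_def using elim by (simp add: powr_powr flip: powr_realpow)
  have "Istar (time \<tau>) = 1 / V \<tau> ^ (2 * h)"
    unfolding V using elim h by (simp add: powr_minus_divide)
  moreover have "0 < 1 + y \<tau> p \<and> 0 < vI \<tau> p \<and> 0 < energy \<tau> p \<and> vI \<tau> p * (1 + y \<tau> p) = V \<tau> \<and>
      (\<forall>k. energy \<tau> p powr (- (real k / (2 * real h))) = vI \<tau> p ^ k \<and>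
           energy \<tau> p powr (real k / (2 * real h)) = 1 / vI \<tau> p ^ k)" if p: "p \<in> P" for p
  proof -
    have y: "0 < 1 + y \<tau> p" using elim(4) p by fastforce
    have vI: "0 < vI \<tau> p" using y elim(2) by (simp add: vI_def)
    have E: "0 < energy \<tau> p" using y elim(5) by (simp add: energy_eq)
    have yk: "((1 + y \<tau> p) ^ (2 * h)) powr (- (real k / (2 * real h))) = 1 / (1 + y \<tau> p) ^ k" for k
    proof -
      have "((1 + y \<tau> p) ^ (2 * h)) powr (- (real k / (2 * real h)))
          = ((1 + y \<tau> p) powr (real (2 * h))) powr (- (real k / (2 * real h)))"
        using powr_realpow[OF y, of "2 * h"] by simp
      also have "\<dots> = (1 + y \<tau> p) powr (- real k)" using h by (simp add: powr_powr)
      also have "\<dots> = 1 / (1 + y \<tau> p) ^ k" using y by (simp add: powr_minus_divide powr_realpow)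
      finally show ?thesis .
    qed
    have k: "energy \<tau> p powr (- (real k / (2 * real h))) = vI \<tau> p ^ k" for k
    proof -
      have "energy \<tau> p powr (- (real k / (2 * real h)))
          = Istar (time \<tau>) powr (- (real k / (2 * real h))) * ((1 + y \<tau> p) ^ (2 * h)) powr (- (real k / (2 * real h)))"
        unfolding energy_eq using elim(5) y by (simp add: powr_mult)
      then show ?thesis unfolding yk V[symmetric] by (simp add: vI_def power_divide power_mult_distrib)
    qed
    have "energy \<tau> p powr (real k / (2 * real h)) = 1 / vI \<tau> p ^ k" for k
      unfolding k[symmetric] using E by (simp add: powr_minus_divide)
    with y vI E k show ?thesis by (simp add: vI_def)
  qed
  ultimately show ?case using elim time_pos Z_pos by simp
qed

lemma energy_powr_neg:
  assumes "e = - (real k / (2 * real h))"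
  shows "\<forall>\<^sub>F \<tau> in at_top. \<forall>p\<in>P. energy \<tau> p powr e = vI \<tau> p ^ k"
  unfolding assms using regular by (rule eventually_mono) blast

lemma energy_powr_pos:
  assumes "e = real k / (2 * real h)"
  shows "\<forall>\<^sub>F \<tau> in at_top. \<forall>p\<in>P. energy \<tau> p powr e = 1 / vI \<tau> p ^ k"
  unfolding assms using regular by (rule eventually_mono) blast

lemma energy_large: "\<forall>\<^sub>F \<tau> in at_top. \<forall>p\<in>P. K \<le> energy \<tau> p"
  using Istar_time_large[of "max 0 K * 2 ^ (2 * h)"] y_small
proof eventually_elim
  case (elim \<tau>)
  show ?case
  proof
    fix p assume p: "p \<in> P"
    have "(1 / 2) ^ (2 * h) \<le> (1 + y \<tau> p) ^ (2 * h)" using elim(2) p by (intro power_mono) auto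
    then have "(max 0 K * 2 ^ (2 * h)) * (1 / 2) ^ (2 * h) \<le> Istar (time \<tau>) * (1 + y \<tau> p) ^ (2 * h)"
      using elim(1) by (intro mult_mono) (auto intro: order_trans[rotated])
    moreover have "(max 0 K * 2 ^ (2 * h)) * (1 / 2) ^ (2 * h) = max 0 K" by (simp add: power_divide)
    ultimately show "K \<le> energy \<tau> p" unfolding energy_eq by simp
  qed
qed

lemma expandable_of_energy:
  assumes EA: "energy_asymptotics h \<alpha> W c" and c: "\<And>j. \<exists>B. \<forall>\<phi>. \<bar>c j \<phi>\<bar> \<le> B"
  shows "expandable m (\<lambda>\<tau> p. W (angle p) (energy \<tau> p) * energy \<tau> p powr (- \<alpha>))"
    and "bigO m (\<lambda>\<tau> p. W (angle p) (energy \<tau> p) * energy \<tau> p powr (- \<alpha>) - (\<Sum>j\<le>m. c j (angle p) * vI \<tau> p ^ j))"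
proof -
  have 1: "\<forall>\<^sub>F \<tau> in at_top. \<forall>p\<in>P. energy \<tau> p powr (- (1 / (2 * real h))) = vI \<tau> p"
    using energy_powr_neg[of "- (1 / (2 * real h))" 1] by simp
  have 2: "bdd_on (\<lambda>p. c j (angle p))" for j using c[of j] unfolding bdd_on_def by blast
  have 3: "0 < h" using h by simp
  note * = expandable_energy[OF EA 3 2 energy_large expandable_vI bigO_vI 1]
  show "expandable m (\<lambda>\<tau> p. W (angle p) (energy \<tau> p) * energy \<tau> p powr (- \<alpha>))" by (rule *(1))
  show "bigO m (\<lambda>\<tau> p. W (angle p) (energy \<tau> p) * energy \<tau> p powr (- \<alpha>) - (\<Sum>j\<le>m. c j (angle p) * vI \<tau> p ^ j))"
    by (rule *(2))
qed

lemma XYcoef_bounded: "\<exists>B. \<forall>\<phi>. \<bar>Xcoef j \<phi>\<bar> \<le> B" "\<exists>B. \<forall>\<phi>. \<bar>Ycoef j \<phi>\<bar> \<le> B"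
  using energy_coeffs_bounded[of h _ X Xcoef E0] energy_coeffs_bounded[of h _ Y Ycoef E0]
    X_asymp Y_asymp XY_bdd h unfolding energy_asymptotics_C1_def by auto

lemma scaled_bounded: "\<exists>B. \<forall>\<phi>. \<bar>c j \<phi>\<bar> \<le> B \<Longrightarrow> \<exists>B. \<forall>\<phi>. \<bar>(\<gamma>::real) * c j \<phi>\<bar> \<le> B"
  by (metis abs_mult abs_ge_zero mult_left_mono)

text \<open>This and the next lemmas fix the weights: X, Y and \<omega> grow at most like the powers
  1, \<open>h\<close>, \<open>h - 1\<close> of \<open>1 / vI\<close>, and the E-derivatives of X and
  Y carry the powers \<open>2 * h - 1\<close> and \<open>h\<close> of \<open>vI\<close>.\<close>

lemma expandable_X: "expandable m (\<lambda>\<tau> p. X (angle p) (energy \<tau> p) * vI \<tau> p)"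
proof (rule expandable_cong)
  show "expandable m (\<lambda>\<tau> p. X (angle p) (energy \<tau> p) * energy \<tau> p powr (- (1 / (2 * real h))))"
    by (rule expandable_of_energy(1)[where c = Xcoef, OF _ XYcoef_bounded(1)]) (use X_asymp in \<open>simp add: energy_asymptotics_C1_def\<close>)
  show "\<forall>\<^sub>F \<tau> in at_top. \<forall>p\<in>P. X (angle p) (energy \<tau> p) * energy \<tau> p powr (- (1 / (2 * real h))) = X (angle p) (energy \<tau> p) * vI \<tau> p"
    using energy_powr_neg[of "- (1 / (2 * real h))" 1, simplified] by eventually_elim simp
qed

lemma expandable_Y: "expandable m (\<lambda>\<tau> p. Y (angle p) (energy \<tau> p) * vI \<tau> p ^ h)"
proof (rule expandable_cong)
  show "expandable m (\<lambda>\<tau> p. Y (angle p) (energy \<tau> p) * energy \<tau> p powr (- (1 / 2)))"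
    by (rule expandable_of_energy(1)[where c = Ycoef, OF _ XYcoef_bounded(2)]) (use Y_asymp in \<open>simp add: energy_asymptotics_C1_def\<close>)
  have "- (1 / 2) = - (real h / (2 * real h))" using h by simp
  from energy_powr_neg[OF this] show "\<forall>\<^sub>F \<tau> in at_top. \<forall>p\<in>P. Y (angle p) (energy \<tau> p) * energy \<tau> p powr (- (1 / 2)) = Y (angle p) (energy \<tau> p) * vI \<tau> p ^ h"
    by eventually_elim simp
qed

lemma expandable_XE: "expandable m (\<lambda>\<tau> p. deriv (X (angle p)) (energy \<tau> p) / vI \<tau> p ^ (2 * h - 1))"
proof (rule expandable_cong)
  show "expandable m (\<lambda>\<tau> p. deriv (X (angle p)) (energy \<tau> p) * energy \<tau> p powr (- (1 / (2 * real h) - 1)))"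
    by (rule expandable_of_energy(1)[where W = "\<lambda>\<phi> E. deriv (X \<phi>) E"])
      (use X_asymp scaled_bounded[OF XYcoef_bounded(1)] in \<open>auto simp: energy_asymptotics_C1_def\<close>)
  have "- (1 / (2 * real h) - 1) = real (2 * h - 1) / (2 * real h)" using h by (simp add: of_nat_diff field_simps)
  from energy_powr_pos[OF this] show "\<forall>\<^sub>F \<tau> in at_top. \<forall>p\<in>P. deriv (X (angle p)) (energy \<tau> p) * energy \<tau> p powr (- (1 / (2 * real h) - 1))
      = deriv (X (angle p)) (energy \<tau> p) / vI \<tau> p ^ (2 * h - 1)"
    by eventually_elim simp
qed

lemma expandable_YE: "expandable m (\<lambda>\<tau> p. deriv (Y (angle p)) (energy \<tau> p) / vI \<tau> p ^ h)"
proof (rule expandable_cong)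
  show "expandable m (\<lambda>\<tau> p. deriv (Y (angle p)) (energy \<tau> p) * energy \<tau> p powr (- (1 / 2 - 1)))"
    by (rule expandable_of_energy(1)[where W = "\<lambda>\<phi> E. deriv (Y \<phi>) E"])
      (use Y_asymp scaled_bounded[OF XYcoef_bounded(2)] in \<open>auto simp: energy_asymptotics_C1_def\<close>)
  have "- (1 / 2 - 1) = real h / (2 * real h)" using h by simp
  from energy_powr_pos[OF this] show "\<forall>\<^sub>F \<tau> in at_top. \<forall>p\<in>P. deriv (Y (angle p)) (energy \<tau> p) * energy \<tau> p powr (- (1 / 2 - 1))
      = deriv (Y (angle p)) (energy \<tau> p) / vI \<tau> p ^ h"
    by eventually_elim simp
qed

lemma \<omega>_exponent: "- ((real h - 1) / (2 * real h)) = - (real (h - 1) / (2 * real h))"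
  using h by (simp add: of_nat_diff)

lemma expandable_\<omega>: "expandable m (\<lambda>\<tau> p. \<omega> (energy \<tau> p) * vI \<tau> p ^ (h - 1))"
  and bigO_\<omega>: "bigO m (\<lambda>\<tau> p. \<omega> (energy \<tau> p) * vI \<tau> p ^ (h - 1) - (\<Sum>j\<le>m. \<omega>coef j * vI \<tau> p ^ j))"
proof -
  have EA: "energy_asymptotics h ((real h - 1) / (2 * real h)) (\<lambda>\<phi>. \<omega>) (\<lambda>j \<phi>. \<omega>coef j)"
    using \<omega>_asymp unfolding energy_asymptotics_C1_def by blast
  note * = expandable_of_energy[OF EA, of m]
  show "expandable m (\<lambda>\<tau> p. \<omega> (energy \<tau> p) * vI \<tau> p ^ (h - 1))"
  proof (rule expandable_cong[OF _ *(1)])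
    show "\<forall>\<^sub>F \<tau> in at_top. \<forall>p\<in>P. \<omega> (energy \<tau> p) * energy \<tau> p powr (- ((real h - 1) / (2 * real h))) = \<omega> (energy \<tau> p) * vI \<tau> p ^ (h - 1)"
      using energy_powr_neg[OF \<omega>_exponent] by eventually_elim simp
  qed auto
  show "bigO m (\<lambda>\<tau> p. \<omega> (energy \<tau> p) * vI \<tau> p ^ (h - 1) - (\<Sum>j\<le>m. \<omega>coef j * vI \<tau> p ^ j))"
  proof (rule bigO_cong[OF _ *(2)])
    show "\<forall>\<^sub>F \<tau> in at_top. \<forall>p\<in>P. \<omega> (energy \<tau> p) * energy \<tau> p powr (- ((real h - 1) / (2 * real h))) - (\<Sum>j\<le>m. \<omega>coef j * vI \<tau> p ^ j) = \<omega> (energy \<tau> p) * vI \<tau> p ^ (h - 1) - (\<Sum>j\<le>m. \<omega>coef j * vI \<tau> p ^ j)"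
      using energy_powr_neg[OF \<omega>_exponent] by eventually_elim simp
  qed auto
qed

end

lemma power_split: "n = i + j \<Longrightarrow> x ^ n = x ^ i * x ^ j" for x :: "'a::monoid_mult"
  by (simp add: power_add)

context rescaled_system
begin

text \<open>Both this ratio and its inverse expand, so powers of \<open>vI\<close> may be traded for
  powers of \<open>Z\<close>, that is, of t.\<close>

definition zw :: "real \<Rightarrow> real \<times> real \<times> real \<Rightarrow> real" where "zw \<tau> w = Z \<tau> / vI \<tau> w"

section \<open>Weights of the perturbation and of the right-hand sides\<close>

lemma expandable_zw: "expandable m zw"
proof (rule expandable_cong)
  have "expandable m (\<lambda>\<tau> p. 1 / Q \<tau>)"
    by (rule expandable_inverse[where \<delta> = "Q0 / 2"])
      (use Q_bounds Q0_pos expandable_Q in \<open>auto elim!: eventually_mono\<close>)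
  then show "expandable m (\<lambda>\<tau> p. 1 / Q \<tau> * (1 + y \<tau> p))"
    by (intro expandable_mult expandable_add expandable_y expandable_const')
  show "\<forall>\<^sub>F \<tau> in at_top. \<forall>p\<in>P. 1 / Q \<tau> * (1 + y \<tau> p) = zw \<tau> p"
    using regular
  proof eventually_elim
    case (elim \<tau>)
    have "1 / Q \<tau> * (1 + y \<tau> p) = zw \<tau> p" if "p \<in> P" for p
    proof -
      have *: "0 < 1 + y \<tau> p" "0 < Z \<tau>" "V \<tau> = Z \<tau> * Q \<tau>" "0 < V \<tau>" using elim that by blast+
      then have "0 < Q \<tau>" by (simp add: zero_less_mult_iff)
      then show ?thesis unfolding zw_def vI_def using * by (simp add: field_simps)
    qed
    then show ?case by blast
  qed
qed

lemma expandable_zw_inverse: "expandable m (\<lambda>\<tau> p. vI \<tau> p / Z \<tau>)"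
proof (rule expandable_cong)
  show "expandable m (\<lambda>\<tau> p. Q \<tau> * (1 / (1 + y \<tau> p)))"
    by (intro expandable_mult expandable_inverse_y expandable_Q)
  show "\<forall>\<^sub>F \<tau> in at_top. \<forall>p\<in>P. Q \<tau> * (1 / (1 + y \<tau> p)) = vI \<tau> p / Z \<tau>"
    by (simp add: vI_def Q_def)
qed

text \<open>A monomial in x and y with exponents i, j has weight \<open>i + h * j\<close>, and
  \<open>deg\<close> leaves a nonnegative power of \<open>vI\<close> over. The error of the power
  law carries a polynomial weight of degree \<open>d\<close> independent of its order; it costs a
  fixed number of powers of z, made up for by taking the law to a higher order.\<close>

lemma expandable_perturbation:
  fixes \<Phi> :: "real \<Rightarrow> real \<Rightarrow> real \<Rightarrow> real \<Rightarrow> real"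
  assumes asymp: "power_law_asymptotics q \<Phi> (\<lambda>k x y S. \<Sum>i\<le>p. \<Sum>j<l'. C k i j S * x ^ i * y ^ j)"
    and zero: "\<And>k i j S. p < i + j \<Longrightarrow> C k i j S = 0"
    and bdd: "\<And>x y t. 0 < t \<Longrightarrow> \<exists>B. \<forall>S. \<bar>\<Phi> x y S t\<bar> \<le> B"
    and deg: "\<And>i j. i + j \<le> p \<Longrightarrow> j < l' \<Longrightarrow> i + h * j + \<kappa> \<le> e"
  shows "expandable m (\<lambda>\<tau> w. \<Phi> (X (angle w) (energy \<tau> w)) (Y (angle w) (energy \<tau> w)) (phase w) (time \<tau>)
           * vI \<tau> w ^ e / vI \<tau> w ^ \<kappa>)"
proof -
  define x where "x \<tau> w = X (angle w) (energy \<tau> w)" for \<tau> w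
  define y' where "y' \<tau> w = Y (angle w) (energy \<tau> w)" for \<tau> w
  have x: "expandable m (\<lambda>\<tau> w. x \<tau> w * vI \<tau> w)" and y': "expandable m (\<lambda>\<tau> w. y' \<tau> w * vI \<tau> w ^ h)" for m
    unfolding x_def y'_def by (rule expandable_X expandable_Y)+
  have C_bdd: "bdd_on (\<lambda>w. C k i j (phase w))" if "i \<le> p" "j < l'" for k i j
    using power_law_coeffs_bounded[OF asymp bdd that, of k] unfolding bdd_on_def by blast
  obtain d :: nat where "\<forall>n. \<exists>K t'. 0 < t' \<and> (\<forall>t\<ge>t'. \<forall>x y S.
        \<bar>\<Phi> x y S t - (\<Sum>k\<le>n. t powr (- (real k / real q)) * (\<Sum>i\<le>p. \<Sum>j<l'. C k i j S * x ^ i * y ^ j))\<bar>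
          \<le> K * t powr (- (real (Suc n) / real q)) * (1 + \<bar>x\<bar> + \<bar>y\<bar>) ^ d)"
    using asymp unfolding power_law_asymptotics_def by blast
  \<comment> \<open>The order m plus the loss: each factor of the polynomial weight costs
    \<open>2 * b * h\<close> powers of z, each division by \<open>vI\<close> costs
    \<open>2 * b\<close>.\<close>
  define n where "n = m + (2 * b * h * d + 2 * b * \<kappa>)"
  obtain K t' where t': "0 < t'" and K: "\<And>t x y S. t' \<le> t \<Longrightarrow>
        \<bar>\<Phi> x y S t - (\<Sum>k\<le>n. t powr (- (real k / real q)) * (\<Sum>i\<le>p. \<Sum>j<l'. C k i j S * x ^ i * y ^ j))\<bar>
          \<le> K * t powr (- (real (Suc n) / real q)) * (1 + \<bar>x\<bar> + \<bar>y\<bar>) ^ d"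
    using spec[OF \<open>\<forall>n. \<exists>K t'. _ n K t'\<close>, of n] by blast
  define R where "R \<tau> w = \<Phi> (x \<tau> w) (y' \<tau> w) (phase w) (time \<tau>) - (\<Sum>k\<le>n. time \<tau> powr (- (real k / real q)) *
     (\<Sum>i\<le>p. \<Sum>j<l'. C k i j (phase w) * x \<tau> w ^ i * y' \<tau> w ^ j))" for \<tau> w
  have qD: "- (real k / real q) * D = - real (2 * (h - 1) * k)" for k
    using q h by (simp add: D_def of_nat_diff)
  have T: "bigO m (\<lambda>\<tau> w. time \<tau> powr (- (real (Suc n) / real q)) / z \<tau> ^ (2 * b * h * d + 2 * b * \<kappa>))"
  proof (rule bigO_divide_zpow)
    have "bigO (2 * (h - 1) * Suc n) (\<lambda>\<tau> w. time \<tau> powr (- (real (Suc n) / real q)))"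
      by (rule bigO_time[OF qD])
    \<comment> \<open>One step in the power law of t is worth \<open>2 * (h - 1)\<close> powers of
      z, hence at least one because \<open>h \<ge> 2\<close>.\<close>
    moreover have "n \<le> 2 * (h - 1) * Suc n"
      using h by (cases "h - 1") auto
    ultimately show "bigO (m + (2 * b * h * d + 2 * b * \<kappa>)) (\<lambda>\<tau> w. time \<tau> powr (- (real (Suc n) / real q)))"
      unfolding n_def[symmetric] by (rule bigO_mono)
  qed
  have W: "bigO 0 (\<lambda>\<tau> w. z \<tau> ^ (2 * b) / vI \<tau> w)"
  proof (rule bigO_cong)
    show "bigO 0 (\<lambda>\<tau> w. \<nu> powr (real (2 * b) / real N) * zw \<tau> w)"
      by (intro bigO_cmult expandable_imp_bigO[OF expandable_zw])
    show "\<forall>\<^sub>F \<tau> in at_top. \<forall>w\<in>P. \<nu> powr (real (2 * b) / real N) * zw \<tau> w = z \<tau> ^ (2 * b) / vI \<tau> w"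
      using eventually_gt_at_top[of 0]
    proof eventually_elim
      case (elim \<tau>)
      have "\<nu> powr (real (2 * b) / real N) * \<nu> powr (- (real (2 * b) / real N)) = 1"
        using \<nu>_pos by (simp flip: powr_add)
      then show ?case by (simp add: zw_def Z_eq[OF elim] mult.assoc[symmetric])
    qed
  qed
  \<comment> \<open>The variable y has the larger weight, h; for x the surplus \<open>h - 1\<close>
    is simply a further decaying factor.\<close>
  have G: "bigO 0 (\<lambda>\<tau> w. z \<tau> ^ (2 * b * h) * (1 + \<bar>x \<tau> w\<bar> + \<bar>y' \<tau> w\<bar>))"
  proof -
    have "bigO (2 * b * h) (\<lambda>\<tau> w. z \<tau> ^ (2 * b * h))" by (rule bigO_zpow)
    then have 1: "bigO 0 (\<lambda>\<tau> w. z \<tau> ^ (2 * b * h))" by (rule bigO_mono) simp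
    have "bigO (2 * b * (h - 1) + 0 + 0) (\<lambda>\<tau> w. z \<tau> ^ (2 * b * (h - 1)) * (z \<tau> ^ (2 * b) / vI \<tau> w) * (x \<tau> w * vI \<tau> w))"
      by (intro bigO_mult bigO_zpow W expandable_imp_bigO[OF x])
    then have 2: "bigO 0 (\<lambda>\<tau> w. z \<tau> ^ (2 * b * (h - 1)) * (z \<tau> ^ (2 * b) / vI \<tau> w) * (x \<tau> w * vI \<tau> w))"
      by (rule bigO_mono) simp
    have 3: "bigO 0 (\<lambda>\<tau> w. (z \<tau> ^ (2 * b) / vI \<tau> w) ^ h * (y' \<tau> w * vI \<tau> w ^ h))"
      using bigO_mult[OF bigO_power[OF W, of h] expandable_imp_bigO[OF y']] by simp
    have abs: "bigO 0 (\<lambda>\<tau> w. \<bar>u \<tau> w\<bar>)" if "bigO 0 u" for u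
      by (rule bigO_bound[OF _ that]) simp
    from bigO_add[OF bigO_add[OF abs[OF 1] abs[OF 2]] abs[OF 3]] show ?thesis
    proof (rule bigO_bound[rotated])
      show "\<forall>\<^sub>F \<tau> in at_top. \<forall>w\<in>P. \<bar>z \<tau> ^ (2 * b * h) * (1 + \<bar>x \<tau> w\<bar> + \<bar>y' \<tau> w\<bar>)\<bar>
        \<le> \<bar>\<bar>z \<tau> ^ (2 * b * h)\<bar> + \<bar>z \<tau> ^ (2 * b * (h - 1)) * (z \<tau> ^ (2 * b) / vI \<tau> w) * (x \<tau> w * vI \<tau> w)\<bar>
           + \<bar>(z \<tau> ^ (2 * b) / vI \<tau> w) ^ h * (y' \<tau> w * vI \<tau> w ^ h)\<bar>\<bar>"
        using regular
      proof eventually_elim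
        case (elim \<tau>)
        have "\<bar>z \<tau> ^ (2 * b * h) * (1 + \<bar>x \<tau> w\<bar> + \<bar>y' \<tau> w\<bar>)\<bar>
          = \<bar>z \<tau> ^ (2 * b * h)\<bar> + \<bar>z \<tau> ^ (2 * b * (h - 1)) * (z \<tau> ^ (2 * b) / vI \<tau> w) * (x \<tau> w * vI \<tau> w)\<bar>
           + \<bar>(z \<tau> ^ (2 * b) / vI \<tau> w) ^ h * (y' \<tau> w * vI \<tau> w ^ h)\<bar>" if "w \<in> P" for w
        proof -
          have v: "vI \<tau> w \<noteq> 0" using elim that by fastforce
          have "2 * b * h = 2 * b * (h - 1) + 2 * b" using h by (cases h) auto
          then have A1: "z \<tau> ^ (2 * b * (h - 1)) * (z \<tau> ^ (2 * b) / vI \<tau> w) * (x \<tau> w * vI \<tau> w) = z \<tau> ^ (2 * b * h) * x \<tau> w"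
            using v by (simp add: power_add)
          have A2: "(z \<tau> ^ (2 * b) / vI \<tau> w) ^ h * (y' \<tau> w * vI \<tau> w ^ h) = z \<tau> ^ (2 * b * h) * y' \<tau> w"
            using v by (simp add: power_divide power_mult)
          have A3: "\<bar>1 + \<bar>x \<tau> w\<bar> + \<bar>y' \<tau> w\<bar>\<bar> = 1 + \<bar>x \<tau> w\<bar> + \<bar>y' \<tau> w\<bar>" by simp
          show ?thesis unfolding A1 A2
            by (subst abs_mult, subst A3) (simp only: abs_mult distrib_left mult_1_right)
        qed
        then show ?case by simp
      qed
    qed
  qed
  have "bigO (m + 0 + 0 + 0) (\<lambda>\<tau> w. (time \<tau> powr (- (real (Suc n) / real q)) / z \<tau> ^ (2 * b * h * d + 2 * b * \<kappa>)) *
      (z \<tau> ^ (2 * b * h) * (1 + \<bar>x \<tau> w\<bar> + \<bar>y' \<tau> w\<bar>)) ^ d * (z \<tau> ^ (2 * b) / vI \<tau> w) ^ \<kappa> * vI \<tau> w ^ e)"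
    using bigO_power[OF G, of d] bigO_power[OF W, of \<kappa>] expandable_imp_bigO[OF expandable_power[OF expandable_vI]]
    by (intro bigO_mult T) simp_all
  then have "bigO m (\<lambda>\<tau> w. K * ((time \<tau> powr (- (real (Suc n) / real q)) / z \<tau> ^ (2 * b * h * d + 2 * b * \<kappa>)) *
      (z \<tau> ^ (2 * b * h) * (1 + \<bar>x \<tau> w\<bar> + \<bar>y' \<tau> w\<bar>)) ^ d * (z \<tau> ^ (2 * b) / vI \<tau> w) ^ \<kappa> * vI \<tau> w ^ e))"
    by (intro bigO_cmult) simp
  then have "bigO m (\<lambda>\<tau> w. R \<tau> w * vI \<tau> w ^ e / vI \<tau> w ^ \<kappa>)"
  proof (rule bigO_bound[rotated])
    show "\<forall>\<^sub>F \<tau> in at_top. \<forall>w\<in>P. \<bar>R \<tau> w * vI \<tau> w ^ e / vI \<tau> w ^ \<kappa>\<bar>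
      \<le> \<bar>K * ((time \<tau> powr (- (real (Suc n) / real q)) / z \<tau> ^ (2 * b * h * d + 2 * b * \<kappa>)) *
      (z \<tau> ^ (2 * b * h) * (1 + \<bar>x \<tau> w\<bar> + \<bar>y' \<tau> w\<bar>)) ^ d * (z \<tau> ^ (2 * b) / vI \<tau> w) ^ \<kappa> * vI \<tau> w ^ e)\<bar>"
      using regular z_pos eventually_time[OF eventually_ge_at_top[of t']]
    proof eventually_elim
      case (elim \<tau>)
      show ?case
      proof
        fix w assume w: "w \<in> P"
        then have v: "0 < vI \<tau> w" using elim by blast
        let ?B = "K * time \<tau> powr (- (real (Suc n) / real q)) * (1 + \<bar>x \<tau> w\<bar> + \<bar>y' \<tau> w\<bar>) ^ d"
        have "\<bar>R \<tau> w * vI \<tau> w ^ e / vI \<tau> w ^ \<kappa>\<bar> = \<bar>R \<tau> w\<bar> * (vI \<tau> w ^ e / vI \<tau> w ^ \<kappa>)"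
          using v by (simp add: abs_mult)
        also have "\<dots> \<le> ?B * (vI \<tau> w ^ e / vI \<tau> w ^ \<kappa>)"
          using K[OF elim(3)] v unfolding R_def by (intro mult_right_mono) auto
        also have "\<dots> = K * ((time \<tau> powr (- (real (Suc n) / real q)) / z \<tau> ^ (2 * b * h * d + 2 * b * \<kappa>)) *
      (z \<tau> ^ (2 * b * h) * (1 + \<bar>x \<tau> w\<bar> + \<bar>y' \<tau> w\<bar>)) ^ d * (z \<tau> ^ (2 * b) / vI \<tau> w) ^ \<kappa> * vI \<tau> w ^ e)"
          using elim(2) v by (simp add: power_add power_mult power_mult_distrib power_divide)
        finally show "\<bar>R \<tau> w * vI \<tau> w ^ e / vI \<tau> w ^ \<kappa>\<bar> \<le> \<bar>\<dots>\<bar>" by linarith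
      qed
    qed
  qed
  then have "expandable m (\<lambda>\<tau> w. R \<tau> w * vI \<tau> w ^ e / vI \<tau> w ^ \<kappa>)" by (rule expandable_bigO)
  moreover have "expandable m (\<lambda>\<tau> w. \<Sum>k\<le>n. time \<tau> powr (- (real k / real q)) * (\<Sum>i\<le>p. \<Sum>j<l'.
      C k i j (phase w) * ((x \<tau> w * vI \<tau> w) ^ i * (y' \<tau> w * vI \<tau> w ^ h) ^ j * vI \<tau> w ^ (e - i - h * j - \<kappa>))))"
  proof (intro expandable_sum expandable_mult)
    fix k
    show "expandable m (\<lambda>\<tau> w. time \<tau> powr (- (real k / real q)))" by (rule expandable_time[OF qD])
  next
    fix k i j assume "i \<in> {..p}" "j \<in> {..<l'}"
    then show "expandable m (\<lambda>\<tau> w. C k i j (phase w))" by (intro expandable_const C_bdd) auto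
  qed (intro expandable_power x y' expandable_vI)+
  ultimately have "expandable m (\<lambda>\<tau> w. R \<tau> w * vI \<tau> w ^ e / vI \<tau> w ^ \<kappa> +
      (\<Sum>k\<le>n. time \<tau> powr (- (real k / real q)) * (\<Sum>i\<le>p. \<Sum>j<l'.
      C k i j (phase w) * ((x \<tau> w * vI \<tau> w) ^ i * (y' \<tau> w * vI \<tau> w ^ h) ^ j * vI \<tau> w ^ (e - i - h * j - \<kappa>)))))"
    by (rule expandable_add)
  then show ?thesis unfolding x_def[symmetric] y'_def[symmetric]
  proof (rule expandable_cong[rotated])
    show "\<forall>\<^sub>F \<tau> in at_top. \<forall>w\<in>P. R \<tau> w * vI \<tau> w ^ e / vI \<tau> w ^ \<kappa> +
      (\<Sum>k\<le>n. time \<tau> powr (- (real k / real q)) * (\<Sum>i\<le>p. \<Sum>j<l'.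
      C k i j (phase w) * ((x \<tau> w * vI \<tau> w) ^ i * (y' \<tau> w * vI \<tau> w ^ h) ^ j * vI \<tau> w ^ (e - i - h * j - \<kappa>))))
      = \<Phi> (x \<tau> w) (y' \<tau> w) (phase w) (time \<tau>) * vI \<tau> w ^ e / vI \<tau> w ^ \<kappa>"
      using regular
    proof eventually_elim
      case (elim \<tau>)
      show ?case
      proof
        fix w assume w: "w \<in> P"
        then have v: "0 < vI \<tau> w" using elim by blast
        \<comment> \<open>The truncated subtraction in the exponent is a true one when
          \<open>i + j \<le> p\<close>; for the other indices the coefficient is zero.\<close>
        have term_eq: "C k i j (phase w) * ((x \<tau> w * vI \<tau> w) ^ i * (y' \<tau> w * vI \<tau> w ^ h) ^ j * vI \<tau> w ^ (e - i - h * j - \<kappa>))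
          = C k i j (phase w) * x \<tau> w ^ i * y' \<tau> w ^ j * (vI \<tau> w ^ e / vI \<tau> w ^ \<kappa>)" if "j < l'" for k i j
        proof (cases "i + j \<le> p")
          case True
          then have "e = i + h * j + (e - i - h * j - \<kappa>) + \<kappa>" using deg[OF True that] by simp
          then have "vI \<tau> w ^ e = vI \<tau> w ^ i * (vI \<tau> w ^ h) ^ j * vI \<tau> w ^ (e - i - h * j - \<kappa>) * vI \<tau> w ^ \<kappa>"
            by (metis power_add power_mult)
          then have "vI \<tau> w ^ e / vI \<tau> w ^ \<kappa> = vI \<tau> w ^ i * (vI \<tau> w ^ h) ^ j * vI \<tau> w ^ (e - i - h * j - \<kappa>)"
            using v by (simp add: divide_eq_eq)
          then show ?thesis by (simp add: power_mult_distrib)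
        qed (simp add: zero)
        have "(\<Sum>k\<le>n. time \<tau> powr (- (real k / real q)) * (\<Sum>i\<le>p. \<Sum>j<l'.
            C k i j (phase w) * ((x \<tau> w * vI \<tau> w) ^ i * (y' \<tau> w * vI \<tau> w ^ h) ^ j * vI \<tau> w ^ (e - i - h * j - \<kappa>))))
          = (\<Sum>k\<le>n. time \<tau> powr (- (real k / real q)) * (\<Sum>i\<le>p. \<Sum>j<l'.
            C k i j (phase w) * x \<tau> w ^ i * y' \<tau> w ^ j)) * (vI \<tau> w ^ e / vI \<tau> w ^ \<kappa>)"
        proof -
          have "(\<Sum>i\<le>p. \<Sum>j<l'. C k i j (phase w) * ((x \<tau> w * vI \<tau> w) ^ i * (y' \<tau> w * vI \<tau> w ^ h) ^ j * vI \<tau> w ^ (e - i - h * j - \<kappa>)))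
              = (\<Sum>i\<le>p. \<Sum>j<l'. C k i j (phase w) * x \<tau> w ^ i * y' \<tau> w ^ j) * (vI \<tau> w ^ e / vI \<tau> w ^ \<kappa>)" for k
            unfolding sum_distrib_right by (intro sum.cong refl term_eq) simp
          then show ?thesis unfolding sum_distrib_right[of _ "{..n}"] by (simp only: mult.assoc)
        qed
        then show "R \<tau> w * vI \<tau> w ^ e / vI \<tau> w ^ \<kappa> +
          (\<Sum>k\<le>n. time \<tau> powr (- (real k / real q)) * (\<Sum>i\<le>p. \<Sum>j<l'.
            C k i j (phase w) * ((x \<tau> w * vI \<tau> w) ^ i * (y' \<tau> w * vI \<tau> w ^ h) ^ j * vI \<tau> w ^ (e - i - h * j - \<kappa>))))
          = \<Phi> (x \<tau> w) (y' \<tau> w) (phase w) (time \<tau>) * vI \<tau> w ^ e / vI \<tau> w ^ \<kappa>"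
          unfolding R_def by (simp add: left_diff_distrib diff_divide_distrib)
      qed
    qed
  qed
qed

text \<open>The largest weight in g: \<open>i + h * j = (i + j) + (h - 1) * j\<close> with
  \<open>i + j \<le> p\<close> and \<open>j \<le> l\<close>. In f the degree in y is smaller by one,
  which saves \<open>h - 1\<close>.\<close>

definition deg :: nat where "deg = p + (h - 1) * l"

lemma expandable_f: "expandable m (\<lambda>\<tau> w. f (X (angle w) (energy \<tau> w)) (Y (angle w) (energy \<tau> w)) (phase w) (time \<tau>)
    * vI \<tau> w ^ deg / vI \<tau> w ^ (h - 1))"
proof (rule expandable_perturbation[OF f_asymp coef_zero(1) f_bdd])
  fix i j assume *: "i + j \<le> p" "j < l"
  have "(h - 1) * Suc j \<le> (h - 1) * l" using *(2) by (intro mult_le_mono2) simp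
  moreover have "h * j = (h - 1) * j + j" using h by (cases h) auto
  ultimately show "i + h * j + (h - 1) \<le> deg" using *(1) unfolding deg_def by simp
qed auto

lemma expandable_g: "expandable m (\<lambda>\<tau> w. g (X (angle w) (energy \<tau> w)) (Y (angle w) (energy \<tau> w)) (phase w) (time \<tau>)
    * vI \<tau> w ^ deg)"
proof -
  have g_asymp': "power_law_asymptotics q g (\<lambda>k x y S. \<Sum>i\<le>p. \<Sum>j<Suc l. Bcoef k i j S * x ^ i * y ^ j)"
    using g_asymp by (simp only: lessThan_Suc_atMost)
  have "expandable m (\<lambda>\<tau> w. g (X (angle w) (energy \<tau> w)) (Y (angle w) (energy \<tau> w)) (phase w) (time \<tau>)
    * vI \<tau> w ^ deg / vI \<tau> w ^ 0)"
  proof (rule expandable_perturbation[OF g_asymp' coef_zero(2) g_bdd])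
    fix i j assume *: "i + j \<le> p" "j < Suc l"
    have "(h - 1) * j \<le> (h - 1) * l" using *(2) by (intro mult_le_mono2) simp
    moreover have "h * j = (h - 1) * j + j" using h by (cases h) auto
    ultimately show "i + h * j + 0 \<le> deg" using *(1) unfolding deg_def by linarith
  qed auto
  then show ?thesis by simp
qed

lemma expandable_dU: "expandable m (\<lambda>\<tau> w. dU (X (angle w) (energy \<tau> w)) * vI \<tau> w ^ (2 * h - 1))"
proof (rule expandable_cong)
  show "expandable m (\<lambda>\<tau> w. (X (angle w) (energy \<tau> w) * vI \<tau> w) ^ (2 * h - 1) +
     (\<Sum>i = 1..2 * h - 1. u i * real i * ((X (angle w) (energy \<tau> w) * vI \<tau> w) ^ (i - 1) * vI \<tau> w ^ (2 * h - 1 - (i - 1)))))"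
    by (intro expandable_add expandable_sum expandable_mult[OF expandable_const'] expandable_mult
        expandable_power expandable_X expandable_vI)
  have "vI \<tau> w ^ (i - 1) * vI \<tau> w ^ (2 * h - 1 - (i - 1)) = vI \<tau> w ^ (2 * h - 1)" if "i \<in> {1..2 * h - 1}" for i \<tau> w
  proof -
    have "(i - 1) + (2 * h - 1 - (i - 1)) = 2 * h - 1" using that by auto
    then show ?thesis by (metis power_add)
  qed
  then show "\<forall>\<^sub>F \<tau> in at_top. \<forall>w\<in>P. (X (angle w) (energy \<tau> w) * vI \<tau> w) ^ (2 * h - 1) +
     (\<Sum>i = 1..2 * h - 1. u i * real i * ((X (angle w) (energy \<tau> w) * vI \<tau> w) ^ (i - 1) * vI \<tau> w ^ (2 * h - 1 - (i - 1))))
     = dU (X (angle w) (energy \<tau> w)) * vI \<tau> w ^ (2 * h - 1)"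
    by (intro always_eventually allI ballI)
      (simp add: dU distrib_right sum_distrib_right power_mult_distrib mult.assoc)
qed

text \<open>This balance is the meaning of \<sigma>: the left exponent is
  \<open>- \<sigma> - a / q\<close>, exactly what compensates the growth of F, of weight
  \<open>deg + h\<close>, relative to the weight \<open>2 * h\<close> of the energy.\<close>

lemma time_key:
  assumes "0 < \<tau>"
  shows "time \<tau> powr (1 - \<nu> + 2 * \<mu> - real a / real q) * Z \<tau> ^ (2 * h) = Z \<tau> ^ (deg + h)"
proof -
  define c where "c = real h - 1"
  have c: "c \<noteq> 0" using h by (simp add: c_def)
  have \<sigma>': "\<sigma> = real b / real q * (real l - 1 + (real p - 1) / c) - real a / real q" using \<sigma> by (simp add: c_def)
  have deg': "real (deg + h) = real p + c * real l + c + 1" "real (2 * h) = 2 * c + 2"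
    using h by (auto simp: deg_def c_def of_nat_diff)
  have e: "1 - \<nu> + 2 * \<mu> - real a / real q = - \<sigma> - real a / real q" by (simp add: \<nu>)
  have q': "real q \<noteq> 0" using q by simp
  have "1 - \<nu> + 2 * \<mu> - real a / real q + - (real b / (real q * c)) * real (2 * h)
      = - (real b / (real q * c)) * real (deg + h)"
    unfolding e \<sigma>' deg' using c q' by (simp add: field_simps)
  then show ?thesis
    unfolding Z_power[OF assms] c_def[symmetric] by (simp flip: powr_add)
qed

definition cM :: real where "cM = \<nu> powr (- (real M / real N))"

text \<open>The terms \<open>f * dU\<close> and \<open>g * Y\<close> share the weight
  \<open>deg + h\<close>, since the missing \<open>h - 1\<close> in f is supplied by dU. Then
  \<open>time_key\<close> cancels all powers that grow.\<close>

lemma expandable_calA_F: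
  "expandable m (\<lambda>\<tau> w. time \<tau> powr (1 - \<nu> + 2 * \<mu> - real a / real q) * F (energy \<tau> w) (angle w) (phase w) (time \<tau>)
      * vI \<tau> w ^ (2 * h))"
proof (rule expandable_cong)
  show "expandable m (\<lambda>\<tau> w.
    (f (X (angle w) (energy \<tau> w)) (Y (angle w) (energy \<tau> w)) (phase w) (time \<tau>) * vI \<tau> w ^ deg / vI \<tau> w ^ (h - 1)
       * (dU (X (angle w) (energy \<tau> w)) * vI \<tau> w ^ (2 * h - 1))
     + g (X (angle w) (energy \<tau> w)) (Y (angle w) (energy \<tau> w)) (phase w) (time \<tau>) * vI \<tau> w ^ deg
       * (Y (angle w) (energy \<tau> w) * vI \<tau> w ^ h)) * (zw \<tau> w ^ (deg + h) * (vI \<tau> w / Z \<tau>) ^ (2 * h)))"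
    by (intro expandable_mult[OF expandable_add[OF expandable_mult[OF expandable_f expandable_dU]
          expandable_mult[OF expandable_g expandable_Y]] expandable_mult[OF expandable_power[OF expandable_zw]
          expandable_power[OF expandable_zw_inverse]]])
  show "\<forall>\<^sub>F \<tau> in at_top. \<forall>w\<in>P.
    (f (X (angle w) (energy \<tau> w)) (Y (angle w) (energy \<tau> w)) (phase w) (time \<tau>) * vI \<tau> w ^ deg / vI \<tau> w ^ (h - 1)
       * (dU (X (angle w) (energy \<tau> w)) * vI \<tau> w ^ (2 * h - 1))
     + g (X (angle w) (energy \<tau> w)) (Y (angle w) (energy \<tau> w)) (phase w) (time \<tau>) * vI \<tau> w ^ deg
       * (Y (angle w) (energy \<tau> w) * vI \<tau> w ^ h)) * (zw \<tau> w ^ (deg + h) * (vI \<tau> w / Z \<tau>) ^ (2 * h))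
    = time \<tau> powr (1 - \<nu> + 2 * \<mu> - real a / real q) * F (energy \<tau> w) (angle w) (phase w) (time \<tau>)
      * vI \<tau> w ^ (2 * h)"
    using regular
  proof eventually_elim
    case (elim \<tau>)
    show ?case
    proof
      fix w assume w: "w \<in> P"
      define v where "v = vI \<tau> w"
      have v: "0 < v" and Z: "0 < Z \<tau>" and \<tau>: "0 < \<tau>" using elim w unfolding v_def by blast+
      define f' where "f' = f (X (angle w) (energy \<tau> w)) (Y (angle w) (energy \<tau> w)) (phase w) (time \<tau>)"
      define g' where "g' = g (X (angle w) (energy \<tau> w)) (Y (angle w) (energy \<tau> w)) (phase w) (time \<tau>)"
      define U' where "U' = dU (X (angle w) (energy \<tau> w))"
      define Y' where "Y' = Y (angle w) (energy \<tau> w)"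
      define k where "k = time \<tau> powr (1 - \<nu> + 2 * \<mu> - real a / real q)"
      have k: "k * Z \<tau> ^ (2 * h) = Z \<tau> ^ (deg + h)" unfolding k_def by (rule time_key[OF \<tau>])
      have "v ^ (2 * h - 1) = v ^ (h - 1) * v ^ h"
        by (rule power_split) (use h in simp)
      then have "(f' * v ^ deg / v ^ (h - 1) * (U' * v ^ (2 * h - 1)) + g' * v ^ deg * (Y' * v ^ h))
          = (f' * U' + g' * Y') * v ^ (deg + h)"
        using v by (simp add: power_add distrib_right)
      moreover have "v ^ (deg + h) * ((Z \<tau> / v) ^ (deg + h) * (v / Z \<tau>) ^ (2 * h)) = k * v ^ (2 * h)"
        unfolding power_divide k[symmetric] using v Z by (simp add: field_simps)
      ultimately have "(f' * v ^ deg / v ^ (h - 1) * (U' * v ^ (2 * h - 1)) + g' * v ^ deg * (Y' * v ^ h))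
          * ((Z \<tau> / v) ^ (deg + h) * (v / Z \<tau>) ^ (2 * h)) = (f' * U' + g' * Y') * (k * v ^ (2 * h))"
        by (simp only: mult.assoc)
      then have "(f' * v ^ deg / v ^ (h - 1) * (U' * v ^ (2 * h - 1)) + g' * v ^ deg * (Y' * v ^ h))
          * ((Z \<tau> / v) ^ (deg + h) * (v / Z \<tau>) ^ (2 * h)) = k * (f' * U' + g' * Y') * v ^ (2 * h)"
        by (simp only: ac_simps)
      then show "(f (X (angle w) (energy \<tau> w)) (Y (angle w) (energy \<tau> w)) (phase w) (time \<tau>) * vI \<tau> w ^ deg / vI \<tau> w ^ (h - 1)
       * (dU (X (angle w) (energy \<tau> w)) * vI \<tau> w ^ (2 * h - 1))
     + g (X (angle w) (energy \<tau> w)) (Y (angle w) (energy \<tau> w)) (phase w) (time \<tau>) * vI \<tau> w ^ deg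
       * (Y (angle w) (energy \<tau> w) * vI \<tau> w ^ h)) * (zw \<tau> w ^ (deg + h) * (vI \<tau> w / Z \<tau>) ^ (2 * h))
    = time \<tau> powr (1 - \<nu> + 2 * \<mu> - real a / real q) * F (energy \<tau> w) (angle w) (phase w) (time \<tau>)
      * vI \<tau> w ^ (2 * h)"
        unfolding F zw_def v_def f'_def g'_def U'_def Y'_def k_def .
    qed
  qed
qed

text \<open>Differentiating the resonance condition expresses the derivative of \<open>Istar\<close>
  through that of \<omega>. The energy asymptotics may be differentiated once, and the scaled
  derivative has a positive limit, so it can be inverted.\<close>

lemma expandable_Istar_log_deriv:
  "expandable m (\<lambda>\<tau> w. time \<tau> powr (1 - \<nu> + 2 * \<mu>) * (deriv Istar (time \<tau>) / Istar (time \<tau>)))"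
proof -
  \<comment> \<open>The derivative of \<omega> with its leading power removed; its limit is
    \<open>\<alpha> * \<omega>coef 0\<close>.\<close>
  define \<Omega> where "\<Omega> \<tau> = deriv \<omega> (Istar (time \<tau>)) * Istar (time \<tau>) powr (- ((real h - 1) / (2 * real h) - 1))" for \<tau>
  define K where "K = vartheta * (real b / real q) / real varkappa"
  define \<alpha> where "\<alpha> = (real h - 1) / (2 * real h)"
  have EA: "energy_asymptotics h (\<alpha> - 1) (\<lambda>\<phi> E. deriv \<omega> E) (\<lambda>j \<phi>. (\<alpha> - real j / (2 * real h)) * \<omega>coef j)"
    using \<omega>_asymp unfolding energy_asymptotics_C1_def \<alpha>_def by blast
  have h0: "0 < h" using h by simp
  have "\<forall>\<^sub>F \<tau> in at_top. \<forall>w\<in>P. Istar (time \<tau>) powr (- (1 / (2 * real h))) = V \<tau>" by (simp add: V_def)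
  note V1 = this
  have L: "\<forall>\<^sub>F \<tau> in at_top. \<forall>w\<in>P. K \<le> Istar (time \<tau>)" for K
    using Istar_time_large[of K] by eventually_elim simp
  note E = expandable_energy[OF EA h0 bdd_on_const L expandable_V bigO_V V1]
  have \<Omega>: "expandable m (\<lambda>\<tau> w. \<Omega> \<tau>)" for m
    unfolding \<Omega>_def \<alpha>_def[symmetric] by (rule E(1))
  have "bigO 1 (\<lambda>\<tau> w. \<Omega> \<tau> - (\<alpha> - real 0 / (2 * real h)) * \<omega>coef 0)"
    unfolding \<Omega>_def \<alpha>_def[symmetric] by (rule E(3))
  then have "bigO 1 (\<lambda>\<tau> w. \<Omega> \<tau> - \<alpha> * \<omega>coef 0)" by simp
  moreover have pos: "0 < \<alpha> * \<omega>coef 0" using h \<omega>coef0 by (simp add: \<alpha>_def)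
  ultimately have near: "\<forall>\<^sub>F \<tau> in at_top. \<forall>w\<in>P. \<bar>\<Omega> \<tau> - \<alpha> * \<omega>coef 0\<bar> < \<alpha> * \<omega>coef 0 / 2"
    by (intro bigO_1_eventually_less) auto
  have low: "\<forall>\<^sub>F \<tau> in at_top. \<forall>w\<in>P. \<alpha> * \<omega>coef 0 / 2 \<le> \<Omega> \<tau>"
    using near
  proof eventually_elim
    case (elim \<tau>)
    show ?case
    proof
      fix w assume "w \<in> P"
      with elim have "\<bar>\<Omega> \<tau> - \<alpha> * \<omega>coef 0\<bar> < \<alpha> * \<omega>coef 0 / 2" by blast
      then show "\<alpha> * \<omega>coef 0 / 2 \<le> \<Omega> \<tau>" by linarith
    qed
  qed
  \<comment> \<open>The bound does not depend on w, but it is quantified over \<open>P\<close>; a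
    point of \<open>P\<close> releases it.\<close>
  have "(0, 0, 0) \<in> P" using d by (simp add: P)
  then have low': "\<forall>\<^sub>F \<tau> in at_top. \<alpha> * \<omega>coef 0 / 2 \<le> \<Omega> \<tau>"
    using low by (auto elim!: eventually_mono)
  have inv: "expandable m (\<lambda>\<tau> w. 1 / \<Omega> \<tau>)"
    by (rule expandable_inverse[OF \<Omega> _ low]) (use pos in simp)
  \<comment> \<open>This is the condition \<open>- 1 \<le> \<sigma>\<close>: the remaining exponent
    \<open>2 * \<mu> - \<nu>\<close> equals \<open>- 1 - \<sigma>\<close>.\<close>
  have "2 * M \<le> N"
  proof -
    have "2 * \<mu> \<le> \<nu>" using \<sigma>_range by (simp add: \<nu>)
    then have "2 * real M \<le> real N" unfolding M_eq N_eq using D_pos by simp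
    then show ?thesis by linarith
  qed
  then have ex: "(2 * \<mu> - \<nu>) * D = - real (N - 2 * M)"
    by (simp add: of_nat_diff N_eq M_eq algebra_simps)
  show ?thesis
  proof (rule expandable_cong)
    show "expandable m (\<lambda>\<tau> w. K * (time \<tau> powr (2 * \<mu> - \<nu>) * (Q \<tau> ^ (h - 1) * (1 / \<Omega> \<tau>))))"
      by (intro expandable_mult[OF expandable_const'] expandable_mult[OF expandable_time[OF ex]]
          expandable_mult[OF expandable_power[OF expandable_Q] inv])
    show "\<forall>\<^sub>F \<tau> in at_top. \<forall>w\<in>P. K * (time \<tau> powr (2 * \<mu> - \<nu>) * (Q \<tau> ^ (h - 1) * (1 / \<Omega> \<tau>)))
      = time \<tau> powr (1 - \<nu> + 2 * \<mu>) * (deriv Istar (time \<tau>) / Istar (time \<tau>))"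
      using regular eventually_time[OF Istar'] low'
    proof eventually_elim
      case (elim \<tau>)
      have \<tau>: "0 < \<tau>" and t: "0 < time \<tau>" and V: "0 < V \<tau>" "V \<tau> = Z \<tau> * Q \<tau>" and I: "Istar (time \<tau>) = 1 / V \<tau> ^ (2 * h)"
        and I0: "0 < Istar (time \<tau>)" using elim(1) by blast+
      have \<Omega>0: "0 < \<Omega> \<tau>" using elim(3) pos by linarith
      have "- ((real h - 1) / (2 * real h) - 1) = real (h + 1) / (2 * real h)" using h by (simp add: field_simps)
      moreover have "V \<tau> ^ (h + 1) = Istar (time \<tau>) powr (- (real (h + 1) / (2 * real h)))"
      proof -
        have "V \<tau> ^ (h + 1) = V \<tau> powr real (h + 1)" by (rule powr_realpow[symmetric]) (rule V(1))
        then show ?thesis by (simp only: V_def powr_powr mult_minus_left times_divide_eq_left mult_1)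
      qed
      ultimately have "\<Omega> \<tau> = deriv \<omega> (Istar (time \<tau>)) / V \<tau> ^ (h + 1)"
        by (simp add: \<Omega>_def powr_minus_divide)
      then have "deriv \<omega> (Istar (time \<tau>)) = \<Omega> \<tau> * V \<tau> ^ (h + 1)" using V(1) by simp
      then have "\<Omega> \<tau> * V \<tau> ^ (h + 1) * deriv Istar (time \<tau>) = K * time \<tau> powr (real b / real q - 1)"
        using elim(2) by (simp add: K_def)
      then have "deriv Istar (time \<tau>) = K * time \<tau> powr (real b / real q - 1) / (\<Omega> \<tau> * V \<tau> ^ (h + 1))"
        using \<Omega>0 V(1) by (simp add: field_simps)
      moreover have "V \<tau> ^ (2 * h) = V \<tau> ^ (h + 1) * V \<tau> ^ (h - 1)"
        by (rule power_split) (use h in simp)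
      ultimately have "deriv Istar (time \<tau>) / Istar (time \<tau>) = K * time \<tau> powr (real b / real q - 1) * V \<tau> ^ (h - 1) / \<Omega> \<tau>"
        using V(1) by (simp add: I)
      also have "V \<tau> ^ (h - 1) = time \<tau> powr (- (real b / real q)) * Q \<tau> ^ (h - 1)"
        unfolding V(2) power_mult_distrib Z_power_h[OF \<tau>] ..
      finally have "time \<tau> powr (1 - \<nu> + 2 * \<mu>) * (deriv Istar (time \<tau>) / Istar (time \<tau>))
         = K * (time \<tau> powr (1 - \<nu> + 2 * \<mu>) * time \<tau> powr (real b / real q - 1) * time \<tau> powr (- (real b / real q))) * Q \<tau> ^ (h - 1) / \<Omega> \<tau>"
        by simp
      also have "time \<tau> powr (1 - \<nu> + 2 * \<mu>) * time \<tau> powr (real b / real q - 1) * time \<tau> powr (- (real b / real q))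
          = time \<tau> powr (2 * \<mu> - \<nu>)"
        by (simp flip: powr_add)
      finally show ?case by simp
    qed
  qed
qed

lemma expandable_calA: "expandable m (\<lambda>\<tau> w. calA (fst w) (fst (snd w)) (snd (snd w)) \<tau>)"
proof (rule expandable_cong)
  \<comment> \<open>Used for the term from the time dependence of the scaling, whose power of t is
    \<open>\<mu> - \<nu>\<close>.\<close>
  have "M \<le> N"
  proof -
    have "\<mu> \<le> \<nu>" using \<sigma>_range \<mu>_pos by (simp add: \<nu>)
    then have "real M \<le> real N" unfolding M_eq N_eq using D_pos by simp
    then show ?thesis by linarith
  qed
  then have ex: "(\<mu> - \<nu>) * D = - real (N - M)"
    by (simp add: of_nat_diff N_eq M_eq algebra_simps)
  have "bdd_on fst" by (rule bdd_onI[of _ d]) (auto simp: P)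
  then show "expandable m (\<lambda>\<tau> w. cM * (
     1 / (2 * real h) * ((time \<tau> powr (1 - \<nu> + 2 * \<mu> - real a / real q) * F (energy \<tau> w) (angle w) (phase w) (time \<tau>)
      * vI \<tau> w ^ (2 * h)) * (1 + y \<tau> w))
     - 1 / (2 * real h) * ((time \<tau> powr (1 - \<nu> + 2 * \<mu>) * (deriv Istar (time \<tau>) / Istar (time \<tau>))) * (1 + y \<tau> w))
     + \<mu> * (time \<tau> powr (\<mu> - \<nu>) * fst w)))"
    by (intro expandable_mult[OF expandable_const'] expandable_add expandable_diff
        expandable_mult[OF expandable_calA_F] expandable_mult[OF expandable_Istar_log_deriv]
        expandable_mult[OF expandable_time[OF ex]] expandable_const expandable_y bdd_on_const)
  show "\<forall>\<^sub>F \<tau> in at_top. \<forall>w\<in>P. cM * (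
     1 / (2 * real h) * ((time \<tau> powr (1 - \<nu> + 2 * \<mu> - real a / real q) * F (energy \<tau> w) (angle w) (phase w) (time \<tau>)
      * vI \<tau> w ^ (2 * h)) * (1 + y \<tau> w))
     - 1 / (2 * real h) * ((time \<tau> powr (1 - \<nu> + 2 * \<mu>) * (deriv Istar (time \<tau>) / Istar (time \<tau>))) * (1 + y \<tau> w))
     + \<mu> * (time \<tau> powr (\<mu> - \<nu>) * fst w))
    = calA (fst w) (fst (snd w)) (snd (snd w)) \<tau>"
    using regular
  proof eventually_elim
    case (elim \<tau>)
    show ?case
    proof
      fix w assume w: "w \<in> P"
      have \<tau>: "0 < \<tau>" and I0: "0 < Istar (time \<tau>)" and I: "Istar (time \<tau>) = 1 / V \<tau> ^ (2 * h)" and V: "0 < V \<tau>"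
        using elim by blast+
      have y: "0 < 1 + y \<tau> w" and v: "vI \<tau> w * (1 + y \<tau> w) = V \<tau>" "0 < vI \<tau> w" using elim w by blast+
      have t: "0 < time \<tau>" by (rule time_pos[OF \<tau>])
      have "(1 + y \<tau> w) ^ (2 * h) = (1 + y \<tau> w) * (1 + y \<tau> w) ^ (2 * h - 1)"
        using h by (cases h) auto
      then have "vI \<tau> w ^ (2 * h) * (1 + y \<tau> w) * (Istar (time \<tau>) * (1 + y \<tau> w) ^ (2 * h - 1)) = 1"
        unfolding I v(1)[symmetric] power_mult_distrib using v(2) y by simp
      then have den: "vI \<tau> w ^ (2 * h) * (1 + y \<tau> w) = 1 / (Istar (time \<tau>) * (1 + y \<tau> w) ^ (2 * h - 1))"
        using I0 y by (simp add: field_simps)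
      have p1: "time \<tau> powr (1 - \<nu> + 2 * \<mu> - real a / real q)
          = time \<tau> powr \<mu> * time \<tau> powr (1 - \<nu> + \<mu>) * time \<tau> powr (- (real a / real q))"
        by (simp only: powr_add[symmetric]) (simp add: algebra_simps)
      have p2: "time \<tau> powr (1 - \<nu> + 2 * \<mu>) = time \<tau> powr \<mu> * time \<tau> powr (1 - \<nu> + \<mu>)"
        by (simp only: powr_add[symmetric]) (simp add: algebra_simps)
      have p3: "time \<tau> powr (\<mu> - \<nu>) = time \<tau> powr \<mu> * time \<tau> powr (1 - \<nu> + \<mu>) * time \<tau> powr (- \<mu> - 1)"
        by (simp only: powr_add[symmetric]) (simp add: algebra_simps)
      define c2 where "c2 = 1 / (2 * real h)"
      define dI where "dI = deriv Istar (time \<tau>) / Istar (time \<tau>)"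
      have "calA (fst w) (fst (snd w)) (snd (snd w)) \<tau> = cM * time \<tau> powr \<mu> *
                  (time \<tau> powr (1 - \<nu> + \<mu>) *
                   (time \<tau> powr (- (real a / real q)) * F (energy \<tau> w) (angle w) (phase w) (time \<tau>)
                       / (2 * real h * Istar (time \<tau>) * (1 + y \<tau> w) ^ (2 * h - 1))
                    - deriv Istar (time \<tau>) / (2 * real h * Istar (time \<tau>)) * (1 + y \<tau> w)
                    + \<mu> * time \<tau> powr (- \<mu> - 1) * fst w))"
        unfolding calA Let_def \<tau>_powr[OF \<tau>] cM_def y_def energy_def angle_def phase_def ..
      also have "time \<tau> powr (- (real a / real q)) * F (energy \<tau> w) (angle w) (phase w) (time \<tau>)
                       / (2 * real h * Istar (time \<tau>) * (1 + y \<tau> w) ^ (2 * h - 1))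
          = c2 * (time \<tau> powr (- (real a / real q)) * F (energy \<tau> w) (angle w) (phase w) (time \<tau>)
              * (vI \<tau> w ^ (2 * h) * (1 + y \<tau> w)))"
        unfolding den c2_def by simp
      also have "deriv Istar (time \<tau>) / (2 * real h * Istar (time \<tau>)) = c2 * dI"
        by (simp add: c2_def dI_def)
      finally show "cM * (
     1 / (2 * real h) * ((time \<tau> powr (1 - \<nu> + 2 * \<mu> - real a / real q) * F (energy \<tau> w) (angle w) (phase w) (time \<tau>)
      * vI \<tau> w ^ (2 * h)) * (1 + y \<tau> w))
     - 1 / (2 * real h) * ((time \<tau> powr (1 - \<nu> + 2 * \<mu>) * (deriv Istar (time \<tau>) / Istar (time \<tau>))) * (1 + y \<tau> w))
     + \<mu> * (time \<tau> powr (\<mu> - \<nu>) * fst w))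
    = calA (fst w) (fst (snd w)) (snd (snd w)) \<tau>"
        unfolding p1 p2 p3 c2_def[symmetric] dI_def[symmetric] by (simp add: algebra_simps)
    qed
  qed
qed

text \<open>A difference of powers of \<open>1 + y\<close> vanishes with y, and the factor y is
  split off explicitly because dividing by y is impossible at \<open>r = 0\<close>. One cofactor is
  expandable to every order.\<close>

lemma one_plus_y_power_diff:
  "\<exists>G. (\<forall>m. expandable m G) \<and>
     (\<forall>\<^sub>F \<tau> in at_top. \<forall>w\<in>P. (1 + y \<tau> w) ^ k / (1 + y \<tau> w) ^ j - 1 = y \<tau> w * G \<tau> w)"
proof (induction k)
  case 0
  show ?case
  proof (induction j)
    case 0
    show ?case by (rule exI[of _ "\<lambda>\<tau> w. 0"]) simp
  next
    case (Suc j)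
    then obtain G where G: "\<And>m. expandable m G"
      "\<forall>\<^sub>F \<tau> in at_top. \<forall>w\<in>P. (1 + y \<tau> w) ^ 0 / (1 + y \<tau> w) ^ j - 1 = y \<tau> w * G \<tau> w" by blast
    have "\<forall>\<^sub>F \<tau> in at_top. \<forall>w\<in>P. (1 + y \<tau> w) ^ 0 / (1 + y \<tau> w) ^ Suc j - 1
        = y \<tau> w * ((G \<tau> w - 1) * (1 / (1 + y \<tau> w)))"
      using G(2) y_small
    proof eventually_elim
      case (elim \<tau>)
      show ?case
      proof
        fix w assume w: "w \<in> P"
        then have "1 / (1 + y \<tau> w) ^ j = 1 + y \<tau> w * G \<tau> w" using elim(1) by (simp add: diff_eq_eq add.commute)
        moreover have "1 / (1 + y \<tau> w) ^ Suc j = 1 / (1 + y \<tau> w) ^ j * (1 / (1 + y \<tau> w))" by simp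
        ultimately have "1 / (1 + y \<tau> w) ^ Suc j = (1 + y \<tau> w * G \<tau> w) * (1 / (1 + y \<tau> w))" by (simp only:)
        moreover have "1 + y \<tau> w \<noteq> 0" using elim(2) w by fastforce
        ultimately show "(1 + y \<tau> w) ^ 0 / (1 + y \<tau> w) ^ Suc j - 1 = y \<tau> w * ((G \<tau> w - 1) * (1 / (1 + y \<tau> w)))"
          by (simp add: field_simps)
      qed
    qed
    moreover have "expandable m (\<lambda>\<tau> w. (G \<tau> w - 1) * (1 / (1 + y \<tau> w)))" for m
      by (intro expandable_mult expandable_diff G(1) expandable_const' expandable_inverse_y)
    ultimately show ?case by blast
  qed
next
  case (Suc k)
  then obtain G where G: "\<And>m. expandable m G"
    "\<forall>\<^sub>F \<tau> in at_top. \<forall>w\<in>P. (1 + y \<tau> w) ^ k / (1 + y \<tau> w) ^ j - 1 = y \<tau> w * G \<tau> w" by blast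
  have "\<forall>\<^sub>F \<tau> in at_top. \<forall>w\<in>P. (1 + y \<tau> w) ^ Suc k / (1 + y \<tau> w) ^ j - 1 = y \<tau> w * (G \<tau> w * (1 + y \<tau> w) + 1)"
    using G(2)
  proof eventually_elim
    case (elim \<tau>)
    show ?case
    proof
      fix w assume w: "w \<in> P"
      then have "(1 + y \<tau> w) ^ k / (1 + y \<tau> w) ^ j = 1 + y \<tau> w * G \<tau> w" using elim(1) by (simp add: diff_eq_eq add.commute)
      then have "(1 + y \<tau> w) ^ Suc k / (1 + y \<tau> w) ^ j = (1 + y \<tau> w) * (1 + y \<tau> w * G \<tau> w)"
        by (simp only: power_Suc times_divide_eq_right[symmetric])
      then show "(1 + y \<tau> w) ^ Suc k / (1 + y \<tau> w) ^ j - 1 = y \<tau> w * (G \<tau> w * (1 + y \<tau> w) + 1)"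
        by (simp add: algebra_simps)
    qed
  qed
  moreover have "expandable m (\<lambda>\<tau> w. G \<tau> w * (1 + y \<tau> w) + 1)" for m
    by (intro expandable_mult expandable_add G(1) expandable_const' expandable_y)
  ultimately show ?case by blast
qed

text \<open>Each of the two frequencies is bounded after scaling by \<open>Z ^ (h - 1)\<close>, so
  the factor \<open>time \<tau> powr \<mu>\<close> would spoil it. Their difference carries a factor
  \<open>y\<close>, and \<open>time \<tau> powr \<mu> * y \<tau> w\<close> is just r.\<close>

lemma \<omega>_difference:
  "expandable m (\<lambda>\<tau> w. time \<tau> powr \<mu> * (Z \<tau> ^ (h - 1) * (\<omega> (energy \<tau> w) - \<omega> (Istar (time \<tau>)))))"
proof -
  \<comment> \<open>The truncation errors do not contain the factor y and are multiplied by
    \<open>time \<tau> powr \<mu>\<close>, which costs M orders.\<close>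
  define n where "n = m + M"
  have "\<forall>j. \<exists>G. (\<forall>m. expandable m G) \<and>
     (\<forall>\<^sub>F \<tau> in at_top. \<forall>w\<in>P. (1 + y \<tau> w) ^ (h - 1) / (1 + y \<tau> w) ^ j - 1 = y \<tau> w * G \<tau> w)"
    using one_plus_y_power_diff by blast
  from choice[OF this] obtain G where "\<forall>j. (\<forall>m. expandable m (G j)) \<and>
    (\<forall>\<^sub>F \<tau> in at_top. \<forall>w\<in>P. (1 + y \<tau> w) ^ (h - 1) / (1 + y \<tau> w) ^ j - 1 = y \<tau> w * G j \<tau> w)" ..
  then have G: "\<And>j m. expandable m (G j)"
    "\<And>j. \<forall>\<^sub>F \<tau> in at_top. \<forall>w\<in>P. (1 + y \<tau> w) ^ (h - 1) / (1 + y \<tau> w) ^ j - 1 = y \<tau> w * G j \<tau> w"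
    by blast+
  have Gn: "\<forall>\<^sub>F \<tau> in at_top. \<forall>j\<in>{..n}. \<forall>w\<in>P. (1 + y \<tau> w) ^ (h - 1) / (1 + y \<tau> w) ^ j - 1 = y \<tau> w * G j \<tau> w"
    by (rule eventually_ball_finite) (use G(2) in auto)
  define RI where "RI \<tau> w = \<omega> (energy \<tau> w) * vI \<tau> w ^ (h - 1) - (\<Sum>j\<le>n. \<omega>coef j * vI \<tau> w ^ j)" for \<tau> w
  define RS where "RS \<tau> w = \<omega> (Istar (time \<tau>)) * V \<tau> ^ (h - 1) - (\<Sum>j\<le>n. \<omega>coef j * V \<tau> ^ j)" for \<tau> and w :: "real \<times> real \<times> real"
  have RI: "bigO n RI" unfolding RI_def[abs_def] by (rule bigO_\<omega>)
  have RS: "bigO n RS"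
  proof -
    have EA: "energy_asymptotics h ((real h - 1) / (2 * real h)) (\<lambda>\<phi>. \<omega>) (\<lambda>j \<phi>. \<omega>coef j)"
      using \<omega>_asymp unfolding energy_asymptotics_C1_def by blast
    have h0: "0 < h" using h by simp
    have L: "\<forall>\<^sub>F \<tau> in at_top. \<forall>w\<in>P. K \<le> Istar (time \<tau>)" for K
      using Istar_time_large[of K] by eventually_elim simp
    have V1: "\<forall>\<^sub>F \<tau> in at_top. \<forall>w\<in>P. Istar (time \<tau>) powr (- (1 / (2 * real h))) = V \<tau>" by (simp add: V_def)
    note E = expandable_energy(2)[OF EA h0 bdd_on_const L expandable_V bigO_V V1, of n]
    show ?thesis
    proof (rule bigO_cong[OF _ E])
      show "\<forall>\<^sub>F \<tau> in at_top. \<forall>w\<in>P. \<omega> (Istar (time \<tau>)) * Istar (time \<tau>) powr (- ((real h - 1) / (2 * real h)))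
          - (\<Sum>j\<le>n. \<omega>coef j * V \<tau> ^ j) = RS \<tau> w"
        using Istar_time_large[of 1]
      proof eventually_elim
        case (elim \<tau>)
        have "V \<tau> ^ (h - 1) = Istar (time \<tau>) powr (- ((real h - 1) / (2 * real h)))"
          unfolding V_def using elim h by (simp add: powr_powr of_nat_diff flip: powr_realpow)
        then show ?case by (simp add: RS_def)
      qed
    qed
  qed
  have tM: "time \<tau> powr \<mu> = 1 / (cM * z \<tau> ^ M)" if "0 < \<tau>" for \<tau>
  proof -
    have "- \<mu> * D = - real M" by (simp add: M_eq)
    from time_powr[OF that this] have "time \<tau> powr (- \<mu>) = cM * z \<tau> ^ M" by (simp only: cM_def)
    moreover have "time \<tau> powr \<mu> = 1 / time \<tau> powr (- \<mu>)" by (simp add: powr_minus_divide)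
    ultimately show ?thesis by simp
  qed
  have cM: "0 < cM" using \<nu>_pos by (simp add: cM_def)
  have rem: "expandable m (\<lambda>\<tau> w. 1 / cM * ((zw \<tau> w ^ (h - 1) * RI \<tau> w - (1 / Q \<tau>) ^ (h - 1) * RS \<tau> w) / z \<tau> ^ M))"
  proof (intro expandable_bigO bigO_cmult bigO_divide_zpow)
    have Qi: "expandable 0 (\<lambda>\<tau> p. 1 / Q \<tau>)"
      by (rule expandable_inverse[where \<delta> = "Q0 / 2"])
        (use Q_bounds Q0_pos expandable_Q in \<open>auto elim!: eventually_mono\<close>)
    have "bigO (0 + n) (\<lambda>\<tau> w. zw \<tau> w ^ (h - 1) * RI \<tau> w)"
      by (rule bigO_mult[OF expandable_imp_bigO[OF expandable_power[OF expandable_zw]] RI])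
    moreover have "bigO (0 + n) (\<lambda>\<tau> w. (1 / Q \<tau>) ^ (h - 1) * RS \<tau> w)"
      by (rule bigO_mult[OF expandable_imp_bigO[OF expandable_power[OF Qi]] RS])
    ultimately have "bigO n (\<lambda>\<tau> w. zw \<tau> w ^ (h - 1) * RI \<tau> w + (- 1) * ((1 / Q \<tau>) ^ (h - 1) * RS \<tau> w))"
      by (intro bigO_add bigO_cmult) simp_all
    then show "bigO (m + M) (\<lambda>\<tau> w. zw \<tau> w ^ (h - 1) * RI \<tau> w - (1 / Q \<tau>) ^ (h - 1) * RS \<tau> w)"
      by (simp add: n_def)
  qed
  have Qi: "expandable m (\<lambda>\<tau> p. 1 / Q \<tau>)"
    by (rule expandable_inverse[where \<delta> = "Q0 / 2"])
      (use Q_bounds Q0_pos expandable_Q in \<open>auto elim!: eventually_mono\<close>)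
  have "bdd_on fst" by (rule bdd_onI[of _ d]) (auto simp: P)
  then have main: "expandable m (\<lambda>\<tau> w. fst w * ((1 / Q \<tau>) ^ (h - 1) * (\<Sum>j\<le>n. \<omega>coef j * (V \<tau> ^ j * G j \<tau> w))))"
    by (intro expandable_mult[OF expandable_const] expandable_mult[OF expandable_power[OF Qi]] expandable_sum
        expandable_mult[OF expandable_const'] expandable_mult[OF expandable_power[OF expandable_V]] G(1))
  show ?thesis
  proof (rule expandable_cong[OF _ expandable_add[OF main rem]])
    show "\<forall>\<^sub>F \<tau> in at_top. \<forall>w\<in>P. fst w * ((1 / Q \<tau>) ^ (h - 1) * (\<Sum>j\<le>n. \<omega>coef j * (V \<tau> ^ j * G j \<tau> w)))
       + 1 / cM * ((zw \<tau> w ^ (h - 1) * RI \<tau> w - (1 / Q \<tau>) ^ (h - 1) * RS \<tau> w) / z \<tau> ^ M)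
      = time \<tau> powr \<mu> * (Z \<tau> ^ (h - 1) * (\<omega> (energy \<tau> w) - \<omega> (Istar (time \<tau>))))"
      using regular Gn
    proof eventually_elim
      case (elim \<tau>)
      show ?case
      proof
        fix w assume w: "w \<in> P"
        have \<tau>: "0 < \<tau>" and V: "0 < V \<tau>" "V \<tau> = Z \<tau> * Q \<tau>" and Z: "0 < Z \<tau>" using elim by blast+
        have y: "0 < 1 + y \<tau> w" and v: "0 < vI \<tau> w" "vI \<tau> w * (1 + y \<tau> w) = V \<tau>" using elim w by blast+
        have Q: "1 / Q \<tau> = Z \<tau> / V \<tau>" using V Z by (simp add: field_simps)
        have zw: "zw \<tau> w = Z \<tau> / V \<tau> * (1 + y \<tau> w)" unfolding zw_def v(2)[symmetric] using y v(1) by simp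
        let ?k = "(Z \<tau> / V \<tau>) ^ (h - 1)"
        have t: "time \<tau> powr \<mu> * y \<tau> w = fst w"
          using time_pos[OF \<tau>] by (simp add: y_def powr_minus)
        have I: "Z \<tau> ^ (h - 1) * \<omega> (energy \<tau> w) = zw \<tau> w ^ (h - 1) * ((\<Sum>j\<le>n. \<omega>coef j * vI \<tau> w ^ j) + RI \<tau> w)"
          unfolding RI_def zw_def using v(1) by (simp add: power_divide)
        have S: "Z \<tau> ^ (h - 1) * \<omega> (Istar (time \<tau>)) = ?k * ((\<Sum>j\<le>n. \<omega>coef j * V \<tau> ^ j) + RS \<tau> w)"
          unfolding RS_def using V(1) by (simp add: power_divide)
        have "zw \<tau> w ^ (h - 1) * (\<Sum>j\<le>n. \<omega>coef j * vI \<tau> w ^ j) - ?k * (\<Sum>j\<le>n. \<omega>coef j * V \<tau> ^ j)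
            = ?k * (\<Sum>j\<le>n. \<omega>coef j * (V \<tau> ^ j * ((1 + y \<tau> w) ^ (h - 1) / (1 + y \<tau> w) ^ j - 1)))"
        proof -
          have vI: "vI \<tau> w = V \<tau> / (1 + y \<tau> w)" by (simp add: vI_def)
          have "zw \<tau> w ^ (h - 1) * (\<Sum>j\<le>n. \<omega>coef j * vI \<tau> w ^ j) - ?k * (\<Sum>j\<le>n. \<omega>coef j * V \<tau> ^ j)
            = ?k * ((\<Sum>j\<le>n. (1 + y \<tau> w) ^ (h - 1) * (\<omega>coef j * vI \<tau> w ^ j)) - (\<Sum>j\<le>n. \<omega>coef j * V \<tau> ^ j))"
            unfolding zw power_mult_distrib sum_distrib_left[symmetric] by (simp only: right_diff_distrib mult.assoc)
          also have "(\<Sum>j\<le>n. (1 + y \<tau> w) ^ (h - 1) * (\<omega>coef j * vI \<tau> w ^ j)) - (\<Sum>j\<le>n. \<omega>coef j * V \<tau> ^ j)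
            = (\<Sum>j\<le>n. \<omega>coef j * (V \<tau> ^ j * ((1 + y \<tau> w) ^ (h - 1) / (1 + y \<tau> w) ^ j - 1)))"
            unfolding sum_subtractf[symmetric] vI by (intro sum.cong refl) (simp add: power_divide right_diff_distrib)
          finally show ?thesis .
        qed
        also have "(\<Sum>j\<le>n. \<omega>coef j * (V \<tau> ^ j * ((1 + y \<tau> w) ^ (h - 1) / (1 + y \<tau> w) ^ j - 1)))
            = y \<tau> w * (\<Sum>j\<le>n. \<omega>coef j * (V \<tau> ^ j * G j \<tau> w))"
          unfolding sum_distrib_left using elim(2) w by (intro sum.cong refl) simp
        finally have main: "zw \<tau> w ^ (h - 1) * (\<Sum>j\<le>n. \<omega>coef j * vI \<tau> w ^ j) - ?k * (\<Sum>j\<le>n. \<omega>coef j * V \<tau> ^ j)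
            = ?k * (y \<tau> w * (\<Sum>j\<le>n. \<omega>coef j * (V \<tau> ^ j * G j \<tau> w)))" .
        have "Z \<tau> ^ (h - 1) * (\<omega> (energy \<tau> w) - \<omega> (Istar (time \<tau>)))
            = ?k * (y \<tau> w * (\<Sum>j\<le>n. \<omega>coef j * (V \<tau> ^ j * G j \<tau> w))) + (zw \<tau> w ^ (h - 1) * RI \<tau> w - ?k * RS \<tau> w)"
          unfolding right_diff_distrib I S main[symmetric] by (simp add: distrib_left)
        then have e: "time \<tau> powr \<mu> * (Z \<tau> ^ (h - 1) * (\<omega> (energy \<tau> w) - \<omega> (Istar (time \<tau>))))
            = (time \<tau> powr \<mu> * y \<tau> w) * (?k * (\<Sum>j\<le>n. \<omega>coef j * (V \<tau> ^ j * G j \<tau> w)))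
              + time \<tau> powr \<mu> * (zw \<tau> w ^ (h - 1) * RI \<tau> w - ?k * RS \<tau> w)"
          by (simp only: distrib_left ac_simps)
        show "fst w * ((1 / Q \<tau>) ^ (h - 1) * (\<Sum>j\<le>n. \<omega>coef j * (V \<tau> ^ j * G j \<tau> w)))
       + 1 / cM * ((zw \<tau> w ^ (h - 1) * RI \<tau> w - (1 / Q \<tau>) ^ (h - 1) * RS \<tau> w) / z \<tau> ^ M)
      = time \<tau> powr \<mu> * (Z \<tau> ^ (h - 1) * (\<omega> (energy \<tau> w) - \<omega> (Istar (time \<tau>))))"
          unfolding e t Q by (simp add: tM[OF \<tau>])
      qed
    qed
  qed
qed

text \<open>The product of \<omega> with the bracket has weight \<open>deg - h\<close>, the weight
  balanced in \<open>time_key\<close>, and a decaying factor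
  \<open>time \<tau> powr (- \<mu>)\<close> is left over.\<close>

lemma expandable_calB_G:
  "expandable m (\<lambda>\<tau> w. time \<tau> powr (1 - \<nu> + \<mu> - real a / real q) * G (energy \<tau> w) (angle w) (phase w) (time \<tau>))"
proof (rule expandable_cong)
  have "expandable m (\<lambda>\<tau> w. time \<tau> powr (- \<mu>))" by (rule expandable_time[of _ M]) (simp add: M_eq)
  then show "expandable m (\<lambda>\<tau> w. time \<tau> powr (- \<mu>) * ((\<omega> (energy \<tau> w) * vI \<tau> w ^ (h - 1) * (
    f (X (angle w) (energy \<tau> w)) (Y (angle w) (energy \<tau> w)) (phase w) (time \<tau>) * vI \<tau> w ^ deg / vI \<tau> w ^ (h - 1)
       * (deriv (Y (angle w)) (energy \<tau> w) / vI \<tau> w ^ h)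
     - g (X (angle w) (energy \<tau> w)) (Y (angle w) (energy \<tau> w)) (phase w) (time \<tau>) * vI \<tau> w ^ deg
       * (deriv (X (angle w)) (energy \<tau> w) / vI \<tau> w ^ (2 * h - 1)))) * (zw \<tau> w ^ deg * (vI \<tau> w / Z \<tau>) ^ h)))"
    by (intro expandable_mult[OF _ expandable_mult[OF expandable_mult[OF expandable_\<omega> expandable_diff[OF expandable_mult[OF expandable_f expandable_YE]
          expandable_mult[OF expandable_g expandable_XE]]] expandable_mult[OF expandable_power[OF expandable_zw]
          expandable_power[OF expandable_zw_inverse]]]])
  show "\<forall>\<^sub>F \<tau> in at_top. \<forall>w\<in>P. time \<tau> powr (- \<mu>) * ((\<omega> (energy \<tau> w) * vI \<tau> w ^ (h - 1) * (
    f (X (angle w) (energy \<tau> w)) (Y (angle w) (energy \<tau> w)) (phase w) (time \<tau>) * vI \<tau> w ^ deg / vI \<tau> w ^ (h - 1)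
       * (deriv (Y (angle w)) (energy \<tau> w) / vI \<tau> w ^ h)
     - g (X (angle w) (energy \<tau> w)) (Y (angle w) (energy \<tau> w)) (phase w) (time \<tau>) * vI \<tau> w ^ deg
       * (deriv (X (angle w)) (energy \<tau> w) / vI \<tau> w ^ (2 * h - 1)))) * (zw \<tau> w ^ deg * (vI \<tau> w / Z \<tau>) ^ h))
    = time \<tau> powr (1 - \<nu> + \<mu> - real a / real q) * G (energy \<tau> w) (angle w) (phase w) (time \<tau>)"
    using regular
  proof eventually_elim
    case (elim \<tau>)
    show ?case
    proof
      fix w assume w: "w \<in> P"
      define v where "v = vI \<tau> w"
      have v: "0 < v" and Z: "0 < Z \<tau>" and \<tau>: "0 < \<tau>" using elim w unfolding v_def by blast+
      define f' where "f' = f (X (angle w) (energy \<tau> w)) (Y (angle w) (energy \<tau> w)) (phase w) (time \<tau>)"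
      define g' where "g' = g (X (angle w) (energy \<tau> w)) (Y (angle w) (energy \<tau> w)) (phase w) (time \<tau>)"
      define X' where "X' = deriv (X (angle w)) (energy \<tau> w)"
      define Y' where "Y' = deriv (Y (angle w)) (energy \<tau> w)"
      define o' where "o' = \<omega> (energy \<tau> w)"
      define k where "k = time \<tau> powr (1 - \<nu> + 2 * \<mu> - real a / real q)"
      have k: "k * Z \<tau> ^ (2 * h) = Z \<tau> ^ (deg + h)" unfolding k_def by (rule time_key[OF \<tau>])
      have "(k * Z \<tau> ^ h) * Z \<tau> ^ h = Z \<tau> ^ deg * Z \<tau> ^ h" using k by (simp add: power_add mult_2)
      then have k: "k * Z \<tau> ^ h = Z \<tau> ^ deg" using Z by simp
      have "v ^ (2 * h - 1) = v ^ (h - 1) * v ^ h"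
        by (rule power_split) (use h in simp)
      then have "o' * v ^ (h - 1) * (f' * v ^ deg / v ^ (h - 1) * (Y' / v ^ h) - g' * v ^ deg * (X' / v ^ (2 * h - 1)))
          = o' * (f' * Y' - g' * X') * (v ^ deg / v ^ h)"
        using v by (simp add: algebra_simps diff_divide_distrib)
      moreover have "(v ^ deg / v ^ h) * ((Z \<tau> / v) ^ deg * (v / Z \<tau>) ^ h) = k"
        unfolding power_divide k[symmetric] using v Z by (simp add: field_simps)
      ultimately have "o' * v ^ (h - 1) * (f' * v ^ deg / v ^ (h - 1) * (Y' / v ^ h) - g' * v ^ deg * (X' / v ^ (2 * h - 1)))
          * ((Z \<tau> / v) ^ deg * (v / Z \<tau>) ^ h) = o' * (f' * Y' - g' * X') * k"
        by (simp only: mult.assoc)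
      moreover have "time \<tau> powr (1 - \<nu> + \<mu> - real a / real q) = time \<tau> powr (- \<mu>) * k"
        unfolding k_def by (simp only: powr_add[symmetric]) (simp add: algebra_simps)
      ultimately have "time \<tau> powr (- \<mu>) * (o' * v ^ (h - 1) * (f' * v ^ deg / v ^ (h - 1) * (Y' / v ^ h) - g' * v ^ deg * (X' / v ^ (2 * h - 1)))
          * ((Z \<tau> / v) ^ deg * (v / Z \<tau>) ^ h)) = time \<tau> powr (1 - \<nu> + \<mu> - real a / real q) * (o' * (f' * Y' - g' * X'))"
        by (simp only: ac_simps)
      then show "time \<tau> powr (- \<mu>) * ((\<omega> (energy \<tau> w) * vI \<tau> w ^ (h - 1) * (
    f (X (angle w) (energy \<tau> w)) (Y (angle w) (energy \<tau> w)) (phase w) (time \<tau>) * vI \<tau> w ^ deg / vI \<tau> w ^ (h - 1)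
       * (deriv (Y (angle w)) (energy \<tau> w) / vI \<tau> w ^ h)
     - g (X (angle w) (energy \<tau> w)) (Y (angle w) (energy \<tau> w)) (phase w) (time \<tau>) * vI \<tau> w ^ deg
       * (deriv (X (angle w)) (energy \<tau> w) / vI \<tau> w ^ (2 * h - 1)))) * (zw \<tau> w ^ deg * (vI \<tau> w / Z \<tau>) ^ h))
    = time \<tau> powr (1 - \<nu> + \<mu> - real a / real q) * G (energy \<tau> w) (angle w) (phase w) (time \<tau>)"
        unfolding G zw_def v_def f'_def g'_def X'_def Y'_def o'_def .
    qed
  qed
qed

lemma expandable_calB: "expandable m (\<lambda>\<tau> w. calB (fst w) (fst (snd w)) (snd (snd w)) \<tau>)"
proof (rule expandable_cong)
  show "expandable m (\<lambda>\<tau> w. cM * (time \<tau> powr \<mu> * (Z \<tau> ^ (h - 1) * (\<omega> (energy \<tau> w) - \<omega> (Istar (time \<tau>))))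
     + time \<tau> powr (1 - \<nu> + \<mu> - real a / real q) * G (energy \<tau> w) (angle w) (phase w) (time \<tau>)))"
    by (intro expandable_mult[OF expandable_const'] expandable_add \<omega>_difference expandable_calB_G)
  show "\<forall>\<^sub>F \<tau> in at_top. \<forall>w\<in>P. cM * (time \<tau> powr \<mu> * (Z \<tau> ^ (h - 1) * (\<omega> (energy \<tau> w) - \<omega> (Istar (time \<tau>))))
     + time \<tau> powr (1 - \<nu> + \<mu> - real a / real q) * G (energy \<tau> w) (angle w) (phase w) (time \<tau>))
    = calB (fst w) (fst (snd w)) (snd (snd w)) \<tau>"
    using eventually_gt_at_top[of 0]
  proof eventually_elim
    case (elim \<tau>)
    show ?case
    proof
      fix w assume w: "w \<in> P"
      have "- (real b / real q) = 1 - \<nu>" by (simp add: \<nu>_eq)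
      then have Z: "Z \<tau> ^ (h - 1) = time \<tau> powr (1 - \<nu>)" by (simp only: Z_power_h[OF elim])
      have p: "time \<tau> powr (1 - \<nu> + \<mu> - real a / real q) = time \<tau> powr \<mu> * time \<tau> powr (1 - \<nu>) * time \<tau> powr (- (real a / real q))"
        by (simp only: powr_add[symmetric]) (simp add: algebra_simps)
      have "calB (fst w) (fst (snd w)) (snd (snd w)) \<tau> = cM * time \<tau> powr \<mu> *
                  (time \<tau> powr (1 - \<nu>) * (\<omega> (energy \<tau> w) - \<omega> (Istar (time \<tau>))
                    + time \<tau> powr (- (real a / real q)) * G (energy \<tau> w) (angle w) (phase w) (time \<tau>)))"
        unfolding calB Let_def \<tau>_powr[OF elim] cM_def energy_def angle_def phase_def ..
      then show "cM * (time \<tau> powr \<mu> * (Z \<tau> ^ (h - 1) * (\<omega> (energy \<tau> w) - \<omega> (Istar (time \<tau>))))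
     + time \<tau> powr (1 - \<nu> + \<mu> - real a / real q) * G (energy \<tau> w) (angle w) (phase w) (time \<tau>))
    = calB (fst w) (fst (snd w)) (snd (snd w)) \<tau>"
        unfolding Z p by (simp add: algebra_simps)
    qed
  qed
qed

end

section \<open>The averaging transformation\<close>

lemma shifted_series_nth: "shifted_series M c $ k = (if k < M then 0 else c (k - M))"
  by (simp add: shifted_series_def fps_X_power_mult_nth)

lemma fps_X_mult_deriv_nth: "(fps_X * fps_deriv F) $ k = of_nat k * F $ k"
  by (cases k) (simp_all add: mult.commute)

lemma fps_mult_nth_low:
  fixes F G :: "real fps"
  assumes "\<And>j. j < i \<Longrightarrow> G $ j = 0" "k < i"
  shows "(F * G) $ k = 0" "(G * F) $ k = 0"
  unfolding fps_mult_nth using assms by (auto intro!: sum.neutral)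

text \<open>Series without constant term raise the order by at least one per factor, so a term does
  not reach below any of its three exponents. This makes different truncations of the composition
  agree.\<close>

lemma fps_composition_term_low:
  fixes P Q :: "real fps"
  assumes "P $ 0 = 0" "Q $ 0 = 0" "k < M \<or> k < i \<or> k < j"
  shows "(fps_X ^ M * c * P ^ i * Q ^ j) $ k = 0"
proof -
  have P: "(P ^ i) $ k' = 0" if "k' < i" for k' using startsby_zero_power_prefix[OF assms(1)] that by blast
  have Q: "(Q ^ j) $ k' = 0" if "k' < j" for k' using startsby_zero_power_prefix[OF assms(2)] that by blast
  have X: "(fps_X ^ M :: real fps) $ k' = 0" if "k' < M" for k' using that by simp
  have "(fps_X ^ M * c) $ k' = 0" if "k' < M" for k' by (rule fps_mult_nth_low(2)[OF X that])
  then have X': "(fps_X ^ M * c * P ^ i) $ k' = 0" if "k' < M" for k' by (rule fps_mult_nth_low(2)[OF _ that])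
  have P': "(fps_X ^ M * c * P ^ i) $ k' = 0" if "k' < i" for k' by (rule fps_mult_nth_low(1)[OF P that])
  consider "k < M" | "k < i" | "k < j" using assms(3) by blast
  then show ?thesis
    by cases (rule fps_mult_nth_low(2)[OF X'] fps_mult_nth_low(2)[OF P'] fps_mult_nth_low(1)[OF Q]; assumption)+
qed

text \<open>The definition cuts the sums at the order of the coefficient. One common cut, valid for
  all orders that matter, is needed to compare with the analytic Taylor sum.\<close>

lemma formal_composition_nth:
  assumes "P $ 0 = 0" "Q $ 0 = 0" "k < M + n + 1"
  shows "formal_composition M L P Q r \<theta> $ k =
    (\<Sum>K\<le>n. \<Sum>i<M + n + 1. \<Sum>j<M + n + 1.
       fps_X ^ (M + K) * fps_const (mixed_deriv i j (L K) r \<theta> / (fact i * fact j)) * P ^ i * Q ^ j) $ k"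
proof -
  let ?m = "M + n + 1"
  let ?t = "\<lambda>K i j. (fps_X ^ (M + K) * fps_const (mixed_deriv i j (L K) r \<theta> / (fact i * fact j)) * P ^ i * Q ^ j) $ k"
  have 0: "?t K i j = 0" if "k < M + K \<or> k < i \<or> k < j" for K i j
    by (rule fps_composition_term_low[OF assms(1,2) that])
  have sub: "(\<Sum>K\<in>A. \<Sum>i\<in>I. \<Sum>j\<in>I. ?t K i j) = (\<Sum>K\<le>?m. \<Sum>i\<le>?m. \<Sum>j\<le>?m. ?t K i j)"
    if A: "A \<subseteq> {..?m}" "\<And>K. K \<notin> A \<Longrightarrow> k < M + K" and I: "I \<subseteq> {..?m}" "\<And>i. i \<notin> I \<Longrightarrow> k < i" for A I
  proof -
    have "(\<Sum>j\<in>I. ?t K i j) = (\<Sum>j\<le>?m. ?t K i j)" for K i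
      by (rule sum.mono_neutral_left) (use I 0 in auto)
    moreover have "(\<Sum>i\<in>I. \<Sum>j\<le>?m. ?t K i j) = (\<Sum>i\<le>?m. \<Sum>j\<le>?m. ?t K i j)" for K
      by (rule sum.mono_neutral_left) (use I 0 in \<open>auto intro!: sum.neutral\<close>)
    moreover have "(\<Sum>K\<in>A. \<Sum>i\<le>?m. \<Sum>j\<le>?m. ?t K i j) = (\<Sum>K\<le>?m. \<Sum>i\<le>?m. \<Sum>j\<le>?m. ?t K i j)"
      by (rule sum.mono_neutral_left) (use A 0 in \<open>auto intro!: sum.neutral\<close>)
    ultimately show ?thesis by simp
  qed
  have "formal_composition M L P Q r \<theta> $ k = (\<Sum>K\<in>{..k}. \<Sum>i\<in>{..k}. \<Sum>j\<in>{..k}. ?t K i j)"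
    by (simp add: formal_composition_def)
  also have "\<dots> = (\<Sum>K\<le>?m. \<Sum>i\<le>?m. \<Sum>j\<le>?m. ?t K i j)" by (rule sub) (use assms(3) in auto)
  also have "\<dots> = (\<Sum>K\<in>{..n}. \<Sum>i\<in>{..<?m}. \<Sum>j\<in>{..<?m}. ?t K i j)" by (rule sub[symmetric]) (use assms(3) in auto)
  finally show ?thesis by (simp add: fps_sum_nth)
qed

text \<open>The strip \<open>\<bar>r\<bar> \<le> 2\<close> leaves room around the set
  \<open>\<bar>R\<bar> \<le> 1\<close> on which the inverse of the averaging map is used.\<close>

locale averaging = small_parameter z P
  for z :: "real \<Rightarrow> real" and P :: "(real \<times> real \<times> real) set" +
  fixes M N n varkappa :: nat and vartheta :: real
    and calA calB :: "real \<Rightarrow> real \<Rightarrow> real \<Rightarrow> real \<Rightarrow> real"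
    and \<Lambda> \<Omega> :: "nat \<Rightarrow> real \<Rightarrow> real \<Rightarrow> real"
    and \<rho> \<psi> :: "nat \<Rightarrow> real \<Rightarrow> real \<Rightarrow> real \<Rightarrow> real"
  assumes z: "z = (\<lambda>\<tau>. \<tau> powr (- (1 / real N)))" and P: "P = {- 2..2} \<times> UNIV \<times> UNIV"
    and M: "0 < M" and N: "0 < N" and varkappa: "0 < varkappa"
    and calA: "\<And>m. expandable m (\<lambda>\<tau> w. calA (fst w) (fst (snd w)) (snd (snd w)) \<tau>)"
    and calB: "\<And>m. expandable m (\<lambda>\<tau> w. calB (fst w) (fst (snd w)) (snd (snd w)) \<tau>)"
    and averaging: "averaging_functions M N vartheta varkappa
                      (\<lambda>K r \<theta> \<zeta>. expansion_coeff N (calA r \<theta> \<zeta>) K)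
                      (\<lambda>K r \<theta> \<zeta>. expansion_coeff N (calB r \<theta> \<zeta>) K) \<Lambda> \<Omega> \<rho> \<psi>"
begin

lemma smooth: "smooth_on (\<lambda>(r, \<theta>). \<Lambda> K r \<theta>) UNIV" "smooth_on (\<lambda>(r, \<theta>). \<Omega> K r \<theta>) UNIV"
  "smooth_on (\<lambda>(r, \<theta>, \<zeta>). \<rho> K r \<theta> \<zeta>) UNIV" "smooth_on (\<lambda>(r, \<theta>, \<zeta>). \<psi> K r \<theta> \<zeta>) UNIV"
  using averaging unfolding averaging_functions_def by blast+

lemma per: "periodic (2 * pi) (\<Lambda> K r)" "periodic (2 * pi) (\<Omega> K r)"
  "periodic (2 * pi) (\<lambda>\<theta>. \<rho> K r \<theta> \<zeta>)" "periodic (2 * pi) (\<lambda>\<theta>. \<psi> K r \<theta> \<zeta>)"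
  "periodic (2 * pi * real varkappa) (\<rho> K r \<theta>)" "periodic (2 * pi * real varkappa) (\<psi> K r \<theta>)"
  using averaging unfolding averaging_functions_def by blast+

lemma identities:
  defines "SP \<equiv> \<lambda>w r \<theta> \<zeta>. shifted_series M (\<lambda>K. (w :: nat \<Rightarrow> real \<Rightarrow> real \<Rightarrow> real \<Rightarrow> real) K r \<theta> \<zeta>)"
  shows "formal_derivative M N vartheta (\<lambda>K r \<theta> \<zeta>. expansion_coeff N (calA r \<theta> \<zeta>) K)
     (\<lambda>K r \<theta> \<zeta>. expansion_coeff N (calB r \<theta> \<zeta>) K) 1 0 \<rho> r \<theta> \<zeta>
     = formal_composition M \<Lambda> (SP \<rho> r \<theta> \<zeta>) (SP \<psi> r \<theta> \<zeta>) r \<theta>"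
   "formal_derivative M N vartheta (\<lambda>K r \<theta> \<zeta>. expansion_coeff N (calA r \<theta> \<zeta>) K)
     (\<lambda>K r \<theta> \<zeta>. expansion_coeff N (calB r \<theta> \<zeta>) K) 0 1 \<psi> r \<theta> \<zeta>
     = formal_composition M \<Omega> (SP \<rho> r \<theta> \<zeta>) (SP \<psi> r \<theta> \<zeta>) r \<theta>"
  using averaging unfolding averaging_functions_def Let_def SP_def by blast+

lemma z_power: "0 < \<tau> \<Longrightarrow> z \<tau> ^ k = \<tau> powr (- (real k / real N))"
  unfolding z by (simp add: powr_powr flip: powr_realpow)

text \<open>A class that is closed under the three partial derivatives and whose members are bounded
  on the strip by periodicity.\<close>

definition regular :: "(nat \<Rightarrow> real \<Rightarrow> real \<Rightarrow> real \<Rightarrow> real) \<Rightarrow> bool" where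
  "regular w \<longleftrightarrow> (\<forall>K. smooth_on (\<lambda>(r, \<theta>, \<zeta>). w K r \<theta> \<zeta>) UNIV \<and>
     (\<forall>r \<zeta>. periodic (2 * pi) (\<lambda>\<theta>. w K r \<theta> \<zeta>)) \<and> (\<forall>r \<theta>. periodic (2 * pi * real varkappa) (w K r \<theta>)))"

lemma regular: "regular \<rho>" "regular \<psi>"
  unfolding regular_def using smooth per by auto

lemma regular_bdd:
  assumes "regular w" shows "bdd_on (\<lambda>x. w K (fst x) (fst (snd x)) (snd (snd x)))"
proof -
  have "\<exists>B. \<forall>r \<theta> \<zeta>. \<bar>r\<bar> \<le> 2 \<longrightarrow> \<bar>w K r \<theta> \<zeta>\<bar> \<le> B"
    by (rule bounded_periodic3[OF smooth_on_imp_continuous_on, of _ "2 * pi" "2 * pi * real varkappa"])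
      (use assms varkappa in \<open>auto simp: regular_def\<close>)
  then obtain B where "\<And>r \<theta> \<zeta>. \<bar>r\<bar> \<le> 2 \<Longrightarrow> \<bar>w K r \<theta> \<zeta>\<bar> \<le> B" by blast
  then show ?thesis by (intro bdd_onI[of _ B]) (auto simp: P)
qed

lemma regular_partials:
  assumes "regular w"
  shows "regular (\<lambda>K r \<theta> \<zeta>. deriv (\<lambda>r'. w K r' \<theta> \<zeta>) r)" "regular (\<lambda>K r \<theta> \<zeta>. deriv (\<lambda>\<theta>'. w K r \<theta>' \<zeta>) \<theta>)"
    "regular (\<lambda>K r \<theta> \<zeta>. deriv (w K r \<theta>) \<zeta>)"
proof -
  have p1: "w K r (\<theta> + 2 * pi) \<zeta> = w K r \<theta> \<zeta>" and p2: "w K r \<theta> (\<zeta> + 2 * pi * real varkappa) = w K r \<theta> \<zeta>"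
    for K r \<theta> \<zeta> using assms by (auto simp: regular_def periodic_def)
  have s: "smooth_on (\<lambda>(r, \<theta>, \<zeta>). w K r \<theta> \<zeta>) UNIV" for K using assms by (auto simp: regular_def)
  show "regular (\<lambda>K r \<theta> \<zeta>. deriv (\<lambda>r'. w K r' \<theta> \<zeta>) r)"
    unfolding regular_def using smooth_on_partials3(1)[OF s] by (auto simp: periodic_def p1 p2)
  show "regular (\<lambda>K r \<theta> \<zeta>. deriv (\<lambda>\<theta>'. w K r \<theta>' \<zeta>) \<theta>)"
    unfolding regular_def using smooth_on_partials3(2)[OF s] assms
    by (auto simp: p2 regular_def periodic_def[of "2 * pi * real varkappa"] intro!: periodic_deriv)
  show "regular (\<lambda>K r \<theta> \<zeta>. deriv (w K r \<theta>) \<zeta>)"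
    unfolding regular_def using smooth_on_partials3(3)[OF s] assms
    by (auto simp: regular_def periodic_def[of "2 * pi"] p1 intro!: periodic_deriv)
      (metis (no_types, lifting) ext p1)
qed

definition psum :: "(nat \<Rightarrow> real \<Rightarrow> real \<Rightarrow> real \<Rightarrow> real) \<Rightarrow> real \<Rightarrow> real \<Rightarrow> real \<Rightarrow> real \<Rightarrow> real" where
  "psum w \<tau> r \<theta> \<zeta> = (\<Sum>K\<le>n. z \<tau> ^ (M + K) * w K r \<theta> \<zeta>)"

text \<open>The cut at \<open>n\<close> does not affect coefficients below order
  \<open>M + n + 1\<close>, so the full formal series describes the truncated sum to that
  order.\<close>

lemma expands_psum:
  assumes "\<And>K. bdd_on (\<lambda>x. w K (fst x) (fst (snd x)) (snd (snd x)))"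
  shows "expands (M + n + 1) (\<lambda>\<tau> x. psum w \<tau> (fst x) (fst (snd x)) (snd (snd x)))
    (\<lambda>x. shifted_series M (\<lambda>K. w K (fst x) (fst (snd x)) (snd (snd x))))"
proof (rule expands_cong)
  show "expands (M + n + 1) (\<lambda>\<tau> x. \<Sum>K\<le>n. z \<tau> ^ (M + K) * w K (fst x) (fst (snd x)) (snd (snd x)))
     (\<lambda>x. \<Sum>K\<le>n. fps_X ^ (M + K) * fps_const (w K (fst x) (fst (snd x)) (snd (snd x))))"
    by (intro expands_sum expands_mult expands_power expands_z expands_const assms)
  fix k x assume k: "k < M + n + 1"
  have "(\<Sum>K\<le>n. fps_X ^ (M + K) * fps_const (w K (fst x) (fst (snd x)) (snd (snd x)))) $ k
     = (\<Sum>K\<le>n. if k = M + K then w K (fst x) (fst (snd x)) (snd (snd x)) else 0)"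
    unfolding fps_sum_nth by (intro sum.cong refl) (simp add: fps_X_power_mult_nth)
  also have "\<dots> = (if k < M then 0 else w (k - M) (fst x) (fst (snd x)) (snd (snd x)))"
  proof (cases "k < M")
    case False
    then have "(\<Sum>K\<le>n. if k = M + K then w K (fst x) (fst (snd x)) (snd (snd x)) else 0)
       = (\<Sum>K\<le>n. if k - M = K then w K (fst x) (fst (snd x)) (snd (snd x)) else 0)"
      by (intro sum.cong refl) auto
    also have "\<dots> = w (k - M) (fst x) (fst (snd x)) (snd (snd x))" using k False by simp
    finally show ?thesis using False by simp
  qed simp
  finally show "(\<Sum>K\<le>n. fps_X ^ (M + K) * fps_const (w K (fst x) (fst (snd x)) (snd (snd x)))) $ k
     = shifted_series M (\<lambda>K. w K (fst x) (fst (snd x)) (snd (snd x))) $ k"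
    by (simp add: shifted_series_nth)
qed (simp add: psum_def)

lemma bigO_psum:
  assumes "regular w" shows "bigO 1 (\<lambda>\<tau> x. psum w \<tau> (fst x) (fst (snd x)) (snd (snd x)))"
proof -
  have "expands (M + n + 1) (\<lambda>\<tau> x. psum w \<tau> (fst x) (fst (snd x)) (snd (snd x)))
    (\<lambda>x. shifted_series M (\<lambda>K. w K (fst x) (fst (snd x)) (snd (snd x))))"
    by (rule expands_psum[OF regular_bdd[OF assms]])
  then have "expands 1 (\<lambda>\<tau> x. psum w \<tau> (fst x) (fst (snd x)) (snd (snd x)))
    (\<lambda>x. shifted_series M (\<lambda>K. w K (fst x) (fst (snd x)) (snd (snd x))))"
    by (rule expands_mono) simp
  then show ?thesis using M by (simp add: expands_iff shifted_series_nth)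
qed

text \<open>The left side of the averaging identity with truncated corrections and the actual
  \<open>calA\<close>, \<open>calB\<close>. The phase \<zeta> is still independent of
  \<tau>.\<close>

definition total :: "real \<Rightarrow> real \<Rightarrow> (nat \<Rightarrow> real \<Rightarrow> real \<Rightarrow> real \<Rightarrow> real) \<Rightarrow> real \<Rightarrow> real \<Rightarrow> real \<Rightarrow> real \<Rightarrow> real" where
  "total cr c\<theta> w \<tau> r \<theta> \<zeta> = z \<tau> ^ M * calA r \<theta> \<zeta> \<tau> * (cr + psum (\<lambda>K r \<theta> \<zeta>. deriv (\<lambda>r'. w K r' \<theta> \<zeta>) r) \<tau> r \<theta> \<zeta>)
     + z \<tau> ^ M * calB r \<theta> \<zeta> \<tau> * (c\<theta> + psum (\<lambda>K r \<theta> \<zeta>. deriv (\<lambda>\<theta>'. w K r \<theta>' \<zeta>) \<theta>) \<tau> r \<theta> \<zeta>)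
     - 1 / real N * (z \<tau> ^ N * psum (\<lambda>K r \<theta> \<zeta>. real (M + K) * w K r \<theta> \<zeta>) \<tau> r \<theta> \<zeta>)
     + vartheta * psum (\<lambda>K r \<theta> \<zeta>. deriv (w K r \<theta>) \<zeta>) \<tau> r \<theta> \<zeta>"

definition averaged :: "(nat \<Rightarrow> real \<Rightarrow> real \<Rightarrow> real) \<Rightarrow> real \<Rightarrow> real \<Rightarrow> real \<Rightarrow> real \<Rightarrow> real" where
  "averaged L \<tau> r \<theta> \<zeta> = (\<Sum>K\<le>n. z \<tau> ^ (M + K) * L K (r + psum \<rho> \<tau> r \<theta> \<zeta>) (\<theta> + psum \<psi> \<tau> r \<theta> \<zeta>))"

lemma expands_total:
  assumes w: "regular w"
  shows "expands (M + n + 1) (\<lambda>\<tau> x. total cr c\<theta> w \<tau> (fst x) (fst (snd x)) (snd (snd x)))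
    (\<lambda>x. formal_derivative M N vartheta (\<lambda>K r \<theta> \<zeta>. expansion_coeff N (calA r \<theta> \<zeta>) K)
     (\<lambda>K r \<theta> \<zeta>. expansion_coeff N (calB r \<theta> \<zeta>) K) cr c\<theta> w (fst x) (fst (snd x)) (snd (snd x)))"
proof -
  have zz: "\<forall>\<^sub>F \<tau> in at_top. z \<tau> = \<tau> powr (- (1 / real N))" by (simp add: z)
  have A: "expands m (\<lambda>\<tau> x. z \<tau> ^ M * calA (fst x) (fst (snd x)) (snd (snd x)) \<tau>)
     (\<lambda>x. shifted_series M (\<lambda>K. expansion_coeff N (calA (fst x) (fst (snd x)) (snd (snd x))) K))" for m
    unfolding shifted_series_def
    by (intro expands_mult expands_power expands_z expands_expansion_coeff[OF calA zz])
  have B: "expands m (\<lambda>\<tau> x. z \<tau> ^ M * calB (fst x) (fst (snd x)) (snd (snd x)) \<tau>)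
     (\<lambda>x. shifted_series M (\<lambda>K. expansion_coeff N (calB (fst x) (fst (snd x)) (snd (snd x))) K))" for m
    unfolding shifted_series_def
    by (intro expands_mult expands_power expands_z expands_expansion_coeff[OF calB zz])
  note part = regular_bdd[OF regular_partials(1)[OF w]] regular_bdd[OF regular_partials(2)[OF w]]
    regular_bdd[OF regular_partials(3)[OF w]]
  have "bdd_on (\<lambda>x. real (M + K) * w K (fst x) (fst (snd x)) (snd (snd x)))" for K
    using bigO_cmult[of 0 "\<lambda>\<tau> x. w K (fst x) (fst (snd x)) (snd (snd x))" "real (M + K)"] regular_bdd[OF w]
    by (simp only: bigO_bdd_iff)
  note scaled = expands_psum[of "\<lambda>K r \<theta> \<zeta>. real (M + K) * w K r \<theta> \<zeta>", OF this]
  \<comment> \<open>\<open>z d/dz\<close> multiplies the coefficient of order \<open>M + K\<close>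
    by that order, which matches the derivative of
    \<open>\<tau> powr (- (M + K) / N)\<close>.\<close>
  have d: "fps_const (1 / real N) * fps_X ^ (N + 1) * fps_deriv (shifted_series M (\<lambda>K. w K r \<theta> \<zeta>))
    = fps_const (1 / real N) * (fps_X ^ N * shifted_series M (\<lambda>K. real (M + K) * w K r \<theta> \<zeta>))" for r \<theta> \<zeta>
  proof -
    have "fps_X * fps_deriv (shifted_series M (\<lambda>K. w K r \<theta> \<zeta>)) = shifted_series M (\<lambda>K. real (M + K) * w K r \<theta> \<zeta>)"
      by (rule fps_ext) (simp add: fps_X_mult_deriv_nth shifted_series_nth)
    then show ?thesis by (simp add: mult.assoc power_commutes[symmetric] del: fps_const_mult)
  qed
  show ?thesis
    unfolding total_def formal_derivative_def d
    by (intro expands_add expands_diff expands_mult[OF A] expands_mult[OF B] expands_psum part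
        expands_const bdd_on_const expands_mult[OF expands_const] expands_mult[OF expands_power[OF expands_z]] scaled)
qed

text \<open>The corrections are of order z, so the Taylor expansion with \<open>M + n + 1\<close>
  terms in each direction has an error of order \<open>M + n + 1\<close>, and substituting their
  expansions gives the formal composition.\<close>

lemma expands_averaged:
  assumes L: "\<And>K. smooth_on (\<lambda>(r, \<theta>). L K r \<theta>) UNIV" "\<And>K r. periodic (2 * pi) (L K r)"
  shows "expands (M + n + 1) (\<lambda>\<tau> x. averaged L \<tau> (fst x) (fst (snd x)) (snd (snd x)))
    (\<lambda>x. formal_composition M L (shifted_series M (\<lambda>K. \<rho> K (fst x) (fst (snd x)) (snd (snd x))))
       (shifted_series M (\<lambda>K. \<psi> K (fst x) (fst (snd x)) (snd (snd x)))) (fst x) (fst (snd x)))"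
proof -
  let ?m = "M + n + 1"
  define a where "a \<tau> x = psum \<rho> \<tau> (fst x) (fst (snd x)) (snd (snd x))" for \<tau> and x :: "real \<times> real \<times> real"
  define b where "b \<tau> x = psum \<psi> \<tau> (fst x) (fst (snd x)) (snd (snd x))" for \<tau> and x :: "real \<times> real \<times> real"
  define p where "p x = shifted_series M (\<lambda>K. \<rho> K (fst x) (fst (snd x)) (snd (snd x)))" for x :: "real \<times> real \<times> real"
  define q where "q x = shifted_series M (\<lambda>K. \<psi> K (fst x) (fst (snd x)) (snd (snd x)))" for x :: "real \<times> real \<times> real"
  have a: "expands ?m a p" unfolding a_def[abs_def] p_def[abs_def] by (rule expands_psum[OF regular_bdd[OF regular(1)]])
  have b: "expands ?m b q" unfolding b_def[abs_def] q_def[abs_def] by (rule expands_psum[OF regular_bdd[OF regular(2)]])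
  have a1: "bigO 1 a" and b1: "bigO 1 b"
    unfolding a_def[abs_def] b_def[abs_def] by (rule bigO_psum[OF regular(1)] bigO_psum[OF regular(2)])+
  have pq: "p x $ 0 = 0" "q x $ 0 = 0" for x using M by (simp_all add: p_def q_def shifted_series_nth)
  define c where "c K i j x = mixed_deriv i j (L K) (fst x) (fst (snd x)) / (fact i * fact j)" for K i j and x :: "real \<times> real \<times> real"
  have c: "bdd_on (c K i j)" for K i j
  proof -
    have "\<exists>B. \<forall>r \<theta>. \<bar>r\<bar> \<le> 2 \<longrightarrow> \<bar>mixed_deriv i j (L K) r \<theta>\<bar> \<le> B"
      by (rule bounded_periodic2[OF smooth_on_imp_continuous_on[OF smooth_mixed_deriv(1)[OF L]]
          smooth_mixed_deriv(2)[OF L]]) simp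
    then obtain B where B: "\<And>r \<theta>. \<bar>r\<bar> \<le> 2 \<Longrightarrow> \<bar>mixed_deriv i j (L K) r \<theta>\<bar> \<le> B" by blast
    show ?thesis
      by (rule bdd_onI[of _ "B / (fact i * fact j)"]) (auto simp: P c_def intro!: divide_right_mono B)
  qed
  have two_pi: "0 < 2 * pi" and m_pos: "0 < ?m" by simp_all
  have LK: "expands ?m (\<lambda>\<tau> x. L K (fst x + a \<tau> x) (fst (snd x) + b \<tau> x))
      (\<lambda>x. \<Sum>i<?m. \<Sum>j<?m. fps_const (c K i j x) * p x ^ i * q x ^ j)" for K
  proof -
    obtain C where C: "\<And>r \<theta> a b :: real. \<bar>r\<bar> \<le> 2 \<Longrightarrow> \<bar>a\<bar> \<le> 1 \<Longrightarrow> \<bar>b\<bar> \<le> 1 \<Longrightarrow>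
      \<bar>L K (r + a) (\<theta> + b) - (\<Sum>i<?m. \<Sum>j<?m. mixed_deriv i j (L K) r \<theta> / (fact i * fact j) * a ^ i * b ^ j)\<bar>
        \<le> C * (\<bar>a\<bar> ^ ?m + \<bar>b\<bar> ^ ?m)"
      using Taylor2_bound[OF L(1)[of K] L(2)[of K] two_pi m_pos, of 2] by blast
    have abs: "bigO k (\<lambda>\<tau> w. \<bar>u \<tau> w\<bar>)" if "bigO k u" for u k
      by (rule bigO_bound[OF _ that]) simp
    have "bigO ?m (\<lambda>\<tau> x. C * (\<bar>a \<tau> x\<bar> ^ ?m + \<bar>b \<tau> x\<bar> ^ ?m))"
      using bigO_power[OF abs[OF a1], of ?m] bigO_power[OF abs[OF b1], of ?m] by (intro bigO_cmult bigO_add) simp_all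
    then have "bigO ?m (\<lambda>\<tau> x. L K (fst x + a \<tau> x) (fst (snd x) + b \<tau> x) - (\<Sum>i<?m. \<Sum>j<?m. c K i j x * a \<tau> x ^ i * b \<tau> x ^ j))"
    proof (rule bigO_bound[rotated])
      show "\<forall>\<^sub>F \<tau> in at_top. \<forall>x\<in>P. \<bar>L K (fst x + a \<tau> x) (fst (snd x) + b \<tau> x) - (\<Sum>i<?m. \<Sum>j<?m. c K i j x * a \<tau> x ^ i * b \<tau> x ^ j)\<bar>
        \<le> \<bar>C * (\<bar>a \<tau> x\<bar> ^ ?m + \<bar>b \<tau> x\<bar> ^ ?m)\<bar>"
        using bigO_1_eventually_less[OF a1 zero_less_one] bigO_1_eventually_less[OF b1 zero_less_one]
      proof eventually_elim
        case (elim \<tau>)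
        show ?case
        proof
          fix x assume x: "x \<in> P"
          have "\<bar>a \<tau> x\<bar> \<le> 1" "\<bar>b \<tau> x\<bar> \<le> 1" "\<bar>fst x\<bar> \<le> 2" using elim x by (auto simp: P less_imp_le)
          from C[OF this(3,1,2), of "fst (snd x)"]
          show "\<bar>L K (fst x + a \<tau> x) (fst (snd x) + b \<tau> x) - (\<Sum>i<?m. \<Sum>j<?m. c K i j x * a \<tau> x ^ i * b \<tau> x ^ j)\<bar>
            \<le> \<bar>C * (\<bar>a \<tau> x\<bar> ^ ?m + \<bar>b \<tau> x\<bar> ^ ?m)\<bar>"
            unfolding c_def by linarith
        qed
      qed
    qed
    from expands_add[OF expands_zero[OF this]]
    have "expands ?m (\<lambda>\<tau> x. L K (fst x + a \<tau> x) (fst (snd x) + b \<tau> x) - (\<Sum>i<?m. \<Sum>j<?m. c K i j x * a \<tau> x ^ i * b \<tau> x ^ j)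
       + (\<Sum>i<?m. \<Sum>j<?m. c K i j x * a \<tau> x ^ i * b \<tau> x ^ j))
      (\<lambda>x. 0 + (\<Sum>i<?m. \<Sum>j<?m. fps_const (c K i j x) * p x ^ i * q x ^ j))"
      by this (intro expands_sum expands_mult expands_const expands_power a b c)
    then show ?thesis by simp
  qed
  have "expands ?m (\<lambda>\<tau> x. \<Sum>K\<le>n. z \<tau> ^ (M + K) * L K (fst x + a \<tau> x) (fst (snd x) + b \<tau> x))
     (\<lambda>x. \<Sum>K\<le>n. fps_X ^ (M + K) * (\<Sum>i<?m. \<Sum>j<?m. fps_const (c K i j x) * p x ^ i * q x ^ j))"
    by (intro expands_sum expands_mult expands_power expands_z LK)
  then show ?thesis
  proof (rule expands_cong[rotated 2])
    show "\<forall>\<^sub>F \<tau> in at_top. \<forall>x\<in>P. (\<Sum>K\<le>n. z \<tau> ^ (M + K) * L K (fst x + a \<tau> x) (fst (snd x) + b \<tau> x))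
      = averaged L \<tau> (fst x) (fst (snd x)) (snd (snd x))"
      by (simp add: averaged_def a_def b_def)
    show "(\<Sum>K\<le>n. fps_X ^ (M + K) * (\<Sum>i<?m. \<Sum>j<?m. fps_const (c K i j x) * p x ^ i * q x ^ j)) $ k
      = formal_composition M L (shifted_series M (\<lambda>K. \<rho> K (fst x) (fst (snd x)) (snd (snd x))))
       (shifted_series M (\<lambda>K. \<psi> K (fst x) (fst (snd x)) (snd (snd x)))) (fst x) (fst (snd x)) $ k" if "k < ?m" for k x
      unfolding p_def[symmetric] q_def[symmetric] formal_composition_nth[OF pq that] c_def
      by (simp only: sum_distrib_left mult.assoc)
  qed
qed

text \<open>Both quantities have the same formal series by the averaging identities, so their
  difference expands with zero coefficients and is pure error.\<close>

lemma remainders: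
  "bigO (M + n + 1) (\<lambda>\<tau> x. total 1 0 \<rho> \<tau> (fst x) (fst (snd x)) (snd (snd x)) - averaged \<Lambda> \<tau> (fst x) (fst (snd x)) (snd (snd x)))"
  "bigO (M + n + 1) (\<lambda>\<tau> x. total 0 1 \<psi> \<tau> (fst x) (fst (snd x)) (snd (snd x)) - averaged \<Omega> \<tau> (fst x) (fst (snd x)) (snd (snd x)))"
proof -
  from expands_diff[OF expands_total[OF regular(1), of 1 0] expands_averaged[where L = \<Lambda>, OF smooth(1) per(1)]]
  show "bigO (M + n + 1) (\<lambda>\<tau> x. total 1 0 \<rho> \<tau> (fst x) (fst (snd x)) (snd (snd x)) - averaged \<Lambda> \<tau> (fst x) (fst (snd x)) (snd (snd x)))"
    unfolding identities diff_self by (rule expands_zeroD)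
  from expands_diff[OF expands_total[OF regular(2), of 0 1] expands_averaged[where L = \<Omega>, OF smooth(2) per(2)]]
  show "bigO (M + n + 1) (\<lambda>\<tau> x. total 0 1 \<psi> \<tau> (fst x) (fst (snd x)) (snd (snd x)) - averaged \<Omega> \<tau> (fst x) (fst (snd x)) (snd (snd x)))"
    unfolding identities diff_self by (rule expands_zeroD)
qed

definition Dr :: "(nat \<Rightarrow> real \<Rightarrow> real \<Rightarrow> real \<Rightarrow> real) \<Rightarrow> nat \<Rightarrow> real \<Rightarrow> real \<Rightarrow> real \<Rightarrow> real" where
  "Dr w = (\<lambda>K r \<theta> \<zeta>. deriv (\<lambda>r'. w K r' \<theta> \<zeta>) r)"

definition D\<theta> :: "(nat \<Rightarrow> real \<Rightarrow> real \<Rightarrow> real \<Rightarrow> real) \<Rightarrow> nat \<Rightarrow> real \<Rightarrow> real \<Rightarrow> real \<Rightarrow> real" where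
  "D\<theta> w = (\<lambda>K r \<theta> \<zeta>. deriv (\<lambda>\<theta>'. w K r \<theta>' \<zeta>) \<theta>)"

definition D\<zeta> :: "(nat \<Rightarrow> real \<Rightarrow> real \<Rightarrow> real \<Rightarrow> real) \<Rightarrow> nat \<Rightarrow> real \<Rightarrow> real \<Rightarrow> real \<Rightarrow> real" where
  "D\<zeta> w = (\<lambda>K r \<theta> \<zeta>. deriv (w K r \<theta>) \<zeta>)"

definition corr :: "(nat \<Rightarrow> real \<Rightarrow> real \<Rightarrow> real \<Rightarrow> real) \<Rightarrow> real \<Rightarrow> real \<Rightarrow> real \<Rightarrow> real" where
  "corr w \<tau> r \<theta> = psum w \<tau> r \<theta> (vartheta * \<tau>)"

text \<open>The derivative of \<open>corr w\<close> in \<tau> with r and \<theta> fixed: one part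
  from the phase \<open>vartheta * \<tau>\<close>, the other from the powers of \<tau>.\<close>

definition dtau :: "(nat \<Rightarrow> real \<Rightarrow> real \<Rightarrow> real \<Rightarrow> real) \<Rightarrow> real \<Rightarrow> real \<Rightarrow> real \<Rightarrow> real" where
  "dtau w \<tau> r \<theta> = vartheta * corr (D\<zeta> w) \<tau> r \<theta>
     - 1 / real N * (z \<tau> ^ N * corr (\<lambda>K r \<theta> \<zeta>. real (M + K) * w K r \<theta> \<zeta>) \<tau> r \<theta>)"

section \<open>The averaging map along the phase curve and its inverse\<close>

lemma total_eq: "total cr c\<theta> w \<tau> r \<theta> (vartheta * \<tau>) =
    (cr + corr (Dr w) \<tau> r \<theta>) * (z \<tau> ^ M * calA r \<theta> (vartheta * \<tau>) \<tau>)
    + (c\<theta> + corr (D\<theta> w) \<tau> r \<theta>) * (z \<tau> ^ M * calB r \<theta> (vartheta * \<tau>) \<tau>) + dtau w \<tau> r \<theta>"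
  unfolding total_def dtau_def corr_def Dr_def D\<theta>_def D\<zeta>_def by (simp add: algebra_simps)

lemma z_power_deriv:
  assumes "0 < \<tau>" shows "((\<lambda>\<tau>. z \<tau> ^ k) has_real_derivative - (real k / real N) * (z \<tau> ^ N * z \<tau> ^ k)) (at \<tau>)"
proof -
  have "((\<lambda>\<tau>. \<tau> powr (- (real k / real N))) has_real_derivative
     - (real k / real N) * \<tau> powr (- (real k / real N) - 1)) (at \<tau>)"
    using assms by (rule has_real_derivative_powr)
  also have "\<tau> powr (- (real k / real N) - 1) = z \<tau> ^ N * z \<tau> ^ k"
    unfolding z_power[OF assms] powr_add[symmetric]
    by (rule arg_cong[of _ _ "\<lambda>x. \<tau> powr x"]) (use N in simp)
  finally show ?thesis
    by (rule has_field_derivative_transform_within_open[of _ _ _ "{0<..}"]) (auto simp: assms z_power)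
qed

lemma corr_has_derivative:
  assumes w: "regular w" and \<tau>: "0 < \<tau>"
  shows "((\<lambda>x. corr w (fst x) (fst (snd x)) (snd (snd x))) has_derivative
     (\<lambda>d. dtau w \<tau> r \<theta> * fst d + corr (Dr w) \<tau> r \<theta> * fst (snd d) + corr (D\<theta> w) \<tau> r \<theta> * snd (snd d))) (at (\<tau>, r, \<theta>))"
proof -
  let ?\<zeta> = "vartheta * \<tau>"
  have W: "((\<lambda>x. w K (fst (snd x)) (snd (snd x)) (vartheta * fst x)) has_derivative
     (\<lambda>d. Dr w K r \<theta> ?\<zeta> * fst (snd d) + D\<theta> w K r \<theta> ?\<zeta> * snd (snd d) + D\<zeta> w K r \<theta> ?\<zeta> * (vartheta * fst d))) (at (\<tau>, r, \<theta>))" for K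
  proof -
    have "(\<lambda>(r, \<theta>, \<zeta>). w K r \<theta> \<zeta>) differentiable (at (r, \<theta>, ?\<zeta>))"
      using w smooth_on_imp_differentiable unfolding regular_def by blast
    note D = has_derivative_partials3(1)[OF this]
    have inner: "((\<lambda>x. (fst (snd x), snd (snd x), vartheta * fst x)) has_derivative
        (\<lambda>d. (fst (snd d), snd (snd d), vartheta * fst d))) (at (\<tau>, r, \<theta>))"
      by (intro has_derivative_Pair has_derivative_fst has_derivative_snd has_derivative_ident has_derivative_mult_right)
    have D': "((\<lambda>(r, \<theta>, \<zeta>). w K r \<theta> \<zeta>) has_derivative
      (\<lambda>(dx, dy, dz). Dr w K r \<theta> ?\<zeta> * dx + D\<theta> w K r \<theta> ?\<zeta> * dy + D\<zeta> w K r \<theta> ?\<zeta> * dz))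
      (at ((\<lambda>x. (fst (snd x), snd (snd x), vartheta * fst x)) (\<tau>, r, \<theta>)))"
      using D by (simp add: Dr_def D\<theta>_def D\<zeta>_def)
    from has_derivative_compose[OF inner D'] show ?thesis by (simp add: case_prod_unfold)
  qed
  have zk: "((\<lambda>x::real \<times> real \<times> real. z (fst x) ^ (M + K)) has_derivative (\<lambda>d. - (real (M + K) / real N) * (z \<tau> ^ N * z \<tau> ^ (M + K)) * fst d)) (at (\<tau>, r, \<theta>))" for K
  proof -
    have "((\<lambda>\<tau>. z \<tau> ^ (M + K)) has_derivative (\<lambda>d. - (real (M + K) / real N) * (z \<tau> ^ N * z \<tau> ^ (M + K)) * d)) (at (fst (\<tau>, r, \<theta>)))"
      unfolding fst_conv
      by (rule has_derivative_eq_rhs[OF z_power_deriv[OF \<tau>, of "M + K", unfolded has_field_derivative_def]]) (rule refl)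
    from has_derivative_compose[OF has_derivative_fst[OF has_derivative_ident] this] show ?thesis .
  qed
  have "((\<lambda>x. \<Sum>K\<le>n. z (fst x) ^ (M + K) * w K (fst (snd x)) (snd (snd x)) (vartheta * fst x)) has_derivative
     (\<lambda>d. \<Sum>K\<le>n. z (fst (\<tau>, r, \<theta>)) ^ (M + K) * (Dr w K r \<theta> ?\<zeta> * fst (snd d) + D\<theta> w K r \<theta> ?\<zeta> * snd (snd d) + D\<zeta> w K r \<theta> ?\<zeta> * (vartheta * fst d))
      + - (real (M + K) / real N) * (z \<tau> ^ N * z \<tau> ^ (M + K)) * fst d * w K (fst (snd (\<tau>, r, \<theta>))) (snd (snd (\<tau>, r, \<theta>))) (vartheta * fst (\<tau>, r, \<theta>)))) (at (\<tau>, r, \<theta>))"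
    by (intro has_derivative_sum has_derivative_mult zk W)
  then show ?thesis unfolding corr_def psum_def
  proof (rule has_derivative_eq_rhs, intro ext)
    fix d :: "real \<times> real \<times> real"
    have "(\<Sum>K\<le>n. z \<tau> ^ (M + K) * (Dr w K r \<theta> ?\<zeta> * fst (snd d) + D\<theta> w K r \<theta> ?\<zeta> * snd (snd d) + D\<zeta> w K r \<theta> ?\<zeta> * (vartheta * fst d))
      + - (real (M + K) / real N) * (z \<tau> ^ N * z \<tau> ^ (M + K)) * fst d * w K r \<theta> ?\<zeta>)
     = (\<Sum>K\<le>n. vartheta * (z \<tau> ^ (M + K) * D\<zeta> w K r \<theta> ?\<zeta>) * fst d - 1 / real N * (z \<tau> ^ N * (z \<tau> ^ (M + K) * (real (M + K) * w K r \<theta> ?\<zeta>))) * fst d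
      + z \<tau> ^ (M + K) * Dr w K r \<theta> ?\<zeta> * fst (snd d) + z \<tau> ^ (M + K) * D\<theta> w K r \<theta> ?\<zeta> * snd (snd d))"
      by (intro sum.cong refl) (simp add: algebra_simps add_divide_distrib)
    then show "(\<Sum>K\<le>n. z (fst (\<tau>, r, \<theta>)) ^ (M + K) * (Dr w K r \<theta> ?\<zeta> * fst (snd d) + D\<theta> w K r \<theta> ?\<zeta> * snd (snd d) + D\<zeta> w K r \<theta> ?\<zeta> * (vartheta * fst d))
      + - (real (M + K) / real N) * (z \<tau> ^ N * z \<tau> ^ (M + K)) * fst d * w K (fst (snd (\<tau>, r, \<theta>))) (snd (snd (\<tau>, r, \<theta>))) (vartheta * fst (\<tau>, r, \<theta>)))
      = dtau w \<tau> r \<theta> * fst d + (\<Sum>K\<le>n. z \<tau> ^ (M + K) * Dr w K r \<theta> ?\<zeta>) * fst (snd d) + (\<Sum>K\<le>n. z \<tau> ^ (M + K) * D\<theta> w K r \<theta> ?\<zeta>) * snd (snd d)"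
      unfolding dtau_def corr_def psum_def
      by (simp only: fst_conv snd_conv sum_subtractf sum.distrib sum_distrib_left sum_distrib_right left_diff_distrib)
  qed
qed

lemma corr_chain:
  assumes w: "regular w" and \<tau>: "0 < \<tau>"
    and r: "(r has_real_derivative r') (at \<tau>)" and \<theta>: "(\<theta> has_real_derivative \<theta>') (at \<tau>)"
  shows "((\<lambda>\<tau>. corr w \<tau> (r \<tau>) (\<theta> \<tau>)) has_real_derivative
    dtau w \<tau> (r \<tau>) (\<theta> \<tau>) + corr (Dr w) \<tau> (r \<tau>) (\<theta> \<tau>) * r' + corr (D\<theta> w) \<tau> (r \<tau>) (\<theta> \<tau>) * \<theta>') (at \<tau>)"
proof -
  have "((\<lambda>\<tau>. (\<tau>, r \<tau>, \<theta> \<tau>)) has_derivative (\<lambda>d. (d, r' * d, \<theta>' * d))) (at \<tau>)"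
    using r \<theta> by (intro has_derivative_Pair has_derivative_ident) (simp_all add: has_field_derivative_def)
  from has_derivative_compose[OF this corr_has_derivative[OF w \<tau>]]
  have "((\<lambda>\<tau>. corr w \<tau> (r \<tau>) (\<theta> \<tau>)) has_derivative (\<lambda>d. dtau w \<tau> (r \<tau>) (\<theta> \<tau>) * d
     + corr (Dr w) \<tau> (r \<tau>) (\<theta> \<tau>) * (r' * d) + corr (D\<theta> w) \<tau> (r \<tau>) (\<theta> \<tau>) * (\<theta>' * d))) (at \<tau>)" by simp
  then show ?thesis
    unfolding has_field_derivative_def by (rule has_derivative_eq_rhs) (auto simp: algebra_simps)
qed

text \<open>Partial derivatives below \<open>1 / 8\<close> give the pair of corrections the
  Lipschitz constant \<open>1 / 2\<close>; corrections below \<open>1 / 2\<close> keep preimages of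
  \<open>\<bar>R\<bar> \<le> 1\<close> within \<open>\<bar>r\<bar> \<le> 3 / 2\<close>.\<close>

definition small :: "real \<Rightarrow> bool" where
  "small \<tau> \<longleftrightarrow> 0 < \<tau> \<and> (\<forall>w\<in>{\<rho>, \<psi>}. \<forall>r \<theta>. \<bar>r\<bar> \<le> 2 \<longrightarrow>
     \<bar>corr w \<tau> r \<theta>\<bar> \<le> 1 / 2 \<and> \<bar>corr (Dr w) \<tau> r \<theta>\<bar> \<le> 1 / 8 \<and> \<bar>corr (D\<theta> w) \<tau> r \<theta>\<bar> \<le> 1 / 8)"

lemma eventually_small: "eventually small at_top"
proof -
  have *: "\<forall>\<^sub>F \<tau> in at_top. \<forall>r \<theta>. \<bar>r\<bar> \<le> 2 \<longrightarrow> \<bar>corr w \<tau> r \<theta>\<bar> \<le> \<epsilon>" if "regular w" "0 < \<epsilon>" for w \<epsilon>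
    using bigO_1_eventually_less[OF bigO_psum[OF that(1)] that(2)]
  proof eventually_elim
    case (elim \<tau>)
    show ?case
    proof (intro allI impI)
      fix r \<theta> :: real assume "\<bar>r\<bar> \<le> 2"
      then have "(r, \<theta>, vartheta * \<tau>) \<in> P" by (auto simp: P)
      from bspec[OF elim this] show "\<bar>corr w \<tau> r \<theta>\<bar> \<le> \<epsilon>" by (simp add: corr_def)
    qed
  qed
  have half: "(0::real) < 1 / 2" and eighth: "(0::real) < 1 / 8" by simp_all
  have **: "\<forall>\<^sub>F \<tau> in at_top. \<forall>r \<theta>. \<bar>r\<bar> \<le> 2 \<longrightarrow>
     \<bar>corr w \<tau> r \<theta>\<bar> \<le> 1 / 2 \<and> \<bar>corr (Dr w) \<tau> r \<theta>\<bar> \<le> 1 / 8 \<and> \<bar>corr (D\<theta> w) \<tau> r \<theta>\<bar> \<le> 1 / 8" if "regular w" for w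
    using *[OF that half] *[OF regular_partials(1)[OF that] eighth] *[OF regular_partials(2)[OF that] eighth]
    unfolding Dr_def[symmetric] D\<theta>_def[symmetric] by eventually_elim simp
  show ?thesis
    using **[OF regular(1)] **[OF regular(2)] eventually_gt_at_top[of 0]
    unfolding small_def by eventually_elim simp
qed

lemma corr_lipschitz:
  assumes "small \<tau>" "w \<in> {\<rho>, \<psi>}" "\<bar>r\<bar> \<le> 2" "\<bar>r'\<bar> \<le> 2"
  shows "\<bar>corr w \<tau> r \<theta> - corr w \<tau> r' \<theta>'\<bar> \<le> 1 / 8 * \<bar>r - r'\<bar> + 1 / 8 * \<bar>\<theta> - \<theta>'\<bar>"
proof -
  have w: "regular w" and \<tau>: "0 < \<tau>" using assms(1,2) regular by (auto simp: small_def)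
  have "\<bar>corr w \<tau> r \<theta> - corr w \<tau> r' \<theta>\<bar> \<le> 1 / 8 * \<bar>r - r'\<bar>"
  proof -
    have "((\<lambda>r. corr w \<tau> r \<theta>) has_real_derivative corr (Dr w) \<tau> x \<theta>) (at x within {- 2..2})" for x
    proof -
      have "((\<lambda>r. (\<tau>, r, \<theta>)) has_derivative (\<lambda>d. (0, d, 0))) (at x)"
        by (intro has_derivative_Pair has_derivative_ident has_derivative_const)
      from has_derivative_compose[OF this corr_has_derivative[OF w \<tau>, of x \<theta>]]
      have "((\<lambda>r. corr w \<tau> r \<theta>) has_derivative (\<lambda>d. corr (Dr w) \<tau> x \<theta> * d)) (at x)" by simp
      then show ?thesis unfolding has_field_derivative_def by (rule has_derivative_at_withinI)
    qed
    from field_differentiable_bound[of "{- 2..2}", OF _ this, of "1 / 8" r r'] show ?thesis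
      using assms by (auto simp: small_def abs_le_iff)
  qed
  moreover have "\<bar>corr w \<tau> r' \<theta> - corr w \<tau> r' \<theta>'\<bar> \<le> 1 / 8 * \<bar>\<theta> - \<theta>'\<bar>"
  proof -
    have "((\<lambda>\<theta>. corr w \<tau> r' \<theta>) has_real_derivative corr (D\<theta> w) \<tau> r' x) (at x within UNIV)" for x
    proof -
      have "((\<lambda>\<theta>. (\<tau>, r', \<theta>)) has_derivative (\<lambda>d. (0, 0, d))) (at x)"
        by (intro has_derivative_Pair has_derivative_ident has_derivative_const)
      from has_derivative_compose[OF this corr_has_derivative[OF w \<tau>, of r' x]]
      have "((\<lambda>\<theta>. corr w \<tau> r' \<theta>) has_derivative (\<lambda>d. corr (D\<theta> w) \<tau> r' x * d)) (at x)" by simp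
      then show ?thesis unfolding has_field_derivative_def by (rule has_derivative_at_withinI)
    qed
    from field_differentiable_bound[of UNIV, OF _ this, of "1 / 8" \<theta> \<theta>'] show ?thesis
      using assms by (auto simp: small_def)
  qed
  ultimately show ?thesis by linarith
qed

definition avg_map :: "real \<Rightarrow> real \<times> real \<Rightarrow> real \<times> real" where
  "avg_map \<tau> = (\<lambda>(r, \<theta>). (r + corr \<rho> \<tau> r \<theta>, \<theta> + corr \<psi> \<tau> r \<theta>))"

lemma correction_lipschitz:
  assumes "small \<tau>" "\<bar>r\<bar> \<le> 2" "\<bar>r'\<bar> \<le> 2"
  shows "norm ((corr \<rho> \<tau> r \<theta>, corr \<psi> \<tau> r \<theta>) - (corr \<rho> \<tau> r' \<theta>', corr \<psi> \<tau> r' \<theta>')) \<le> 1 / 2 * norm ((r, \<theta>) - (r', \<theta>'))"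
proof -
  have "norm ((corr \<rho> \<tau> r \<theta>, corr \<psi> \<tau> r \<theta>) - (corr \<rho> \<tau> r' \<theta>', corr \<psi> \<tau> r' \<theta>'))
      \<le> \<bar>corr \<rho> \<tau> r \<theta> - corr \<rho> \<tau> r' \<theta>'\<bar> + \<bar>corr \<psi> \<tau> r \<theta> - corr \<psi> \<tau> r' \<theta>'\<bar>"
    using norm_Pair_le[of "corr \<rho> \<tau> r \<theta> - corr \<rho> \<tau> r' \<theta>'" "corr \<psi> \<tau> r \<theta> - corr \<psi> \<tau> r' \<theta>'"] by simp
  also have "\<dots> \<le> 1 / 4 * \<bar>r - r'\<bar> + 1 / 4 * \<bar>\<theta> - \<theta>'\<bar>"
    using corr_lipschitz[OF assms(1) _ assms(2,3), of \<rho> \<theta> \<theta>'] corr_lipschitz[OF assms(1) _ assms(2,3), of \<psi> \<theta> \<theta>'] by simp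
  also have "\<dots> \<le> 1 / 2 * norm ((r, \<theta>) - (r', \<theta>'))"
    using norm_fst_le[of "r - r'" "\<theta> - \<theta>'"] norm_snd_le[of "\<theta> - \<theta>'" "r - r'"] by simp
  finally show ?thesis .
qed

lemma avg_map_inj:
  assumes "small \<tau>" shows "inj_on (avg_map \<tau>) ({- 2..2} \<times> UNIV)"
proof (rule inj_onI)
  fix v w assume v: "v \<in> {- 2..2} \<times> UNIV" and w: "w \<in> {- 2..2} \<times> UNIV" and eq: "avg_map \<tau> v = avg_map \<tau> w"
  obtain r \<theta> r' \<theta>' where vw: "v = (r, \<theta>)" "w = (r', \<theta>')" by (metis surj_pair)
  have "v - w = - ((corr \<rho> \<tau> r \<theta>, corr \<psi> \<tau> r \<theta>) - (corr \<rho> \<tau> r' \<theta>', corr \<psi> \<tau> r' \<theta>'))"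
    using eq by (simp add: avg_map_def vw)
  then have "norm (v - w) = norm ((corr \<rho> \<tau> r \<theta>, corr \<psi> \<tau> r \<theta>) - (corr \<rho> \<tau> r' \<theta>', corr \<psi> \<tau> r' \<theta>'))"
    by (simp only: norm_minus_cancel)
  also have "\<dots> \<le> 1 / 2 * norm (v - w)"
    unfolding vw by (rule correction_lipschitz[OF assms]) (use v w vw in auto)
  finally show "v = w" by simp
qed

lemma avg_map_surj:
  assumes "small \<tau>" "\<bar>R\<bar> \<le> 1"
  shows "\<exists>r \<theta>. \<bar>r\<bar> < 2 \<and> avg_map \<tau> (r, \<theta>) = (R, \<Psi>)"
proof -
  let ?S = "{- 2..2::real} \<times> (UNIV :: real set)"
  \<comment> \<open>A fixed point of this contraction is a preimage of (R, \<Psi>). The strip is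
    closed, hence complete, although unbounded in \<theta>.\<close>
  define F where "F = (\<lambda>(r, \<theta>). (R - corr \<rho> \<tau> r \<theta>, \<Psi> - corr \<psi> \<tau> r \<theta>))"
  have bd: "\<bar>corr \<rho> \<tau> r \<theta>\<bar> \<le> 1 / 2" if "\<bar>r\<bar> \<le> 2" for r \<theta> using assms(1) that by (auto simp: small_def)
  have "\<exists>!x. x \<in> ?S \<and> F x = x"
  proof (rule Banach_fix[of ?S "1 / 2"])
    show "complete ?S" unfolding complete_eq_closed by (intro closed_Times) auto
    show "?S \<noteq> {}" by force
    show "F ` ?S \<subseteq> ?S"
    proof (rule image_subsetI)
      fix v assume "v \<in> ?S"
      moreover obtain r \<theta> where v: "v = (r, \<theta>)" by (metis surj_pair)
      ultimately have "\<bar>corr \<rho> \<tau> r \<theta>\<bar> \<le> 1 / 2" by (intro bd) auto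
      then show "F v \<in> ?S" using assms(2) by (simp add: F_def v) linarith
    qed
    show "dist (F v) (F w) \<le> 1 / 2 * dist v w" if "v \<in> ?S" "w \<in> ?S" for v w
    proof -
      obtain r \<theta> r' \<theta>' where vw: "v = (r, \<theta>)" "w = (r', \<theta>')" by (metis surj_pair)
      have "norm (F v - F w) = norm (- ((corr \<rho> \<tau> r \<theta>, corr \<psi> \<tau> r \<theta>) - (corr \<rho> \<tau> r' \<theta>', corr \<psi> \<tau> r' \<theta>')))"
        by (rule arg_cong[of _ _ norm]) (simp add: F_def vw)
      also have "\<dots> \<le> 1 / 2 * norm (v - w)"
        unfolding norm_minus_cancel vw by (rule correction_lipschitz[OF assms(1)]) (use that vw in auto)
      finally show ?thesis by (simp add: dist_norm)
    qed
  qed auto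
  then obtain v where v: "v \<in> ?S" "F v = v" by blast
  obtain r \<theta> where rv: "v = (r, \<theta>)" by (metis surj_pair)
  have r: "\<bar>r\<bar> \<le> 2" and eq: "F (r, \<theta>) = (r, \<theta>)" using v by (auto simp: rv)
  then have "avg_map \<tau> (r, \<theta>) = (R, \<Psi>)" by (auto simp: F_def avg_map_def)
  moreover have "\<bar>r\<bar> < 2" using bd[OF r, of \<theta>] eq assms(2) by (auto simp: F_def abs_less_iff abs_le_iff)
  ultimately show ?thesis by blast
qed

definition avg_inv :: "real \<Rightarrow> real \<times> real \<Rightarrow> real \<times> real" where
  "avg_inv \<tau> = inv_into ({- 2..2} \<times> UNIV) (avg_map \<tau>)"

section \<open>Remainders, and transport of solutions through averaging\<close>

lemma avg_inv_left: "small \<tau> \<Longrightarrow> \<bar>r\<bar> \<le> 2 \<Longrightarrow> avg_inv \<tau> (avg_map \<tau> (r, \<theta>)) = (r, \<theta>)"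
  unfolding avg_inv_def by (rule inv_into_f_f[OF avg_map_inj]) auto

lemma avg_inv_right:
  assumes "small \<tau>" "\<bar>R\<bar> \<le> 1"
  shows "\<bar>fst (avg_inv \<tau> (R, \<Psi>))\<bar> < 2" "avg_map \<tau> (avg_inv \<tau> (R, \<Psi>)) = (R, \<Psi>)"
proof -
  obtain r \<theta> where *: "\<bar>r\<bar> < 2" "avg_map \<tau> (r, \<theta>) = (R, \<Psi>)" using avg_map_surj[OF assms] by blast
  then have "avg_inv \<tau> (R, \<Psi>) = (r, \<theta>)" using avg_inv_left[OF assms(1), of r \<theta>] by simp
  then show "\<bar>fst (avg_inv \<tau> (R, \<Psi>))\<bar> < 2" "avg_map \<tau> (avg_inv \<tau> (R, \<Psi>)) = (R, \<Psi>)" using * by simp_all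
qed

text \<open>The remainder as a function of the old variables. It has a meaning for every r,
  including those where the averaging map has not been inverted.\<close>

definition \<Lambda>loc :: "real \<Rightarrow> real \<Rightarrow> real \<Rightarrow> real" where
  "\<Lambda>loc r \<theta> \<tau> = total 1 0 \<rho> \<tau> r \<theta> (vartheta * \<tau>) - averaged \<Lambda> \<tau> r \<theta> (vartheta * \<tau>)"

definition \<Omega>loc :: "real \<Rightarrow> real \<Rightarrow> real \<Rightarrow> real" where
  "\<Omega>loc r \<theta> \<tau> = total 0 1 \<psi> \<tau> r \<theta> (vartheta * \<tau>) - averaged \<Omega> \<tau> r \<theta> (vartheta * \<tau>)"

text \<open>The same remainder transported to the averaged variables. Off the image of the strip
  \<open>inv_into\<close> returns an arbitrary value; the estimate concerns
  \<open>\<bar>R\<bar> \<le> 1\<close>.\<close>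

definition \<Lambda>rem :: "real \<Rightarrow> real \<Rightarrow> real \<Rightarrow> real" where
  "\<Lambda>rem R \<Psi> \<tau> = \<Lambda>loc (fst (avg_inv \<tau> (R, \<Psi>))) (snd (avg_inv \<tau> (R, \<Psi>))) \<tau>"

definition \<Omega>rem :: "real \<Rightarrow> real \<Rightarrow> real \<Rightarrow> real" where
  "\<Omega>rem R \<Psi> \<tau> = \<Omega>loc (fst (avg_inv \<tau> (R, \<Psi>))) (snd (avg_inv \<tau> (R, \<Psi>))) \<tau>"

lemma rem_eq_loc:
  assumes "small \<tau>" "\<bar>r\<bar> \<le> 2"
  shows "\<Lambda>rem (r + corr \<rho> \<tau> r \<theta>) (\<theta> + corr \<psi> \<tau> r \<theta>) \<tau> = \<Lambda>loc r \<theta> \<tau>"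
    "\<Omega>rem (r + corr \<rho> \<tau> r \<theta>) (\<theta> + corr \<psi> \<tau> r \<theta>) \<tau> = \<Omega>loc r \<theta> \<tau>"
  using avg_inv_left[OF assms, of \<theta>] by (simp_all add: \<Lambda>rem_def \<Omega>rem_def avg_map_def)

lemma rem_bound:
  "\<exists>C. \<forall>\<^sub>F \<tau> in at_top. \<forall>R \<Psi>. \<bar>R\<bar> \<le> 1 \<longrightarrow>
     \<bar>\<Lambda>rem R \<Psi> \<tau>\<bar> \<le> C * \<tau> powr (- (real (M + n + 1) / real N)) \<and>
     \<bar>\<Omega>rem R \<Psi> \<tau>\<bar> \<le> C * \<tau> powr (- (real (M + n + 1) / real N))"
proof -
  obtain C1 where C1: "\<forall>\<^sub>F \<tau> in at_top. \<forall>x\<in>P. \<bar>total 1 0 \<rho> \<tau> (fst x) (fst (snd x)) (snd (snd x))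
      - averaged \<Lambda> \<tau> (fst x) (fst (snd x)) (snd (snd x))\<bar> \<le> C1 * z \<tau> ^ (M + n + 1)"
    using remainders(1) unfolding bigO_def by blast
  obtain C2 where C2: "\<forall>\<^sub>F \<tau> in at_top. \<forall>x\<in>P. \<bar>total 0 1 \<psi> \<tau> (fst x) (fst (snd x)) (snd (snd x))
      - averaged \<Omega> \<tau> (fst x) (fst (snd x)) (snd (snd x))\<bar> \<le> C2 * z \<tau> ^ (M + n + 1)"
    using remainders(2) unfolding bigO_def by blast
  have "\<forall>\<^sub>F \<tau> in at_top. \<forall>R \<Psi>. \<bar>R\<bar> \<le> 1 \<longrightarrow>
     \<bar>\<Lambda>rem R \<Psi> \<tau>\<bar> \<le> max C1 C2 * \<tau> powr (- (real (M + n + 1) / real N)) \<and>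
     \<bar>\<Omega>rem R \<Psi> \<tau>\<bar> \<le> max C1 C2 * \<tau> powr (- (real (M + n + 1) / real N))"
    using C1 C2 eventually_small
  proof eventually_elim
    case (elim \<tau>)
    have \<tau>: "0 < \<tau>" using elim(3) by (simp add: small_def)
    have le: "C1 * z \<tau> ^ (M + n + 1) \<le> max C1 C2 * z \<tau> ^ (M + n + 1)" "C2 * z \<tau> ^ (M + n + 1) \<le> max C1 C2 * z \<tau> ^ (M + n + 1)"
      unfolding z_power[OF \<tau>] by (intro mult_right_mono; simp)+
    show ?case
    proof (intro allI impI)
      fix R \<Psi> :: real assume R: "\<bar>R\<bar> \<le> 1"
      define x where "x = (fst (avg_inv \<tau> (R, \<Psi>)), snd (avg_inv \<tau> (R, \<Psi>)), vartheta * \<tau>)"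
      have x: "x \<in> P" using avg_inv_right(1)[OF elim(3) R, of \<Psi>] by (auto simp: x_def P abs_less_iff)
      have "\<bar>\<Lambda>rem R \<Psi> \<tau>\<bar> \<le> C1 * z \<tau> ^ (M + n + 1)"
        using bspec[OF elim(1) x] unfolding \<Lambda>rem_def \<Lambda>loc_def x_def by simp
      moreover have "\<bar>\<Omega>rem R \<Psi> \<tau>\<bar> \<le> C2 * z \<tau> ^ (M + n + 1)"
        using bspec[OF elim(2) x] unfolding \<Omega>rem_def \<Omega>loc_def x_def by simp
      ultimately show "\<bar>\<Lambda>rem R \<Psi> \<tau>\<bar> \<le> max C1 C2 * \<tau> powr (- (real (M + n + 1) / real N)) \<and>
         \<bar>\<Omega>rem R \<Psi> \<tau>\<bar> \<le> max C1 C2 * \<tau> powr (- (real (M + n + 1) / real N))"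
        using le unfolding z_power[OF \<tau>] by linarith
    qed
  qed
  then show ?thesis by blast
qed

lemma jacobian_pos:
  assumes "small \<tau>" "\<bar>r\<bar> \<le> 2"
  shows "0 < (1 + corr (Dr \<rho>) \<tau> r \<theta>) * (1 + corr (D\<theta> \<psi>) \<tau> r \<theta>) - corr (D\<theta> \<rho>) \<tau> r \<theta> * corr (Dr \<psi>) \<tau> r \<theta>"
proof -
  have b: "\<bar>corr (Dr \<rho>) \<tau> r \<theta>\<bar> \<le> 1 / 8" "\<bar>corr (D\<theta> \<psi>) \<tau> r \<theta>\<bar> \<le> 1 / 8"
     "\<bar>corr (D\<theta> \<rho>) \<tau> r \<theta>\<bar> \<le> 1 / 8" "\<bar>corr (Dr \<psi>) \<tau> r \<theta>\<bar> \<le> 1 / 8" using assms by (auto simp: small_def)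
  have "7 / 8 * (7 / 8) \<le> (1 + corr (Dr \<rho>) \<tau> r \<theta>) * (1 + corr (D\<theta> \<psi>) \<tau> r \<theta>)"
    by (rule mult_mono) (use b in \<open>auto simp: abs_le_iff\<close>)
  moreover have "\<bar>corr (D\<theta> \<rho>) \<tau> r \<theta> * corr (Dr \<psi>) \<tau> r \<theta>\<bar> \<le> 1 / 8 * (1 / 8)"
    unfolding abs_mult by (rule mult_mono) (use b in auto)
  ultimately show ?thesis by linarith
qed

text \<open>The inverse varies with \<tau>. Adding \<tau> as a coordinate turns the family into one
  map of three variables, and its inverse is composed with the curve (\<tau>, R, \<Psi>).\<close>

lemma inverse_curve_differentiable:
  assumes sm: "\<And>\<tau>. \<tau>0 < \<tau> \<Longrightarrow> small \<tau>" and J: "open J" "J \<subseteq> {\<tau>0<..}" "\<tau> \<in> J"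
    and R: "(R has_real_derivative R') (at \<tau>)" and \<Psi>: "(\<Psi> has_real_derivative \<Psi>') (at \<tau>)"
    and bd: "\<And>\<tau>. \<tau> \<in> J \<Longrightarrow> \<bar>R \<tau>\<bar> \<le> 1"
  shows "(\<lambda>\<tau>. fst (avg_inv \<tau> (R \<tau>, \<Psi> \<tau>))) differentiable (at \<tau>)"
    "(\<lambda>\<tau>. snd (avg_inv \<tau> (R \<tau>, \<Psi> \<tau>))) differentiable (at \<tau>)"
proof -
  let ?S = "{max 0 \<tau>0<..} \<times> {- 2<..<2::real} \<times> (UNIV :: real set)"
  define \<Gamma> where "\<Gamma> x = (fst x, fst (snd x) + corr \<rho> (fst x) (fst (snd x)) (snd (snd x)),
     snd (snd x) + corr \<psi> (fst x) (fst (snd x)) (snd (snd x)))" for x :: "real \<times> real \<times> real"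
  define g where "g x = (fst x, avg_inv (fst x) (snd x))" for x :: "real \<times> real \<times> real"
  have \<tau>0: "0 < \<tau>" "\<tau>0 < \<tau>" using sm[of \<tau>] J by (auto simp: small_def)
  have op: "open ?S" by (intro open_Times) auto
  have d\<Gamma>: "(\<Gamma> has_derivative (\<lambda>d. (fst d,
      fst (snd d) + (dtau \<rho> \<tau> r \<theta> * fst d + corr (Dr \<rho>) \<tau> r \<theta> * fst (snd d) + corr (D\<theta> \<rho>) \<tau> r \<theta> * snd (snd d)),
      snd (snd d) + (dtau \<psi> \<tau> r \<theta> * fst d + corr (Dr \<psi>) \<tau> r \<theta> * fst (snd d) + corr (D\<theta> \<psi>) \<tau> r \<theta> * snd (snd d))))) (at (\<tau>, r, \<theta>))"
    if "0 < \<tau>" for \<tau> r \<theta>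
    unfolding \<Gamma>_def[abs_def]
    by (intro has_derivative_Pair has_derivative_add has_derivative_fst has_derivative_snd has_derivative_ident
        corr_has_derivative regular that)
  have cont: "continuous_on ?S \<Gamma>"
  proof (rule continuous_at_imp_continuous_on, rule ballI)
    fix x assume "x \<in> ?S"
    then obtain t r \<theta> where "x = (t, r, \<theta>)" "0 < t" by (cases x) auto
    then show "isCont \<Gamma> x" using has_derivative_continuous[OF d\<Gamma>] by blast
  qed
  have gf: "g (\<Gamma> x) = x" if "x \<in> ?S" for x
  proof -
    obtain t r \<theta> where x: "x = (t, r, \<theta>)" by (cases x)
    then have t: "small t" "\<bar>r\<bar> \<le> 2" using sm that by auto
    show ?thesis using avg_inv_left[OF t, of \<theta>] by (simp add: g_def \<Gamma>_def x avg_map_def)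
  qed
  have sm\<tau>: "small \<tau>" and R1: "\<bar>R \<tau>\<bar> \<le> 1" using sm J bd by auto
  obtain r \<theta> where r: "avg_inv \<tau> (R \<tau>, \<Psi> \<tau>) = (r, \<theta>)" by (metis surj_pair)
  \<comment> \<open>The strict inequality places the point in the open set to which the inverse
    function theorem is applied.\<close>
  have r2: "\<bar>r\<bar> < 2" and eq: "avg_map \<tau> (r, \<theta>) = (R \<tau>, \<Psi> \<tau>)" using avg_inv_right[OF sm\<tau> R1, of "\<Psi> \<tau>"] r by auto
  let ?a = "1 + corr (Dr \<rho>) \<tau> r \<theta>" and ?b = "corr (D\<theta> \<rho>) \<tau> r \<theta>" and ?c = "corr (Dr \<psi>) \<tau> r \<theta>" and ?d = "1 + corr (D\<theta> \<psi>) \<tau> r \<theta>"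
  define \<Delta> where "\<Delta> = ?a * ?d - ?b * ?c"
  have \<Delta>: "0 < \<Delta>" unfolding \<Delta>_def by (rule jacobian_pos[OF sm\<tau>]) (use r2 in simp)
  \<comment> \<open>Inverse of the derivative: the \<tau>-part is subtracted first, then the system
    in r and \<theta> is solved by Cramer's rule with determinant \<Delta>.\<close>
  define g' where "g' d = (fst d,
     (?d * (fst (snd d) - dtau \<rho> \<tau> r \<theta> * fst d) - ?b * (snd (snd d) - dtau \<psi> \<tau> r \<theta> * fst d)) / \<Delta>,
     (?a * (snd (snd d) - dtau \<psi> \<tau> r \<theta> * fst d) - ?c * (fst (snd d) - dtau \<rho> \<tau> r \<theta> * fst d)) / \<Delta>)" for d :: "real \<times> real \<times> real"
  have "(g has_derivative g') (at (\<Gamma> (\<tau>, r, \<theta>)))"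
  proof (rule has_derivative_inverse_strong[OF op _ cont gf d\<Gamma>[OF \<tau>0(1)]])
    show "(\<tau>, r, \<theta>) \<in> ?S" using \<tau>0 r2 by (auto simp: abs_less_iff)
    show "(\<lambda>d. (fst d,
      fst (snd d) + (dtau \<rho> \<tau> r \<theta> * fst d + corr (Dr \<rho>) \<tau> r \<theta> * fst (snd d) + corr (D\<theta> \<rho>) \<tau> r \<theta> * snd (snd d)),
      snd (snd d) + (dtau \<psi> \<tau> r \<theta> * fst d + corr (Dr \<psi>) \<tau> r \<theta> * fst (snd d) + corr (D\<theta> \<psi>) \<tau> r \<theta> * snd (snd d)))) \<circ> g' = id"
    proof
      fix d :: "real \<times> real \<times> real"
      define u where "u = fst (snd d) - dtau \<rho> \<tau> r \<theta> * fst d"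
      define v where "v = snd (snd d) - dtau \<psi> \<tau> r \<theta> * fst d"
      have 1: "?a * ((?d * u - ?b * v) / \<Delta>) + ?b * ((?a * v - ?c * u) / \<Delta>) = u"
      proof -
        have "?a * ((?d * u - ?b * v) / \<Delta>) + ?b * ((?a * v - ?c * u) / \<Delta>) = (?a * (?d * u - ?b * v) + ?b * (?a * v - ?c * u)) / \<Delta>"
          by (simp only: add_divide_distrib times_divide_eq_right)
        also have "?a * (?d * u - ?b * v) + ?b * (?a * v - ?c * u) = \<Delta> * u" by (simp add: \<Delta>_def algebra_simps)
        finally show ?thesis using \<Delta> by simp
      qed
      have 2: "?c * ((?d * u - ?b * v) / \<Delta>) + ?d * ((?a * v - ?c * u) / \<Delta>) = v"
      proof -
        have "?c * ((?d * u - ?b * v) / \<Delta>) + ?d * ((?a * v - ?c * u) / \<Delta>) = (?c * (?d * u - ?b * v) + ?d * (?a * v - ?c * u)) / \<Delta>"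
          by (simp only: add_divide_distrib times_divide_eq_right)
        also have "?c * (?d * u - ?b * v) + ?d * (?a * v - ?c * u) = \<Delta> * v" by (simp add: \<Delta>_def algebra_simps)
        finally show ?thesis using \<Delta> by simp
      qed
      define x where "x = (?d * u - ?b * v) / \<Delta>"
      define y where "y = (?a * v - ?c * u) / \<Delta>"
      have g'd: "g' d = (fst d, x, y)" by (simp only: g'_def u_def v_def x_def y_def)
      have "?a * x + ?b * y = u" "?c * x + ?d * y = v" using 1 2 by (simp_all only: x_def y_def)
      then have "x + (dtau \<rho> \<tau> r \<theta> * fst d + corr (Dr \<rho>) \<tau> r \<theta> * x + corr (D\<theta> \<rho>) \<tau> r \<theta> * y) = fst (snd d)"
        "y + (dtau \<psi> \<tau> r \<theta> * fst d + corr (Dr \<psi>) \<tau> r \<theta> * x + corr (D\<theta> \<psi>) \<tau> r \<theta> * y) = snd (snd d)"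
        unfolding u_def v_def by (simp_all only: distrib_right mult_1)
      then show "((\<lambda>d. (fst d,
      fst (snd d) + (dtau \<rho> \<tau> r \<theta> * fst d + corr (Dr \<rho>) \<tau> r \<theta> * fst (snd d) + corr (D\<theta> \<rho>) \<tau> r \<theta> * snd (snd d)),
      snd (snd d) + (dtau \<psi> \<tau> r \<theta> * fst d + corr (Dr \<psi>) \<tau> r \<theta> * fst (snd d) + corr (D\<theta> \<psi>) \<tau> r \<theta> * snd (snd d)))) \<circ> g') d = id d"
        by (simp add: g'd)
    qed
  qed
  moreover have "\<Gamma> (\<tau>, r, \<theta>) = (\<tau>, R \<tau>, \<Psi> \<tau>)" using eq by (simp add: \<Gamma>_def avg_map_def)
  ultimately have dg: "(g has_derivative g') (at (\<tau>, R \<tau>, \<Psi> \<tau>))" by simp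
  have "((\<lambda>\<tau>. (\<tau>, R \<tau>, \<Psi> \<tau>)) has_derivative (\<lambda>d. (d, R' * d, \<Psi>' * d))) (at \<tau>)"
    using R \<Psi> by (intro has_derivative_Pair has_derivative_ident) (simp_all add: has_field_derivative_def)
  from has_derivative_compose[OF this dg]
  have *: "((\<lambda>\<tau>. (\<tau>, avg_inv \<tau> (R \<tau>, \<Psi> \<tau>))) has_derivative (\<lambda>d. g' (d, R' * d, \<Psi>' * d))) (at \<tau>)"
    by (simp add: g_def)
  from has_derivative_fst[OF has_derivative_snd[OF *]] has_derivative_snd[OF has_derivative_snd[OF *]]
  show "(\<lambda>\<tau>. fst (avg_inv \<tau> (R \<tau>, \<Psi> \<tau>))) differentiable (at \<tau>)"
    "(\<lambda>\<tau>. snd (avg_inv \<tau> (R \<tau>, \<Psi> \<tau>))) differentiable (at \<tau>)"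
    unfolding differentiable_def by auto
qed

text \<open>With r and \<theta> known to be differentiable, comparing two expressions for the
  derivatives of R and \<Psi> gives a homogeneous linear system for the defects in the equations for
  r and \<theta>. Its determinant is positive, so the defects vanish.\<close>

lemma averaged_solution_lifts:
  assumes sm: "\<And>\<tau>. \<tau>0 < \<tau> \<Longrightarrow> small \<tau>" and J: "open J" "J \<subseteq> {\<tau>0<..}"
    and bd: "\<And>\<tau>. \<tau> \<in> J \<Longrightarrow> \<bar>R \<tau>\<bar> \<le> 1"
    and R: "\<And>\<tau>. \<tau> \<in> J \<Longrightarrow> (R has_real_derivative (\<Sum>K\<le>n. z \<tau> ^ (M + K) * \<Lambda> K (R \<tau>) (\<Psi> \<tau>)) + \<Lambda>rem (R \<tau>) (\<Psi> \<tau>) \<tau>) (at \<tau>)"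
    and \<Psi>: "\<And>\<tau>. \<tau> \<in> J \<Longrightarrow> (\<Psi> has_real_derivative (\<Sum>K\<le>n. z \<tau> ^ (M + K) * \<Omega> K (R \<tau>) (\<Psi> \<tau>)) + \<Omega>rem (R \<tau>) (\<Psi> \<tau>) \<tau>) (at \<tau>)"
  obtains r \<theta> where "\<And>\<tau>. \<tau> \<in> J \<Longrightarrow> \<bar>r \<tau>\<bar> \<le> 2 \<and> R \<tau> = r \<tau> + corr \<rho> \<tau> (r \<tau>) (\<theta> \<tau>) \<and> \<Psi> \<tau> = \<theta> \<tau> + corr \<psi> \<tau> (r \<tau>) (\<theta> \<tau>)"
    "\<And>\<tau>. \<tau> \<in> J \<Longrightarrow> (r has_real_derivative z \<tau> ^ M * calA (r \<tau>) (\<theta> \<tau>) (vartheta * \<tau>) \<tau>) (at \<tau>)"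
    "\<And>\<tau>. \<tau> \<in> J \<Longrightarrow> (\<theta> has_real_derivative z \<tau> ^ M * calB (r \<tau>) (\<theta> \<tau>) (vartheta * \<tau>) \<tau>) (at \<tau>)"
proof -
  define r where "r \<tau> = fst (avg_inv \<tau> (R \<tau>, \<Psi> \<tau>))" for \<tau>
  define \<theta> where "\<theta> \<tau> = snd (avg_inv \<tau> (R \<tau>, \<Psi> \<tau>))" for \<tau>
  have rel: "\<bar>r \<tau>\<bar> \<le> 2" "R \<tau> = r \<tau> + corr \<rho> \<tau> (r \<tau>) (\<theta> \<tau>)" "\<Psi> \<tau> = \<theta> \<tau> + corr \<psi> \<tau> (r \<tau>) (\<theta> \<tau>)" if "\<tau> \<in> J" for \<tau>
  proof -
    have "small \<tau>" using sm J that by auto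
    from avg_inv_right[OF this bd[OF that], of "\<Psi> \<tau>"]
    show "\<bar>r \<tau>\<bar> \<le> 2" "R \<tau> = r \<tau> + corr \<rho> \<tau> (r \<tau>) (\<theta> \<tau>)" "\<Psi> \<tau> = \<theta> \<tau> + corr \<psi> \<tau> (r \<tau>) (\<theta> \<tau>)"
      by (auto simp: r_def \<theta>_def avg_map_def case_prod_unfold)
  qed
  have main: "(r has_real_derivative z \<tau> ^ M * calA (r \<tau>) (\<theta> \<tau>) (vartheta * \<tau>) \<tau>) (at \<tau>) \<and>
     (\<theta> has_real_derivative z \<tau> ^ M * calB (r \<tau>) (\<theta> \<tau>) (vartheta * \<tau>) \<tau>) (at \<tau>)" if \<tau>: "\<tau> \<in> J" for \<tau>
  proof -
    have sm\<tau>: "small \<tau>" and pos: "0 < \<tau>" using sm J \<tau> by (auto simp: small_def)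
    obtain r' where r': "(r has_real_derivative r') (at \<tau>)"
      using inverse_curve_differentiable(1)[OF sm J \<tau> R[OF \<tau>] \<Psi>[OF \<tau>] bd] unfolding r_def[symmetric]
      by (auto simp: real_differentiable_def)
    obtain \<theta>' where \<theta>': "(\<theta> has_real_derivative \<theta>') (at \<tau>)"
      using inverse_curve_differentiable(2)[OF sm J \<tau> R[OF \<tau>] \<Psi>[OF \<tau>] bd] unfolding \<theta>_def[symmetric]
      by (auto simp: real_differentiable_def)
    define A where "A = z \<tau> ^ M * calA (r \<tau>) (\<theta> \<tau>) (vartheta * \<tau>) \<tau>"
    define B where "B = z \<tau> ^ M * calB (r \<tau>) (\<theta> \<tau>) (vartheta * \<tau>) \<tau>"
    let ?a = "corr (Dr \<rho>) \<tau> (r \<tau>) (\<theta> \<tau>)" and ?b = "corr (D\<theta> \<rho>) \<tau> (r \<tau>) (\<theta> \<tau>)"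
      and ?c = "corr (Dr \<psi>) \<tau> (r \<tau>) (\<theta> \<tau>)" and ?d = "corr (D\<theta> \<psi>) \<tau> (r \<tau>) (\<theta> \<tau>)"
    have "((\<lambda>\<tau>. r \<tau> + corr \<rho> \<tau> (r \<tau>) (\<theta> \<tau>)) has_real_derivative r' + (dtau \<rho> \<tau> (r \<tau>) (\<theta> \<tau>) + ?a * r' + ?b * \<theta>')) (at \<tau>)"
      by (intro DERIV_add r' corr_chain[OF regular(1) pos r' \<theta>'])
    then have "(R has_real_derivative r' + (dtau \<rho> \<tau> (r \<tau>) (\<theta> \<tau>) + ?a * r' + ?b * \<theta>')) (at \<tau>)"
      by (rule has_field_derivative_transform_within_open[OF _ J(1) \<tau>]) (simp add: rel(2)[symmetric])
    from DERIV_unique[OF this R[OF \<tau>]]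
    have "r' + (dtau \<rho> \<tau> (r \<tau>) (\<theta> \<tau>) + ?a * r' + ?b * \<theta>') = total 1 0 \<rho> \<tau> (r \<tau>) (\<theta> \<tau>) (vartheta * \<tau>)"
      using rem_eq_loc(1)[OF sm\<tau> rel(1)[OF \<tau>], of "\<theta> \<tau>"]
      by (simp add: \<Lambda>loc_def averaged_def corr_def[symmetric] rel(2,3)[OF \<tau>, symmetric])
    then have 1: "(1 + ?a) * (r' - A) + ?b * (\<theta>' - B) = 0"
      unfolding total_eq A_def[symmetric] B_def[symmetric] by (simp add: algebra_simps)
    have "((\<lambda>\<tau>. \<theta> \<tau> + corr \<psi> \<tau> (r \<tau>) (\<theta> \<tau>)) has_real_derivative \<theta>' + (dtau \<psi> \<tau> (r \<tau>) (\<theta> \<tau>) + ?c * r' + ?d * \<theta>')) (at \<tau>)"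
      by (intro DERIV_add \<theta>' corr_chain[OF regular(2) pos r' \<theta>'])
    then have "(\<Psi> has_real_derivative \<theta>' + (dtau \<psi> \<tau> (r \<tau>) (\<theta> \<tau>) + ?c * r' + ?d * \<theta>')) (at \<tau>)"
      by (rule has_field_derivative_transform_within_open[OF _ J(1) \<tau>]) (simp add: rel(3)[symmetric])
    from DERIV_unique[OF this \<Psi>[OF \<tau>]]
    have "\<theta>' + (dtau \<psi> \<tau> (r \<tau>) (\<theta> \<tau>) + ?c * r' + ?d * \<theta>') = total 0 1 \<psi> \<tau> (r \<tau>) (\<theta> \<tau>) (vartheta * \<tau>)"
      using rem_eq_loc(2)[OF sm\<tau> rel(1)[OF \<tau>], of "\<theta> \<tau>"]
      by (simp add: \<Omega>loc_def averaged_def corr_def[symmetric] rel(2,3)[OF \<tau>, symmetric])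
    then have 2: "?c * (r' - A) + (1 + ?d) * (\<theta>' - B) = 0"
      unfolding total_eq A_def[symmetric] B_def[symmetric] by (simp add: algebra_simps)
    have \<Delta>: "0 < (1 + ?a) * (1 + ?d) - ?b * ?c" by (rule jacobian_pos[OF sm\<tau> rel(1)[OF \<tau>]])
    \<comment> \<open>Cramer's rule: this combination of the two equations isolates the defect of r,
      the later one that of \<theta>.\<close>
    have "((1 + ?a) * (1 + ?d) - ?b * ?c) * (r' - A)
        = (1 + ?d) * ((1 + ?a) * (r' - A) + ?b * (\<theta>' - B)) - ?b * (?c * (r' - A) + (1 + ?d) * (\<theta>' - B))"
      by (simp add: algebra_simps)
    then have "r' = A" unfolding 1 2 using \<Delta> by simp
    have "((1 + ?a) * (1 + ?d) - ?b * ?c) * (\<theta>' - B)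
        = (1 + ?a) * (?c * (r' - A) + (1 + ?d) * (\<theta>' - B)) - ?c * ((1 + ?a) * (r' - A) + ?b * (\<theta>' - B))"
      by (simp add: algebra_simps)
    then have "\<theta>' = B" unfolding 1 2 using \<Delta> by simp
    show ?thesis using r' \<theta>' \<open>r' = A\<close> \<open>\<theta>' = B\<close> by (simp add: A_def B_def)
  qed
  show ?thesis using that[of r \<theta>] rel main by blast
qed

text \<open>Pure chain rule, valid for r of any size; this is why the forward direction is expressed
  with \<open>\<Lambda>loc\<close> and \<open>\<Omega>loc\<close>.\<close>

lemma solution_averages:
  assumes \<tau>: "0 < \<tau>"
    and r: "(r has_real_derivative z \<tau> ^ M * calA (r \<tau>) (\<theta> \<tau>) (vartheta * \<tau>) \<tau>) (at \<tau>)"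
    and \<theta>: "(\<theta> has_real_derivative z \<tau> ^ M * calB (r \<tau>) (\<theta> \<tau>) (vartheta * \<tau>) \<tau>) (at \<tau>)"
  shows "((\<lambda>\<tau>. r \<tau> + corr \<rho> \<tau> (r \<tau>) (\<theta> \<tau>)) has_real_derivative
      (\<Sum>K\<le>n. z \<tau> ^ (M + K) * \<Lambda> K (r \<tau> + corr \<rho> \<tau> (r \<tau>) (\<theta> \<tau>)) (\<theta> \<tau> + corr \<psi> \<tau> (r \<tau>) (\<theta> \<tau>))) + \<Lambda>loc (r \<tau>) (\<theta> \<tau>) \<tau>) (at \<tau>)"
    and "((\<lambda>\<tau>. \<theta> \<tau> + corr \<psi> \<tau> (r \<tau>) (\<theta> \<tau>)) has_real_derivative
      (\<Sum>K\<le>n. z \<tau> ^ (M + K) * \<Omega> K (r \<tau> + corr \<rho> \<tau> (r \<tau>) (\<theta> \<tau>)) (\<theta> \<tau> + corr \<psi> \<tau> (r \<tau>) (\<theta> \<tau>))) + \<Omega>loc (r \<tau>) (\<theta> \<tau>) \<tau>) (at \<tau>)"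
proof -
  show "((\<lambda>\<tau>. r \<tau> + corr \<rho> \<tau> (r \<tau>) (\<theta> \<tau>)) has_real_derivative
      (\<Sum>K\<le>n. z \<tau> ^ (M + K) * \<Lambda> K (r \<tau> + corr \<rho> \<tau> (r \<tau>) (\<theta> \<tau>)) (\<theta> \<tau> + corr \<psi> \<tau> (r \<tau>) (\<theta> \<tau>))) + \<Lambda>loc (r \<tau>) (\<theta> \<tau>) \<tau>) (at \<tau>)"
    by (rule DERIV_cong[OF DERIV_add[OF r corr_chain[OF regular(1) \<tau> r \<theta>]]])
      (unfold \<Lambda>loc_def total_eq averaged_def corr_def[symmetric], simp add: algebra_simps)
  show "((\<lambda>\<tau>. \<theta> \<tau> + corr \<psi> \<tau> (r \<tau>) (\<theta> \<tau>)) has_real_derivative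
      (\<Sum>K\<le>n. z \<tau> ^ (M + K) * \<Omega> K (r \<tau> + corr \<rho> \<tau> (r \<tau>) (\<theta> \<tau>)) (\<theta> \<tau> + corr \<psi> \<tau> (r \<tau>) (\<theta> \<tau>))) + \<Omega>loc (r \<tau>) (\<theta> \<tau>) \<tau>) (at \<tau>)"
    by (rule DERIV_cong[OF DERIV_add[OF \<theta> corr_chain[OF regular(2) \<tau> r \<theta>]]])
      (unfold \<Omega>loc_def total_eq averaged_def corr_def[symmetric], simp add: algebra_simps)
qed

end

section \<open>Equivalence of the systems\<close>

text \<open>A nonintegrable function would have \<open>integral\<close> equal to 0, so integrability
  comes first: the integrand is dominated by the derivative of \<open>arcsin\<close>, as
  \<open>\<xi> ^ (2 * h)\<close> is at most the square of \<xi>.\<close>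

lemma period_integral_pos:
  assumes "0 < h"
  shows "0 < integral {- 1..1} (\<lambda>\<xi>::real. 1 / sqrt (1 - \<xi> ^ (2 * h)))"
proof -
  let ?f = "\<lambda>\<xi>::real. 1 / sqrt (1 - \<xi> ^ (2 * h))"
  have le: "\<xi> ^ (2 * h) \<le> \<xi>\<^sup>2" if "\<xi> \<in> {- 1..1}" for \<xi> :: real
  proof -
    have "\<xi>\<^sup>2 \<le> 1" unfolding abs_square_le_1 using that by auto
    then have "(\<xi>\<^sup>2) ^ h \<le> (\<xi>\<^sup>2) ^ 1" using assms by (intro power_decreasing) auto
    then show ?thesis by (simp add: power_mult)
  qed
  have sq: "\<xi>\<^sup>2 < 1" if "\<xi> \<in> {- 1..1}" "\<xi> \<noteq> 1" "\<xi> \<noteq> - 1" for \<xi> :: real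
    using that by (auto simp: abs_square_less_1 abs_less_iff)
  have "((\<lambda>x. inverse (sqrt (1 - x\<^sup>2))) has_integral (arcsin 1 - arcsin (- 1))) {- 1..1}"
  proof (rule fundamental_theorem_of_calculus_interior)
    show "continuous_on {- 1..1} arcsin" by (rule continuous_on_arcsin')
    fix x :: real assume "x \<in> {- 1<..<1}"
    then show "(arcsin has_vector_derivative inverse (sqrt (1 - x\<^sup>2))) (at x)"
      using DERIV_arcsin[of x] by (simp add: has_real_derivative_iff_has_vector_derivative)
  qed simp
  then have dom: "(\<lambda>x. inverse (sqrt (1 - x\<^sup>2)) :: real) integrable_on {- 1..1}" by (rule has_integral_integrable)
  have int: "?f integrable_on {- 1..1}"
  proof (rule measurable_bounded_by_integrable_imp_integrable[OF _ dom])
    have "?f \<in> borel_measurable lborel" by measurable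
    then show "?f \<in> borel_measurable (lebesgue_on {- 1..1})"
      by (intro measurable_restrict_space1 measurable_completion)
    fix \<xi> :: real assume \<xi>: "\<xi> \<in> {- 1..1}"
    show "norm (?f \<xi>) \<le> inverse (sqrt (1 - \<xi>\<^sup>2))"
    proof (cases "\<xi> = 1 \<or> \<xi> = - 1")
      case False
      then have "0 < 1 - \<xi>\<^sup>2" "1 - \<xi>\<^sup>2 \<le> 1 - \<xi> ^ (2 * h)" using sq le \<xi> by auto
      then show ?thesis by (simp add: inverse_eq_divide frac_le)
    qed auto
  qed simp
  have k: "((\<lambda>x::real. 1 - x\<^sup>2) has_integral ((1 - 1 ^ 3 / 3) - (- 1 - (- 1) ^ 3 / 3))) {- 1..1}"
  proof (rule fundamental_theorem_of_calculus)
    fix x :: real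
    have "((\<lambda>x. x - x ^ 3 / 3) has_real_derivative 1 - x\<^sup>2) (at x within {- 1..1})"
      by (auto intro!: derivative_eq_intros)
    then show "((\<lambda>x. x - x ^ 3 / 3) has_vector_derivative 1 - x\<^sup>2) (at x within {- 1..1})"
      by (simp add: has_real_derivative_iff_has_vector_derivative)
  qed simp
  \<comment> \<open>This lower bound vanishes at both end points, where the singular integrand has
    the value 0 by the convention \<open>1 / 0 = 0\<close>.\<close>
  have "integral {- 1..1} (\<lambda>x::real. 1 - x\<^sup>2) \<le> integral {- 1..1} ?f"
  proof (rule integral_le[OF has_integral_integrable[OF k] int])
    fix \<xi> :: real assume \<xi>: "\<xi> \<in> {- 1..1}"
    show "1 - \<xi>\<^sup>2 \<le> ?f \<xi>"
    proof (cases "\<xi> = 1 \<or> \<xi> = - 1")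
      case False
      then have "0 < 1 - \<xi> ^ (2 * h)" using sq[of \<xi>] le[of \<xi>] \<xi> by auto
      moreover have "1 - \<xi> ^ (2 * h) \<le> 1" by (simp add: power_mult)
      ultimately have "1 \<le> ?f \<xi>" by simp
      then show ?thesis using zero_le_power2[of \<xi>] by linarith
    qed auto
  qed
  moreover have "integral {- 1..1} (\<lambda>x::real. 1 - x\<^sup>2) = 4 / 3"
    using integral_unique[OF k] by simp
  ultimately show ?thesis by linarith
qed

text \<open>An increasing \<omega> is bounded on energies between \<open>E1\<close> and K by its
  values at the ends, so once \<open>\<omega> (Istar t)\<close> exceeds both, \<open>Istar t\<close>
  is beyond K.\<close>

lemma filterlim_of_increasing_image:
  fixes \<omega> Istar :: "real \<Rightarrow> real"
  assumes inc: "\<And>E. E1 < E \<Longrightarrow> (\<omega> has_real_derivative \<omega>' E) (at E)" "\<And>E. E1 < E \<Longrightarrow> 0 < \<omega>' E"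
    and ge: "\<forall>\<^sub>F t in at_top. E1 \<le> Istar t"
    and lim: "filterlim (\<lambda>t. \<omega> (Istar t)) at_top at_top"
  shows "filterlim Istar at_top at_top"
  unfolding filterlim_at_top
proof
  fix Z :: real
  define K where "K = max Z (E1 + 1)"
  have "\<forall>\<^sub>F t in at_top. max (\<omega> E1) (\<omega> K) < \<omega> (Istar t)"
    using lim unfolding filterlim_at_top_dense by blast
  with ge show "\<forall>\<^sub>F t in at_top. Z \<le> Istar t"
  proof eventually_elim
    case (elim t)
    show ?case
    proof (rule ccontr)
      assume "\<not> Z \<le> Istar t"
      then have lt: "Istar t < K" by (simp add: K_def)
      \<comment> \<open>Monotonicity is known strictly above \<open>E1\<close>; the value at
        \<open>E1\<close> itself is excluded by the first entry of the maximum.\<close>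
      have "E1 < Istar t" using elim by (cases "E1 = Istar t") auto
      then have "\<omega> (Istar t) < \<omega> K"
        using DERIV_pos_imp_increasing[OF lt, of \<omega>] inc by (meson less_le_trans)
      then show False using elim(2) by simp
    qed
  qed
qed

text \<open>The cross terms collapse because \<open>dU * X_E + Y * Y_E = 1\<close>, the derivative
  of the energy identity; the same identity is used in the converse direction below.\<close>

lemma (in hamiltonian_orbits) energy_angle_to_cartesian:
  assumes E: "E0 < I t"
    and I: "(I has_real_derivative \<epsilon> * (f * dU (X (\<phi> t) (I t)) + g * Y (\<phi> t) (I t))) (at t)"
    and \<phi>: "(\<phi> has_real_derivative \<omega> (I t) + \<epsilon> * (\<omega> (I t) * (f * deriv (Y (\<phi> t)) (I t) - g * deriv (X (\<phi> t)) (I t)))) (at t)"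
  shows "((\<lambda>t. X (\<phi> t) (I t)) has_real_derivative Y (\<phi> t) (I t) + \<epsilon> * f) (at t)"
    and "((\<lambda>t. Y (\<phi> t) (I t)) has_real_derivative - dU (X (\<phi> t) (I t)) + \<epsilon> * g) (at t)"
proof -
  let ?U = "dU (X (\<phi> t) (I t))" and ?Y = "Y (\<phi> t) (I t)" and ?XE = "deriv (X (\<phi> t)) (I t)" and ?YE = "deriv (Y (\<phi> t)) (I t)"
  define o' where "o' = \<omega> (I t)"
  have o': "0 < o'" unfolding o'_def by (rule \<omega>_pos[OF E])
  have J: "?U * ?XE + ?Y * ?YE = 1" by (rule XY_differentiable(3)[OF E])
  define \<phi>' where "\<phi>' = o' + \<epsilon> * (o' * (f * ?YE - g * ?XE))"
  define I' where "I' = \<epsilon> * (f * ?U + g * ?Y)"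
  have pair: "((\<lambda>t. (\<phi> t, I t)) has_derivative (\<lambda>d. (\<phi>' * d, I' * d))) (at t)"
    using \<phi> I by (intro has_derivative_Pair) (simp_all add: has_field_derivative_def \<phi>'_def I'_def o'_def)
  have \<phi>o: "\<phi>' / o' = 1 + \<epsilon> * (f * ?YE - g * ?XE)" using o' by (simp add: \<phi>'_def add_divide_distrib)
  have "?Y / o' * \<phi>' + ?XE * I' = ?Y * (\<phi>' / o') + ?XE * I'" by simp
  also have "\<dots> = ?Y + \<epsilon> * f * (?U * ?XE + ?Y * ?YE)" unfolding \<phi>o I'_def by (simp add: algebra_simps)
  finally have 1: "?Y / o' * \<phi>' + ?XE * I' = ?Y + \<epsilon> * f" by (simp add: J)
  have "- ?U / o' * \<phi>' + ?YE * I' = - ?U * (\<phi>' / o') + ?YE * I'" by simp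
  also have "\<dots> = - ?U + \<epsilon> * g * (?U * ?XE + ?Y * ?YE)" unfolding \<phi>o I'_def by (simp add: algebra_simps)
  finally have 2: "- ?U / o' * \<phi>' + ?YE * I' = - ?U + \<epsilon> * g" by (simp add: J)
  have "((\<lambda>t. X (\<phi> t) (I t)) has_derivative (\<lambda>d. ?Y / o' * (\<phi>' * d) + ?XE * (I' * d))) (at t)"
    using has_derivative_compose[OF pair XY_differentiable(1)[OF E]] by (simp add: o'_def)
  then show "((\<lambda>t. X (\<phi> t) (I t)) has_real_derivative ?Y + \<epsilon> * f) (at t)"
    unfolding has_field_derivative_def
    by (rule has_derivative_eq_rhs) (unfold 1[symmetric], auto simp: algebra_simps)
  have "((\<lambda>t. Y (\<phi> t) (I t)) has_derivative (\<lambda>d. - ?U / o' * (\<phi>' * d) + ?YE * (I' * d))) (at t)"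
    using has_derivative_compose[OF pair XY_differentiable(2)[OF E]] by (simp add: o'_def)
  then show "((\<lambda>t. Y (\<phi> t) (I t)) has_real_derivative - ?U + \<epsilon> * g) (at t)"
    unfolding has_field_derivative_def
    by (rule has_derivative_eq_rhs) (unfold 2[symmetric], auto simp: algebra_simps)
qed

lemma (in hamiltonian_orbits) cartesian_to_energy_angle:
  assumes J: "open J" "is_interval J" and E: "\<And>t. t \<in> J \<Longrightarrow> E0 < H (x t) (y t)"
    and x: "\<And>t. t \<in> J \<Longrightarrow> (x has_real_derivative y t + \<epsilon> t * f t) (at t)"
    and y: "\<And>t. t \<in> J \<Longrightarrow> (y has_real_derivative - dU (x t) + \<epsilon> t * g t) (at t)"
  obtains \<phi> where
    "\<And>t. t \<in> J \<Longrightarrow> X (\<phi> t) (H (x t) (y t)) = x t \<and> Y (\<phi> t) (H (x t) (y t)) = y t"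
    "\<And>t. t \<in> J \<Longrightarrow> ((\<lambda>t. H (x t) (y t)) has_real_derivative \<epsilon> t * (f t * dU (x t) + g t * y t)) (at t)"
    "\<And>t. t \<in> J \<Longrightarrow> (\<phi> has_real_derivative \<omega> (H (x t) (y t)) + \<epsilon> t * (\<omega> (H (x t) (y t)) *
       (f t * deriv (Y (\<phi> t)) (H (x t) (y t)) - g t * deriv (X (\<phi> t)) (H (x t) (y t))))) (at t)"
proof -
  have "\<exists>\<phi>. (\<forall>t\<in>J. X (\<phi> t) (H (x t) (y t)) = x t \<and> Y (\<phi> t) (H (x t) (y t)) = y t) \<and>
     (\<forall>t\<in>J. (\<phi> has_real_derivative \<omega> (H (x t) (y t)) *
       (deriv (Y (\<phi> t)) (H (x t) (y t)) * (y t + \<epsilon> t * f t) - deriv (X (\<phi> t)) (H (x t) (y t)) * (- dU (x t) + \<epsilon> t * g t))) (at t))"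
    by (rule lift_angle[OF J x y E]) blast+
  then obtain \<phi> where \<phi>: "\<And>t. t \<in> J \<Longrightarrow> X (\<phi> t) (H (x t) (y t)) = x t \<and> Y (\<phi> t) (H (x t) (y t)) = y t"
    and d\<phi>: "\<And>t. t \<in> J \<Longrightarrow> (\<phi> has_real_derivative \<omega> (H (x t) (y t)) *
       (deriv (Y (\<phi> t)) (H (x t) (y t)) * (y t + \<epsilon> t * f t) - deriv (X (\<phi> t)) (H (x t) (y t)) * (- dU (x t) + \<epsilon> t * g t))) (at t)"
    by blast
  have dH: "((\<lambda>t. H (x t) (y t)) has_real_derivative \<epsilon> t * (f t * dU (x t) + g t * y t)) (at t)" if t: "t \<in> J" for t
    unfolding H by (auto intro!: derivative_eq_intros x[OF t] y[OF t] DERIV_chain2[OF U]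
        simp: algebra_simps add_divide_distrib diff_divide_distrib)
  have "(\<phi> has_real_derivative \<omega> (H (x t) (y t)) + \<epsilon> t * (\<omega> (H (x t) (y t)) *
       (f t * deriv (Y (\<phi> t)) (H (x t) (y t)) - g t * deriv (X (\<phi> t)) (H (x t) (y t))))) (at t)" if t: "t \<in> J" for t
  proof -
    define XE where "XE = deriv (X (\<phi> t)) (H (x t) (y t))"
    define YE where "YE = deriv (Y (\<phi> t)) (H (x t) (y t))"
    have "dU (x t) * XE + y t * YE = 1"
      using XY_differentiable(3)[OF E[OF t], of "\<phi> t"] \<phi>[OF t] by (simp add: XE_def YE_def)
    moreover have "\<omega> (H (x t) (y t)) * (YE * (y t + \<epsilon> t * f t) - XE * (- dU (x t) + \<epsilon> t * g t))
        = \<omega> (H (x t) (y t)) * (dU (x t) * XE + y t * YE) + \<epsilon> t * (\<omega> (H (x t) (y t)) * (f t * YE - g t * XE))"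
      by (simp add: algebra_simps)
    ultimately show ?thesis using d\<phi>[OF t] unfolding XE_def[symmetric] YE_def[symmetric] by simp
  qed
  then show ?thesis using that[of \<phi>] \<phi> dH by blast
qed

lemma action_derivative:
  fixes Is r :: "real \<Rightarrow> real"
  assumes "(Is has_real_derivative Is') (at t)" "(r has_real_derivative r') (at t)" "0 < t" "0 < h"
  shows "((\<lambda>t. Is t * (1 + t powr (- \<mu>) * r t) ^ (2 * h)) has_real_derivative
     Is' * (1 + t powr (- \<mu>) * r t) ^ (2 * h) + 2 * real h * Is t * (1 + t powr (- \<mu>) * r t) ^ (2 * h - 1)
       * (t powr (- \<mu>) * r' - \<mu> * t powr (- \<mu> - 1) * r t)) (at t)"
proof -
  have p: "((\<lambda>t. t powr (- \<mu>)) has_real_derivative - \<mu> * t powr (- \<mu> - 1)) (at t)"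
    by (rule has_real_derivative_powr[OF assms(3)])
  have w: "((\<lambda>t. 1 + t powr (- \<mu>) * r t) has_real_derivative t powr (- \<mu>) * r' - \<mu> * t powr (- \<mu> - 1) * r t) (at t)"
    by (rule DERIV_cong[OF DERIV_add[OF DERIV_const DERIV_mult[OF p assms(2)]]]) simp
  show ?thesis
    by (rule DERIV_cong[OF DERIV_mult[OF assms(1) DERIV_power[OF w]]]) (simp add: algebra_simps)
qed

text \<open>An equivalence, since the equation for I is turned into that for r in the forward
  direction and back again in the other.\<close>

lemma action_equation_iff:
  fixes w Is :: real
  assumes "0 < t" "0 < h" "0 < Is" "0 < w"
  shows "Is' * w ^ (2 * h) + 2 * real h * Is * w ^ (2 * h - 1) * (t powr (- \<mu>) * r' - \<mu> * t powr (- \<mu> - 1) * r) = F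
    \<longleftrightarrow> r' = t powr \<mu> * (F / (2 * real h * Is * w ^ (2 * h - 1)) - Is' / (2 * real h * Is) * w + \<mu> * t powr (- \<mu> - 1) * r)"
proof -
  define k where "k = 2 * real h * Is * w ^ (2 * h - 1)"
  have k: "0 < k" using assms by (simp add: k_def)
  have p: "t powr \<mu> * t powr (- \<mu>) = 1" using assms(1) by (simp flip: powr_add)
  have "w ^ (2 * h) = w ^ (2 * h - 1) * w" using assms(2) by (cases h) auto
  then have "Is' * w ^ (2 * h) = k * (Is' / (2 * real h * Is) * w)" using assms by (simp add: k_def)
  then have "Is' * w ^ (2 * h) + k * (t powr (- \<mu>) * r' - \<mu> * t powr (- \<mu> - 1) * r) = F
    \<longleftrightarrow> k * (Is' / (2 * real h * Is) * w + (t powr (- \<mu>) * r' - \<mu> * t powr (- \<mu> - 1) * r)) = F"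
    by (simp add: distrib_left)
  also have "\<dots> \<longleftrightarrow> Is' / (2 * real h * Is) * w + (t powr (- \<mu>) * r' - \<mu> * t powr (- \<mu> - 1) * r) = F / k"
    using k by (simp add: eq_divide_eq mult.commute)
  also have "\<dots> \<longleftrightarrow> t powr (- \<mu>) * r' = F / k - Is' / (2 * real h * Is) * w + \<mu> * t powr (- \<mu> - 1) * r"
    by linarith
  also have "\<dots> \<longleftrightarrow> t powr \<mu> * (t powr (- \<mu>) * r') = t powr \<mu> * (F / k - Is' / (2 * real h * Is) * w + \<mu> * t powr (- \<mu> - 1) * r)"
    using assms(1) by simp
  also have "t powr \<mu> * (t powr (- \<mu>) * r') = r'" using p by (simp add: mult.assoc[symmetric])
  finally show ?thesis unfolding k_def .
qed

text \<open>The positive root of order \<open>2 * h\<close> inverts the scaling of the energy, and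
  it is differentiable since the quotient of energies is positive.\<close>

lemma action_inverse:
  fixes I Is :: "real \<Rightarrow> real" and \<mu> :: real
  assumes "0 < t" "0 < h" "0 < Is t" "0 < I t"
  defines "r \<equiv> \<lambda>t. t powr \<mu> * ((I t / Is t) powr (1 / (2 * real h)) - 1)"
  shows "0 < 1 + t powr (- \<mu>) * r t" "Is t * (1 + t powr (- \<mu>) * r t) ^ (2 * h) = I t"
    and "I differentiable (at t) \<Longrightarrow> Is differentiable (at t) \<Longrightarrow> r differentiable (at t)"
proof -
  have p: "t powr (- \<mu>) * t powr \<mu> = 1" using assms(1) by (simp flip: powr_add)
  have w: "1 + t powr (- \<mu>) * r t = (I t / Is t) powr (1 / (2 * real h))"
    unfolding r_def using p by (simp add: mult.assoc[symmetric])
  show "0 < 1 + t powr (- \<mu>) * r t" unfolding w using assms by simp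
  have "((I t / Is t) powr (1 / (2 * real h))) ^ (2 * h) = I t / Is t"
    using assms by (simp add: powr_powr flip: powr_realpow)
  then show "Is t * (1 + t powr (- \<mu>) * r t) ^ (2 * h) = I t" unfolding w using assms by simp
  assume I: "I differentiable (at t)" and Is: "Is differentiable (at t)"
  obtain I' Is' where d: "(I has_real_derivative I') (at t)" "(Is has_real_derivative Is') (at t)"
    using I Is by (auto simp: real_differentiable_def)
  have q: "0 < I t / Is t" using assms by simp
  have "((\<lambda>t. I t / Is t) has_real_derivative (I' * Is t - I t * Is') / (Is t * Is t)) (at t)"
    by (rule DERIV_divide[OF d]) (use assms in simp)
  from DERIV_chain2[OF has_real_derivative_powr[OF q] this]
  have "((\<lambda>t. (I t / Is t) powr (1 / (2 * real h))) has_real_derivative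
     1 / (2 * real h) * (I t / Is t) powr (1 / (2 * real h) - 1) * ((I' * Is t - I t * Is') / (Is t * Is t))) (at t)" .
  from DERIV_mult[OF has_real_derivative_powr[OF assms(1), of \<mu>] DERIV_diff[OF this DERIV_const[of 1]]]
  show "r differentiable (at t)" unfolding r_def real_differentiable_def by blast
qed

lemma DERIV_eq_iff:
  fixes f :: "real \<Rightarrow> real"
  assumes "(f has_real_derivative D) (at x)"
  shows "D = E \<longleftrightarrow> (f has_real_derivative E) (at x)"
  using assms DERIV_unique by metis

theorem theorem1:
  fixes h a b q l p varkappa M N n :: nat
    and s \<sigma> \<mu> \<nu> vartheta \<kappa> E0 E1 t1 :: real
    and u :: "nat \<Rightarrow> real"
    and U S T \<omega> Istar time tau :: "real \<Rightarrow> real"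
    and H x0 y0 X Y Ires :: "real \<Rightarrow> real \<Rightarrow> real"
    and f g F G calA calB :: "real \<Rightarrow> real \<Rightarrow> real \<Rightarrow> real \<Rightarrow> real"
    and Acoef Bcoef :: "nat \<Rightarrow> nat \<Rightarrow> nat \<Rightarrow> real \<Rightarrow> real"
    and Xcoef Ycoef :: "nat \<Rightarrow> real \<Rightarrow> real"
    and \<omega>coef :: "nat \<Rightarrow> real"
    and D :: "real \<Rightarrow> (real \<times> real) set"
    and \<Lambda> \<Omega> :: "nat \<Rightarrow> real \<Rightarrow> real \<Rightarrow> real"
    and \<rho> \<psi> :: "nat \<Rightarrow> real \<Rightarrow> real \<Rightarrow> real \<Rightarrow> real"
    and xmap ymap Rmap \<Psi>map :: "real \<Rightarrow> real \<Rightarrow> real \<Rightarrow> real"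
  assumes h: "2 \<le> h" and a: "1 \<le> a" "a \<le> q" and b: "1 \<le> b" "b \<le> q"
    and lp: "l \<le> p" "p \<le> 2 * h - 1" and s: "0 < s" and varkappa: "1 \<le> varkappa"
    and S: "S = (\<lambda>t. s * t powr (1 + real b / real q))"
    and U: "U = (\<lambda>x. x ^ (2 * h) / (2 * real h) + (\<Sum>i = 1..2 * h - 1. u i * x ^ i))"
    and H: "H = (\<lambda>x y. y\<^sup>2 / 2 + U x)"
    and D: "D = (\<lambda>E. {(x, y). E < H x y})"
    and f_smooth: "smooth_on (\<lambda>(x, y, S, t). f x y S t) {(x, y, S, t). 0 < t}"
    and g_smooth: "smooth_on (\<lambda>(x, y, S, t). g x y S t) {(x, y, S, t). 0 < t}"
    and f_periodic: "\<And>x y t. 0 < t \<Longrightarrow> periodic (2 * pi) (\<lambda>S. f x y S t)"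
    and g_periodic: "\<And>x y t. 0 < t \<Longrightarrow> periodic (2 * pi) (\<lambda>S. g x y S t)"
    and f_asymp: "power_law_asymptotics q f
                    (\<lambda>k x y S. \<Sum>i\<le>p. \<Sum>j<l. Acoef k i j S * x ^ i * y ^ j)"
    and g_asymp: "power_law_asymptotics q g
                    (\<lambda>k x y S. \<Sum>i\<le>p. \<Sum>j\<le>l. Bcoef k i j S * x ^ i * y ^ j)"
    and coef_periodic: "\<And>k i j. periodic (2 * pi) (Acoef k i j)"
                       "\<And>k i j. periodic (2 * pi) (Bcoef k i j)"
    and coef_zero: "\<And>k i j S. p < i + j \<Longrightarrow> Acoef k i j S = 0"
                   "\<And>k i j S. p < i + j \<Longrightarrow> Bcoef k i j S = 0"
    and E0: "0 < E0" "\<And>E. E0 < E \<Longrightarrow> closed_curve {(x, y). H x y = E}"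
            "\<And>x y. E0 < H x y \<Longrightarrow> \<not> (deriv (\<lambda>\<eta>. H x \<eta>) y = 0 \<and> deriv (\<lambda>\<xi>. H \<xi> y) x = 0)"
    and orbit: "\<And>E. E0 < E \<Longrightarrow>
            solves_on UNIV (\<lambda>x y t. deriv (\<lambda>\<eta>. H x \<eta>) y) (\<lambda>x y t. - deriv (\<lambda>\<xi>. H \<xi> y) x)
              (\<lambda>t. x0 t E) (\<lambda>t. y0 t E)"
            "\<And>E. E0 < E \<Longrightarrow> range (\<lambda>t. (x0 t E, y0 t E)) = {(x, y). H x y = E}"
            "\<And>E. E0 < E \<Longrightarrow> \<exists>P>0. periodic P (\<lambda>t. x0 t E) \<and> periodic P (\<lambda>t. y0 t E)"
    and T: "T = (\<lambda>E. Inf {P. 0 < P \<and> periodic P (\<lambda>t. x0 t E) \<and> periodic P (\<lambda>t. y0 t E)})"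
    and \<omega>: "\<omega> = (\<lambda>E. 2 * pi / T E)"
    and orbit_smooth: "smooth_on (\<lambda>(t, E). x0 t E) (UNIV \<times> {E0<..})"
                      "smooth_on (\<lambda>(t, E). y0 t E) (UNIV \<times> {E0<..})"
                      "smooth_on \<omega> {E0<..}"
    and XY: "X = (\<lambda>\<phi> E. x0 (\<phi> / \<omega> E) E)" "Y = (\<lambda>\<phi> E. y0 (\<phi> / \<omega> E) E)"
    and X_asymp: "energy_asymptotics_C1 h (1 / (2 * real h)) X Xcoef"
    and Y_asymp: "energy_asymptotics_C1 h (1 / 2) Y Ycoef"
    and \<omega>_asymp: "energy_asymptotics_C1 h ((real h - 1) / (2 * real h)) (\<lambda>\<phi>. \<omega>) (\<lambda>j \<phi>. \<omega>coef j)"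
    and XYcoef_periodic: "\<And>j. periodic (2 * pi) (Xcoef j)" "\<And>j. periodic (2 * pi) (Ycoef j)"
    and \<kappa>: "\<kappa> = sqrt 2 * (2 * real h) powr (1 / (2 * real h))
                  * integral {-1..1} (\<lambda>\<xi>. 1 / sqrt (1 - \<xi> ^ (2 * h)))"
    and \<omega>coef0: "\<omega>coef 0 = 2 * pi / \<kappa>"
    and F: "F = (\<lambda>I \<phi> S t. f (X \<phi> I) (Y \<phi> I) S t * deriv U (X \<phi> I) + g (X \<phi> I) (Y \<phi> I) S t * Y \<phi> I)"
    and G: "G = (\<lambda>I \<phi> S t. \<omega> I * (f (X \<phi> I) (Y \<phi> I) S t * deriv (\<lambda>E. Y \<phi> E) I
                                  - g (X \<phi> I) (Y \<phi> I) S t * deriv (\<lambda>E. X \<phi> E) I))"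
    and E1: "E0 \<le> E1" "\<And>E. E0 < E \<Longrightarrow> E1 \<le> E \<Longrightarrow> 0 < deriv \<omega> E"
    and t1: "0 < t1"
    and Istar: "smooth_on Istar {t1<..}" "\<And>t. t1 \<le> t \<Longrightarrow> E1 \<le> Istar t"
               "\<And>t. t1 \<le> t \<Longrightarrow> \<omega> (Istar t) = deriv S t / real varkappa"
    and \<sigma>: "\<sigma> = real b / real q * (real l - 1 + (real p - 1) / (real h - 1)) - real a / real q"
    and vartheta: "vartheta = s * (1 + real b / real q)"
    and \<mu>: "\<mu> = (real b / real q - \<sigma>) / 2"
    and \<nu>: "\<nu> = 1 + 2 * \<mu> + \<sigma>"
    and M: "real M = 2 * \<mu> * real q * (real h - 1)"
    and N: "real N = 2 * \<nu> * real q * (real h - 1)"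
    and tau: "tau = (\<lambda>t. t powr \<nu> / \<nu>)"
    and time: "time = (\<lambda>\<tau>. (\<nu> * \<tau>) powr (1 / \<nu>))"
    and Ires: "Ires = (\<lambda>t r. Istar t * (1 + t powr (- \<mu>) * r) ^ (2 * h))"
    and calA: "calA = (\<lambda>r \<theta> \<zeta> \<tau>. \<tau> powr (real M / real N) *
                 (let t = time \<tau>; I = Ires t r; \<phi> = \<theta> + \<zeta> / real varkappa in
                  t powr (1 - \<nu> + \<mu>) *
                   (t powr (- (real a / real q)) * F I \<phi> \<zeta> t
                       / (2 * real h * Istar t * (1 + t powr (- \<mu>) * r) ^ (2 * h - 1))
                    - deriv Istar t / (2 * real h * Istar t) * (1 + t powr (- \<mu>) * r)
                    + \<mu> * t powr (- \<mu> - 1) * r)))"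
    and calB: "calB = (\<lambda>r \<theta> \<zeta> \<tau>. \<tau> powr (real M / real N) *
                 (let t = time \<tau>; I = Ires t r; \<phi> = \<theta> + \<zeta> / real varkappa in
                  t powr (1 - \<nu>) *
                   (\<omega> I - \<omega> (Istar t) + t powr (- (real a / real q)) * G I \<phi> \<zeta> t)))"
    and averaging: "averaging_functions M N vartheta varkappa
                      (\<lambda>K r \<theta> \<zeta>. expansion_coeff N (calA r \<theta> \<zeta>) K)
                      (\<lambda>K r \<theta> \<zeta>. expansion_coeff N (calB r \<theta> \<zeta>) K) \<Lambda> \<Omega> \<rho> \<psi>"
    and \<sigma>_range: "- 1 \<le> \<sigma>" "\<sigma> < real b / real q"
    and xmap: "xmap = (\<lambda>t r \<theta>. X (\<theta> + S t / real varkappa) (Ires t r))"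
    and ymap: "ymap = (\<lambda>t r \<theta>. Y (\<theta> + S t / real varkappa) (Ires t r))"
    and Rmap: "Rmap = (\<lambda>\<tau> r \<theta>. r + (\<Sum>K\<le>n. \<tau> powr (- (real (M + K) / real N)) * \<rho> K r \<theta> (vartheta * \<tau>)))"
    and \<Psi>map: "\<Psi>map = (\<lambda>\<tau> r \<theta>. \<theta> + (\<Sum>K\<le>n. \<tau> powr (- (real (M + K) / real N)) * \<psi> K r \<theta> (vartheta * \<tau>)))"
  shows "\<exists>t0>0. t1 \<le> t0 \<and> (\<exists>d0>0. \<exists>d1\<ge>d0. \<exists>\<Lambda>rem \<Omega>rem \<Lambda>loc \<Omega>loc.
    \<comment> \<open>remainders\<close>
    (\<exists>C. \<forall>\<^sub>F \<tau> in at_top. \<forall>R \<Psi>. \<bar>R\<bar> \<le> d0 \<longrightarrow>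
        \<bar>\<Lambda>rem R \<Psi> \<tau>\<bar> \<le> C * \<tau> powr (- (real (M + n + 1) / real N)) \<and>
        \<bar>\<Omega>rem R \<Psi> \<tau>\<bar> \<le> C * \<tau> powr (- (real (M + n + 1) / real N))) \<and>
    \<comment> \<open>\<open>(r, \<theta>)\<close> are coordinates on all of \<open>D E1\<close>, the angle being determined modulo \<open>2 \<pi>\<close>\<close>
    (\<forall>t>t0. let adm = (\<lambda>r. 0 < 1 + t powr (- \<mu>) * r \<and> E1 < Ires t r) in
        (\<lambda>(r, \<theta>). (xmap t r \<theta>, ymap t r \<theta>)) ` ({r. adm r} \<times> UNIV) = D E1 \<and>
        (\<forall>r \<theta> r' \<theta>'. adm r \<and> adm r' \<longrightarrow>
           (xmap t r \<theta> = xmap t r' \<theta>' \<and> ymap t r \<theta> = ymap t r' \<theta>') =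
           (r = r' \<and> (\<exists>k::int. \<theta>' = \<theta> + 2 * pi * of_int k))) \<and>
        (\<forall>r. \<bar>r\<bar> \<le> d1 \<longrightarrow> adm r)) \<and>
    \<comment> \<open>the last transformation is one-to-one for bounded \<open>r\<close> and reaches the strip \<open>\<bar>R\<bar> \<le> d0\<close>\<close>
    (\<forall>t>t0. inj_on (\<lambda>(r, \<theta>). (Rmap (tau t) r \<theta>, \<Psi>map (tau t) r \<theta>)) ({- d1..d1} \<times> UNIV) \<and>
        {- d0..d0} \<times> UNIV \<subseteq> (\<lambda>(r, \<theta>). (Rmap (tau t) r \<theta>, \<Psi>map (tau t) r \<theta>)) ` ({- d1..d1} \<times> UNIV)) \<and>
    (\<forall>t>t0. \<forall>r \<theta>. \<bar>r\<bar> \<le> d1 \<longrightarrow>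
        \<Lambda>loc r \<theta> (tau t) = \<Lambda>rem (Rmap (tau t) r \<theta>) (\<Psi>map (tau t) r \<theta>) (tau t) \<and>
        \<Omega>loc r \<theta> (tau t) = \<Omega>rem (Rmap (tau t) r \<theta>) (\<Psi>map (tau t) r \<theta>) (tau t)) \<and>
    \<comment> \<open>from the perturbed system in \<open>D E1\<close> to the averaged system\<close>
    (\<forall>J x y. open J \<and> is_interval J \<and> J \<subseteq> {t0<..} \<and> (\<forall>t\<in>J. (x t, y t) \<in> D E1) \<and>
        solves_on J
          (\<lambda>x y t. deriv (\<lambda>\<eta>. H x \<eta>) y + t powr (- (real a / real q)) * f x y (S t) t)
          (\<lambda>x y t. - deriv (\<lambda>\<xi>. H \<xi> y) x + t powr (- (real a / real q)) * g x y (S t) t) x y \<longrightarrow>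
        (\<exists>r \<theta>. (\<forall>t\<in>J. r differentiable (at t) \<and> \<theta> differentiable (at t) \<and>
                   0 < 1 + t powr (- \<mu>) * r t \<and> E1 < Ires t (r t) \<and>
                   x t = xmap t (r t) (\<theta> t) \<and> y t = ymap t (r t) (\<theta> t)) \<and>
           solves_on (tau ` J)
             (\<lambda>R \<Psi> \<tau>. (\<Sum>K\<le>n. \<tau> powr (- (real (M + K) / real N)) * \<Lambda> K R \<Psi>)
                        + \<Lambda>loc (r (time \<tau>)) (\<theta> (time \<tau>)) \<tau>)
             (\<lambda>R \<Psi> \<tau>. (\<Sum>K\<le>n. \<tau> powr (- (real (M + K) / real N)) * \<Omega> K R \<Psi>)
                        + \<Omega>loc (r (time \<tau>)) (\<theta> (time \<tau>)) \<tau>)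
             (\<lambda>\<tau>. Rmap \<tau> (r (time \<tau>)) (\<theta> (time \<tau>)))
             (\<lambda>\<tau>. \<Psi>map \<tau> (r (time \<tau>)) (\<theta> (time \<tau>))))) \<and>
    \<comment> \<open>and back\<close>
    (\<forall>J R \<Psi>. open J \<and> is_interval J \<and> J \<subseteq> {t0<..} \<and> (\<forall>t\<in>J. \<bar>R (tau t)\<bar> \<le> d0) \<and>
        solves_on (tau ` J)
          (\<lambda>R \<Psi> \<tau>. (\<Sum>K\<le>n. \<tau> powr (- (real (M + K) / real N)) * \<Lambda> K R \<Psi>) + \<Lambda>rem R \<Psi> \<tau>)
          (\<lambda>R \<Psi> \<tau>. (\<Sum>K\<le>n. \<tau> powr (- (real (M + K) / real N)) * \<Omega> K R \<Psi>) + \<Omega>rem R \<Psi> \<tau>) R \<Psi> \<longrightarrow>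
        (\<exists>r \<theta>. (\<forall>t\<in>J. r differentiable (at t) \<and> \<theta> differentiable (at t) \<and> \<bar>r t\<bar> \<le> d1 \<and>
                   R (tau t) = Rmap (tau t) (r t) (\<theta> t) \<and> \<Psi> (tau t) = \<Psi>map (tau t) (r t) (\<theta> t)) \<and>
           solves_on J
             (\<lambda>x y t. deriv (\<lambda>\<eta>. H x \<eta>) y + t powr (- (real a / real q)) * f x y (S t) t)
             (\<lambda>x y t. - deriv (\<lambda>\<xi>. H \<xi> y) x + t powr (- (real a / real q)) * g x y (S t) t)
             (\<lambda>t. xmap t (r t) (\<theta> t)) (\<lambda>t. ymap t (r t) (\<theta> t)))))"
proof -
  have q: "1 \<le> q" using b by linarith
  have h0: "0 < h" using h by simp
  have bq: "0 < real b / real q" using b q by simp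
  have \<mu>0: "0 < \<mu>" using \<sigma>_range by (simp add: \<mu>)
  have \<nu>_eq: "\<nu> = 1 + real b / real q" by (simp add: \<nu> \<mu> field_simps)
  have \<nu>0: "0 < \<nu>" using bq by (simp add: \<nu>_eq)
  have vartheta_eq: "vartheta = s * \<nu>" by (simp add: vartheta \<nu>_eq)
  have vartheta0: "0 < vartheta" using s \<nu>0 by (simp add: vartheta_eq)
  have M0: "0 < M"
  proof -
    have "0 < real M" unfolding M using \<mu>0 q h by simp
    then show ?thesis by simp
  qed
  have N0: "0 < N"
  proof -
    have "0 < real N" unfolding N using \<nu>0 q h by simp
    then show ?thesis by simp
  qed

  define dU where "dU x = x ^ (2 * h - 1) + (\<Sum>i = 1..2 * h - 1. u i * (real i * x ^ (i - 1)))" for x :: real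
  \<comment> \<open>For \<open>i = 1\<close> the factor \<open>real (i - 1)\<close> is zero, so the
    truncated exponent does no harm.\<close>
  define d2U where "d2U x = real (2 * h - 1) * x ^ (2 * h - 1 - Suc 0)
     + (\<Sum>i = 1..2 * h - 1. u i * (real i * (real (i - 1) * x ^ (i - 1 - Suc 0))))" for x :: real
  have U_deriv: "(U has_real_derivative dU x) (at x)" for x
  proof -
    have "(U has_real_derivative real (2 * h) * x ^ (2 * h - Suc 0) / (2 * real h)
        + (\<Sum>i = 1..2 * h - 1. u i * (real i * x ^ (i - Suc 0)))) (at x)"
      unfolding U by (intro DERIV_add DERIV_cdivide DERIV_sum DERIV_cmult DERIV_pow)
    then show ?thesis using h0 by (simp add: dU_def)
  qed
  have dU_deriv: "(dU has_real_derivative d2U x) (at x)" for x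
    unfolding dU_def[abs_def] d2U_def by (intro DERIV_add DERIV_sum DERIV_cmult DERIV_pow)
  have deriv_U: "deriv U = dU" using U_deriv by (intro ext DERIV_imp_deriv)
  have H_x: "deriv (\<lambda>\<xi>. H \<xi> y) x = dU x" for x y
    unfolding H by (rule DERIV_imp_deriv) (auto intro!: derivative_eq_intros U_deriv)
  have H_y: "deriv (\<lambda>\<eta>. H x \<eta>) y = y" for x y
    unfolding H by (rule DERIV_imp_deriv) (auto intro!: derivative_eq_intros)

  interpret HO: hamiltonian_orbits U dU d2U H x0 y0 X Y T \<omega> E0
  proof
    show "continuous_on UNIV d2U" unfolding d2U_def[abs_def] by (intro continuous_intros)
    show "compact {(x, y). H x y = E}" if "E0 < E" for E
      using E0(2)[OF that] compact_simple_path_image unfolding closed_curve_def by metis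
    show "y \<noteq> 0 \<or> dU x \<noteq> 0" if "E0 < H x y" for x y
      using E0(3)[OF that] by (auto simp: H_x H_y)
    show "((\<lambda>t. x0 t E) has_real_derivative y0 t E) (at t)" "((\<lambda>t. y0 t E) has_real_derivative - dU (x0 t E)) (at t)"
      if "E0 < E" for E t
      using orbit(1)[OF that] by (simp_all add: solves_on_def H_x H_y)
    show "(\<lambda>(t, E). x0 t E) differentiable at (t, E)" "(\<lambda>(t, E). y0 t E) differentiable at (t, E)"
      if "E0 < E" for t E
      using smooth_on_imp_differentiable[OF orbit_smooth(1)] smooth_on_imp_differentiable[OF orbit_smooth(2)] that by auto
    show "\<omega> differentiable at E" if "E0 < E" for E
      using smooth_on_imp_differentiable[OF orbit_smooth(3)] that by auto
  qed (fact U_deriv dU_deriv H orbit(2) orbit(3) T \<omega> XY)+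

  have S_deriv: "(S has_real_derivative vartheta * t powr (real b / real q)) (at t)" if "0 < t" for t
  proof -
    have "(S has_real_derivative s * ((1 + real b / real q) * t powr (1 + real b / real q - 1))) (at t)"
      unfolding S by (intro DERIV_cmult has_real_derivative_powr that)
    then show ?thesis by (simp add: vartheta mult.assoc)
  qed
  have \<omega>_Istar: "\<omega> (Istar t) = vartheta * t powr (real b / real q) / real varkappa" if "t1 \<le> t" for t
    using Istar(3)[OF that] DERIV_imp_deriv[OF S_deriv[of t]] t1 that by simp
  have \<omega>_deriv: "(\<omega> has_real_derivative deriv \<omega> E) (at E)" if "E0 < E" for E
    using HO.\<omega>_diff[OF that] by (simp add: DERIV_deriv_iff_real_differentiable)
  \<comment> \<open>The resonance condition forces \<open>\<omega> (Istar t)\<close> to infinity,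
    and monotonicity of \<omega> carries this over to \<open>Istar\<close>.\<close>
  have Istar_lim: "filterlim Istar at_top at_top"
  proof (rule filterlim_of_increasing_image)
    show "(\<omega> has_real_derivative deriv \<omega> E) (at E)" "0 < deriv \<omega> E" if "E1 < E" for E
      using \<omega>_deriv E1 that by auto
    show "\<forall>\<^sub>F t in at_top. E1 \<le> Istar t"
      using eventually_ge_at_top[of t1] by eventually_elim (rule Istar(2))
    have "filterlim (\<lambda>t. (vartheta / real varkappa) * t powr (real b / real q)) at_top at_top"
      using vartheta0 varkappa
      by (intro filterlim_tendsto_pos_mult_at_top[OF tendsto_const] filterlim_powr_at_top bq) simp
    moreover have "\<forall>\<^sub>F t in at_top. (vartheta / real varkappa) * t powr (real b / real q) = \<omega> (Istar t)"
      using eventually_ge_at_top[of t1] by eventually_elim (simp add: \<omega>_Istar)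
    ultimately show "filterlim (\<lambda>t. \<omega> (Istar t)) at_top at_top"
      by (rule filterlim_cong[OF refl refl, THEN iffD1, rotated])
  qed
  have Istar_diff: "(Istar has_real_derivative deriv Istar t) (at t)" if "t1 < t" for t
    using smooth_on_imp_differentiable[OF Istar(1)] that by (simp add: DERIV_deriv_iff_real_differentiable)
  \<comment> \<open>Differentiation of the resonance condition, for times so large that
    \<open>Istar t\<close> exceeds E0, where \<omega> is differentiable.\<close>
  have Istar_deriv: "\<forall>\<^sub>F t in at_top. deriv \<omega> (Istar t) * deriv Istar t
        = vartheta * (real b / real q) * t powr (real b / real q - 1) / real varkappa"
    using eventually_gt_at_top[of t1] filterlim_at_top_dense[THEN iffD1, OF Istar_lim, rule_format, of E0]
  proof eventually_elim
    case (elim t)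
    have "((\<lambda>t. \<omega> (Istar t)) has_real_derivative deriv \<omega> (Istar t) * deriv Istar t) (at t)"
      by (rule DERIV_chain2[OF \<omega>_deriv[OF elim(2)] Istar_diff[OF elim(1)]])
    then have 1: "((\<lambda>t. vartheta * t powr (real b / real q) / real varkappa) has_real_derivative deriv \<omega> (Istar t) * deriv Istar t) (at t)"
      by (rule has_field_derivative_transform_within_open[of _ _ _ "{t1<..}"]) (use elim \<omega>_Istar in auto)
    have "((\<lambda>t. vartheta * t powr (real b / real q) / real varkappa) has_real_derivative
       vartheta * (real b / real q * t powr (real b / real q - 1)) / real varkappa) (at t)"
      by (intro DERIV_cdivide DERIV_cmult has_real_derivative_powr) (use elim t1 in simp)
    from DERIV_unique[OF 1 this] show ?case by (simp add: mult.assoc)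
  qed

  \<comment> \<open>A dummy first variable \<open>w\<close> makes the bound for functions of two
    variables applicable, with the interval for \<open>w\<close> reduced to 0.\<close>
  have bounded_in_phase: "\<exists>B. \<forall>S. \<bar>k x y S t\<bar> \<le> B"
    if "smooth_on (\<lambda>(x, y, S, t). k x y S t) {(x, y, S, t). 0 < t}" "periodic (2 * pi) (\<lambda>S. k x y S t)" "0 < t"
    for k :: "real \<Rightarrow> real \<Rightarrow> real \<Rightarrow> real \<Rightarrow> real" and x y t
  proof -
    have "continuous_on UNIV (\<lambda>(w::real, S). (x, y, S, t))"
      unfolding case_prod_unfold by (intro continuous_intros)
    then have "continuous_on UNIV ((\<lambda>(x, y, S, t). k x y S t) \<circ> (\<lambda>(w::real, S). (x, y, S, t)))"
      by (rule continuous_on_compose) (rule continuous_on_subset[OF smooth_on_imp_continuous_on[OF that(1)]], use that(3) in auto)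
    then have "continuous_on UNIV (\<lambda>(w::real, S). k x y S t)" by (simp add: o_def case_prod_unfold)
    from bounded_periodic2[OF this, of "2 * pi" 0] that(2) show ?thesis by auto
  qed

  have "0 < \<kappa>" unfolding \<kappa> using period_integral_pos[OF h0] h0 by simp
  then have \<omega>coef_pos: "0 < \<omega>coef 0" by (simp add: \<omega>coef0)

  define z where "z = (\<lambda>\<tau>. \<tau> powr (- (1 / real N)))"
  define P where "P = {- 2..2 :: real} \<times> (UNIV :: real set) \<times> (UNIV :: real set)"
  interpret small_parameter z P
  proof
    show "\<forall>\<^sub>F \<tau> in at_top. 0 < z \<tau>" using eventually_gt_at_top[of 0] by eventually_elim (simp add: z_def)
    show "(z \<longlongrightarrow> 0) at_top" unfolding z_def using N0 by (intro tendsto_neg_powr filterlim_ident) simp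
  qed
  interpret RS: rescaled_system z P h a b q l p varkappa M N \<sigma> \<mu> \<nu> vartheta 2 E0 u dU \<omega> Istar time
    X Y Ires f g F G calA calB Acoef Bcoef Xcoef Ycoef \<omega>coef
  proof
    show "\<exists>B. \<forall>S. \<bar>f x y S t\<bar> \<le> B" "\<exists>B. \<forall>S. \<bar>g x y S t\<bar> \<le> B" if "0 < t" for x y t
      using bounded_in_phase[OF f_smooth f_periodic] bounded_in_phase[OF g_smooth g_periodic] that by auto
    show "F = (\<lambda>I \<phi> S t. f (X \<phi> I) (Y \<phi> I) S t * dU (X \<phi> I) + g (X \<phi> I) (Y \<phi> I) S t * Y \<phi> I)"
      unfolding F deriv_U ..
    show "\<forall>\<^sub>F t in at_top. \<omega> (Istar t) = vartheta * t powr (real b / real q) / real varkappa"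
      using eventually_ge_at_top[of t1] by eventually_elim (rule \<omega>_Istar)
  qed (fact z_def P_def h b(1) q varkappa vartheta0 dU_def f_asymp g_asymp coef_zero HO.XY_bounded X_asymp Y_asymp
      \<omega>_asymp \<omega>coef_pos G Istar_lim Istar_deriv \<sigma> \<mu> \<nu> M N \<sigma>_range time Ires calA calB zero_less_numeral)+
  interpret AV: averaging z P M N n varkappa vartheta calA calB \<Lambda> \<Omega> \<rho> \<psi>
    by unfold_locales (use z_def P_def M0 N0 varkappa RS.expandable_calA RS.expandable_calB averaging in auto)

  have tau_pos: "0 < tau t" if "0 < t" for t using that \<nu>0 by (simp add: tau)
  have time_tau: "time (tau t) = t" if "0 < t" for t
    using that \<nu>0 by (simp add: tau time powr_powr)
  have tau_time: "tau (time \<tau>) = \<tau>" if "0 < \<tau>" for \<tau>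
    using that \<nu>0 by (simp add: tau time powr_powr)
  have S_tau: "vartheta * tau t = S t" if "0 < t" for t
    using \<nu>0 by (simp add: tau S vartheta_eq \<nu>_eq[symmetric])
  have tau_deriv: "(tau has_real_derivative t powr (\<nu> - 1)) (at t)" if "0 < t" for t
  proof -
    have "(tau has_real_derivative \<nu> * t powr (\<nu> - 1) / \<nu>) (at t)"
      unfolding tau by (intro DERIV_cdivide has_real_derivative_powr that)
    then show ?thesis using \<nu>0 by simp
  qed
  have time_deriv: "(time has_real_derivative time \<tau> powr (1 - \<nu>)) (at \<tau>)" if "0 < \<tau>" for \<tau>
  proof -
    have lin: "((\<lambda>\<tau>. \<nu> * \<tau>) has_real_derivative \<nu>) (at \<tau>)" by (auto intro!: derivative_eq_intros)
    have "(time has_real_derivative 1 / \<nu> * (\<nu> * \<tau>) powr (1 / \<nu> - 1) * \<nu>) (at \<tau>)"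
      unfolding time by (rule DERIV_chain2[OF has_real_derivative_powr lin]) (use \<nu>0 that in simp)
    moreover have "time \<tau> powr (1 - \<nu>) = (\<nu> * \<tau>) powr (1 / \<nu> - 1)"
      using \<nu>0 by (simp add: time powr_powr diff_divide_distrib)
    ultimately show ?thesis using \<nu>0 by simp
  qed
  have z_sum: "(\<Sum>K\<le>n. \<tau> powr (- (real (M + K) / real N)) * c K) = (\<Sum>K\<le>n. z \<tau> ^ (M + K) * c K)"
    if "0 < \<tau>" for \<tau> and c :: "nat \<Rightarrow> real"
    by (simp only: AV.z_power[OF that])
  have Rmap_eq: "Rmap \<tau> r \<theta> = r + AV.corr \<rho> \<tau> r \<theta>" and \<Psi>map_eq: "\<Psi>map \<tau> r \<theta> = \<theta> + AV.corr \<psi> \<tau> r \<theta>"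
    if "0 < \<tau>" for \<tau> r \<theta>
    unfolding Rmap \<Psi>map AV.corr_def AV.psum_def z_sum[OF that] by (rule refl)+

  \<comment> \<open>Right-hand sides in the original time t and with the full angle \<phi>;
    \<open>calA_eq\<close> and \<open>calB_eq\<close> show that they differ from the rescaled ones
    by the factor \<open>t powr (1 - \<nu>)\<close>, the derivative of t in \<tau>.\<close>
  define rdot where "rdot t r \<phi> = t powr \<mu> * (t powr (- (real a / real q)) * F (Ires t r) \<phi> (S t) t
      / (2 * real h * Istar t * (1 + t powr (- \<mu>) * r) ^ (2 * h - 1))
    - deriv Istar t / (2 * real h * Istar t) * (1 + t powr (- \<mu>) * r) + \<mu> * t powr (- \<mu> - 1) * r)" for t r \<phi>
  define \<theta>dot where "\<theta>dot t r \<phi> = \<omega> (Ires t r) - \<omega> (Istar t) + t powr (- (real a / real q)) * G (Ires t r) \<phi> (S t) t" for t r \<phi>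
  have z_cancel: "z \<tau> ^ M * (\<tau> powr (real M / real N) * c) = c" if "0 < \<tau>" for \<tau> c
    using that by (simp add: AV.z_power mult.assoc[symmetric] flip: powr_add)
  have calA_eq: "z (tau t) ^ M * calA r \<theta> (vartheta * tau t) (tau t) = t powr (1 - \<nu>) * rdot t r (\<theta> + S t / real varkappa)"
    if "0 < t" for t r \<theta>
    unfolding calA Let_def z_cancel[OF tau_pos[OF that]] S_tau[OF that] time_tau[OF that] rdot_def powr_add
    by (simp only: mult.assoc)
  have calB_eq: "z (tau t) ^ M * calB r \<theta> (vartheta * tau t) (tau t) = t powr (1 - \<nu>) * \<theta>dot t r (\<theta> + S t / real varkappa)"
    if "0 < t" for t r \<theta>
    unfolding calB Let_def z_cancel[OF tau_pos[OF that]] S_tau[OF that] time_tau[OF that] \<theta>dot_def ..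

  obtain \<tau>0 where \<tau>0: "\<And>\<tau>. \<tau>0 < \<tau> \<Longrightarrow> AV.small \<tau>"
    using AV.eventually_small unfolding eventually_at_top_dense by blast
  have tau_lim: "filterlim tau at_top at_top"
  proof -
    have "filterlim (\<lambda>t. 1 / \<nu> * t powr \<nu>) at_top at_top"
      using \<nu>0 by (intro filterlim_tendsto_pos_mult_at_top[OF tendsto_const] filterlim_powr_at_top) simp_all
    then show ?thesis by (simp add: tau)
  qed
  have "\<forall>\<^sub>F t in at_top. \<tau>0 < tau t \<and> (\<forall>r. \<bar>r\<bar> \<le> 2 \<longrightarrow> 0 < 1 + t powr (- \<mu>) * r \<and> E1 < Ires t r)"
  proof -
    have "((\<lambda>t. t powr (- \<mu>)) \<longlongrightarrow> 0) at_top" using \<mu>0 by (intro tendsto_neg_powr filterlim_ident) simp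
    from order_tendstoD(2)[OF this, of "1 / 4"] have "\<forall>\<^sub>F t in at_top. t powr (- \<mu>) < 1 / 4" by simp
    moreover have "\<forall>\<^sub>F t in at_top. \<tau>0 < tau t"
      using tau_lim unfolding filterlim_at_top_dense by blast
    moreover have "\<forall>\<^sub>F t in at_top. E1 * 2 ^ (2 * h) < Istar t"
      using Istar_lim unfolding filterlim_at_top_dense by blast
    ultimately show ?thesis
    proof eventually_elim
      case (elim t)
      have "0 < 1 + t powr (- \<mu>) * r \<and> E1 < Ires t r" if r: "\<bar>r\<bar> \<le> 2" for r
      proof -
        \<comment> \<open>For such r the factor \<open>1 + t powr (- \<mu>) * r\<close> is at least
          \<open>1 / 2\<close>, so the energy loses at most the factor \<open>2 ^ (2 * h)\<close>,
          for which the bound on \<open>Istar t\<close> allows.\<close>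
        have "\<bar>t powr (- \<mu>) * r\<bar> \<le> 1 / 4 * 2"
          unfolding abs_mult using elim(1) r by (intro mult_mono) auto
        then have w: "1 / 2 \<le> 1 + t powr (- \<mu>) * r" by linarith
        have "0 < E1 * 2 ^ (2 * h)" using E0 E1 by simp
        then have I: "0 < Istar t" using elim(3) by linarith
        have "E1 = E1 * 2 ^ (2 * h) * (1 / 2) ^ (2 * h)" by (simp add: power_divide)
        also have "\<dots> < Istar t * (1 / 2) ^ (2 * h)" using elim(3) by (intro mult_strict_right_mono) auto
        also have "\<dots> \<le> Istar t * (1 + t powr (- \<mu>) * r) ^ (2 * h)"
          using w I by (intro mult_left_mono power_mono) auto
        finally show ?thesis using w by (simp add: Ires)
      qed
      then show ?case using elim(2) by blast
    qed
  qed
  then obtain t00 where t00: "\<And>t. t00 \<le> t \<Longrightarrow> \<tau>0 < tau t"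
    "\<And>t r. t00 \<le> t \<Longrightarrow> \<bar>r\<bar> \<le> 2 \<Longrightarrow> 0 < 1 + t powr (- \<mu>) * r \<and> E1 < Ires t r"
    unfolding eventually_at_top_linorder by blast
  define t0 where "t0 = max t1 t00"
  have t0: "0 < t0" "t1 \<le> t0" using t1 by (simp_all add: t0_def)
  have small: "AV.small (tau t)" and adm: "\<And>r. \<bar>r\<bar> \<le> 2 \<Longrightarrow> 0 < 1 + t powr (- \<mu>) * r \<and> E1 < Ires t r"
    and \<tau>0_less: "\<tau>0 < tau t" and t_pos: "0 < t" and t1_less: "t1 < t" and Istar_pos: "0 < Istar t" if "t0 < t" for t
    using that \<tau>0 t00 t0 Istar(2)[of t] E0 E1 unfolding t0_def by auto

  \<comment> \<open>Only differentiability of r is presupposed, so the equivalence can be entered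
    from the energy equation as well as from the equation for r.\<close>
  have action: "(r has_real_derivative rdot t (r t) (\<phi> t)) (at t) \<longleftrightarrow>
      ((\<lambda>t. Ires t (r t)) has_real_derivative t powr (- (real a / real q)) * F (Ires t (r t)) (\<phi> t) (S t) t) (at t)"
    if t: "t0 < t" and w: "0 < 1 + t powr (- \<mu>) * r t" and r: "r differentiable (at t)" for r \<phi> :: "real \<Rightarrow> real" and t
  proof -
    obtain r' where r': "(r has_real_derivative r') (at t)" using r by (auto simp: real_differentiable_def)
    note d = action_derivative[OF Istar_diff[OF t1_less[OF t]] r' t_pos[OF t] h0, of \<mu>]
    have "(r has_real_derivative rdot t (r t) (\<phi> t)) (at t) \<longleftrightarrow> r' = rdot t (r t) (\<phi> t)"
      by (rule DERIV_eq_iff[OF r', symmetric])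
    also have "\<dots> \<longleftrightarrow> deriv Istar t * (1 + t powr (- \<mu>) * r t) ^ (2 * h) + 2 * real h * Istar t * (1 + t powr (- \<mu>) * r t) ^ (2 * h - 1)
       * (t powr (- \<mu>) * r' - \<mu> * t powr (- \<mu> - 1) * r t) = t powr (- (real a / real q)) * F (Ires t (r t)) (\<phi> t) (S t) t"
      unfolding rdot_def by (rule action_equation_iff[symmetric, OF t_pos[OF t] h0 Istar_pos[OF t] w])
    also have "\<dots> \<longleftrightarrow> ((\<lambda>t. Ires t (r t)) has_real_derivative t powr (- (real a / real q)) * F (Ires t (r t)) (\<phi> t) (S t) t) (at t)"
      unfolding Ires by (rule DERIV_eq_iff[OF d])
    finally show ?thesis .
  qed
  have phase_deriv: "((\<lambda>t. S t / real varkappa) has_real_derivative \<omega> (Istar t)) (at t)" if "t0 < t" for t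
    using DERIV_cdivide[OF S_deriv[OF t_pos[OF that]], of "real varkappa"] \<omega>_Istar[of t] t1_less[OF that] by simp

  have remainders: "(\<exists>C. \<forall>\<^sub>F \<tau> in at_top. \<forall>R \<Psi>. \<bar>R\<bar> \<le> 1 \<longrightarrow>
        \<bar>AV.\<Lambda>rem R \<Psi> \<tau>\<bar> \<le> C * \<tau> powr (- (real (M + n + 1) / real N)) \<and>
        \<bar>AV.\<Omega>rem R \<Psi> \<tau>\<bar> \<le> C * \<tau> powr (- (real (M + n + 1) / real N)))"
    by (rule AV.rem_bound)

  have coordinates: "(\<forall>t>t0. let adm = (\<lambda>r. 0 < 1 + t powr (- \<mu>) * r \<and> E1 < Ires t r) in
        (\<lambda>(r, \<theta>). (xmap t r \<theta>, ymap t r \<theta>)) ` ({r. adm r} \<times> UNIV) = D E1 \<and>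
        (\<forall>r \<theta> r' \<theta>'. adm r \<and> adm r' \<longrightarrow>
           (xmap t r \<theta> = xmap t r' \<theta>' \<and> ymap t r \<theta> = ymap t r' \<theta>') =
           (r = r' \<and> (\<exists>k::int. \<theta>' = \<theta> + 2 * pi * of_int k))) \<and>
        (\<forall>r. \<bar>r\<bar> \<le> 2 \<longrightarrow> adm r))"
  proof (intro allI impI, unfold Let_def, intro conjI allI impI)
    fix t assume t: "t0 < t"
    have Ipos: "0 < Istar t" by (rule Istar_pos[OF t])
    show "(\<lambda>(r, \<theta>). (xmap t r \<theta>, ymap t r \<theta>)) ` ({r. 0 < 1 + t powr (- \<mu>) * r \<and> E1 < Ires t r} \<times> UNIV) = D E1"
    proof (intro set_eqI iffI)
      fix v assume "v \<in> (\<lambda>(r, \<theta>). (xmap t r \<theta>, ymap t r \<theta>)) ` ({r. 0 < 1 + t powr (- \<mu>) * r \<and> E1 < Ires t r} \<times> UNIV)"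
      then obtain r \<theta> where v: "v = (xmap t r \<theta>, ymap t r \<theta>)" and r: "E1 < Ires t r" by auto
      have "H (xmap t r \<theta>) (ymap t r \<theta>) = Ires t r"
        unfolding xmap ymap by (rule HO.XY_energy) (use r E1 in simp)
      then show "v \<in> D E1" using r by (simp add: v D)
    next
      fix v assume "v \<in> D E1"
      then obtain x y where v: "v = (x, y)" and E: "E1 < H x y" by (auto simp: D)
      have E': "E0 < H x y" using E E1 by simp
      obtain \<phi> where \<phi>: "X \<phi> (H x y) = x" "Y \<phi> (H x y) = y" using HO.XY_surj[OF E'] .
      define r where "r = t powr \<mu> * ((H x y / Istar t) powr (1 / (2 * real h)) - 1)"
      have "0 < H x y" using E' E0(1) by simp
      note r = action_inverse[of t h Istar "\<lambda>_. H x y" \<mu>, OF t_pos[OF t] h0 Ipos this, folded r_def]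
      have "Ires t r = H x y" using r(2) by (simp add: Ires)
      then show "v \<in> (\<lambda>(r, \<theta>). (xmap t r \<theta>, ymap t r \<theta>)) ` ({r. 0 < 1 + t powr (- \<mu>) * r \<and> E1 < Ires t r} \<times> UNIV)"
        using r(1) E \<phi> by (intro image_eqI[of _ _ "(r, \<phi> - S t / real varkappa)"]) (auto simp: v xmap ymap)
    qed
  next
    fix t r \<theta> r' \<theta>' assume t: "t0 < t" and a: "(0 < 1 + t powr (- \<mu>) * r \<and> E1 < Ires t r) \<and> 0 < 1 + t powr (- \<mu>) * r' \<and> E1 < Ires t r'"
    have Ipos: "0 < Istar t" by (rule Istar_pos[OF t])
    have "Ires t r = Ires t r' \<longleftrightarrow> 1 + t powr (- \<mu>) * r = 1 + t powr (- \<mu>) * r'"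
      unfolding Ires using Ipos a h0 by (auto simp: power_eq_iff_eq_base)
    also have "\<dots> \<longleftrightarrow> r = r'" using t_pos[OF t] by simp
    finally have r: "Ires t r = Ires t r' \<longleftrightarrow> r = r'" .
    have \<theta>: "\<theta>' + S t / real varkappa = \<theta> + S t / real varkappa + c \<longleftrightarrow> \<theta>' = \<theta> + c" for c by auto
    have "E0 < Ires t r" "E0 < Ires t r'" using a E1 by auto
    from HO.XY_inj[OF this, of "\<theta> + S t / real varkappa" "\<theta>' + S t / real varkappa"]
    show "(xmap t r \<theta> = xmap t r' \<theta>' \<and> ymap t r \<theta> = ymap t r' \<theta>') = (r = r' \<and> (\<exists>k::int. \<theta>' = \<theta> + 2 * pi * of_int k))"
      unfolding xmap ymap r \<theta> .
  next
    fix t r :: real assume "t0 < t" "\<bar>r\<bar> \<le> 2"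
    then show "0 < 1 + t powr (- \<mu>) * r" "E1 < Ires t r" using adm by blast+
  qed

  have near_identity: "(\<forall>t>t0. inj_on (\<lambda>(r, \<theta>). (Rmap (tau t) r \<theta>, \<Psi>map (tau t) r \<theta>)) ({- 2..2} \<times> UNIV) \<and>
        {- 1..1} \<times> UNIV \<subseteq> (\<lambda>(r, \<theta>). (Rmap (tau t) r \<theta>, \<Psi>map (tau t) r \<theta>)) ` ({- 2..2} \<times> UNIV))"
  proof (intro allI impI)
    fix t assume t: "t0 < t"
    have eq: "(\<lambda>(r, \<theta>). (Rmap (tau t) r \<theta>, \<Psi>map (tau t) r \<theta>)) = AV.avg_map (tau t)"
      by (simp add: AV.avg_map_def Rmap_eq[OF tau_pos[OF t_pos[OF t]]] \<Psi>map_eq[OF tau_pos[OF t_pos[OF t]]])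
    have "v \<in> AV.avg_map (tau t) ` ({- 2..2} \<times> UNIV)" if "v \<in> {- 1..1} \<times> UNIV" for v
    proof -
      obtain R \<Psi> where vR: "v = (R, \<Psi>)" by (metis surj_pair)
      with that have v: "v = (R, \<Psi>)" "\<bar>R\<bar> \<le> 1" by auto
      obtain r \<theta> where "\<bar>r\<bar> < 2" "AV.avg_map (tau t) (r, \<theta>) = (R, \<Psi>)"
        using AV.avg_map_surj[OF small[OF t] v(2)] by blast
      then show ?thesis by (intro image_eqI[of _ _ "(r, \<theta>)"]) (auto simp: v)
    qed
    then show "inj_on (\<lambda>(r, \<theta>). (Rmap (tau t) r \<theta>, \<Psi>map (tau t) r \<theta>)) ({- 2..2} \<times> UNIV) \<and>
        {- 1..1} \<times> UNIV \<subseteq> (\<lambda>(r, \<theta>). (Rmap (tau t) r \<theta>, \<Psi>map (tau t) r \<theta>)) ` ({- 2..2} \<times> UNIV)"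
      unfolding eq using AV.avg_map_inj[OF small[OF t]] by blast
  qed

  have local_remainders: "(\<forall>t>t0. \<forall>r \<theta>. \<bar>r\<bar> \<le> 2 \<longrightarrow>
        AV.\<Lambda>loc r \<theta> (tau t) = AV.\<Lambda>rem (Rmap (tau t) r \<theta>) (\<Psi>map (tau t) r \<theta>) (tau t) \<and>
        AV.\<Omega>loc r \<theta> (tau t) = AV.\<Omega>rem (Rmap (tau t) r \<theta>) (\<Psi>map (tau t) r \<theta>) (tau t))"
    using AV.rem_eq_loc[OF small] by (auto simp: Rmap_eq \<Psi>map_eq tau_pos t_pos)

  have forward: "(\<forall>J x y. open J \<and> is_interval J \<and> J \<subseteq> {t0<..} \<and> (\<forall>t\<in>J. (x t, y t) \<in> D E1) \<and>
        solves_on J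
          (\<lambda>x y t. deriv (\<lambda>\<eta>. H x \<eta>) y + t powr (- (real a / real q)) * f x y (S t) t)
          (\<lambda>x y t. - deriv (\<lambda>\<xi>. H \<xi> y) x + t powr (- (real a / real q)) * g x y (S t) t) x y \<longrightarrow>
        (\<exists>r \<theta>. (\<forall>t\<in>J. r differentiable (at t) \<and> \<theta> differentiable (at t) \<and>
                   0 < 1 + t powr (- \<mu>) * r t \<and> E1 < Ires t (r t) \<and>
                   x t = xmap t (r t) (\<theta> t) \<and> y t = ymap t (r t) (\<theta> t)) \<and>
           solves_on (tau ` J)
             (\<lambda>R \<Psi> \<tau>. (\<Sum>K\<le>n. \<tau> powr (- (real (M + K) / real N)) * \<Lambda> K R \<Psi>)
                        + AV.\<Lambda>loc (r (time \<tau>)) (\<theta> (time \<tau>)) \<tau>)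
             (\<lambda>R \<Psi> \<tau>. (\<Sum>K\<le>n. \<tau> powr (- (real (M + K) / real N)) * \<Omega> K R \<Psi>)
                        + AV.\<Omega>loc (r (time \<tau>)) (\<theta> (time \<tau>)) \<tau>)
             (\<lambda>\<tau>. Rmap \<tau> (r (time \<tau>)) (\<theta> (time \<tau>)))
             (\<lambda>\<tau>. \<Psi>map \<tau> (r (time \<tau>)) (\<theta> (time \<tau>)))))"
  proof (intro allI impI)
    fix J x y
    assume "open J \<and> is_interval J \<and> J \<subseteq> {t0<..} \<and> (\<forall>t\<in>J. (x t, y t) \<in> D E1) \<and>
        solves_on J
          (\<lambda>x y t. deriv (\<lambda>\<eta>. H x \<eta>) y + t powr (- (real a / real q)) * f x y (S t) t)
          (\<lambda>x y t. - deriv (\<lambda>\<xi>. H \<xi> y) x + t powr (- (real a / real q)) * g x y (S t) t) x y"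
    then have J: "open J" "is_interval J" and Jt: "\<And>t. t \<in> J \<Longrightarrow> t0 < t" and E: "\<And>t. t \<in> J \<Longrightarrow> E1 < H (x t) (y t)"
      and x: "\<And>t. t \<in> J \<Longrightarrow> (x has_real_derivative y t + t powr (- (real a / real q)) * f (x t) (y t) (S t) t) (at t)"
      and y: "\<And>t. t \<in> J \<Longrightarrow> (y has_real_derivative - dU (x t) + t powr (- (real a / real q)) * g (x t) (y t) (S t) t) (at t)"
      by (auto simp: solves_on_def H_x H_y D)
    have E': "E0 < H (x t) (y t)" if "t \<in> J" for t using E[OF that] E1 by simp
    have "\<exists>\<phi>. (\<forall>t\<in>J. X (\<phi> t) (H (x t) (y t)) = x t \<and> Y (\<phi> t) (H (x t) (y t)) = y t) \<and>
      (\<forall>t\<in>J. ((\<lambda>t. H (x t) (y t)) has_real_derivative t powr (- (real a / real q)) *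
         (f (x t) (y t) (S t) t * dU (x t) + g (x t) (y t) (S t) t * y t)) (at t)) \<and>
      (\<forall>t\<in>J. (\<phi> has_real_derivative \<omega> (H (x t) (y t)) + t powr (- (real a / real q)) * (\<omega> (H (x t) (y t)) *
         (f (x t) (y t) (S t) t * deriv (Y (\<phi> t)) (H (x t) (y t)) - g (x t) (y t) (S t) t * deriv (X (\<phi> t)) (H (x t) (y t))))) (at t))"
      by (rule HO.cartesian_to_energy_angle[OF J E' x y]) blast+
    then obtain \<phi> where \<phi>: "\<And>t. t \<in> J \<Longrightarrow> X (\<phi> t) (H (x t) (y t)) = x t" "\<And>t. t \<in> J \<Longrightarrow> Y (\<phi> t) (H (x t) (y t)) = y t"
      and dH: "\<And>t. t \<in> J \<Longrightarrow> ((\<lambda>t. H (x t) (y t)) has_real_derivative t powr (- (real a / real q)) *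
         (f (x t) (y t) (S t) t * dU (x t) + g (x t) (y t) (S t) t * y t)) (at t)"
      and d\<phi>: "\<And>t. t \<in> J \<Longrightarrow> (\<phi> has_real_derivative \<omega> (H (x t) (y t)) + t powr (- (real a / real q)) * (\<omega> (H (x t) (y t)) *
         (f (x t) (y t) (S t) t * deriv (Y (\<phi> t)) (H (x t) (y t)) - g (x t) (y t) (S t) t * deriv (X (\<phi> t)) (H (x t) (y t))))) (at t)"
      by blast
    \<comment> \<open>The root from \<open>action_inverse\<close> recovers r from the energy, and
      subtracting the resonant phase from the lifted angle gives \<theta>.\<close>
    define r where "r = (\<lambda>t. t powr \<mu> * ((H (x t) (y t) / Istar t) powr (1 / (2 * real h)) - 1))"
    define \<theta> where "\<theta> = (\<lambda>t. \<phi> t - S t / real varkappa)"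
    have H_pos: "0 < H (x t) (y t)" if "t \<in> J" for t using E'[OF that] E0(1) by simp
    note inv = action_inverse[of _ h Istar "\<lambda>t. H (x t) (y t)" \<mu>, OF t_pos h0 Istar_pos H_pos, OF Jt Jt, folded r_def]
    have w: "0 < 1 + t powr (- \<mu>) * r t" and Ir: "Ires t (r t) = H (x t) (y t)" if t: "t \<in> J" for t
      using inv(1,2)[OF t t t] by (simp_all add: Ires r_def)
    have r_diff: "r differentiable (at t)" if t: "t \<in> J" for t
      using inv(3)[OF t t t] dH[OF t] Istar_diff[OF t1_less[OF Jt[OF t]]]
      by (auto simp: real_differentiable_def)
    have dr: "(r has_real_derivative rdot t (r t) (\<phi> t)) (at t)" if t: "t \<in> J" for t
    proof -
      have "((\<lambda>t. Ires t (r t)) has_real_derivative t powr (- (real a / real q)) * F (Ires t (r t)) (\<phi> t) (S t) t) (at t)"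
        using dH[OF t] unfolding Ir[OF t] RS.F \<phi>[OF t]
        by (rule has_field_derivative_transform_within_open[OF _ J(1) t]) (simp add: Ir)
      then show ?thesis using action[where \<phi> = \<phi>, OF Jt[OF t] w[OF t] r_diff[OF t]] by blast
    qed
    have d\<theta>: "(\<theta> has_real_derivative \<theta>dot t (r t) (\<phi> t)) (at t)" if t: "t \<in> J" for t
      unfolding \<theta>_def
      by (rule DERIV_cong[OF DERIV_diff[OF d\<phi>[OF t] phase_deriv[OF Jt[OF t]]]]) (simp add: \<theta>dot_def Ir[OF t] G \<phi>[OF t])
    show "\<exists>r \<theta>. (\<forall>t\<in>J. r differentiable (at t) \<and> \<theta> differentiable (at t) \<and>
                   0 < 1 + t powr (- \<mu>) * r t \<and> E1 < Ires t (r t) \<and>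
                   x t = xmap t (r t) (\<theta> t) \<and> y t = ymap t (r t) (\<theta> t)) \<and>
           solves_on (tau ` J)
             (\<lambda>R \<Psi> \<tau>. (\<Sum>K\<le>n. \<tau> powr (- (real (M + K) / real N)) * \<Lambda> K R \<Psi>)
                        + AV.\<Lambda>loc (r (time \<tau>)) (\<theta> (time \<tau>)) \<tau>)
             (\<lambda>R \<Psi> \<tau>. (\<Sum>K\<le>n. \<tau> powr (- (real (M + K) / real N)) * \<Omega> K R \<Psi>)
                        + AV.\<Omega>loc (r (time \<tau>)) (\<theta> (time \<tau>)) \<tau>)
             (\<lambda>\<tau>. Rmap \<tau> (r (time \<tau>)) (\<theta> (time \<tau>)))
             (\<lambda>\<tau>. \<Psi>map \<tau> (r (time \<tau>)) (\<theta> (time \<tau>)))"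
    proof (rule exI[of _ r], rule exI[of _ \<theta>], intro conjI ballI)
      fix t assume t: "t \<in> J"
      show "r differentiable (at t)" by (rule r_diff[OF t])
      show "0 < 1 + t powr (- \<mu>) * r t" by (rule w[OF t])
      show "\<theta> differentiable (at t)" using d\<theta>[OF t] by (auto simp: real_differentiable_def)
      show "E1 < Ires t (r t)" using E[OF t] Ir[OF t] by simp
      show "x t = xmap t (r t) (\<theta> t)" "y t = ymap t (r t) (\<theta> t)"
        using \<phi>[OF t] by (simp_all add: xmap ymap \<theta>_def Ir[OF t])
    next
      show "solves_on (tau ` J)
             (\<lambda>R \<Psi> \<tau>. (\<Sum>K\<le>n. \<tau> powr (- (real (M + K) / real N)) * \<Lambda> K R \<Psi>)
                        + AV.\<Lambda>loc (r (time \<tau>)) (\<theta> (time \<tau>)) \<tau>)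
             (\<lambda>R \<Psi> \<tau>. (\<Sum>K\<le>n. \<tau> powr (- (real (M + K) / real N)) * \<Omega> K R \<Psi>)
                        + AV.\<Omega>loc (r (time \<tau>)) (\<theta> (time \<tau>)) \<tau>)
             (\<lambda>\<tau>. Rmap \<tau> (r (time \<tau>)) (\<theta> (time \<tau>)))
             (\<lambda>\<tau>. \<Psi>map \<tau> (r (time \<tau>)) (\<theta> (time \<tau>)))"
        unfolding solves_on_def
      proof (intro ballI)
        fix \<tau> assume "\<tau> \<in> tau ` J"
        then obtain t where t: "t \<in> J" and \<tau>: "\<tau> = tau t" by blast
        have tp: "0 < t" by (rule t_pos[OF Jt[OF t]])
        have \<tau>p: "0 < \<tau>" using tau_pos[OF tp] \<tau> by simp
        have tm: "time \<tau> = t" using time_tau[OF tp] \<tau> by simp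
        have \<theta>\<phi>: "\<theta> t + S t / real varkappa = \<phi> t" by (simp add: \<theta>_def)
        have 1: "((\<lambda>\<tau>. r (time \<tau>)) has_real_derivative z \<tau> ^ M * calA (r (time \<tau>)) (\<theta> (time \<tau>)) (vartheta * \<tau>) \<tau>) (at \<tau>)"
          using DERIV_chain2[OF dr[OF t, folded tm] time_deriv[OF \<tau>p]]
          by (simp add: tm \<tau> calA_eq[OF tp] \<theta>\<phi> mult.commute time_tau[OF tp])
        have 2: "((\<lambda>\<tau>. \<theta> (time \<tau>)) has_real_derivative z \<tau> ^ M * calB (r (time \<tau>)) (\<theta> (time \<tau>)) (vartheta * \<tau>) \<tau>) (at \<tau>)"
          using DERIV_chain2[OF d\<theta>[OF t, folded tm] time_deriv[OF \<tau>p]]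
          by (simp add: tm \<tau> calB_eq[OF tp] \<theta>\<phi> mult.commute time_tau[OF tp])
        note av = AV.solution_averages[of \<tau> "\<lambda>\<tau>. r (time \<tau>)" "\<lambda>\<tau>. \<theta> (time \<tau>)", OF \<tau>p 1 2]
        show "((\<lambda>\<tau>. Rmap \<tau> (r (time \<tau>)) (\<theta> (time \<tau>))) has_real_derivative
            (\<Sum>K\<le>n. \<tau> powr (- (real (M + K) / real N)) * \<Lambda> K (Rmap \<tau> (r (time \<tau>)) (\<theta> (time \<tau>))) (\<Psi>map \<tau> (r (time \<tau>)) (\<theta> (time \<tau>))))
              + AV.\<Lambda>loc (r (time \<tau>)) (\<theta> (time \<tau>)) \<tau>) (at \<tau>) \<and>
          ((\<lambda>\<tau>. \<Psi>map \<tau> (r (time \<tau>)) (\<theta> (time \<tau>))) has_real_derivative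
            (\<Sum>K\<le>n. \<tau> powr (- (real (M + K) / real N)) * \<Omega> K (Rmap \<tau> (r (time \<tau>)) (\<theta> (time \<tau>))) (\<Psi>map \<tau> (r (time \<tau>)) (\<theta> (time \<tau>))))
              + AV.\<Omega>loc (r (time \<tau>)) (\<theta> (time \<tau>)) \<tau>) (at \<tau>)"
          unfolding z_sum[OF \<tau>p] Rmap_eq[OF \<tau>p] \<Psi>map_eq[OF \<tau>p]
          by (intro conjI has_field_derivative_transform_within_open[OF av(1), of "{0<..}"]
              has_field_derivative_transform_within_open[OF av(2), of "{0<..}"])
            (use \<tau>p in \<open>auto simp: Rmap_eq \<Psi>map_eq\<close>)
      qed
    qed
  qed

  have backward: "(\<forall>J R \<Psi>. open J \<and> is_interval J \<and> J \<subseteq> {t0<..} \<and> (\<forall>t\<in>J. \<bar>R (tau t)\<bar> \<le> 1) \<and>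
        solves_on (tau ` J)
          (\<lambda>R \<Psi> \<tau>. (\<Sum>K\<le>n. \<tau> powr (- (real (M + K) / real N)) * \<Lambda> K R \<Psi>) + AV.\<Lambda>rem R \<Psi> \<tau>)
          (\<lambda>R \<Psi> \<tau>. (\<Sum>K\<le>n. \<tau> powr (- (real (M + K) / real N)) * \<Omega> K R \<Psi>) + AV.\<Omega>rem R \<Psi> \<tau>) R \<Psi> \<longrightarrow>
        (\<exists>r \<theta>. (\<forall>t\<in>J. r differentiable (at t) \<and> \<theta> differentiable (at t) \<and> \<bar>r t\<bar> \<le> 2 \<and>
                   R (tau t) = Rmap (tau t) (r t) (\<theta> t) \<and> \<Psi> (tau t) = \<Psi>map (tau t) (r t) (\<theta> t)) \<and>
           solves_on J
             (\<lambda>x y t. deriv (\<lambda>\<eta>. H x \<eta>) y + t powr (- (real a / real q)) * f x y (S t) t)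
             (\<lambda>x y t. - deriv (\<lambda>\<xi>. H \<xi> y) x + t powr (- (real a / real q)) * g x y (S t) t)
             (\<lambda>t. xmap t (r t) (\<theta> t)) (\<lambda>t. ymap t (r t) (\<theta> t))))"
  proof (intro allI impI)
    fix J R \<Psi>
    assume "open J \<and> is_interval J \<and> J \<subseteq> {t0<..} \<and> (\<forall>t\<in>J. \<bar>R (tau t)\<bar> \<le> 1) \<and>
        solves_on (tau ` J)
          (\<lambda>R \<Psi> \<tau>. (\<Sum>K\<le>n. \<tau> powr (- (real (M + K) / real N)) * \<Lambda> K R \<Psi>) + AV.\<Lambda>rem R \<Psi> \<tau>)
          (\<lambda>R \<Psi> \<tau>. (\<Sum>K\<le>n. \<tau> powr (- (real (M + K) / real N)) * \<Omega> K R \<Psi>) + AV.\<Omega>rem R \<Psi> \<tau>) R \<Psi>"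
    then have J: "open J" and Jt: "\<And>t. t \<in> J \<Longrightarrow> t0 < t" and Rb: "\<And>\<tau>. \<tau> \<in> tau ` J \<Longrightarrow> \<bar>R \<tau>\<bar> \<le> 1"
      and sol: "solves_on (tau ` J)
          (\<lambda>R \<Psi> \<tau>. (\<Sum>K\<le>n. \<tau> powr (- (real (M + K) / real N)) * \<Lambda> K R \<Psi>) + AV.\<Lambda>rem R \<Psi> \<tau>)
          (\<lambda>R \<Psi> \<tau>. (\<Sum>K\<le>n. \<tau> powr (- (real (M + K) / real N)) * \<Omega> K R \<Psi>) + AV.\<Omega>rem R \<Psi> \<tau>) R \<Psi>" by auto
    have \<tau>J: "0 < \<tau>" "\<tau>0 < \<tau>" if "\<tau> \<in> tau ` J" for \<tau>
      using that tau_pos[OF t_pos[OF Jt]] \<tau>0_less[OF Jt] by auto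
    \<comment> \<open>The image is the preimage of J under the continuous inverse
      \<open>time\<close> on the positive half-line.\<close>
    have op: "open (tau ` J)"
    proof -
      have "tau ` J = {0<..} \<inter> time -` J"
      proof (intro set_eqI iffI)
        fix \<tau> assume "\<tau> \<in> tau ` J"
        then obtain t where t: "t \<in> J" "\<tau> = tau t" by blast
        then show "\<tau> \<in> {0<..} \<inter> time -` J" using tau_pos[OF t_pos[OF Jt[OF t(1)]]] time_tau[OF t_pos[OF Jt[OF t(1)]]] by simp
      next
        fix \<tau> assume "\<tau> \<in> {0<..} \<inter> time -` J"
        then show "\<tau> \<in> tau ` J" using tau_time[of \<tau>] by (intro image_eqI[of _ _ "time \<tau>"]) auto
      qed
      moreover have "continuous_on {0<..} time"
        by (intro continuous_at_imp_continuous_on ballI DERIV_isCont[OF time_deriv]) simp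
      ultimately show ?thesis using continuous_open_preimage[of "{0<..}" time J] J by simp
    qed
    have sub: "tau ` J \<subseteq> {\<tau>0<..}" using \<tau>J(2) by blast
    have dR\<Psi>: "(R has_real_derivative (\<Sum>K\<le>n. z \<tau> ^ (M + K) * \<Lambda> K (R \<tau>) (\<Psi> \<tau>)) + AV.\<Lambda>rem (R \<tau>) (\<Psi> \<tau>) \<tau>) (at \<tau>)"
      "(\<Psi> has_real_derivative (\<Sum>K\<le>n. z \<tau> ^ (M + K) * \<Omega> K (R \<tau>) (\<Psi> \<tau>)) + AV.\<Omega>rem (R \<tau>) (\<Psi> \<tau>) \<tau>) (at \<tau>)"
      if "\<tau> \<in> tau ` J" for \<tau>
      using bspec[OF sol[unfolded solves_on_def] that] unfolding z_sum[OF \<tau>J(1)[OF that]] by blast+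
    obtain r \<theta> where rel: "\<And>\<tau>. \<tau> \<in> tau ` J \<Longrightarrow> \<bar>r \<tau>\<bar> \<le> 2 \<and> R \<tau> = r \<tau> + AV.corr \<rho> \<tau> (r \<tau>) (\<theta> \<tau>) \<and> \<Psi> \<tau> = \<theta> \<tau> + AV.corr \<psi> \<tau> (r \<tau>) (\<theta> \<tau>)"
      and dr: "\<And>\<tau>. \<tau> \<in> tau ` J \<Longrightarrow> (r has_real_derivative z \<tau> ^ M * calA (r \<tau>) (\<theta> \<tau>) (vartheta * \<tau>) \<tau>) (at \<tau>)"
      and d\<theta>: "\<And>\<tau>. \<tau> \<in> tau ` J \<Longrightarrow> (\<theta> has_real_derivative z \<tau> ^ M * calB (r \<tau>) (\<theta> \<tau>) (vartheta * \<tau>) \<tau>) (at \<tau>)"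
      by (rule AV.averaged_solution_lifts[OF \<tau>0 op sub Rb dR\<Psi>]) blast+
    define r' where "r' t = r (tau t)" for t
    define \<theta>' where "\<theta>' t = \<theta> (tau t)" for t
    define \<phi> where "\<phi> t = \<theta>' t + S t / real varkappa" for t
    have dr': "(r' has_real_derivative rdot t (r' t) (\<phi> t)) (at t)"
      and d\<theta>': "(\<theta>' has_real_derivative \<theta>dot t (r' t) (\<phi> t)) (at t)" if t: "t \<in> J" for t
    proof -
      have tp: "0 < t" by (rule t_pos[OF Jt[OF t]])
      \<comment> \<open>The derivative of \<open>tau\<close> cancels the factor between the rescaled
        and the original right-hand sides.\<close>
      have one: "t powr (1 - \<nu>) * c * t powr (\<nu> - 1) = c" for c
      proof -
        have "t powr (1 - \<nu>) * t powr (\<nu> - 1) = 1" using tp by (simp flip: powr_add)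
        then show ?thesis by (metis mult.assoc mult.commute mult_1)
      qed
      have "((\<lambda>t. r (tau t)) has_real_derivative z (tau t) ^ M * calA (r (tau t)) (\<theta> (tau t)) (vartheta * tau t) (tau t) * t powr (\<nu> - 1)) (at t)"
        by (rule DERIV_chain2[OF dr tau_deriv[OF tp]]) (use t in simp)
      then show "(r' has_real_derivative rdot t (r' t) (\<phi> t)) (at t)"
        unfolding calA_eq[OF tp] one r'_def[symmetric] \<theta>'_def[symmetric] \<phi>_def[symmetric] .
      have "((\<lambda>t. \<theta> (tau t)) has_real_derivative z (tau t) ^ M * calB (r (tau t)) (\<theta> (tau t)) (vartheta * tau t) (tau t) * t powr (\<nu> - 1)) (at t)"
        by (rule DERIV_chain2[OF d\<theta> tau_deriv[OF tp]]) (use t in simp)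
      then show "(\<theta>' has_real_derivative \<theta>dot t (r' t) (\<phi> t)) (at t)"
        unfolding calB_eq[OF tp] one r'_def[symmetric] \<theta>'_def[symmetric] \<phi>_def[symmetric] .
    qed
    have r2: "\<bar>r' t\<bar> \<le> 2" if "t \<in> J" for t using rel[of "tau t"] that by (simp add: r'_def)
    have xy: "((\<lambda>t. X (\<phi> t) (Ires t (r' t))) has_real_derivative Y (\<phi> t) (Ires t (r' t))
          + t powr (- (real a / real q)) * f (X (\<phi> t) (Ires t (r' t))) (Y (\<phi> t) (Ires t (r' t))) (S t) t) (at t)"
        "((\<lambda>t. Y (\<phi> t) (Ires t (r' t))) has_real_derivative - dU (X (\<phi> t) (Ires t (r' t)))
          + t powr (- (real a / real q)) * g (X (\<phi> t) (Ires t (r' t))) (Y (\<phi> t) (Ires t (r' t))) (S t) t) (at t)"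
      if t: "t \<in> J" for t
    proof -
      have w: "0 < 1 + t powr (- \<mu>) * r' t" and E: "E0 < Ires t (r' t)" using adm[OF Jt[OF t] r2[OF t]] E1 by auto
      have "r' differentiable (at t)" using dr'[OF t] by (auto simp: real_differentiable_def)
      from action[where \<phi> = \<phi>, OF Jt[OF t] w this] dr'[OF t]
      have I: "((\<lambda>t. Ires t (r' t)) has_real_derivative t powr (- (real a / real q)) * F (Ires t (r' t)) (\<phi> t) (S t) t) (at t)" by blast
      have "(\<phi> has_real_derivative \<theta>dot t (r' t) (\<phi> t) + \<omega> (Istar t)) (at t)"
        unfolding \<phi>_def[abs_def] by (rule DERIV_add[OF d\<theta>'[OF t, unfolded \<phi>_def] phase_deriv[OF Jt[OF t]]])
      then have d\<phi>: "(\<phi> has_real_derivative \<omega> (Ires t (r' t)) + t powr (- (real a / real q)) * G (Ires t (r' t)) (\<phi> t) (S t) t) (at t)"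
        by (simp add: \<theta>dot_def)
      note * = HO.energy_angle_to_cartesian[of "\<lambda>t. Ires t (r' t)" t, OF E I[unfolded RS.F] d\<phi>[unfolded G]]
      show "((\<lambda>t. X (\<phi> t) (Ires t (r' t))) has_real_derivative Y (\<phi> t) (Ires t (r' t))
          + t powr (- (real a / real q)) * f (X (\<phi> t) (Ires t (r' t))) (Y (\<phi> t) (Ires t (r' t))) (S t) t) (at t)"
        "((\<lambda>t. Y (\<phi> t) (Ires t (r' t))) has_real_derivative - dU (X (\<phi> t) (Ires t (r' t)))
          + t powr (- (real a / real q)) * g (X (\<phi> t) (Ires t (r' t))) (Y (\<phi> t) (Ires t (r' t))) (S t) t) (at t)"
        by (rule *)+
    qed
    show "\<exists>r \<theta>. (\<forall>t\<in>J. r differentiable (at t) \<and> \<theta> differentiable (at t) \<and> \<bar>r t\<bar> \<le> 2 \<and>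
                   R (tau t) = Rmap (tau t) (r t) (\<theta> t) \<and> \<Psi> (tau t) = \<Psi>map (tau t) (r t) (\<theta> t)) \<and>
           solves_on J
             (\<lambda>x y t. deriv (\<lambda>\<eta>. H x \<eta>) y + t powr (- (real a / real q)) * f x y (S t) t)
             (\<lambda>x y t. - deriv (\<lambda>\<xi>. H \<xi> y) x + t powr (- (real a / real q)) * g x y (S t) t)
             (\<lambda>t. xmap t (r t) (\<theta> t)) (\<lambda>t. ymap t (r t) (\<theta> t))"
    proof (rule exI[of _ r'], rule exI[of _ \<theta>'], intro conjI ballI)
      fix t assume t: "t \<in> J"
      show "r' differentiable (at t)" "\<theta>' differentiable (at t)"
        using dr'[OF t] d\<theta>'[OF t] by (auto simp: real_differentiable_def)
      show "\<bar>r' t\<bar> \<le> 2" by (rule r2[OF t])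
      show "R (tau t) = Rmap (tau t) (r' t) (\<theta>' t)" "\<Psi> (tau t) = \<Psi>map (tau t) (r' t) (\<theta>' t)"
        using rel[of "tau t"] t tau_pos[OF t_pos[OF Jt[OF t]]] by (simp_all add: Rmap_eq \<Psi>map_eq r'_def \<theta>'_def)
    next
      show "solves_on J
             (\<lambda>x y t. deriv (\<lambda>\<eta>. H x \<eta>) y + t powr (- (real a / real q)) * f x y (S t) t)
             (\<lambda>x y t. - deriv (\<lambda>\<xi>. H \<xi> y) x + t powr (- (real a / real q)) * g x y (S t) t)
             (\<lambda>t. xmap t (r' t) (\<theta>' t)) (\<lambda>t. ymap t (r' t) (\<theta>' t))"
        unfolding solves_on_def H_x H_y xmap ymap \<phi>_def[symmetric] using xy by blast
    qed
  qed

  \<comment> \<open>The constants are \<open>d0 = 1\<close> and \<open>d1 = 2\<close>, the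
    half-widths of the strip of R and of the strip of r on which the averaging map is a bijection
    onto its image.\<close>
  show ?thesis
    apply (rule exI[of _ t0], intro conjI t0)
    apply (rule exI[of _ "1::real"], intro conjI)
     apply simp
    apply (rule exI[of _ "2::real"], intro conjI)
     apply simp
    apply (rule exI[of _ AV.\<Lambda>rem], rule exI[of _ AV.\<Omega>rem], rule exI[of _ AV.\<Lambda>loc], rule exI[of _ AV.\<Omega>loc])
    apply (intro conjI remainders coordinates near_identity local_remainders forward backward)
    done
qed

end
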